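(* Let $\Omega\subset\mathbb{R}^3$ be a contractible polyhedral domain with a simplicial triangulation $\mathcal{T}_h$, and let $W_h,\Theta_h,\Sigma_h,V_h$ be the (lowest order) spaces and $\Pi_h^W,\Pi_h^\Theta,\Pi_h^\Sigma,\Pi_h^V$ the interpolation operators defined in the context from the listed degrees of freedom, which are unisolvent for the respective local spaces $\mathcal{P}_7(K;\mathbb{R}^3)$, $\mathcal{P}_6(K;\mathbb{S})$, $\Sigma_K$. Then $W_h\subset H^1(\Omega;\mathbb{R}^3)$, $\Theta_h\subset H(\operatorname{curl}\operatorname{curl}^*,\Omega;\mathbb{S})$, $\Sigma_h\subset H(\operatorname{div},\Omega;\mathbb{S})$, the sequence $$\mathbb{T}\hookrightarrow W_h\xrightarrow{\ \epsilon\ }\Theta_h\xrightarrow{\operatorname{curl}\operatorname{curl}^*}\Sigma_h\xrightarrow{\operatorname{div}}V_h\to0$$ is a complex (each operator maps its space into the next one, and compositions of successive operators vanish), and the operators commute with the differential operators: $$\Pi_h^\Theta\,\epsilon(w)=\epsilon(\Pi_h^Ww),\qquad \Pi_h^\Sigma\operatorname{curl}\operatorname{curl}^*S=\operatorname{curl}\operatorname{curl}^*\Pi_h^\Theta S,\qquad \Pi_h^V\operatorname{div}T=\operatorname{div}\Pi_h^\Sigma T$$ for all $w\in C^\infty(\overline\Omega;\mathbb{R}^3)$ and $S,T\in C^\infty(\overline\Omega;\mathbb{S})$.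
   Context: General notation. $\mathbb{S}$: real symmetric $3\times3$ matrices; prime: transpose; $S:T$: Frobenius product. $\mathbb{T}=\{x\mapsto a+b\times x: a,b\in\mathbb{R}^3\}$. $\mathcal{P}_j(D;X)$: polynomials of degree at most $j$ on $D$ with values in $X$. $\epsilon(v)=\frac12[\operatorname{grad}v+(\operatorname{grad}v)']$; the divergence of a matrix field is row-wise; $\operatorname{curl}$ of a matrix field is row-wise and $\operatorname{curl}^*S=(\operatorname{curl}S')'$, so $(\operatorname{curl}\operatorname{curl}^*S)_{ij}=\sum\varepsilon_{ikl}\varepsilon_{jmp}\partial_k\partial_mS_{lp}$ with $\varepsilon$ the Levi-Civita symbol. $H(\operatorname{div},\Omega;\mathbb{S})$ and $H(\operatorname{curl}\operatorname{curl}^*,\Omega;\mathbb{S})$ are the spaces of $L^2$ symmetric matrix fields whose (distributional) $\operatorname{div}$, resp. $\operatorname{curl}\operatorname{curl}^*$, is in $L^2$. Geometry. $\Delta_1(K),\Delta_2(K)$ are the edges and faces of a tetrahedron $K$, $\Delta_1(f)$ the edges of a face $f$. For a face $f$: unit normal $n$, $Q_n=I-nn'$, $\epsilon_f(v)=Q_n\epsilon(v)Q_n$, $\operatorname{grad}_f\operatorname{grad}_f^*q$ is the tangential Hessian of a scalar $q$ on $f$ (i.e. $Q_n(\operatorname{Hess}q)Q_n$), and $\Lambda_f(S)=2\epsilon_f(Sn)-Q_n\frac{\partial S}{\partial n}Q_n$. $b_f$ is the cubic bubble on $f$ (product of the three barycentric coordinates of the vertices of $f$). For an edge $e$: unit tangent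 $s$, $Q_s=I-ss'$, and if $e\subset f$, $m$ is the unit vector in the plane of $f$ normal to $e$ pointing into $f$. $\Gamma_e(S)=2\partial_sQ_s(Ss)-Q_s\operatorname{grad}(s'Ss)$ on $e$. $\operatorname{rot}_{e^\perp}P_sSQ_s$ denotes, up to an irrelevant sign, the scalar $\partial_{\mu}(s'S\nu)-\partial_{\nu}(s'S\mu)$ for an orthonormal basis $\mu,\nu$ of $e^\perp$. Further $$E(f)=\Bigl\{v\in\mathcal{P}_7(f;\mathbb{R}) : v|_{\partial f}=0,\ \int_e\partial_mv\,ds=0,\ e\in\Delta_1(f)\Bigr\},$$ $\mathcal{P}_7^0(K;\mathbb{R}^3)=\{v\in\mathcal{P}_7(K;\mathbb{R}^3):v=0\text{ on }\partial K\}$, $\mathcal{M}_4(K)=\{T\in\mathcal{P}_4(K;\mathbb{S}):\operatorname{div}T=0,\ Tn=0\text{ on }\partial K\}$. Spaces. Each of $W_h,\Theta_h,\Sigma_h$ consists of fields lying locally, on each $K\in\mathcal{T}_h$, in the stated local space and such that each degree of freedom attached to a vertex, edge or face has the same value from every tetrahedron containing it (with fixed choices of $s,n,m,\dots$). The interpolation operator onto each reproduces all the degrees of freedom. $V_h$: all piecewise $\mathcal{P}_1(K;\mathbb{R}^3)$ fields; $\Pi_h^V$ is the $L^2$-projection. $\Sigma_h$: local space $\Sigma_K=\{T\in\mathcal{P}_4(K;\mathbb{S}):\operatorname{div}T\in\mathcal{P}_1(K;\mathbb{R}^3)\}$; degrees of freedom: vertex values of $T$; for each edge with linearly independent normals $n_\pm$,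 moments of degree $\le2$ of $s'Tn_-$, $s'Tn_+$, $n_-'Tn_-$, $n_+'Tn_+$, $n_-'Tn_+$; for each face, moments of degree $\le1$ of $Tn$; the average of $T$ over $K$; $\int_KT:U\,dx$ for $U\in\mathcal{M}_4(K)$. $\Theta_h$: local space $\mathcal{P}_6(K;\mathbb{S})$ (dimension 504); degrees of freedom: (1) $S$ and $\operatorname{curl}\operatorname{curl}^*S$ at each vertex; (2) $\int_es'Ss\,v\,ds$, $v\in\mathcal{P}_4(e;\mathbb{R})$, each edge $e$; (3) $\int_e\Gamma_e(S)\cdot v\,ds$, $v\in\mathcal{P}_5(e;Q_s\mathbb{R}^3)$, each edge; (4) $\int_eQ_s(\operatorname{curl}\operatorname{curl}^*S):W\,ds$, $W\in\mathcal{P}_2(e;Q_s\mathbb{S})$, each edge; (5) $\int_e\operatorname{rot}_{e^\perp}P_sSQ_s\,ds$, each edge; (6) $\int_fQ_nSQ_n:\epsilon_f(v)\,dx_f$, $v\in b_f\mathcal{P}_4(f;Q_n\mathbb{R}^3)$, each face $f$; (7) $\int_e(s'\Lambda_f(S)m)v\,ds$, $v\in\mathcal{P}_1(e;\mathbb{R})$ with $\int_ev\,ds=0$, each face $f$ and $e\in\Delta_1(f)$; (8) $\int_f\Lambda_f(S)\,dx_f$, each face; (9) $\int_f\Lambda_f(S):\operatorname{grad}_f\operatorname{grad}_f^*v\,dx_f$, $v\in E(f)$, each face; (10) $\int_K\operatorname{curl}\operatorname{curl}^*S:T\,dx$, $T\in\mathcal{M}_4(K)$; (11) $\int_KS:\epsilon(v)\,dx$,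 $v\in\mathcal{P}^0_7(K;\mathbb{R}^3)$. $W_h$: local space $\mathcal{P}_7(K;\mathbb{R}^3)$ (dimension 360); degrees of freedom: (1) $w$ and its first order derivatives at each vertex; (2) $\int_ew\cdot q\,ds$, $q\in\mathcal{P}_3(e;\mathbb{R}^3)$, each edge; (3) $\int_f\epsilon_f(Q_nw):\epsilon_f(q)\,dx_f$, $q\in b_f\mathcal{P}_4(f;Q_n\mathbb{R}^3)$, each face; (4) $\int_e\partial_m(n'w)\,ds$, each face $f$ and $e\in\Delta_1(f)$; (5) $\int_f\operatorname{grad}_f\operatorname{grad}_f^*(n'w):\operatorname{grad}_f\operatorname{grad}_f^*q\,dx_f$, $q\in E(f)$, each face; (6) $\int_K\epsilon(w):\epsilon(q)\,dx$, $q\in\mathcal{P}_7^0(K;\mathbb{R}^3)$. *)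

theory Defs
  imports "HOL-Analysis.Analysis"
begin

type_synonym vec3 = "real^3"
type_synonym mat3 = "real^3^3"

section \<open>Linear algebra and differential operators\<close>

definition Sym :: "mat3 set" where
  "Sym = {A. transpose A = A}"

text \<open>The orthogonal projection \<open>I - n n'\<close>, for a unit vector \<open>n\<close>. The Frobenius product is
  \<open>(\<bullet>)\<close> on \<open>mat3\<close>.\<close>
definition Qp :: "vec3 \<Rightarrow> mat3" where
  "Qp n = (\<chi> i j. (if i = j then 1 else 0) - n $ i * n $ j)"

definition levi_civita :: "3 \<Rightarrow> 3 \<Rightarrow> 3 \<Rightarrow> real" where
  "levi_civita i j k = axis i 1 \<bullet> cross3 (axis j 1) (axis k 1)"

definition dd :: "vec3 \<Rightarrow> (vec3 \<Rightarrow> 'b::real_normed_vector) \<Rightarrow> vec3 \<Rightarrow> 'b" where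
  "dd v f x = frechet_derivative f (at x) v"

definition pd :: "3 \<Rightarrow> (vec3 \<Rightarrow> 'b::real_normed_vector) \<Rightarrow> vec3 \<Rightarrow> 'b" where
  "pd i = dd (axis i 1)"

definition sgrad :: "(vec3 \<Rightarrow> real) \<Rightarrow> vec3 \<Rightarrow> vec3" where
  "sgrad q x = (\<chi> i. pd i q x)"

definition hess :: "(vec3 \<Rightarrow> real) \<Rightarrow> vec3 \<Rightarrow> mat3" where
  "hess q x = (\<chi> i j. pd i (pd j q) x)"

definition vgrad :: "(vec3 \<Rightarrow> vec3) \<Rightarrow> vec3 \<Rightarrow> mat3" where
  "vgrad v x = (\<chi> i j. pd j v x $ i)"

definition eps :: "(vec3 \<Rightarrow> vec3) \<Rightarrow> vec3 \<Rightarrow> mat3" where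
  "eps v x = (1/2) *\<^sub>R (vgrad v x + transpose (vgrad v x))"

definition mdiv :: "(vec3 \<Rightarrow> mat3) \<Rightarrow> vec3 \<Rightarrow> vec3" where
  "mdiv T x = (\<chi> i. \<Sum>j\<in>UNIV. pd j T x $ i $ j)"

definition mcurl :: "(vec3 \<Rightarrow> mat3) \<Rightarrow> vec3 \<Rightarrow> mat3" where
  "mcurl S x = (\<chi> i j. \<Sum>m\<in>UNIV. \<Sum>p\<in>UNIV. levi_civita j m p * pd m S x $ i $ p)"

definition mcurl_star :: "(vec3 \<Rightarrow> mat3) \<Rightarrow> vec3 \<Rightarrow> mat3" where
  "mcurl_star S x = transpose (mcurl (\<lambda>y. transpose (S y)) x)"

definition ccs :: "(vec3 \<Rightarrow> mat3) \<Rightarrow> vec3 \<Rightarrow> mat3" where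
  "ccs S = mcurl (mcurl_star S)"

definition eps_f :: "vec3 \<Rightarrow> (vec3 \<Rightarrow> vec3) \<Rightarrow> vec3 \<Rightarrow> mat3" where
  "eps_f n v x = Qp n ** eps v x ** Qp n"

definition hess_f :: "vec3 \<Rightarrow> (vec3 \<Rightarrow> real) \<Rightarrow> vec3 \<Rightarrow> mat3" where
  "hess_f n q x = Qp n ** hess q x ** Qp n"

definition Lam :: "vec3 \<Rightarrow> (vec3 \<Rightarrow> mat3) \<Rightarrow> vec3 \<Rightarrow> mat3" where
  "Lam n S x = 2 *\<^sub>R eps_f n (\<lambda>y. S y *v n) x - Qp n ** dd n S x ** Qp n"

definition Gam :: "vec3 \<Rightarrow> (vec3 \<Rightarrow> mat3) \<Rightarrow> vec3 \<Rightarrow> vec3" where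
  "Gam s S x = 2 *\<^sub>R dd s (\<lambda>y. Qp s *v (S y *v s)) x
             - Qp s *v sgrad (\<lambda>y. s \<bullet> (S y *v s)) x"

definition rot_perp :: "vec3 \<Rightarrow> vec3 \<Rightarrow> vec3 \<Rightarrow> (vec3 \<Rightarrow> mat3) \<Rightarrow> vec3 \<Rightarrow> real" where
  "rot_perp s \<mu> \<nu> S x = dd \<mu> (\<lambda>y. s \<bullet> (S y *v \<nu>)) x - dd \<nu> (\<lambda>y. s \<bullet> (S y *v \<mu>)) x"

text \<open>Infinitely differentiable functions on the whole space. A member of \<open>C\<^sup>\<infinity>\<close> of a closed set is
  represented by such an extension; all the functionals below see only its values on that set.\<close>
primrec Ck :: "nat \<Rightarrow> (vec3 \<Rightarrow> 'b::real_normed_vector) \<Rightarrow> bool" where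
  "Ck 0 f \<longleftrightarrow> continuous_on UNIV f"
| "Ck (Suc k) f \<longleftrightarrow> (\<forall>x. f differentiable (at x)) \<and> (\<forall>i. Ck k (pd i f))"

definition smooth :: "(vec3 \<Rightarrow> 'b::real_normed_vector) \<Rightarrow> bool" where
  "smooth f \<longleftrightarrow> (\<forall>k. Ck k f)"

definition rigid :: "(vec3 \<Rightarrow> vec3) set" where
  "rigid = {r. \<exists>a b. r = (\<lambda>x. a + cross3 b x)}"

text \<open>Polynomials of degree at most \<open>k\<close> with values in the subspace \<open>X\<close>. Polynomials on a
  tetrahedron, face or edge are the restrictions of these; each use below depends on the
  restriction only.\<close>
definition polys :: "nat \<Rightarrow> 'b::real_normed_vector set \<Rightarrow> (vec3 \<Rightarrow> 'b) set" where
  "polys k X = {p. \<exists>c. (\<forall>\<alpha>. c \<alpha> \<in> X) \<and>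
     p = (\<lambda>x. \<Sum>(a, b, d)\<in>{(a, b, d). a + b + d \<le> k}. (x $ 1 ^ a * x $ 2 ^ b * x $ 3 ^ d) *\<^sub>R c (a, b, d))}"


section \<open>Simplices and integrals over them\<close>

definition verts :: "vec3 set \<Rightarrow> vec3 set" where
  "verts D = {x. x extreme_point_of D}"

definition edges :: "vec3 set \<Rightarrow> vec3 set set" where
  "edges D = {e. e face_of D \<and> aff_dim e = 1}"

definition faces :: "vec3 set \<Rightarrow> vec3 set set" where
  "faces D = {f. f face_of D \<and> aff_dim f = 2}"

text \<open>The arc length integral over a segment and the surface area integral over a triangle; they do
  not depend on the ordering of the vertices that is chosen.\<close>
definition edge_int :: "vec3 set \<Rightarrow> (vec3 \<Rightarrow> real) \<Rightarrow> real" where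
  "edge_int e g = (let (a, b) = (SOME (a, b). e = closed_segment a b)
     in norm (b - a) * integral {0..1} (\<lambda>t. g (a + t *\<^sub>R (b - a))))"

definition face_int :: "vec3 set \<Rightarrow> (vec3 \<Rightarrow> real) \<Rightarrow> real" where
  "face_int f g = (let (a, b, c) = (SOME (a, b, c). f = convex hull {a, b, c})
     in norm (cross3 (b - a) (c - a)) *
        integral {0..1} (\<lambda>t. integral {0..1 - t} (\<lambda>u. g (a + t *\<^sub>R (b - a) + u *\<^sub>R (c - a)))))"

definition bary :: "vec3 set \<Rightarrow> vec3 \<Rightarrow> vec3 \<Rightarrow> real" where
  "bary V v x = (THE u. (\<forall>w. w \<notin> V \<longrightarrow> u w = 0) \<and> sum u V = 1 \<and> (\<Sum>w\<in>V. u w *\<^sub>R w) = x) v"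

text \<open>\<open>b\<^sub>f P\<^sub>k(f; X)\<close>, where \<open>b\<^sub>f\<close> is the cubic bubble on \<open>f\<close>: polynomials that equal \<open>b\<^sub>f p\<close> on \<open>f\<close>.\<close>
definition bubble_polys :: "vec3 set \<Rightarrow> nat \<Rightarrow> vec3 set \<Rightarrow> (vec3 \<Rightarrow> vec3) set" where
  "bubble_polys f k X = {q \<in> polys (k + 3) X. \<exists>p\<in>polys k X. \<forall>x\<in>f.
     q x = (\<Prod>v\<in>verts f. bary (verts f) v x) *\<^sub>R p x}"

definition unit_normal :: "vec3 set \<Rightarrow> vec3 \<Rightarrow> bool" where
  "unit_normal f n \<longleftrightarrow> norm n = 1 \<and> (\<forall>x\<in>f. \<forall>y\<in>f. n \<bullet> (y - x) = 0)"

definition unit_tangent :: "vec3 set \<Rightarrow> vec3 \<Rightarrow> bool" where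
  "unit_tangent e s \<longleftrightarrow> norm s = 1 \<and> s \<in> span {y - x |x y. x \<in> e \<and> y \<in> e}"

text \<open>The vector \<open>m\<close>: unit, in the plane of \<open>f\<close>, normal to \<open>e\<close> and pointing into \<open>f\<close>.\<close>
definition conormal :: "vec3 set \<Rightarrow> vec3 set \<Rightarrow> vec3" where
  "conormal f e = (THE m. norm m = 1 \<and> m \<in> span {y - x |x y. x \<in> f \<and> y \<in> f} \<and>
     (\<forall>x\<in>e. \<forall>y\<in>e. m \<bullet> (y - x) = 0) \<and> (\<forall>x\<in>e. \<forall>y\<in>f. m \<bullet> (y - x) \<ge> 0))"

definition Ef :: "vec3 set \<Rightarrow> (vec3 \<Rightarrow> real) set" where
  "Ef f = {v \<in> polys 7 UNIV. (\<forall>x\<in>rel_frontier f. v x = 0) \<and>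
     (\<forall>e\<in>edges f. edge_int e (dd (conormal f e) v) = 0)}"

definition P70 :: "vec3 set \<Rightarrow> (vec3 \<Rightarrow> vec3) set" where
  "P70 K = {v \<in> polys 7 UNIV. \<forall>x\<in>frontier K. v x = 0}"

definition M4 :: "(vec3 set \<Rightarrow> vec3) \<Rightarrow> vec3 set \<Rightarrow> (vec3 \<Rightarrow> mat3) set" where
  "M4 n K = {T \<in> polys 4 Sym. (\<forall>x\<in>K. mdiv T x = 0) \<and> (\<forall>f\<in>faces K. \<forall>x\<in>f. T x *v n f = 0)}"


section \<open>Domain and mesh\<close>

definition polyhedral_domain :: "vec3 set \<Rightarrow> bool" where
  "polyhedral_domain \<Omega> \<longleftrightarrow> open \<Omega> \<and> connected \<Omega> \<and> \<Omega> \<noteq> {} \<and> bounded \<Omega> \<and>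
     (\<exists>F. finite F \<and> (\<forall>P\<in>F. polytope P \<and> aff_dim P = 2) \<and> frontier \<Omega> = \<Union>F)"

definition simplicial_mesh :: "vec3 set \<Rightarrow> vec3 set set \<Rightarrow> bool" where
  "simplicial_mesh \<Omega> \<T> \<longleftrightarrow> triangulation \<T> \<and> (\<forall>K\<in>\<T>. 3 simplex K) \<and> \<Union>\<T> = closure \<Omega>"

text \<open>The vectors fixed once and for all on the faces and edges of the mesh: \<open>n f\<close>; \<open>s e\<close>; the
  normals \<open>n\<^sub>-\<close>, \<open>n\<^sub>+\<close> of \<open>e\<close>; an orthonormal basis \<open>\<mu> e\<close>, \<open>\<nu> e\<close> of the orthogonal complement of \<open>e\<close>.\<close>
definition frame_choice ::
  "vec3 set set \<Rightarrow> (vec3 set \<Rightarrow> vec3) \<Rightarrow> (vec3 set \<Rightarrow> vec3) \<Rightarrow> (vec3 set \<Rightarrow> vec3) \<Rightarrow> (vec3 set \<Rightarrow> vec3) \<Rightarrow>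
   (vec3 set \<Rightarrow> vec3) \<Rightarrow> (vec3 set \<Rightarrow> vec3) \<Rightarrow> bool" where
  "frame_choice \<T> n s nm np \<mu> \<nu> \<longleftrightarrow>
     (\<forall>K\<in>\<T>. \<forall>f\<in>faces K. unit_normal f (n f)) \<and>
     (\<forall>K\<in>\<T>. \<forall>e\<in>edges K. unit_tangent e (s e) \<and>
        nm e \<bullet> s e = 0 \<and> np e \<bullet> s e = 0 \<and> nm e \<noteq> np e \<and> independent {nm e, np e} \<and>
        norm (\<mu> e) = 1 \<and> norm (\<nu> e) = 1 \<and> \<mu> e \<bullet> \<nu> e = 0 \<and> \<mu> e \<bullet> s e = 0 \<and> \<nu> e \<bullet> s e = 0)"


section \<open>Finite element spaces and interpolation\<close>

text \<open>Degrees of freedom are real functionals on fields, given as one set for each vertex, edge, face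
  and tetrahedron; vector- and matrix-valued ones are entered by components.

  A piecewise polynomial field on the mesh is represented by the family of its polynomial pieces,
  extended by zero to sets that are not tetrahedra of the mesh.\<close>

type_synonym 'b dofs = "vec3 set \<Rightarrow> ((vec3 \<Rightarrow> 'b) \<Rightarrow> real) set"
type_synonym 'b vdofs = "vec3 \<Rightarrow> ((vec3 \<Rightarrow> 'b) \<Rightarrow> real) set"

definition all_dofs :: "'b vdofs \<Rightarrow> 'b dofs \<Rightarrow> 'b dofs \<Rightarrow> 'b dofs \<Rightarrow> 'b dofs" where
  "all_dofs vd ed fd kd K =
     (\<Union>x\<in>verts K. vd x) \<union> (\<Union>e\<in>edges K. ed e) \<union> (\<Union>f\<in>faces K. fd f) \<union> kd K"

definition broken :: "vec3 set set \<Rightarrow> (vec3 \<Rightarrow> 'b::zero) set \<Rightarrow> (vec3 set \<Rightarrow> vec3 \<Rightarrow> 'b) set" where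
  "broken \<T> P = {u. (\<forall>K\<in>\<T>. u K \<in> P) \<and> (\<forall>K. K \<notin> \<T> \<longrightarrow> u K = (\<lambda>x. 0))}"

definition fe_space :: "vec3 set set \<Rightarrow> (vec3 \<Rightarrow> 'b::zero) set \<Rightarrow> 'b vdofs \<Rightarrow> 'b dofs \<Rightarrow> 'b dofs \<Rightarrow>
    (vec3 set \<Rightarrow> vec3 \<Rightarrow> 'b) set" where
  "fe_space \<T> P vd ed fd = {u \<in> broken \<T> P. \<forall>K\<in>\<T>. \<forall>K'\<in>\<T>.
     (\<forall>x\<in>verts K \<inter> verts K'. \<forall>d\<in>vd x. d (u K) = d (u K')) \<and>
     (\<forall>e\<in>edges K \<inter> edges K'. \<forall>d\<in>ed e. d (u K) = d (u K')) \<and>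
     (\<forall>f\<in>faces K \<inter> faces K'. \<forall>d\<in>fd f. d (u K) = d (u K'))}"

definition interpolant :: "vec3 set set \<Rightarrow> (vec3 set \<Rightarrow> vec3 \<Rightarrow> 'b) set \<Rightarrow> 'b dofs \<Rightarrow> (vec3 \<Rightarrow> 'b) \<Rightarrow>
    vec3 set \<Rightarrow> vec3 \<Rightarrow> 'b" where
  "interpolant \<T> U D w = (THE u. u \<in> U \<and> (\<forall>K\<in>\<T>. \<forall>d\<in>D K. d (u K) = d w))"

text \<open>Ciarlet's unisolvence. The set \<open>D\<close> contains the moments against all members of each test space;
  choosing bases of the test spaces leaves a finite list \<open>B\<close> of functionals of which the others
  are linear combinations (on smooth fields that are \<open>X\<close>-valued on \<open>K\<close>), and the values of the
  functionals in \<open>B\<close> can be prescribed arbitrarily and determine the member of \<open>P\<close>.\<close>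
definition unisolvent :: "vec3 set \<Rightarrow> 'b::real_normed_vector set \<Rightarrow> (vec3 \<Rightarrow> 'b) set \<Rightarrow>
    ((vec3 \<Rightarrow> 'b) \<Rightarrow> real) set \<Rightarrow> bool" where
  "unisolvent K X P D \<longleftrightarrow> (\<exists>B\<subseteq>D. finite B \<and>
     (\<forall>d\<in>D. \<exists>c. \<forall>w. smooth w \<and> (\<forall>x\<in>K. w x \<in> X) \<longrightarrow> d w = (\<Sum>b\<in>B. c b * b w)) \<and>
     (\<forall>\<alpha>. \<exists>!p. p \<in> P \<and> (\<forall>b\<in>B. b p = \<alpha> b)))"

text \<open>The function on \<open>\<Omega>\<close>, defined almost everywhere, with the given pieces.\<close>
definition glue :: "vec3 set set \<Rightarrow> (vec3 set \<Rightarrow> vec3 \<Rightarrow> 'b::zero) \<Rightarrow> vec3 \<Rightarrow> 'b" where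
  "glue \<T> u x = (if \<exists>K\<in>\<T>. x \<in> interior K then u (THE K. K \<in> \<T> \<and> x \<in> interior K) x else 0)"

definition restrict_mesh :: "vec3 set set \<Rightarrow> (vec3 \<Rightarrow> 'b::zero) \<Rightarrow> vec3 set \<Rightarrow> vec3 \<Rightarrow> 'b" where
  "restrict_mesh \<T> w K = (if K \<in> \<T> then w else (\<lambda>x. 0))"

definition piecewise :: "((vec3 \<Rightarrow> 'a) \<Rightarrow> vec3 \<Rightarrow> 'b) \<Rightarrow> (vec3 set \<Rightarrow> vec3 \<Rightarrow> 'a) \<Rightarrow> vec3 set \<Rightarrow> vec3 \<Rightarrow> 'b" where
  "piecewise L u = (\<lambda>K. L (u K))"


subsection \<open>The space of displacements\<close>

definition W_loc :: "(vec3 \<Rightarrow> vec3) set" where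
  "W_loc = polys 7 UNIV"

definition W_vdofs :: "vec3 vdofs" where
  "W_vdofs x = {(\<lambda>w. w x $ i) |i. True} \<union> {(\<lambda>w. pd j w x $ i) |i j. True}"

definition W_edofs :: "vec3 dofs" where
  "W_edofs e = {(\<lambda>w. edge_int e (\<lambda>x. w x \<bullet> q x)) |q. q \<in> polys 3 UNIV}"

definition W_fdofs :: "(vec3 set \<Rightarrow> vec3) \<Rightarrow> vec3 dofs" where
  "W_fdofs n f =
     {(\<lambda>w. face_int f (\<lambda>x. eps_f (n f) (\<lambda>y. Qp (n f) *v w y) x \<bullet> eps_f (n f) q x)) |q.
        q \<in> bubble_polys f 4 (range ((*v) (Qp (n f))))} \<union>
     {(\<lambda>w. edge_int e (dd (conormal f e) (\<lambda>y. n f \<bullet> w y))) |e. e \<in> edges f} \<union>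
     {(\<lambda>w. face_int f (\<lambda>x. hess_f (n f) (\<lambda>y. n f \<bullet> w y) x \<bullet> hess_f (n f) q x)) |q. q \<in> Ef f}"

definition W_kdofs :: "vec3 dofs" where
  "W_kdofs K = {(\<lambda>w. integral K (\<lambda>x. eps w x \<bullet> eps q x)) |q. q \<in> P70 K}"

definition W_dofs :: "(vec3 set \<Rightarrow> vec3) \<Rightarrow> vec3 dofs" where
  "W_dofs n = all_dofs W_vdofs W_edofs (W_fdofs n) W_kdofs"

definition W_h :: "vec3 set set \<Rightarrow> (vec3 set \<Rightarrow> vec3) \<Rightarrow> (vec3 set \<Rightarrow> vec3 \<Rightarrow> vec3) set" where
  "W_h \<T> n = fe_space \<T> W_loc W_vdofs W_edofs (W_fdofs n)"

definition Pi_W :: "vec3 set set \<Rightarrow> (vec3 set \<Rightarrow> vec3) \<Rightarrow> (vec3 \<Rightarrow> vec3) \<Rightarrow> vec3 set \<Rightarrow> vec3 \<Rightarrow> vec3" where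
  "Pi_W \<T> n = interpolant \<T> (W_h \<T> n) (W_dofs n)"


subsection \<open>The space of strains\<close>

definition Th_loc :: "(vec3 \<Rightarrow> mat3) set" where
  "Th_loc = polys 6 Sym"

definition Th_vdofs :: "mat3 vdofs" where
  "Th_vdofs x = {(\<lambda>S. S x $ i $ j) |i j. True} \<union> {(\<lambda>S. ccs S x $ i $ j) |i j. True}"

definition Th_edofs :: "(vec3 set \<Rightarrow> vec3) \<Rightarrow> (vec3 set \<Rightarrow> vec3) \<Rightarrow> (vec3 set \<Rightarrow> vec3) \<Rightarrow> mat3 dofs" where
  "Th_edofs s \<mu> \<nu> e =
     {(\<lambda>S. edge_int e (\<lambda>x. (s e \<bullet> (S x *v s e)) * v x)) |v. v \<in> polys 4 UNIV} \<union>
     {(\<lambda>S. edge_int e (\<lambda>x. Gam (s e) S x \<bullet> v x)) |v. v \<in> polys 5 (range ((*v) (Qp (s e))))} \<union>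
     {(\<lambda>S. edge_int e (\<lambda>x. (Qp (s e) ** ccs S x) \<bullet> W x)) |W. W \<in> polys 2 ((**) (Qp (s e)) ` Sym)} \<union>
     {(\<lambda>S. edge_int e (rot_perp (s e) (\<mu> e) (\<nu> e) S))}"

definition Th_fdofs :: "(vec3 set \<Rightarrow> vec3) \<Rightarrow> (vec3 set \<Rightarrow> vec3) \<Rightarrow> mat3 dofs" where
  "Th_fdofs n s f =
     {(\<lambda>S. face_int f (\<lambda>x. (Qp (n f) ** S x ** Qp (n f)) \<bullet> eps_f (n f) v x)) |v.
        v \<in> bubble_polys f 4 (range ((*v) (Qp (n f))))} \<union>
     {(\<lambda>S. edge_int e (\<lambda>x. (s e \<bullet> (Lam (n f) S x *v conormal f e)) * v x)) |e v.
        e \<in> edges f \<and> v \<in> polys 1 UNIV \<and> edge_int e v = 0} \<union>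
     {(\<lambda>S. face_int f (\<lambda>x. Lam (n f) S x $ i $ j)) |i j. True} \<union>
     {(\<lambda>S. face_int f (\<lambda>x. Lam (n f) S x \<bullet> hess_f (n f) v x)) |v. v \<in> Ef f}"

definition Th_kdofs :: "(vec3 set \<Rightarrow> vec3) \<Rightarrow> mat3 dofs" where
  "Th_kdofs n K =
     {(\<lambda>S. integral K (\<lambda>x. ccs S x \<bullet> T x)) |T. T \<in> M4 n K} \<union>
     {(\<lambda>S. integral K (\<lambda>x. S x \<bullet> eps v x)) |v. v \<in> P70 K}"

definition Th_dofs :: "(vec3 set \<Rightarrow> vec3) \<Rightarrow> (vec3 set \<Rightarrow> vec3) \<Rightarrow> (vec3 set \<Rightarrow> vec3) \<Rightarrow>
    (vec3 set \<Rightarrow> vec3) \<Rightarrow> mat3 dofs" where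
  "Th_dofs n s \<mu> \<nu> = all_dofs Th_vdofs (Th_edofs s \<mu> \<nu>) (Th_fdofs n s) (Th_kdofs n)"

definition Th_h :: "vec3 set set \<Rightarrow> (vec3 set \<Rightarrow> vec3) \<Rightarrow> (vec3 set \<Rightarrow> vec3) \<Rightarrow> (vec3 set \<Rightarrow> vec3) \<Rightarrow>
    (vec3 set \<Rightarrow> vec3) \<Rightarrow> (vec3 set \<Rightarrow> vec3 \<Rightarrow> mat3) set" where
  "Th_h \<T> n s \<mu> \<nu> = fe_space \<T> Th_loc Th_vdofs (Th_edofs s \<mu> \<nu>) (Th_fdofs n s)"

definition Pi_Th :: "vec3 set set \<Rightarrow> (vec3 set \<Rightarrow> vec3) \<Rightarrow> (vec3 set \<Rightarrow> vec3) \<Rightarrow> (vec3 set \<Rightarrow> vec3) \<Rightarrow>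
    (vec3 set \<Rightarrow> vec3) \<Rightarrow> (vec3 \<Rightarrow> mat3) \<Rightarrow> vec3 set \<Rightarrow> vec3 \<Rightarrow> mat3" where
  "Pi_Th \<T> n s \<mu> \<nu> = interpolant \<T> (Th_h \<T> n s \<mu> \<nu>) (Th_dofs n s \<mu> \<nu>)"


subsection \<open>The space of stresses\<close>

definition Sg_loc :: "(vec3 \<Rightarrow> mat3) set" where
  "Sg_loc = {T \<in> polys 4 Sym. mdiv T \<in> polys 1 UNIV}"

definition Sg_vdofs :: "mat3 vdofs" where
  "Sg_vdofs x = {(\<lambda>T. T x $ i $ j) |i j. True}"

definition Sg_edofs :: "(vec3 set \<Rightarrow> vec3) \<Rightarrow> (vec3 set \<Rightarrow> vec3) \<Rightarrow> (vec3 set \<Rightarrow> vec3) \<Rightarrow> mat3 dofs" where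
  "Sg_edofs s nm np e =
     {(\<lambda>T. edge_int e (\<lambda>x. (a \<bullet> (T x *v b)) * v x)) |a b v.
        (a, b) \<in> {(s e, nm e), (s e, np e), (nm e, nm e), (np e, np e), (nm e, np e)} \<and>
        v \<in> polys 2 UNIV}"

definition Sg_fdofs :: "(vec3 set \<Rightarrow> vec3) \<Rightarrow> mat3 dofs" where
  "Sg_fdofs n f = {(\<lambda>T. face_int f (\<lambda>x. (T x *v n f) \<bullet> v x)) |v. v \<in> polys 1 UNIV}"

definition Sg_kdofs :: "(vec3 set \<Rightarrow> vec3) \<Rightarrow> mat3 dofs" where
  "Sg_kdofs n K =
     {(\<lambda>T. integral K (\<lambda>x. T x $ i $ j) / measure lebesgue K) |i j. True} \<union>
     {(\<lambda>T. integral K (\<lambda>x. T x \<bullet> U x)) |U. U \<in> M4 n K}"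

definition Sg_dofs :: "(vec3 set \<Rightarrow> vec3) \<Rightarrow> (vec3 set \<Rightarrow> vec3) \<Rightarrow> (vec3 set \<Rightarrow> vec3) \<Rightarrow>
    (vec3 set \<Rightarrow> vec3) \<Rightarrow> mat3 dofs" where
  "Sg_dofs n s nm np = all_dofs Sg_vdofs (Sg_edofs s nm np) (Sg_fdofs n) (Sg_kdofs n)"

definition Sg_h :: "vec3 set set \<Rightarrow> (vec3 set \<Rightarrow> vec3) \<Rightarrow> (vec3 set \<Rightarrow> vec3) \<Rightarrow> (vec3 set \<Rightarrow> vec3) \<Rightarrow>
    (vec3 set \<Rightarrow> vec3) \<Rightarrow> (vec3 set \<Rightarrow> vec3 \<Rightarrow> mat3) set" where
  "Sg_h \<T> n s nm np = fe_space \<T> Sg_loc Sg_vdofs (Sg_edofs s nm np) (Sg_fdofs n)"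

definition Pi_Sg :: "vec3 set set \<Rightarrow> (vec3 set \<Rightarrow> vec3) \<Rightarrow> (vec3 set \<Rightarrow> vec3) \<Rightarrow> (vec3 set \<Rightarrow> vec3) \<Rightarrow>
    (vec3 set \<Rightarrow> vec3) \<Rightarrow> (vec3 \<Rightarrow> mat3) \<Rightarrow> vec3 set \<Rightarrow> vec3 \<Rightarrow> mat3" where
  "Pi_Sg \<T> n s nm np = interpolant \<T> (Sg_h \<T> n s nm np) (Sg_dofs n s nm np)"


subsection \<open>The space of loads\<close>

definition V_h :: "vec3 set set \<Rightarrow> (vec3 set \<Rightarrow> vec3 \<Rightarrow> vec3) set" where
  "V_h \<T> = broken \<T> (polys 1 UNIV)"

definition Pi_V :: "vec3 set set \<Rightarrow> (vec3 \<Rightarrow> vec3) \<Rightarrow> vec3 set \<Rightarrow> vec3 \<Rightarrow> vec3" where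
  "Pi_V \<T> g = (THE u. u \<in> V_h \<T> \<and>
     (\<forall>v\<in>V_h \<T>. (\<Sum>K\<in>\<T>. integral K (\<lambda>x. (u K x - g x) \<bullet> v K x)) = 0))"


section \<open>Distributional derivatives and function spaces\<close>

definition test_fun :: "vec3 set \<Rightarrow> (vec3 \<Rightarrow> real) \<Rightarrow> bool" where
  "test_fun \<Omega> \<phi> \<longleftrightarrow> smooth \<phi> \<and> (\<exists>C\<subseteq>\<Omega>. compact C \<and> (\<forall>x. x \<notin> C \<longrightarrow> \<phi> x = 0))"

definition L2 :: "vec3 set \<Rightarrow> (vec3 \<Rightarrow> 'b::euclidean_space) \<Rightarrow> bool" where
  "L2 \<Omega> f \<longleftrightarrow> f \<in> borel_measurable (lebesgue_on \<Omega>) \<and> integrable (lebesgue_on \<Omega>) (\<lambda>x. (norm (f x))\<^sup>2)"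

definition weak_grad :: "vec3 set \<Rightarrow> (vec3 \<Rightarrow> vec3) \<Rightarrow> (vec3 \<Rightarrow> mat3) \<Rightarrow> bool" where
  "weak_grad \<Omega> w G \<longleftrightarrow> (\<forall>\<phi>. test_fun \<Omega> \<phi> \<longrightarrow> (\<forall>i j.
     (LINT x|lebesgue_on \<Omega>. G x $ i $ j * \<phi> x) = - (LINT x|lebesgue_on \<Omega>. w x $ i * pd j \<phi> x)))"

definition weak_eps :: "vec3 set \<Rightarrow> (vec3 \<Rightarrow> vec3) \<Rightarrow> (vec3 \<Rightarrow> mat3) \<Rightarrow> bool" where
  "weak_eps \<Omega> w E \<longleftrightarrow> (\<forall>\<phi>. test_fun \<Omega> \<phi> \<longrightarrow> (\<forall>i j.
     (LINT x|lebesgue_on \<Omega>. E x $ i $ j * \<phi> x) =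
     - (LINT x|lebesgue_on \<Omega>. 1/2 * (w x $ i * pd j \<phi> x + w x $ j * pd i \<phi> x))))"

definition weak_div :: "vec3 set \<Rightarrow> (vec3 \<Rightarrow> mat3) \<Rightarrow> (vec3 \<Rightarrow> vec3) \<Rightarrow> bool" where
  "weak_div \<Omega> T g \<longleftrightarrow> (\<forall>\<phi>. test_fun \<Omega> \<phi> \<longrightarrow> (\<forall>i.
     (LINT x|lebesgue_on \<Omega>. g x $ i * \<phi> x) =
     - (LINT x|lebesgue_on \<Omega>. (\<Sum>j\<in>UNIV. T x $ i $ j * pd j \<phi> x))))"

definition weak_ccs :: "vec3 set \<Rightarrow> (vec3 \<Rightarrow> mat3) \<Rightarrow> (vec3 \<Rightarrow> mat3) \<Rightarrow> bool" where
  "weak_ccs \<Omega> S R \<longleftrightarrow> (\<forall>\<phi>. test_fun \<Omega> \<phi> \<longrightarrow> (\<forall>i j.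
     (LINT x|lebesgue_on \<Omega>. R x $ i $ j * \<phi> x) =
     (LINT x|lebesgue_on \<Omega>. (\<Sum>k\<in>UNIV. \<Sum>l\<in>UNIV. \<Sum>m\<in>UNIV. \<Sum>p\<in>UNIV.
        levi_civita i k l * levi_civita j m p * S x $ l $ p * pd k (pd m \<phi>) x))))"

definition H1 :: "vec3 set \<Rightarrow> (vec3 \<Rightarrow> vec3) set" where
  "H1 \<Omega> = {w. L2 \<Omega> w \<and> (\<exists>G. L2 \<Omega> G \<and> weak_grad \<Omega> w G)}"

definition H_ccs :: "vec3 set \<Rightarrow> (vec3 \<Rightarrow> mat3) set" where
  "H_ccs \<Omega> = {S. L2 \<Omega> S \<and> (AE x in lebesgue_on \<Omega>. S x \<in> Sym) \<and> (\<exists>R. L2 \<Omega> R \<and> weak_ccs \<Omega> S R)}"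

definition H_div :: "vec3 set \<Rightarrow> (vec3 \<Rightarrow> mat3) set" where
  "H_div \<Omega> = {T. L2 \<Omega> T \<and> (AE x in lebesgue_on \<Omega>. T x \<in> Sym) \<and> (\<exists>g. L2 \<Omega> g \<and> weak_div \<Omega> T g)}"

end

(*
A field in one of the spaces is a piecewise polynomial whose degrees of freedom on vertices, edges
and faces agree across elements. On a common face the degrees of freedom of the difference of two
pieces vanish, and integration by parts on edges and faces together with counting zeros forces the
relevant traces of the difference to vanish: u for W, the tangential part of S and Lambda_f(S) for
Theta, Tn for Sigma. Integration by parts over the tetrahedra then turns the elementwise derivatives
into distributional ones: the contributions of an interior face cancel, and those of a boundary face
vanish with the test function. For curl curl* the face integrals reduce to tangential derivatives.

The interpolants commute with the operators because of unisolvence: if all degrees of freedom of w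
vanish, then so do all degrees of freedom of epsilon(w), by integration by parts on edges, faces and
tetrahedra. Apply this to w minus its interpolant. The same holds for curl curl* and for div.
*)
theory Submission
 imports Defs
begin

text \<open>The face degrees of freedom of a strain test only against surface strains
  \<open>eps_f n v\<close> and surface Hessians of special functions, so zeros cannot be counted
  directly: the tangential part of S has to be recognised as such a strain itself, and Lambda_f(S)
  as such a Hessian. The integrability condition for both potentials is that the normal trace of
  \<open>ccs S\<close> vanishes on the face, and it does because zero degrees of freedom of S entail
  zero degrees of freedom of \<open>ccs S\<close>. The commuting property rests on the same
  implication, which is therefore proved for smooth fields and not only for polynomials.

  The pieces of S agree across a face only tangentially. The components of the jump with a normal
  index leave integrals over edges, which cancel only in the sum over all faces around an edge; the
  signs express that the boundary of a boundary is zero.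

  Matrix fields enter through the forms x'Sy with free vectors x, y, and curl is evaluated on cross
  products. The operators become differences of directional derivatives, into which the frame of an
  edge or a face can be inserted.\<close>

notation scaleR (infixr "*R" 75) and inner (infix "<.>" 70)

abbreviation "seg \<equiv> closed_segment"
abbreviation "hull3 a b c \<equiv> convex hull {a, b, c}"
abbreviation "hull4 a b c d \<equiv> convex hull {a, b, c, d}"
abbreviation "cont \<equiv> continuous_on UNIV"

abbreviation pt1 :: "'a::real_vector => 'a => real => 'a" where
  "pt1 a b t \<equiv> a + t *R (b - a)"
abbreviation pt2 :: "'a::real_vector => 'a => 'a => real => real => 'a" where
  "pt2 a b c t u \<equiv> a + t *R (b - a) + u *R (c - a)"

section \<open>Smooth functions and directional derivatives\<close>

lemma dd_eqI: "(f has_derivative f') (at x) ==> dd v f x = f' v"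
 by (simp add: dd_def frechet_derivative_at[symmetric])

lemma dd_has_derivative: "f differentiable (at x) ==> (f has_derivative (%v. dd v f x)) (at x)"
 unfolding dd_def by (simp add: frechet_derivative_works[symmetric])

lemma Ck_mono: "Ck (Suc k) f ==> Ck k f"
proof (induction k arbitrary: f)
 case 0
 then show ?case
  by (auto intro!: differentiable_imp_continuous_on simp: differentiable_on_def)
next
 case (Suc k)
 then show ?case by auto
qed

lemma Ck_add: "Ck k f ==> Ck k g ==> Ck k (%x. f x + g x)"
proof (induction k arbitrary: f g)
 case 0
 then show ?case by (auto intro: continuous_intros)
next
 case (Suc k)
 have "pd i (%x. f x + g x) = (%x. pd i f x + pd i g x)" for i
  unfolding pd_def
  using Suc.prems by (intro ext dd_eqI) (auto intro!: has_derivative_add dd_has_derivative)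
 with Suc show ?case by (auto intro: differentiable_add)
qed

lemma Ck_linear:
 assumes L: "bounded_linear L"
 shows "Ck k f ==> Ck k (%x. L (f x))"
proof (induction k arbitrary: f)
 case 0
 then show ?case by (auto intro: bounded_linear.continuous_on[OF L])
next
 case (Suc k)
 have *: "((%x. L (f x)) has_derivative (%v. L (dd v f x))) (at x)" for x
  using Suc.prems by (intro bounded_linear.has_derivative[OF L] dd_has_derivative) auto
 then have "pd i (%x. L (f x)) = (%x. L (pd i f x))" for i
  unfolding pd_def by (intro ext dd_eqI)
 with Suc * show ?case by (auto simp: differentiable_def)
qed

lemma Ck_bilinear:
 assumes B: "bounded_bilinear B"
 shows "Ck k f ==> Ck k g ==> Ck k (%x. B (f x) (g x))"
proof (induction k arbitrary: f g)
 case 0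
 then show ?case by (auto intro: bounded_bilinear.continuous_on[OF B])
next
 case (Suc k)
 have *: "((%x. B (f x) (g x)) has_derivative (%v. B (f x) (dd v g x) + B (dd v f x) (g x))) (at x)" for x
  using Suc.prems by (intro bounded_bilinear.FDERIV[OF B] dd_has_derivative) auto
 then have **: "pd i (%x. B (f x) (g x)) = (%x. B (f x) (pd i g x) + B (pd i f x) (g x))" for i
  unfolding pd_def by (intro ext dd_eqI)
 have "Ck k (%x. B (f x) (pd i g x) + B (pd i f x) (g x))" for i
  using Suc.prems Ck_mono[of k f] Ck_mono[of k g] by (intro Ck_add Suc.IH) auto
 with * ** show ?case by (auto simp: differentiable_def)
qed

lemma Ck_const: "Ck k (%x. c)"
proof (induction k arbitrary: c)
 case (Suc k)
 have "pd i (%x. c) = (%x. 0)" for i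
  unfolding pd_def by (intro ext dd_eqI) auto
 with Suc show ?case by simp
qed simp

lemma smooth_const [simp, intro]: "smooth (%x. c)"
 by (simp add: smooth_def Ck_const)

lemma smooth_add [simp, intro]: "smooth f ==> smooth g ==> smooth (%x. f x + g x)"
 by (simp add: smooth_def Ck_add)

lemma smooth_linear: "bounded_linear L ==> smooth f ==> smooth (%x. L (f x))"
 by (simp add: smooth_def Ck_linear)

lemma smooth_bilinear: "bounded_bilinear B ==> smooth f ==> smooth g ==> smooth (%x. B (f x) (g x))"
 by (simp add: smooth_def Ck_bilinear)

lemma smooth_minus [simp, intro]: "smooth f ==> smooth (%x. - f x)"
 by (rule smooth_linear[OF bounded_linear_minus[OF bounded_linear_ident]])

lemma smooth_diff [simp, intro]: "smooth f ==> smooth g ==> smooth (%x. f x - g x)"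
 using smooth_add[of f "%x. - g x"] by simp

lemma smooth_mult [simp, intro]:
 fixes f :: "vec3 => 'a::real_normed_algebra"
 shows "smooth f ==> smooth g ==> smooth (%x. f x * g x)"
 by (rule smooth_bilinear[OF bounded_bilinear_mult])

lemma smooth_scaleR [simp, intro]: "smooth f ==> smooth g ==> smooth (%x. f x *R g x)"
 by (rule smooth_bilinear[OF bounded_bilinear_scaleR])

lemma smooth_inner [simp, intro]: "smooth f ==> smooth g ==> smooth (%x. f x <.> g x)"
 by (rule smooth_bilinear[OF bounded_bilinear_inner])

lemma smooth_sum [simp, intro]: "(!!i. i : I ==> smooth (f i)) ==> smooth (%x. \<Sum>i\<in>I. f i x)"
 by (induction I rule: infinite_finite_induct) auto

lemma smooth_differentiable: "smooth f ==> f differentiable (at x)"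
 unfolding smooth_def by (auto dest: spec[of _ "Suc 0"])

lemma smooth_cont [intro]: "smooth f ==> continuous_on A f"
 unfolding smooth_def by (metis Ck.simps(1) continuous_on_subset subset_UNIV)

lemma smooth_pd: "smooth f ==> smooth (pd i f)"
 unfolding smooth_def by (metis Ck.simps(2))

lemma smooth_id [simp, intro]: "smooth (%x. x)"
proof -
 have "pd i (%x::vec3. x) = (%x. axis i 1)" for i
  unfolding pd_def by (intro ext dd_eqI) auto
 then have "Ck k (%x::vec3. x)" for k
  by (cases k) (auto simp: Ck_const)
 then show ?thesis
  by (simp add: smooth_def)
qed

lemma smooth_nth [simp, intro]: "smooth f ==> smooth (%x. f x $ i)"
 by (rule smooth_linear[OF bounded_linear_vec_nth])

lemma linear_linearI: "linear f ==> bounded_linear (f :: 'a::euclidean_space => 'b::real_normed_vector)"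
 by (simp add: linear_conv_bounded_linear)

lemma smooth_has_derivative: "smooth f ==> (f has_derivative (%v. dd v f x)) (at x)"
 by (intro dd_has_derivative smooth_differentiable)

lemma dd_linear_dir: "smooth f ==> bounded_linear (%v. dd v f x)"
 using smooth_has_derivative has_derivative_bounded_linear by blast

lemma dd_dir_add: "smooth f ==> dd (u + v) f = (%x. dd u f x + dd v f x)"
 by (intro ext) (simp add: linear_simps[OF dd_linear_dir])

lemma dd_dir_diff: "smooth f ==> dd (u - v) f = (%x. dd u f x - dd v f x)"
 by (intro ext) (simp add: linear_simps[OF dd_linear_dir])

lemma dd_dir_scaleR: "smooth f ==> dd (c *R v) f = (%x. c *R dd v f x)"
 by (intro ext) (simp add: linear_simps[OF dd_linear_dir])

lemma dd_dir_0: "smooth f ==> dd 0 f = (%x. 0)"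
 by (intro ext) (simp add: linear_simps[OF dd_linear_dir])

lemma dd_dir_sum: "smooth f ==> dd (\<Sum>i\<in>I. v i) f = (%x. \<Sum>i\<in>I. dd (v i) f x)"
 by (intro ext) (rule linear_sum[OF bounded_linear.linear[OF dd_linear_dir]])

lemma dd_eq_sum_pd: "smooth f ==> dd v f = (%x. \<Sum>i\<in>UNIV. v $ i *R pd i f x)"
proof -
 assume f: "smooth f"
 have "v = (\<Sum>i\<in>UNIV. v $ i *R axis i 1)"
  by (simp add: vec_eq_iff axis_def if_distrib cong: if_cong)
 then have "dd v f = dd (\<Sum>i\<in>UNIV. v $ i *R axis i 1) f" by simp
 then show ?thesis
  by (simp only: dd_dir_sum[OF f] dd_dir_scaleR[OF f] pd_def)
qed

lemma smooth_dd [simp, intro]: "smooth f ==> smooth (dd v f)"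
 by (simp add: dd_eq_sum_pd smooth_pd)

lemma dd_const [simp]: "dd v (%x. c) = (%x. 0)"
 by (intro ext dd_eqI) auto

lemma dd_id: "dd v (%x. x) = (%x. v)"
 by (intro ext dd_eqI) auto

lemma dd_add: "smooth f ==> smooth g ==> dd v (%x. f x + g x) = (%x. dd v f x + dd v g x)"
 by (rule ext) (rule dd_eqI[OF has_derivative_add[OF smooth_has_derivative smooth_has_derivative]])

lemma dd_linear: "bounded_linear L ==> smooth f ==> dd v (%x. L (f x)) = (%x. L (dd v f x))"
 by (rule ext) (rule dd_eqI[OF bounded_linear.has_derivative[OF _ smooth_has_derivative]])

lemma dd_bilinear: "bounded_bilinear B ==> smooth f ==> smooth g ==>
  dd v (%x. B (f x) (g x)) = (%x. B (f x) (dd v g x) + B (dd v f x) (g x))"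
 by (rule ext) (rule dd_eqI[OF bounded_bilinear.FDERIV[OF _ smooth_has_derivative smooth_has_derivative]])

lemma dd_diff: "smooth f ==> smooth g ==> dd v (%x. f x - g x) = (%x. dd v f x - dd v g x)"
 by (rule ext) (rule dd_eqI[OF has_derivative_diff[OF smooth_has_derivative smooth_has_derivative]])

lemma dd_mult:
 fixes f :: "vec3 => real"
 shows "smooth f ==> smooth g ==> dd v (%x. f x * g x) = (%x. f x * dd v g x + dd v f x * g x)"
 by (rule dd_bilinear[OF bounded_bilinear_mult])

lemma dd_cmult:
 fixes f :: "vec3 => real"
 shows "smooth f ==> dd v (%x. c * f x) = (%x. c * dd v f x)"
 by (rule dd_linear[OF bounded_linear_mult_right])

lemma dd_scaleR: "smooth f ==> smooth g ==>
  dd v (%x. f x *R g x) = (%x. f x *R dd v g x + dd v f x *R g x)"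
 by (rule dd_bilinear[OF bounded_bilinear_scaleR])

lemma dd_cinner: "smooth f ==> dd v (%x. c <.> f x) = (%x. c <.> dd v f x)"
 by (rule dd_linear[OF bounded_linear_inner_right])

lemma dd_nth: "smooth f ==> dd v (%x. f x $ i) = (%x. dd v f x $ i)"
 by (rule dd_linear[OF bounded_linear_vec_nth])

lemma dd_sum: "(!!i. i : I ==> smooth (f i)) ==> dd v (%x. \<Sum>i\<in>I. f i x) = (%x. \<Sum>i\<in>I. dd v (f i) x)"
 by (rule ext) (rule dd_eqI[OF has_derivative_sum[OF smooth_has_derivative]])

lemma smooth_has_vector_derivative:
 assumes "smooth f"
 shows "((%t. f (a + t *R v)) has_vector_derivative dd v f (a + t *R v)) (at t within T)"
proof -
 have "((%t. f (a + t *R v)) has_derivative (%h. dd (h *R v) f (a + t *R v))) (at t within T)"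
  by (rule has_derivative_compose[OF _ smooth_has_derivative[OF assms]])
    (auto intro!: derivative_eq_intros)
 then show ?thesis
  by (simp add: has_vector_derivative_def dd_dir_scaleR[OF assms])
qed

text \<open>Both mixed derivatives are limits of the same second difference quotient.\<close>
lemma dd_commute_real:
 fixes f :: "vec3 => real"
 assumes f: "smooth f"
 shows "dd u (dd v f) = dd v (dd u f)"
proof (rule ext, rule ccontr)
 fix x assume neq: "dd u (dd v f) x ~= dd v (dd u f) x"
 have fd: "((%t. g (y + t *R w)) has_real_derivative dd w g (y + t *R w)) (at t)"
  if "smooth g" for g :: "vec3 => real" and y w t
  using smooth_has_vector_derivative[OF that] by (simp add: has_real_derivative_iff_has_vector_derivative)
 define D where "D p q t = f (x + t *R p + t *R q) - f (x + t *R p) - f (x + t *R q) + f x" for p q t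
 have key: "\<exists>\<sigma> \<tau>. 0 < \<sigma> & \<sigma> < t & 0 < \<tau> & \<tau> < t & D p q t = t * t * dd q (dd p f) (x + \<sigma> *R p + \<tau> *R q)"
  if "t > 0" for p q t
 proof -
  have "\<exists>z>0. z < t & (f ((x + t *R q) + t *R p) - f (x + t *R p)) - (f ((x + t *R q) + 0 *R p) - f (x + 0 *R p))
    = (t - 0) * (dd p f ((x + t *R q) + z *R p) - dd p f (x + z *R p))"
   using that by (intro MVT2 DERIV_diff fd f)
  then obtain \<sigma> where \<sigma>: "0 < \<sigma>" "\<sigma> < t" and
    "(f ((x + t *R q) + t *R p) - f (x + t *R p)) - (f ((x + t *R q) + 0 *R p) - f (x + 0 *R p))
    = (t - 0) * (dd p f ((x + t *R q) + \<sigma> *R p) - dd p f (x + \<sigma> *R p))"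
   by blast
  then have D: "D p q t = t * (dd p f ((x + \<sigma> *R p) + t *R q) - dd p f (x + \<sigma> *R p))"
   by (simp add: D_def add.assoc add.commute[of "t *R q"])
  have "\<exists>z>0. z < t & dd p f ((x + \<sigma> *R p) + t *R q) - dd p f ((x + \<sigma> *R p) + 0 *R q)
    = (t - 0) * dd q (dd p f) ((x + \<sigma> *R p) + z *R q)"
   using that f by (intro MVT2 fd smooth_dd)
  then obtain \<tau> where "0 < \<tau>" "\<tau> < t" and
    "dd p f ((x + \<sigma> *R p) + t *R q) - dd p f ((x + \<sigma> *R p) + 0 *R q)
    = (t - 0) * dd q (dd p f) ((x + \<sigma> *R p) + \<tau> *R q)" by blast
  then have "D p q t = t * t * dd q (dd p f) (x + \<sigma> *R p + \<tau> *R q)"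
   by (simp add: D)
  with \<sigma> \<open>0 < \<tau>\<close> \<open>\<tau> < t\<close> show ?thesis by blast
 qed
 \<comment> \<open>Half the gap: a common value of the two mixed derivatives at nearby points cannot
   lie strictly within \<open>e\<close> of both values at \<open>x\<close>.\<close>
 define e where "e = \<bar>dd u (dd v f) x - dd v (dd u f) x\<bar> / 2"
 have "e > 0" using neq by (simp add: e_def)
 have cont: "\<exists>d>0. \<forall>y. dist y x < d \<longrightarrow> dist (g y) (g x) < e" if "smooth g" for g :: "vec3 => real"
  using smooth_cont[OF that, of UNIV] \<open>e > 0\<close> unfolding continuous_on_iff by blast
 obtain d1 where d1: "d1 > 0" "!!y. dist y x < d1 ==> dist (dd u (dd v f) y) (dd u (dd v f) x) < e"
  using cont[OF smooth_dd[OF smooth_dd[OF f]]] by blast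
 obtain d2 where d2: "d2 > 0" "!!y. dist y x < d2 ==> dist (dd v (dd u f) y) (dd v (dd u f) x) < e"
  using cont[OF smooth_dd[OF smooth_dd[OF f]]] by blast
 define c where "c = norm u + norm v + 1"
 have "c > 0" by (simp add: c_def add_nonneg_pos)
 \<comment> \<open>With this step size the intermediate points of both second differences stay
   within \<open>min d1 d2\<close> of \<open>x\<close>.\<close>
 define t where "t = min d1 d2 / c"
 have "t > 0" using d1 d2 \<open>c > 0\<close> by (simp add: t_def)
 have near: "dist (x + \<sigma> *R p + \<tau> *R q) x < min d1 d2"
  if "0 < \<sigma>" "\<sigma> < t" "0 < \<tau>" "\<tau> < t" "norm p + norm q + 1 = c" for \<sigma> \<tau> p q
 proof -
  have "dist (x + \<sigma> *R p + \<tau> *R q) x = norm (\<sigma> *R p + \<tau> *R q)"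
   by (simp add: dist_norm)
  also have "\<dots> <= \<sigma> * norm p + \<tau> * norm q"
   using norm_triangle_ineq[of "\<sigma> *R p" "\<tau> *R q"] that by simp
  also have "\<dots> <= t * norm p + t * norm q"
   using that by (intro add_mono mult_right_mono) auto
  also have "\<dots> < t * c"
   using \<open>t > 0\<close> by (simp add: that(5)[symmetric] distrib_left)
  finally show ?thesis using \<open>c > 0\<close> by (simp add: t_def)
 qed
 obtain \<sigma> \<tau> where 1: "0 < \<sigma>" "\<sigma> < t" "0 < \<tau>" "\<tau> < t" "D u v t = t * t * dd v (dd u f) (x + \<sigma> *R u + \<tau> *R v)"
  using key[OF \<open>t > 0\<close>] by blast
 obtain \<sigma>' \<tau>' where 2: "0 < \<sigma>'" "\<sigma>' < t" "0 < \<tau>'" "\<tau>' < t" "D v u t = t * t * dd u (dd v f) (x + \<sigma>' *R v + \<tau>' *R u)"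
  using key[OF \<open>t > 0\<close>] by blast
 have "D u v t = D v u t" by (simp add: D_def add.assoc add.commute[of "t *R u"])
 then have "dd v (dd u f) (x + \<sigma> *R u + \<tau> *R v) = dd u (dd v f) (x + \<sigma>' *R v + \<tau>' *R u)"
  using 1(5) 2(5) \<open>t > 0\<close> by simp
 moreover have "\<bar>dd v (dd u f) (x + \<sigma> *R u + \<tau> *R v) - dd v (dd u f) x\<bar> < e"
  using d2(2) near[OF 1(1-4)] by (simp add: c_def dist_real_def)
 moreover have "\<bar>dd u (dd v f) (x + \<sigma>' *R v + \<tau>' *R u) - dd u (dd v f) x\<bar> < e"
  using d1(2) near[OF 2(1-4)] by (simp add: c_def dist_real_def)
 ultimately show False
  unfolding e_def by (smt (verit) field_sum_of_halves)
qed

lemma dd_commute: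
 fixes f :: "vec3 => 'b::euclidean_space"
 assumes f: "smooth f"
 shows "dd u (dd v f) = dd v (dd u f)"
proof
 fix x
 have "c <.> dd u (dd v f) x = c <.> dd v (dd u f) x" for c
  using dd_commute_real[of "%x. c <.> f x" u v] f by (simp add: dd_cinner fun_eq_iff)
 then show "dd u (dd v f) x = dd v (dd u f) x"
  by (metis vector_eq_ldot)
qed

lemma dd_cong_open:
 assumes "open A" "x : A" "!!y. y : A ==> f y = g y"
 shows "dd v f x = dd v g x"
proof -
 have "(f has_derivative f') (at x) \<longleftrightarrow> (g has_derivative f') (at x)" for f'
 proof
  show "(f has_derivative f') (at x) ==> (g has_derivative f') (at x)"
   by (rule has_derivative_transform_within_open[OF _ assms])
  show "(g has_derivative f') (at x) ==> (f has_derivative f') (at x)"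
   by (rule has_derivative_transform_within_open[OF _ assms(1,2) assms(3)[symmetric]])
 qed
 then show ?thesis
  unfolding dd_def frechet_derivative_def by simp
qed

lemma smooth_eq_closure:
 assumes "smooth f" "smooth g" "!!y. y : A ==> f y = g y" "x : closure A"
 shows "f x = g x"
proof -
 have "continuous_on (closure A) (%x. f x - g x)"
  using assms by auto
 then have "(%x. f x - g x) x = 0"
  by (rule continuous_constant_on_closure) (use assms in auto)
 then show ?thesis by simp
qed

text \<open>In the interior a derivative sees only values on \<open>K\<close>, and continuity
  carries the equality to the boundary of \<open>K\<close>. Hence the degrees of freedom on
  \<open>K\<close> ignore how a smooth field is extended beyond it.\<close>

lemma dd_cong_closure:
 assumes "smooth f" "smooth g" "!!y. y : K ==> f y = g y" "K \<subseteq> closure (interior K)" "x : K"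
 shows "dd v f x = dd v g x"
proof (rule smooth_eq_closure[where A = "interior K"])
 show "dd v f y = dd v g y" if "y : interior K" for y
  using that assms(3) interior_subset by (intro dd_cong_open[where A = "interior K"]) auto
qed (use assms in auto)

text \<open>A directional derivative belongs to the restriction to one line. This is how tangential
  derivatives are read off from traces on edges and faces.\<close>

lemma dd_cong_line:
 assumes "smooth f" "smooth g" "!!t. f (x + t *R v) = g (x + t *R v)"
 shows "dd v f x = dd v g x"
proof -
 have "((%t. f (x + t *R v)) has_vector_derivative dd v f (x + 0 *R v)) (at 0 within UNIV)"
  by (rule smooth_has_vector_derivative[OF assms(1)])
 moreover have "((%t. f (x + t *R v)) has_vector_derivative dd v g (x + 0 *R v)) (at 0 within UNIV)"
  using smooth_has_vector_derivative[OF assms(2), of x v 0 UNIV] assms(3) by simp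
 ultimately show ?thesis
  using vector_derivative_unique_at by force
qed

section \<open>Polynomials\<close>

text \<open>A form of \<open>polys\<close> that admits induction; \<open>polys_iff\<close>
  identifies the two for subspaces. The index is an upper bound for the degree, hence the rule
  \<open>mono\<close>.\<close>

inductive polyi :: "'b::real_normed_vector set => nat => (vec3 => 'b) => bool" for X where
 const: "c : X ==> polyi X 0 (%x. c)"
| add: "polyi X k p ==> polyi X k q ==> polyi X k (%x. p x + q x)"
| mult: "polyi X k p ==> polyi X (Suc k) (%x. x $ i *R p x)"
| mono: "polyi X k p ==> polyi X (Suc k) p"

lemma polyi_mono: "k <= l ==> polyi X k p ==> polyi X l p"
 by (induction rule: dec_induct) (auto intro: polyi.mono)

lemma polyi_power: "polyi X k p ==> polyi X (j + k) (%x. x $ i ^ j *R p x)"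
proof (induction j)
 case (Suc j)
 from polyi.mult[OF Suc.IH[OF Suc.prems], of i] show ?case by simp
qed simp

lemma polyi_monomial:
 assumes "c : X"
 shows "polyi X (i + j + k) (%x. (x $ 1 ^ i * x $ 2 ^ j * x $ 3 ^ k) *R c)"
proof -
 have "polyi X (i + (j + (k + 0))) (%x. x $ 1 ^ i *R x $ 2 ^ j *R x $ 3 ^ k *R c)"
  by (intro polyi_power polyi.const assms)
 then show ?thesis by (simp add: add.assoc mult.assoc)
qed

lemma polyi_sum:
 assumes "subspace X" "finite I" "!!i. i : I ==> polyi X k (p i)"
 shows "polyi X k (%x. \<Sum>i\<in>I. p i x)"
 using assms(2,3)
proof (induction I)
 case empty
 then show ?case
  using polyi_mono[OF _ polyi.const[of 0 X]] subspace_0[OF assms(1)] by auto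
qed (auto intro: polyi.add)

definition mono_ix :: "nat => (nat \<times> nat \<times> nat) set" where
 "mono_ix k = {(a, b, d). a + b + d <= k}"

lemma finite_mono_ix [simp]: "finite (mono_ix k)"
 by (rule finite_subset[of _ "{..k} \<times> {..k} \<times> {..k}"]) (auto simp: mono_ix_def)

definition mono_fun :: "nat \<times> nat \<times> nat => vec3 => real" where
 "mono_fun = (%(a, b, d) x. x $ 1 ^ a * x $ 2 ^ b * x $ 3 ^ d)"

lemma polys_alt: "p : polys k X \<longleftrightarrow> (\<exists>c. (\<forall>\<alpha>. c \<alpha> : X) & p = (%x. \<Sum>\<alpha>\<in>mono_ix k. mono_fun \<alpha> x *R c \<alpha>))"
 unfolding polys_def mono_ix_def[symmetric] mono_fun_def by (simp add: case_prod_unfold)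

lemma polys_imp_polyi:
 assumes "subspace X" "p : polys k X"
 shows "polyi X k p"
proof -
 obtain c where c: "!!\<alpha>. c \<alpha> : X" "p = (%x. \<Sum>\<alpha>\<in>mono_ix k. mono_fun \<alpha> x *R c \<alpha>)"
  using assms(2) by (auto simp: polys_alt)
 show ?thesis
  unfolding c(2) using c(1)
  by (intro polyi_sum[OF assms(1)] finite_mono_ix)
    (auto simp: mono_ix_def mono_fun_def intro: polyi_mono[OF _ polyi_monomial])
qed

lemma polyi_imp_polys:
 assumes X: "subspace X" and "polyi X k p"
 shows "p : polys k X"
 using assms(2)
proof induction
 case (const c)
 have "mono_ix 0 = {(0, 0, 0)}" by (auto simp: mono_ix_def)
 then show ?case using const
  by (auto simp: polys_alt mono_fun_def intro!: exI[of _ "%_. c"])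
next
 case (add k p q)
 then obtain c d where c: "!!\<alpha>. c \<alpha> : X" "p = (%x. \<Sum>\<alpha>\<in>mono_ix k. mono_fun \<alpha> x *R c \<alpha>)"
  and d: "!!\<alpha>. d \<alpha> : X" "q = (%x. \<Sum>\<alpha>\<in>mono_ix k. mono_fun \<alpha> x *R d \<alpha>)"
  by (auto simp: polys_alt)
 then show ?case
  by (auto simp: polys_alt sum.distrib scaleR_add_right subspace_add[OF X] intro!: exI[of _ "%\<alpha>. c \<alpha> + d \<alpha>"])
next
 case (mono k p)
 then obtain c where c: "!!\<alpha>. c \<alpha> : X" "p = (%x. \<Sum>\<alpha>\<in>mono_ix k. mono_fun \<alpha> x *R c \<alpha>)"
  by (auto simp: polys_alt)
 have "mono_ix k \<subseteq> mono_ix (Suc k)" by (auto simp: mono_ix_def)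
 then have "p = (%x. \<Sum>\<alpha>\<in>mono_ix (Suc k). mono_fun \<alpha> x *R (if \<alpha> : mono_ix k then c \<alpha> else 0))"
  unfolding c(2) by (intro ext sum.mono_neutral_cong_left) auto
 then show ?case
  using c(1) subspace_0[OF X] by (auto simp: polys_alt intro!: exI[of _ "%\<alpha>. if \<alpha> : mono_ix k then c \<alpha> else 0"])
next
 case (mult k p i)
 then obtain c where c: "!!\<alpha>. c \<alpha> : X" "p = (%x. \<Sum>\<alpha>\<in>mono_ix k. mono_fun \<alpha> x *R c \<alpha>)"
  by (auto simp: polys_alt)
 \<comment> \<open>Multiplication by the coordinate \<open>i\<close> raises one exponent;
   \<open>s\<close> is the effect on multi-indices.\<close>
 define s where "s = (%(a, b, d). (if i = 1 then Suc a else a, if i = 2 then Suc b else b, if i = 3 then Suc d else d) :: nat \<times> nat \<times> nat)"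
 have i: "i = 1 \<or> i = 2 \<or> i = 3" using exhaust_3[of i] by blast
 have inj: "inj_on s (mono_ix k)"
  by (rule inj_onI) (simp add: s_def case_prod_unfold prod_eq_iff split: if_splits)
 have sub: "s ` mono_ix k \<subseteq> mono_ix (Suc k)"
  using i by (elim disjE) (simp_all add: mono_ix_def s_def subset_iff case_prod_unfold image_iff Bex_def, force+)
 have sm: "mono_fun (s \<alpha>) x = x $ i * mono_fun \<alpha> x" for \<alpha> x
  using i by (cases \<alpha>) (elim disjE, simp_all add: s_def mono_fun_def mult_ac)
 \<comment> \<open>The coefficients are transported along the shift; monomials without the factor
   \<open>x $ i\<close> get 0.\<close>
 define c' where "c' \<alpha> = (if \<alpha> : s ` mono_ix k then c (the_inv_into (mono_ix k) s \<alpha>) else 0)" for \<alpha>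
 have "(\<Sum>\<alpha>\<in>mono_ix (Suc k). mono_fun \<alpha> x *R c' \<alpha>) = x $ i *R p x" for x
 proof -
  have "(\<Sum>\<alpha>\<in>mono_ix (Suc k). mono_fun \<alpha> x *R c' \<alpha>) = (\<Sum>\<alpha>\<in>s ` mono_ix k. mono_fun \<alpha> x *R c' \<alpha>)"
   using sub by (intro sum.mono_neutral_right) (auto simp: c'_def)
  also have "\<dots> = (\<Sum>\<alpha>\<in>mono_ix k. (x $ i * mono_fun \<alpha> x) *R c \<alpha>)"
   unfolding sum.reindex[OF inj] by (intro sum.cong) (auto simp: c'_def sm the_inv_into_f_f[OF inj])
  finally show ?thesis
   by (simp add: c(2) scaleR_sum_right)
 qed
 moreover have "\<forall>\<alpha>. c' \<alpha> : X" using c(1) subspace_0[OF X] by (auto simp: c'_def)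
 ultimately show ?case
  unfolding polys_alt by (intro exI[of _ c']) (auto simp: fun_eq_iff)
qed

lemma polys_iff: "subspace X ==> p : polys k X \<longleftrightarrow> polyi X k p"
 using polys_imp_polyi polyi_imp_polys by blast

lemma polyi_smooth: "polyi X k p ==> smooth p"
 by (induction rule: polyi.induct) auto

lemma polyi_val: "polyi X k p ==> subspace X ==> p x : X"
 by (induction rule: polyi.induct) (auto simp: subspace_add subspace_scale)

lemma polyi_linear: "polyi X k p ==> linear L ==> L ` X \<subseteq> Y ==> polyi Y k (%x. L (p x))"
proof (induction rule: polyi.induct)
 case (add k p q)
 then show ?case by (simp add: linear_add polyi.add)
next
 case (mult k p i)
 then show ?case by (simp add: linear_cmul polyi.mult)
qed (auto intro: polyi.intros)

lemma polyi_scale: "subspace X ==> polyi X k p ==> polyi X k (%x. c *R p x)"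
 by (rule polyi_linear[where X = X]) (auto simp: subspace_scale)

lemma polyi_diff: "subspace X ==> polyi X k p ==> polyi X k q ==> polyi X k (%x. p x - q x)"
 using polyi.add[of X k p "%x. (-1) *R q x"] polyi_scale[of X k q "-1"] by simp

lemma polyi_const: "c : X ==> polyi X k (%x. c)"
 by (rule polyi_mono[OF _ polyi.const]) auto

lemma polyi_subset: "polyi X k p ==> X \<subseteq> Y ==> polyi Y k p"
 by (induction rule: polyi.induct) (auto intro: polyi.intros)

lemma dd_polyi_0:
 assumes "polyi X 0 p" shows "dd v p = (%x. 0)"
proof -
 have "k = 0 ==> dd v p = (%x. 0)" if "polyi X k p" for k
  using that by (induction rule: polyi.induct) (auto simp: dd_add polyi_smooth)
 with assms show ?thesis by simp
qed

lemma polyi_pd: "polyi X k p ==> subspace X ==> polyi X (k - 1) (pd i p)"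
proof (induction rule: polyi.induct)
 case (const c)
 then show ?case by (auto simp: pd_def subspace_0 intro: polyi_const)
next
 case (add k p q)
 then show ?case
  by (auto simp: pd_def dd_add polyi_smooth intro: polyi.add)
next
 case (mult k p j)
 have "pd i (%x. x $ j *R p x) = (%x. x $ j *R pd i p x + (axis i 1 $ j) *R p x)"
  by (simp only: pd_def dd_scaleR[OF smooth_nth[OF smooth_id] polyi_smooth[OF mult.hyps]] dd_nth[OF smooth_id] dd_id)
 \<comment> \<open>For \<open>k = 0\<close> the truncated \<open>k - 1\<close> leaves no room for
   the factor \<open>x $ j\<close>, but then the derivative of \<open>p\<close> is zero.\<close>
 moreover have "polyi X k (%x. x $ j *R pd i p x)"
 proof (cases k)
  case 0
  then have "pd i p = (%x. 0)"
   using mult.hyps by (simp add: pd_def dd_polyi_0)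
  then show ?thesis
   using mult.prems by (auto intro: polyi_const simp: subspace_0)
 next
  case (Suc l)
  then show ?thesis using polyi.mult[of X l] mult by auto
 qed
 ultimately show ?case
  using polyi_scale[OF mult.prems mult.hyps] by (auto intro: polyi.add)
next
 case (mono k p)
 then show ?case using polyi_mono[of "k - 1" "Suc k - 1"] by auto
qed

lemma polyi_dd:
 assumes "polyi X k p" "subspace X" shows "polyi X (k - 1) (dd v p)"
 unfolding dd_eq_sum_pd[OF polyi_smooth[OF assms(1)]]
 using assms by (intro polyi_sum polyi_scale polyi_pd) auto

lemma polyi_scalar_mult: "polyi UNIV j (l :: vec3 => real) ==> polyi X k p ==> subspace X ==> polyi X (j + k) (%x. l x *R p x)"
proof (induction rule: polyi.induct)
 case (const c)
 then show ?case by (auto intro: polyi_scale)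
next
 case (add j p q)
 then show ?case by (simp add: scaleR_add_left polyi.add)
next
 case (mult j l i)
 then show ?case using polyi.mult[of X "j + k" "%x. l x *R p x" i] by simp
next
 case (mono k p)
 then show ?case by (simp add: polyi.mono)
qed

lemma polyi_affine: "polyi UNIV (Suc 0) (%x. c <.> x + d :: real)"
proof -
 have "polyi UNIV (Suc 0) (%x. (\<Sum>i\<in>UNIV. c $ i *R (x $ i *R 1)) + d)"
  by (intro polyi.add polyi_sum polyi_scale polyi.mult polyi_const) auto
 then show ?thesis by (simp add: inner_vec_def)
qed

lemma polyi_compose_affine:
 assumes "polyi X k p" "subspace X" "linear A"
 shows "polyi X k (%x. p (a + A x))"
 using assms(1)
proof induction
 case (mult k p i)
 have "(%x. (a + A x) $ i) = (%x. adjoint A (axis i 1) <.> x + a $ i)"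
  using adjoint_works[OF assms(3)] by (simp add: inner_axis fun_eq_iff inner_commute[of "adjoint A _"])
 then have "polyi UNIV (Suc 0) (%x. (a + A x) $ i)"
  by (simp only: polyi_affine)
 from polyi_scalar_mult[OF this mult.IH assms(2)] show ?case by simp
qed (auto intro: polyi.intros)

text \<open>Division by an affine function \<open>\<lambda>\<close>: if \<open>p\<close> vanishes on its zero set, apply this with
 \<open>v\<close> such that the derivative of \<open>\<lambda>\<close> along \<open>v\<close> is \<open>1\<close>.\<close>
lemma polyi_division:
 fixes c v :: vec3 and d :: real
 assumes "polyi X k p" "subspace X"
 shows "\<exists>q. polyi X (k - 1) q & (k = 0 \<longrightarrow> q = (%x. 0)) & (\<forall>x. p x - p (x - (c <.> x + d) *R v) = (c <.> x + d) *R q x)"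
 using assms(1)
proof induction
 case (const c)
 then show ?case using subspace_0[OF assms(2)] by (auto intro!: exI[of _ "%x. 0"] polyi_const)
next
 case (add k p q)
 then obtain p' q' where pq: "k = 0 \<longrightarrow> p' = (%x. 0)" "k = 0 \<longrightarrow> q' = (%x. 0)"
  "polyi X (k - 1) p'" "!!x. p x - p (x - (c <.> x + d) *R v) = (c <.> x + d) *R p' x"
  "polyi X (k - 1) q'" "!!x. q x - q (x - (c <.> x + d) *R v) = (c <.> x + d) *R q' x"
  by blast
 have "p x + q x - (p (x - (c <.> x + d) *R v) + q (x - (c <.> x + d) *R v)) = (c <.> x + d) *R (p' x + q' x)" for x
  by (simp add: add_diff_add pq scaleR_add_right)
 with pq show ?case
  by (intro exI[of _ "%x. p' x + q' x"]) (auto intro!: polyi.add)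
next
 case (mono k p)
 then show ?case using polyi_mono[of "k - 1" "Suc k - 1"] by auto
next
 case (mult k p i)
 then obtain p' where p': "polyi X (k - 1) p'" "!!x. p x - p (x - (c <.> x + d) *R v) = (c <.> x + d) *R p' x"
   "k = 0 \<longrightarrow> p' = (%x. 0)"
  by blast
 \<comment> \<open>Leibniz rule for differences: with \<open>y = x - l *R v\<close> the coordinates
   satisfy \<open>x $ i - y $ i = l * v $ i\<close>, so both summands of the difference carry the
   factor \<open>l\<close>.\<close>
 define q where "q x = x $ i *R p' x + v $ i *R p (x - (c <.> x + d) *R v)" for x
 have *: "x $ i *R P - (x - l *R v) $ i *R Q = x $ i *R (P - Q) + (l * v $ i) *R Q" for x l and P Q :: 'a
  by (simp add: scaleR_left_diff_distrib scaleR_right_diff_distrib)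
 have "x $ i *R p x - (x - (c <.> x + d) *R v) $ i *R p (x - (c <.> x + d) *R v) = (c <.> x + d) *R q x" for x
  unfolding * p' q_def by (simp only: scaleR_add_right scaleR_scaleR mult.commute)
 moreover have "polyi X k q"
 proof -
  have "linear (%x. x - (c <.> x) *R v)"
   by (rule linearI) (auto simp: algebra_simps inner_add_right)
  from polyi_compose_affine[OF mult.hyps assms(2) this, of "- d *R v"]
  have "polyi X k (%x. p (x - (c <.> x + d) *R v))"
   by (simp add: algebra_simps)
  then have 1: "polyi X k (%x. v $ i *R p (x - (c <.> x + d) *R v))"
   using assms(2) by (rule polyi_scale[rotated])
  \<comment> \<open>For this bound the induction records that the quotient is zero in degree
    0.\<close>
  have 2: "polyi X k (%x. x $ i *R p' x)"
  proof (cases k)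
   case 0
   then show ?thesis using p'(3) subspace_0[OF assms(2)] by (auto intro: polyi_const)
  next
   case (Suc l)
   then show ?thesis using polyi.mult[of X l] p' by auto
  qed
  from 1 2 show ?thesis unfolding q_def by (intro polyi.add)
 qed
 ultimately show ?case by (intro exI[of _ q]) simp
qed

section \<open>Integrals over simplices\<close>

lemma compact_fubini:
 fixes f :: "'a::euclidean_space \<times> 'b::euclidean_space => real"
 assumes "compact S" "cont f"
 shows "(LINT z|lborel. indicator S z * f z) = (LINT x|lborel. LINT y|lborel. indicator S (x, y) * f (x, y))"
  and "integrable lborel (%x. LINT y|lborel. indicator S (x, y) * f (x, y))"
proof -
 have "continuous_on S f" using assms continuous_on_subset by blast
 then have I: "integrable (lborel \<Otimes>\<^sub>M lborel) (%z. indicator S z * f z)"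
  using borel_integrable_compact[OF assms(1), of f] by (simp add: lborel_prod)
 show "integrable lborel (%x. LINT y|lborel. indicator S (x, y) * f (x, y))"
  using lborel_pair.integrable_fst'[OF I] by simp
 show "(LINT z|lborel. indicator S z * f z) = (LINT x|lborel. LINT y|lborel. indicator S (x, y) * f (x, y))"
  using lborel_pair.integral_fst'[OF I] by (simp add: lborel_prod)
qed

lemma LINT_interval:
 fixes f :: "real => real"
 assumes "cont f"
 shows "(LINT x|lborel. indicator {a..b} x * f x) = integral {a..b} f"
proof -
 have "continuous_on {a..b} f" using assms continuous_on_subset by blast
 from set_borel_integral_eq_integral(2)[OF borel_integrable_atLeastAtMost'[OF this]]
 show ?thesis by (simp add: set_lebesgue_integral_def)
qed

definition tri :: "(real \<times> real) set" where
 "tri = {(t, u). 0 <= t & 0 <= u & t + u <= 1}"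

lemma compact_tri [simp]: "compact tri"
proof -
 have "closed {z::real \<times> real. 0 <= fst z & 0 <= snd z & fst z + snd z <= 1}"
  by (intro closed_Collect_conj closed_Collect_le continuous_intros)
 moreover have "tri = {z. 0 <= fst z & 0 <= snd z & fst z + snd z <= 1}" by (auto simp: tri_def)
 moreover have "tri \<subseteq> cbox (0, 0) (1, 1)" by (auto simp: tri_def)
 ultimately show ?thesis by (metis bounded_cbox bounded_subset compact_eq_bounded_closed)
qed

lemma indicator_tri: "indicator tri (t, u) = indicator {0..1} t * (indicator {0..1 - t} u :: real)"
 by (auto simp: tri_def indicator_def)

lemma integral_tri:
 fixes f :: "real \<times> real => real"
 assumes f: "cont f"
 shows "(LINT z|lborel. indicator tri z * f z) = integral {0..1} (%t. integral {0..1 - t} (%u. f (t, u)))"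
proof -
 have "cont (%u. f (t, u))" for t
  using f by (auto intro!: continuous_intros continuous_on_compose2[OF f])
 then have eq: "(LINT u|lborel. indicator tri (t, u) * f (t, u)) = indicator {0..1} t * integral {0..1 - t} (%u. f (t, u))" for t
  by (simp add: indicator_tri mult.assoc LINT_interval)
 have "set_integrable lborel {0..1} (%t. integral {0..1 - t} (%u. f (t, u)))"
  using compact_fubini(2)[OF compact_tri f] unfolding eq set_integrable_def by simp
 from set_borel_integral_eq_integral(2)[OF this] show ?thesis
  using compact_fubini(1)[OF compact_tri f] unfolding eq by (simp add: set_lebesgue_integral_def)
qed

lemma integral_tri_swap:
 fixes f :: "real \<times> real => real"
 assumes f: "cont f"
 shows "integral {0..1} (%t. integral {0..1 - t} (%u. f (t, u))) = integral {0..1} (%t. integral {0..1 - t} (%u. f (u, t)))"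
proof -
 let ?F = "%z. indicator tri z * f z"
 have I: "integrable (lborel \<Otimes>\<^sub>M lborel) ?F"
  using borel_integrable_compact[OF compact_tri, of f] continuous_on_subset[OF f] by (simp add: lborel_prod)
 have f': "cont (%z. f (snd z, fst z))"
  by (auto intro!: continuous_intros continuous_on_compose2[OF f])
 have s: "indicator tri (u, t) = (indicator tri (t, u) :: real)" for t u
  by (auto simp: tri_def indicator_def)
 have "(LINT z|lborel. ?F z) = (LINT x|lborel. LINT y|lborel. ?F (x, y))"
  by (rule compact_fubini[OF compact_tri f])
 also have "\<dots> = (LINT y|lborel. LINT x|lborel. ?F (x, y))"
  by (rule lborel_pair.Fubini_integral[of "%x y. ?F (x, y)", symmetric]) (use I in \<open>simp add: case_prod_unfold\<close>)
 also have "\<dots> = (LINT z|lborel. indicator tri z * f (snd z, fst z))"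
  unfolding compact_fubini(1)[OF compact_tri f'] by (simp add: s)
 finally show ?thesis
  unfolding integral_tri[OF f] integral_tri[OF f'] by simp
qed

text \<open>Normalised integrals over a segment and, in \<open>M2\<close>, a triangle;
  \<open>edge_int_eq\<close> and \<open>face_int_eq\<close> restore the factors, which are the
  length and twice the area. Without them integration by parts involves edge vectors but no
  norms.\<close>

definition M1 :: "vec3 => vec3 => (vec3 => real) => real" where
 "M1 a b g = integral {0..1} (%t. g (pt1 a b t))"

definition M2 :: "vec3 => vec3 => vec3 => (vec3 => real) => real" where
 "M2 a b c g = integral {0..1} (%t. integral {0..1 - t} (%u. g (pt2 a b c t u)))"

lemma integral_flip: "integral {0..h} (%t. f (h - t)) = integral {0..h} (f :: real => real)"
proof -
 have "integral {0..h} (%t. f (h - t)) = integral {-h..0} (%t. f (h + t))"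
  using Henstock_Kurzweil_Integration.integral_reflect_real[of h 0 "%t. f (h - t)"]
  by (simp only: minus_zero diff_minus_eq_add)
 also have "\<dots> = integral {0..h} f"
  using integral_shift_Icc_real[of "-h" 0 f h] by (simp add: o_def)
 finally show ?thesis .
qed

lemma M1_swap: "M1 a b g = M1 b a g"
proof -
 have "M1 b a g = integral {0..1} (%t. g (pt1 a b (1 - t)))"
  unfolding M1_def by (intro integral_cong arg_cong[of _ _ g]) (simp add: algebra_simps)
 with integral_flip[of 1 "%t. g (pt1 a b t)"] show ?thesis
  by (simp only: M1_def)
qed

lemma cont_line:
 fixes g :: "vec3 => real"
 shows "cont g ==> continuous_on A (%t::real. g (a + t *R v))"
 by (rule continuous_on_compose2[of UNIV g]) (auto intro!: continuous_intros)

text \<open>The substitution of \<open>1 - t - u\<close> for \<open>u\<close> in the inner integral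
  exchanges \<open>a\<close> and \<open>c\<close>; together with \<open>M2_swap\<close> it generates
  all permutations of the vertices.\<close>

lemma M2_flip: "M2 a b c g = M2 c b a g"
proof -
 have "integral {0..1 - t} (%u. g (pt2 a b c t u)) =
   integral {0..1 - t} (%u. g (pt2 c b a t u))" for t
 proof -
  have "integral {0..1 - t} (%u. g (pt2 c b a t u))
    = integral {0..1 - t} (%u. g (pt2 a b c t (1 - t - u)))"
   by (intro integral_cong arg_cong[of _ _ g]) (simp add: algebra_simps)
  with integral_flip[of "1 - t" "%u. g (pt2 a b c t u)"] show ?thesis
   by (simp only:)
 qed
 then show ?thesis by (simp only: M2_def)
qed

lemma M2_swap:
 assumes "cont g"
 shows "M2 a b c g = M2 a c b g"
proof -
 have "cont (%z. g (a + fst z *R (b - a) + snd z *R (c - a)))"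
  by (auto intro!: continuous_intros continuous_on_compose2[OF assms])
 from integral_tri_swap[OF this] show ?thesis
  by (simp add: M2_def algebra_simps)
qed

lemma M2_swap': "cont g ==> M2 a b c g = M2 b a c g"
 by (metis M2_flip M2_swap)

lemma M1_FTC:
 assumes "smooth g" shows "M1 a b (dd (b - a) g) = g b - g a"
proof -
 have "((%t. dd (b - a) g (pt1 a b t)) has_integral g (pt1 a b 1) - g (pt1 a b 0)) {0..1}"
  by (intro fundamental_theorem_of_calculus smooth_has_vector_derivative assms) auto
 then show ?thesis by (simp add: M1_def integral_unique)
qed

lemma integrable_line:
 fixes g :: "vec3 => real"
 shows "cont g ==> (%t::real. g (a + t *R v) :: real) integrable_on {l..r}"
 by (intro integrable_continuous_real cont_line)

text \<open>Lines in direction \<open>c - a\<close> enter the triangle through the edge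
  \<open>a b\<close> and leave it through \<open>b c\<close>.\<close>

lemma M2_FTC:
 assumes g: "smooth g" shows "M2 a b c (dd (c - a) g) = M1 b c g - M1 a b g"
proof -
 have "integral {0..1 - t} (%u. dd (c - a) g (pt2 a b c t u))
   = g (pt1 c b t) - g (pt1 a b t)" if "t : {0..1}" for t
 proof -
  have "((%u. dd (c - a) g ((pt1 a b t) + u *R (c - a))) has_integral
    g ((pt1 a b t) + (1 - t) *R (c - a)) - g ((pt1 a b t) + 0 *R (c - a))) {0..1 - t}"
   using that by (intro fundamental_theorem_of_calculus smooth_has_vector_derivative g) auto
  moreover have "(pt1 a b t) + (1 - t) *R (c - a) = pt1 c b t"
   by (simp add: algebra_simps)
  ultimately show ?thesis by (simp add: integral_unique)
 qed
 then have "M2 a b c (dd (c - a) g) = integral {0..1} (%t. g (pt1 c b t) - g (pt1 a b t))"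
  unfolding M2_def by (intro integral_cong) auto
 also have "\<dots> = M1 c b g - M1 a b g"
  unfolding M1_def using g by (intro integral_diff integrable_line smooth_cont)
 finally show ?thesis by (simp add: M1_swap)
qed

lemma M2_FTC':
 assumes g: "smooth g" shows "M2 a b c (dd (b - a) g) = M1 b c g - M1 a c g"
proof -
 have "M2 a b c (dd (b - a) g) = M2 a c b (dd (b - a) g)"
  using g by (intro M2_swap smooth_cont smooth_dd)
 then show ?thesis
  using M2_FTC[OF g, of a c b] by (simp add: M1_swap[of c b])
qed

lemma M1_add: "cont f ==> cont g ==> M1 a b (%x. f x + g x) = M1 a b f + M1 a b g"
 unfolding M1_def by (intro integral_add integrable_line)

lemma M1_cmult: "M1 a b (%x. c * f x) = c * M1 a b f"
 unfolding M1_def by simp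

lemma M1_diff: "cont f ==> cont g ==> M1 a b (%x. f x - g x) = M1 a b f - M1 a b g"
 unfolding M1_def by (intro integral_diff integrable_line)

lemma on_segment: "t : {0..1} ==> pt1 a b t : seg a b"
proof -
 have "pt1 a b t = (1 - t) *R a + t *R b" by (simp add: algebra_simps)
 then show "t : {0..1} ==> ?thesis" by (auto simp: in_segment)
qed

lemma segment_point:
 assumes "x : seg a b"
 obtains t where "t : {0..1}" "x = pt1 a b t"
proof -
 obtain t where "0 <= t" "t <= 1" "x = (1 - t) *R a + t *R b"
  using assms by (auto simp: in_segment)
 then show thesis by (intro that[of t]) (auto simp: algebra_simps)
qed

lemma M1_cong: "(!!x. x : seg a b ==> f x = g x) ==> M1 a b f = M1 a b g"
 unfolding M1_def by (intro integral_cong) (simp add: on_segment)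

lemma M1_zero: "(!!x. x : seg a b ==> f x = 0) ==> M1 a b f = 0"
 using M1_cong[of a b f "%x. 0"] by (simp add: M1_def)

lemma integral_eq_0D:
 fixes f :: "real => real"
 assumes "continuous_on {a..b} f" "!!x. x : {a..b} ==> 0 <= f x" "integral {a..b} f = 0" "a < b" "x : {a..b}"
 shows "f x = 0"
proof (rule has_integral_0_cbox_imp_0[of a b f x])
 show "(f has_integral 0) (cbox a b)"
  using integrable_integral[OF integrable_continuous_real[OF assms(1)]] assms(3) by simp
qed (use assms in auto)

lemma M1_eq_0D:
 assumes "cont g" "!!x. x : seg a b ==> 0 <= g x" "M1 a b g = 0" "x : seg a b"
 shows "g x = 0"
proof -
 obtain t where t: "t : {0..1}" "x = pt1 a b t"
  using assms(4) by (rule segment_point)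
 have "(%t. g (pt1 a b t)) t = 0"
  by (rule integral_eq_0D[of 0 1 "%t. g (pt1 a b t)" t])
   (use t(1) in \<open>simp_all add: assms(2) on_segment cont_line[OF assms(1)] assms(3)[unfolded M1_def] del: atLeastAtMost_iff\<close>)
 with t show ?thesis by simp
qed

lemma triangle_points:
 "hull3 a b c = {pt2 a b c t u |t u. 0 <= t & 0 <= u & t + u <= (1::real)}"
 unfolding convex_hull_3_alt by blast

lemma in_triangle: "0 <= t ==> 0 <= u ==> t + u <= 1 ==> pt2 a b c t u : hull3 a b c"
 unfolding triangle_points by blast

lemma M2_cong: "(!!x. x : hull3 a b c ==> f x = g x) ==> M2 a b c f = M2 a b c g"
 unfolding M2_def by (intro integral_cong) (simp add: in_triangle)

lemma integral_rescale:
 fixes f :: "real => real"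
 assumes "0 <= h" shows "integral {0..h} f = h * integral {0..1} (%v. f (h * v))"
proof (cases "h = 0")
 case False
 with assms have "(%x. x / h) ` {0..h} = {0..1}"
  by (auto simp: image_iff divide_simps intro!: bexI[of _ "h * _"])
 then show ?thesis
  using integral_stretch_real[where m = h and f = f and a = 0 and b = h] False assms by (simp add: divide_simps mult.commute)
qed simp

text \<open>The inner interval depends on \<open>t\<close>; after rescaling to the unit interval it
  is a parameter integral over a fixed domain.\<close>

lemma M2_inner:
 fixes g :: "vec3 => real"
 assumes g: "cont g"
 shows "continuous_on {0..1} (%t. integral {0..1 - t} (%u. g (pt2 a b c t u)))"
proof -
 have "continuous_on {0..1} (%t. (1 - t) * integral (cbox 0 1) (%v::real. g (pt1 a b t + ((1 - t) * v) *R (c - a))))"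
 proof (intro continuous_intros integral_continuous_on_param)
  show "continuous_on ({0..1} \<times> cbox 0 1) (%(t, v). g (pt1 a b t + ((1 - t) * v) *R (c - a)))"
   unfolding case_prod_unfold by (rule continuous_on_compose2[OF g]) (auto intro!: continuous_intros)
 qed
 then show ?thesis
  by (rule continuous_on_eq) (subst integral_rescale[where h = "1 - _"], simp_all)
qed

lemma M2_add:
 assumes f: "cont f" and g: "cont g"
 shows "M2 a b c (%x. f x + g x) = M2 a b c f + M2 a b c g"
 unfolding M2_def
 by (simp add: integral_add integrable_line f g integrable_continuous_real M2_inner)

lemma M2_cmult: "M2 a b c (%x. r * f x) = r * M2 a b c f"
 unfolding M2_def by simp

lemma M2_diff:
 assumes f: "cont f" and g: "cont g"
 shows "M2 a b c (%x. f x - g x) = M2 a b c f - M2 a b c g"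
 unfolding M2_def
 by (simp add: integral_diff integrable_line f g integrable_continuous_real M2_inner)

lemma M2_eq_0D:
 assumes g: "cont g" "!!x. x : hull3 a b c ==> 0 <= g x"
  and "M2 a b c g = 0" "x : hull3 a b c"
 shows "g x = 0"
proof -
 have *: "g (pt2 a b c t u) = 0"
  if tu: "0 <= t" "0 <= u" "t + u <= 1" "t < 1" and h: "M2 a b c g = 0"
   "!!x. x : hull3 a b c ==> 0 <= g x" for t u and a b c :: vec3
 proof -
  let ?F = "%t. integral {0..1 - t} (%u. g (pt2 a b c t u))"
  have "?F t = 0"
  proof (rule integral_eq_0D[where f = ?F])
   show "continuous_on {0..1} ?F" by (rule M2_inner[OF g(1)])
   show "0 <= ?F t" if "t : {0..1}" for t
    using that g(1) by (intro integral_nonneg integrable_line) (auto intro!: h in_triangle)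
   show "integral {0..1} ?F = 0" using h by (simp add: M2_def)
  qed (use tu in auto)
  then show ?thesis
   using tu by (intro integral_eq_0D[of 0 "1 - t" "%u. g (pt2 a b c t u)"])
    (auto intro!: cont_line g(1) h in_triangle)
 qed
 obtain t u where x: "x = pt2 a b c t u" and tu: "0 <= t" "0 <= u" "t + u <= 1"
  using assms(4) unfolding triangle_points by blast
 show ?thesis
 proof (cases "t < 1")
  case True
  with * tu assms x show ?thesis by auto
 next
  \<comment> \<open>At the vertex \<open>b\<close> the inner interval is a single point and gives no
    information; exchanging \<open>b\<close> and \<open>c\<close> makes this vertex the end of an
    interval of length 1.\<close>
  case False
  then have "x = pt2 a c b u t" "u < 1" using x tu by (auto simp: algebra_simps)
  moreover have "M2 a c b g = 0" using assms(3) M2_swap[OF g(1)] by simp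
  moreover have "{a, c, b} = {a, b, c}" by auto
  ultimately show ?thesis
   using *[of u t a c b] tu assms by (auto simp: add.commute)
 qed
qed

section \<open>Integrals over tetrahedra in affine coordinates\<close>

definition tet :: "(real \<times> real \<times> real) set" where
 "tet = {(t, u, w). 0 <= t & 0 <= u & 0 <= w & t + u + w <= 1}"

lemma compact_tet [simp]: "compact tet"
proof -
 have "closed {z::real \<times> real \<times> real. 0 <= fst z & 0 <= fst (snd z) & 0 <= snd (snd z) & fst z + fst (snd z) + snd (snd z) <= 1}"
  by (intro closed_Collect_conj closed_Collect_le continuous_intros)
 moreover have "tet = {z. 0 <= fst z & 0 <= fst (snd z) & 0 <= snd (snd z) & fst z + fst (snd z) + snd (snd z) <= 1}"
  by (auto simp: tet_def)
 moreover have "tet \<subseteq> cbox (0, 0, 0) (1, 1, 1)" by (auto simp: tet_def)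
 ultimately show ?thesis by (metis bounded_cbox bounded_subset compact_eq_bounded_closed)
qed

lemma integral_tet:
 fixes f :: "real \<times> real \<times> real => real"
 assumes f: "cont f"
 shows "(LINT z|lborel. indicator tet z * f z) =
  integral {0..1} (%t. integral {0..1 - t} (%u. integral {0..1 - t - u} (%w. f (t, u, w))))"
proof -
 let ?I = "%t. integral {0..1 - t} (%u. integral {0..1 - t - u} (%w. f (t, u, w)))"
 have inner: "(LINT y|lborel. indicator tet (t, y) * f (t, y)) = indicator {0..1} t * ?I t" for t
 proof (cases "t : {0..1}")
  case True
  define C where "C = {y. (t, y) : tet}"
  have "C = snd ` (tet \<inter> ({t} \<times> UNIV))" by (force simp: C_def)
  then have C: "compact C"
   by (auto intro!: compact_continuous_image compact_Int_closed closed_Times continuous_intros)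
  have ft: "cont (%y. f (t, y))"
   by (auto intro!: continuous_intros continuous_on_compose2[OF f])
  have fu: "cont (%w. f (t, u, w))" for u
   by (auto intro!: continuous_intros continuous_on_compose2[OF f])
  have ind: "indicator C (u, w) = indicator {0..1 - t} u * (indicator {0..1 - t - u} w :: real)" for u w
   using True by (auto simp: C_def tet_def indicator_def)
  have eq: "(LINT w|lborel. indicator C (u, w) * f (t, u, w)) = indicator {0..1 - t} u * integral {0..1 - t - u} (%w. f (t, u, w))" for u
   by (simp add: ind mult.assoc LINT_interval fu)
  have "set_integrable lborel {0..1 - t} (%u. integral {0..1 - t - u} (%w. f (t, u, w)))"
   using compact_fubini(2)[OF C ft] unfolding eq set_integrable_def by simp
  from set_borel_integral_eq_integral(2)[OF this]
  have "(LINT y|lborel. indicator C y * f (t, y)) = ?I t"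
   using compact_fubini(1)[OF C ft] unfolding eq by (simp add: set_lebesgue_integral_def)
  moreover have "indicator C y = (indicator tet (t, y) :: real)" for y
   by (simp add: C_def indicator_def)
  ultimately show ?thesis using True by simp
 next
  case False
  then have "indicator tet (t, y) = (0::real)" for y
   by (auto simp: tet_def indicator_def)
  with False show ?thesis by simp
 qed
 have "set_integrable lborel {0..1} ?I"
  using compact_fubini(2)[OF compact_tet f] unfolding inner set_integrable_def by simp
 from set_borel_integral_eq_integral(2)[OF this] show ?thesis
  using compact_fubini(1)[OF compact_tet f] unfolding inner by (simp add: set_lebesgue_integral_def)
qed

lemma compact_absolutely_integrable:
 fixes f :: "'a::euclidean_space => 'b::euclidean_space"
 assumes "compact S" "continuous_on S f"
 shows "f absolutely_integrable_on S"
proof (rule absolutely_integrable_onI)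
 show "f integrable_on S"
  using borel_integrable_compact[OF assms] set_borel_integral_eq_integral(1)[of S f] by (simp add: set_integrable_def)
 show "(%x. norm (f x)) integrable_on S"
  using borel_integrable_compact[OF assms(1) continuous_on_norm[OF assms(2)]]
   set_borel_integral_eq_integral(1)[of S "%x. norm (f x)"] by (simp add: set_integrable_def)
qed

definition vec_of :: "real \<times> real \<times> real => vec3" where
 "vec_of z = vector [fst z, fst (snd z), snd (snd z)]"

lemma vec_of_nth [simp]: "vec_of z $ 1 = fst z" "vec_of z $ 2 = fst (snd z)" "vec_of z $ 3 = snd (snd z)"
 by (simp_all add: vec_of_def)

lemma vec_of_continuous: "continuous_on A vec_of"
proof -
 have "continuous_on A (%z. \<chi> i. vec_of z $ i)"
 proof (rule continuous_on_vec_lambda)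
  fix i :: 3
  show "continuous_on A (%z. vec_of z $ i)"
   using exhaust_3[of i] by (elim disjE) (simp_all add: continuous_intros)
 qed
 then show ?thesis by simp
qed

text \<open>Transports Fubini's theorem from nested products to \<open>vec3\<close>; a measure is
  recognised as Lebesgue measure by its values on boxes.\<close>

lemma lborel_vec3: "lborel = distr lborel borel vec_of"
proof (rule lborel_eqI)
 fix l u :: vec3
 assume lu: "!!b. b : Basis ==> l <.> b <= u <.> b"
 then have le: "l $ i <= u $ i" for i
  by (metis axis_in_Basis_iff inner_axis inner_real_def mult.right_neutral Basis_real_def singletonI)
 have "vec_of -` box l u = {l $ 1<..<u $ 1} \<times> {l $ 2<..<u $ 2} \<times> {l $ 3<..<u $ 3}"
  by (auto simp: box_def Basis_vec_def inner_axis forall_3)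
 moreover have "vec_of : borel_measurable lborel"
  using vec_of_continuous by (auto intro!: borel_measurable_continuous_onI)
 ultimately have "emeasure (distr lborel borel vec_of) (box l u) =
   emeasure (lborel \<Otimes>\<^sub>M (lborel \<Otimes>\<^sub>M lborel)) ({l $ 1<..<u $ 1} \<times> {l $ 2<..<u $ 2} \<times> {l $ 3<..<u $ 3})"
  by (simp add: emeasure_distr lborel_prod)
 also have "\<dots> = ennreal (u $ 1 - l $ 1) * (ennreal (u $ 2 - l $ 2) * ennreal (u $ 3 - l $ 3))"
 proof -
  have "emeasure (lborel \<Otimes>\<^sub>M lborel) (A \<times> B) = emeasure lborel A * emeasure lborel B"
   if "open A" "open B" for A :: "real set" and B :: "'b::euclidean_space set"
   using that by (intro lborel.emeasure_pair_measure_Times) auto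
  from this[of "{l $ 1<..<u $ 1}" "{l $ 2<..<u $ 2} \<times> {l $ 3<..<u $ 3}"] this[of "{l $ 2<..<u $ 2}" "{l $ 3<..<u $ 3}"]
  show ?thesis using le by (simp add: lborel_prod open_Times)
 qed
 also have "\<dots> = ennreal (\<Prod>b\<in>Basis. (u - l) <.> b)"
 proof -
  have B: "(Basis :: vec3 set) = {axis 1 1, axis 2 1, axis 3 1}"
   by (auto simp: Basis_vec_def UNIV_3)
  have "(\<Prod>b\<in>Basis. (u - l) <.> b) = (u $ 1 - l $ 1) * ((u $ 2 - l $ 2) * (u $ 3 - l $ 3))"
   unfolding B by (simp add: inner_axis axis_eq_axis)
  then show ?thesis using le by (simp add: ennreal_mult')
 qed
 finally show "emeasure (distr lborel borel vec_of) (box l u) = (\<Prod>b\<in>Basis. (u - l) <.> b)" .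
qed simp

lemma tetra_image:
 "hull4 a b c d = (%y::vec3. a + (y $ 1 *R (b - a) + y $ 2 *R (c - a) + y $ 3 *R (d - a))) ` vec_of ` tet"
proof -
 have "x : hull4 a b c d \<longleftrightarrow>
   (\<exists>t u w. 0 <= t & 0 <= u & 0 <= w & t + u + w <= 1 & x = a + (t *R (b - a) + u *R (c - a) + w *R (d - a)))" for x
 proof -
  have "x : hull4 a b c d \<longleftrightarrow> (\<exists>v\<ge>0. \<exists>w\<ge>0::real. \<exists>y\<in>hull3 b c d. v + w = 1 & x = v *R a + w *R y)"
   by (subst convex_hull_insert) auto
  also have "\<dots> \<longleftrightarrow> (\<exists>t u w. 0 <= t & 0 <= u & 0 <= w & t + u + w <= 1 & x = a + (t *R (b - a) + u *R (c - a) + w *R (d - a)))"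
  proof safe
   fix v w :: real and y assume h: "0 <= v" "0 <= w" "y : hull3 b c d" "v + w = 1"
   then obtain p q r where y: "0 <= p" "0 <= q" "0 <= r" "p + q + r = 1" "y = p *R b + q *R c + r *R d"
    unfolding convex_hull_3 by blast
   have r: "r = 1 - p - q" and v: "v = 1 - w" using y h by auto
   show "\<exists>t u ww. 0 <= t & 0 <= u & 0 <= ww & t + u + ww <= 1 &
     v *R a + w *R y = a + (t *R (b - a) + u *R (c - a) + ww *R (d - a))"
   proof (intro exI conjI)
    show "w * p + w * q + w * r <= 1" using y h by (simp add: distrib_left[symmetric])
    show "v *R a + w *R y = a + ((w * p) *R (b - a) + (w * q) *R (c - a) + (w * r) *R (d - a))"
     unfolding y(5) v r by (simp add: algebra_simps)
   qed (use y h in auto)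
  next
   fix t u w :: real
   assume h: "0 <= t" "0 <= u" "0 <= w" "t + u + w <= 1"
   define s where "s = t + u + w"
   show "\<exists>v\<ge>0. \<exists>wa\<ge>0::real. \<exists>y\<in>hull3 b c d. v + wa = 1 &
     a + (t *R (b - a) + u *R (c - a) + w *R (d - a)) = v *R a + wa *R y"
   proof (cases "s = 0")
    case True
    then have "t = 0" "u = 0" "w = 0" using h by (auto simp: s_def)
    then show ?thesis by (intro exI[of _ 1] exI[of _ 0] conjI bexI[of _ b]) (auto simp: hull_inc)
   next
    case False
    then have "s > 0" using h by (simp add: s_def)
    define y where "y = (t / s) *R b + (u / s) *R c + (w / s) *R d"
    have "y : hull3 b c d"
     unfolding convex_hull_3 y_def using h \<open>s > 0\<close>
     by (intro CollectI exI[of _ "t / s"] exI[of _ "u / s"] exI[of _ "w / s"] conjI)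
      (auto simp: s_def add_divide_distrib[symmetric])
    moreover have "a + (t *R (b - a) + u *R (c - a) + w *R (d - a)) = (1 - s) *R a + s *R y"
    proof -
     have "s *R y = t *R b + u *R c + w *R d"
      using \<open>s > 0\<close> by (simp add: y_def scaleR_add_right)
     then show ?thesis by (simp add: s_def algebra_simps)
    qed
    ultimately show ?thesis using h \<open>s > 0\<close>
     by (intro exI[of _ "1 - s"] conjI exI[of _ s] bexI[of _ y]) (auto simp: s_def)
   qed
  qed
  finally show ?thesis .
 qed
 note mem = this
 show ?thesis
 proof (intro set_eqI iffI)
  fix x assume "x : hull4 a b c d"
  then obtain t u w where "0 <= t" "0 <= u" "0 <= w" "t + u + w <= 1"
   and x: "x = a + (t *R (b - a) + u *R (c - a) + w *R (d - a))" unfolding mem by blast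
  then have "(t, u, w) : tet" by (simp add: tet_def)
  moreover have "x = a + (vec_of (t, u, w) $ 1 *R (b - a) + vec_of (t, u, w) $ 2 *R (c - a) + vec_of (t, u, w) $ 3 *R (d - a))"
   using x by simp
  ultimately show "x : (%y::vec3. a + (y $ 1 *R (b - a) + y $ 2 *R (c - a) + y $ 3 *R (d - a))) ` vec_of ` tet"
   by blast
 next
  fix x assume "x : (%y::vec3. a + (y $ 1 *R (b - a) + y $ 2 *R (c - a) + y $ 3 *R (d - a))) ` vec_of ` tet"
  then obtain t u w where "(t, u, w) : tet"
   and x: "x = a + (vec_of (t, u, w) $ 1 *R (b - a) + vec_of (t, u, w) $ 2 *R (c - a) + vec_of (t, u, w) $ 3 *R (d - a))"
   by fast
  then have "0 <= t" "0 <= u" "0 <= w" "t + u + w <= 1" by (auto simp: tet_def)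
  then show "x : hull4 a b c d"
   unfolding mem using x by auto
 qed
qed

lemma integral_tetra:
 assumes V: "(d - a) <.> cross3 (b - a) (c - a) ~= 0" and g: "cont g"
 shows "integral (hull4 a b c d) g = \<bar>(d - a) <.> cross3 (b - a) (c - a)\<bar> *
  integral {0..1} (%t. integral {0..1 - t} (%u. integral {0..1 - t - u} (%w.
   g (pt2 a b c t u + w *R (d - a)))))"
proof -
 define L where "L y = y $ 1 *R (b - a) + y $ 2 *R (c - a) + y $ 3 *R (d - a)" for y :: vec3
 define S where "S = vec_of ` tet"
 have lin: "linear L" unfolding L_def by (rule linearI) (auto simp: algebra_simps)
 have det: "det (matrix L) = (d - a) <.> cross3 (b - a) (c - a)"
  by (simp add: det_3 matrix_def L_def axis_def cross3_def inner_vec_def sum_3 vector_def) algebra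
 then have "inj L" using V lin by (metis det_nz_iff_inj)
 then have inj: "inj_on (%y. a + L y) S" by (auto simp: inj_on_def)
 have S: "compact S" unfolding S_def by (intro compact_continuous_image vec_of_continuous compact_tet)
 have gL: "cont (%y. g (a + L y))"
  using linear_continuous_on[OF linear_linearI[OF lin]]
  by (auto intro!: continuous_on_compose2[OF g] continuous_intros)
 \<comment> \<open>The change of variables formula is applied to functions with values in
   \<open>real^1\<close>, hence the passage through \<open>vec\<close> and back.\<close>
 let ?v = "%r::real. vec r :: real^1"
 let ?D = "\<bar>det (matrix L)\<bar>"
 have cv: "cont (%x. ?v (h x))" if "cont h" for h :: "vec3 => real"
  using that by (auto intro: continuous_on_vec_lambda simp: vec_def)
 have ai: "(%x. ?v (h x)) absolutely_integrable_on T" if "compact T" "cont h" for T and h :: "vec3 => real"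
  using that cv by (intro compact_absolutely_integrable) (auto intro: continuous_on_subset)
 have nth: "integral T (%x. ?v (h x)) $ 1 = integral T h" if "compact T" "cont h" for T and h :: "vec3 => real"
  using integral_component_eq_cart[OF set_lebesgue_integral_eq_integral(1)[OF ai[OF that]], of 1] by simp
 have K: "(%y. a + L y) ` S = hull4 a b c d"
  unfolding tetra_image S_def L_def ..
 have cK: "compact (hull4 a b c d)" by (simp add: finite_imp_compact_convex_hull)
 have cD: "cont (%y. ?D * g (a + L y))" using gL by (intro continuous_intros)
 have "((%y. a + L y) has_derivative L) (at x within S)" for x
  using has_derivative_add[OF has_derivative_const bounded_linear_imp_has_derivative[OF linear_linearI[OF lin]]] by simp
 from has_absolute_integral_change_of_variables_compact[OF S this inj, of "%x. ?v (g x)" "integral S (%y. ?v (?D * g (a + L y)))"]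
 have "integral (hull4 a b c d) (%x. ?v (g x)) = integral S (%y. ?v (?D * g (a + L y)))"
  using ai[OF S cD] by (simp add: K vec_cmul scalar_mult_eq_scaleR)
 then have "integral (hull4 a b c d) g = ?D * integral S (%y. g (a + L y))"
  using nth[OF cK g] nth[OF S cD] by simp
 also have "integral S (%y. g (a + L y)) = (LINT y|lborel. indicator S y * g (a + L y))"
 proof -
  have "set_integrable lborel S (%y. g (a + L y))"
   using borel_integrable_compact[OF S continuous_on_subset[OF gL subset_UNIV]] by (simp add: set_integrable_def)
  from set_borel_integral_eq_integral(2)[OF this] show ?thesis by (simp add: set_lebesgue_integral_def)
 qed
 also have "\<dots> = (LINT z|lborel. indicator S (vec_of z) * g (a + L (vec_of z)))"
 proof -
  have "vec_of : measurable lborel borel"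
   using vec_of_continuous by (auto intro!: borel_measurable_continuous_onI)
  moreover have "(%y. indicator S y * g (a + L y)) : borel_measurable borel"
   using compact_imp_closed[OF S] gL by (intro borel_measurable_times borel_measurable_indicator borel_measurable_continuous_onI) auto
  ultimately show ?thesis
   by (subst lborel_vec3) (rule integral_distr)
 qed
 also have "\<dots> = (LINT z|lborel. indicator tet z * g (a + L (vec_of z)))"
 proof -
  have "inj vec_of"
   by (rule injI) (metis prod_eqI vec_of_nth)
  then have "indicator S (vec_of z) = (indicator tet z :: real)" for z
   by (simp add: S_def indicator_def inj_image_mem_iff)
  then show ?thesis by simp
 qed
 also have "\<dots> = integral {0..1} (%t. integral {0..1 - t} (%u. integral {0..1 - t - u} (%w. g (a + L (vec_of (t, u, w))))))"
  by (rule integral_tet) (rule continuous_on_compose2[OF gL vec_of_continuous], simp)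
 finally show ?thesis
  unfolding det by (simp add: L_def add.assoc)
qed

section \<open>Triangles and tetrahedra\<close>

text \<open>Triangles, and in \<open>tetv\<close> tetrahedra, with labelled vertices. The
  cardinality is part of the definition because affine independence of the set does not notice a
  repeated label.\<close>

definition triv :: "vec3 set => vec3 => vec3 => vec3 => bool" where
 "triv f a b c \<longleftrightarrow> f = hull3 a b c & \<not> affine_dependent {a, b, c} & card {a, b, c} = 3"

definition tetv :: "vec3 set => vec3 => vec3 => vec3 => vec3 => bool" where
 "tetv K a b c d \<longleftrightarrow> K = hull4 a b c d & \<not> affine_dependent {a, b, c, d} & card {a, b, c, d} = 4"

lemma triv_perm: "triv f a b c ==> {a', b', c'} = {a, b, c} ==> triv f a' b' c'"
 by (simp add: triv_def)

lemma tetv_perm: "tetv K a b c d ==> {a', b', c', d'} = {a, b, c, d} ==> tetv K a' b' c' d'"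
 by (simp add: tetv_def)

lemma triv_swaps:
 assumes "triv f a b c"
 shows "triv f b a c" "triv f a c b" "triv f b c a" "triv f c a b" "triv f c b a"
 using assms by (rule triv_perm; blast)+

lemma triv_distinct: assumes "triv f a b c" shows "a ~= b" "a ~= c" "b ~= c"
 using assms by (auto simp: triv_def card_insert_if split: if_splits)

lemma tetv_distinct:
 assumes "tetv K a b c d"
 shows "a ~= b" "a ~= c" "a ~= d" "b ~= c" "b ~= d" "c ~= d"
 using assms by (auto simp: tetv_def card_insert_if split: if_splits)

lemma triv_cross: assumes "triv f a b c" shows "cross3 (b - a) (c - a) ~= 0"
proof
 assume "cross3 (b - a) (c - a) = 0"
 then have "collinear {0, b - a, c - a}" by (simp add: cross_eq_0)
 then have "collinear {b, a, c}" by (subst collinear_3) (simp_all only: NO_MATCH_def)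
 then show False
  using assms triv_distinct[OF assms] by (auto simp: collinear_3_eq_affine_dependent triv_def insert_commute)
qed

lemma tetv_volume: assumes "tetv K a b c d" shows "(d - a) <.> cross3 (b - a) (c - a) ~= 0"
proof
 assume V: "(d - a) <.> cross3 (b - a) (c - a) = 0"
 define L where "L y = y $ 1 *R (b - a) + y $ 2 *R (c - a) + y $ 3 *R (d - a)" for y :: vec3
 have lin: "linear L" unfolding L_def by (rule linearI) (auto simp: algebra_simps)
 have "det (matrix L) = (d - a) <.> cross3 (b - a) (c - a)"
  by (simp add: det_3 matrix_def L_def axis_def cross3_def inner_vec_def sum_3 vector_def) algebra
 then have "\<not> inj L" using V det_nz_iff_inj[OF lin] by simp
 then obtain y where y: "L y = 0" "y ~= 0" using linear_injective_0[OF lin] by blast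
 note ds = tetv_distinct[OF assms]
 \<comment> \<open>A kernel vector of the edge matrix gives the coefficients of an affine
   dependence; the one at \<open>a\<close> makes their sum zero.\<close>
 define u where "u x = (if x = a then - (y $ 1 + y $ 2 + y $ 3) else if x = b then y $ 1 else if x = c then y $ 2 else y $ 3)" for x
 have "sum u {a, b, c, d} = 0" using ds by (simp add: u_def)
 moreover have "(\<Sum>x\<in>{a, b, c, d}. u x *R x) = L y"
  using ds by (simp add: u_def L_def algebra_simps)
 moreover have "\<exists>x\<in>{a, b, c, d}. u x ~= 0"
 proof -
  have "y $ 1 ~= 0 \<or> y $ 2 ~= 0 \<or> y $ 3 ~= 0" using y(2) by (auto simp: vec_eq_iff forall_3)
  then show ?thesis using ds by (auto simp: u_def)
 qed
 ultimately have "affine_dependent {a, b, c, d}"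
  using y(1) by (subst affine_dependent_explicit_finite) auto
 then show False using assms by (simp add: tetv_def)
qed

lemma simplex_3_tetv:
 assumes "3 simplex K" obtains a b c d where "tetv K a b c d"
proof -
 obtain C where C: "\<not> affine_dependent C" "int (card C) = 4" "K = convex hull C"
  using assms by (auto simp: simplex_def)
 then have "card C = 4" by simp
 then obtain a b c d where "C = {a, b, c, d}"
  by (auto simp: card_Suc_eq numeral_eq_Suc)
 with C \<open>card C = 4\<close> show thesis by (intro that[of a b c d]) (auto simp: tetv_def)
qed

lemma tetv_triv:
 assumes "tetv K a b c d" shows "triv (hull3 a b c) a b c"
 using assms affine_independent_subset[of "{a, b, c, d}" "{a, b, c}"] tetv_distinct[OF assms]
 by (auto simp: triv_def tetv_def)

lemma face_of_hull_card:
 fixes S :: "vec3 set"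
 assumes "\<not> affine_dependent S"
 shows "T face_of convex hull S & aff_dim T = int k \<longleftrightarrow> (\<exists>C\<subseteq>S. card C = Suc k & T = convex hull C)"
proof -
 have "aff_dim (convex hull C) = int k \<longleftrightarrow> card C = Suc k" if "C \<subseteq> S" for C
  using aff_dim_affine_independent[of C] affine_independent_subset[OF assms that] by (auto simp: aff_dim_convex_hull)
 then show ?thesis
  unfolding face_of_convex_hull_affine_independent[OF assms] by auto
qed

lemma tetv_faces_iff: "tetv K a b c d ==> f : faces K \<longleftrightarrow> (\<exists>C\<subseteq>{a, b, c, d}. card C = 3 & f = convex hull C)"
 using face_of_hull_card[of "{a, b, c, d}" f 2] by (simp add: faces_def tetv_def numeral_3_eq_3)

lemma tetv_edges_iff: "tetv K a b c d ==> e : edges K \<longleftrightarrow> (\<exists>C\<subseteq>{a, b, c, d}. card C = 2 & e = convex hull C)"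
 using face_of_hull_card[of "{a, b, c, d}" e 1] by (simp add: edges_def tetv_def numeral_2_eq_2)

lemma triv_edges_iff: "triv f a b c ==> e : edges f \<longleftrightarrow> (\<exists>C\<subseteq>{a, b, c}. card C = 2 & e = convex hull C)"
 using face_of_hull_card[of "{a, b, c}" e 1] by (simp add: edges_def triv_def numeral_2_eq_2)

lemma tetv_verts: "tetv K a b c d ==> verts K = {a, b, c, d}"
 by (auto simp: verts_def tetv_def extreme_point_of_convex_hull_affine_independent)

lemma triv_verts: "triv f a b c ==> verts f = {a, b, c}"
 by (auto simp: verts_def triv_def extreme_point_of_convex_hull_affine_independent)

lemma tetv_face: "tetv K a b c d ==> hull3 a b c : faces K"
 using tetv_distinct[of K a b c d] by (simp add: tetv_faces_iff) (intro exI[of _ "{a, b, c}"], auto)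

lemma triv_edge: "triv f a b c ==> seg a b : edges f"
 using triv_distinct[of f a b c] by (simp add: triv_edges_iff segment_convex_hull) (intro exI[of _ "{a, b}"], auto)

lemma card_Diff_one:
 assumes "finite S" "C \<subseteq> S" "card S = Suc (card C)"
 shows "\<exists>x\<in>S. C = S - {x}"
proof -
 have "card (S - C) = 1"
  using assms by (subst card_Diff_subset) (auto intro: finite_subset)
 then obtain x where "S - C = {x}" by (auto simp: card_1_singleton_iff)
 with assms(2) have "x : S" "C = S - {x}" by blast+
 then show ?thesis by blast
qed

text \<open>Any face can be labelled as the one opposite to the last vertex, so that arguments on
  faces need one labelling only. \<open>edge_cases\<close> and \<open>face_edge_cases\<close> serve
  the same purpose for edges.\<close>

lemma face_cases:
 assumes T: "tetv K a b c d" and f: "f : faces K"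
 obtains a' b' c' d' where "tetv K a' b' c' d'" "f = convex hull {a', b', c'}"
proof -
 obtain C where C: "C \<subseteq> {a, b, c, d}" "card C = 3" "f = convex hull C"
  using f tetv_faces_iff[OF T] by blast
 then obtain x where x: "x : {a, b, c, d}" "C = {a, b, c, d} - {x}"
  using card_Diff_one[of "{a, b, c, d}" C] T by (auto simp: tetv_def)
 consider "x = a" | "x = b" | "x = c" | "x = d" using x by blast
 then show thesis
 proof cases
  case 1
  have "C = {b, c, d}" using x 1 tetv_distinct[OF T] by auto
  with C show thesis by (intro that[of b c d a] tetv_perm[OF T]) auto
 next
  case 2
  have "C = {a, c, d}" using x 2 tetv_distinct[OF T] by auto
  with C show thesis by (intro that[of a c d b] tetv_perm[OF T]) auto
 next
  case 3
  have "C = {a, b, d}" using x 3 tetv_distinct[OF T] by auto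
  with C show thesis by (intro that[of a b d c] tetv_perm[OF T]) auto
 next
  case 4
  have "C = {a, b, c}" using x 4 tetv_distinct[OF T] by auto
  with C T show thesis by (intro that) auto
 qed
qed

lemma tetv_faces:
 assumes T: "tetv K a b c d"
 shows "faces K = {hull3 a b c, hull3 a b d, hull3 a c d, hull3 b c d}"
proof
 show "{hull3 a b c, hull3 a b d, hull3 a c d, hull3 b c d} \<subseteq> faces K"
  using tetv_face[OF T] tetv_face[OF tetv_perm[OF T, of a b d c]] tetv_face[OF tetv_perm[OF T, of a c d b]]
   tetv_face[OF tetv_perm[OF T, of b c d a]] by (auto simp: insert_commute)
 show "faces K \<subseteq> {hull3 a b c, hull3 a b d, hull3 a c d, hull3 b c d}"
 proof
  fix f assume "f : faces K"
  then obtain C where C: "C \<subseteq> {a, b, c, d}" "card C = 3" "f = convex hull C"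
   using tetv_faces_iff[OF T] by blast
  then obtain x where x: "x : {a, b, c, d}" "C = {a, b, c, d} - {x}"
   using card_Diff_one[of "{a, b, c, d}" C] T by (auto simp: tetv_def)
  then have "C = {a, b, c} \<or> C = {a, b, d} \<or> C = {a, c, d} \<or> C = {b, c, d}"
   using tetv_distinct[OF T] by auto
  then show "f : {hull3 a b c, hull3 a b d, hull3 a c d, hull3 b c d}"
   using C(3) by blast
 qed
qed

lemma hull_eq_iff:
 assumes "\<not> affine_dependent S" "\<not> affine_dependent (T :: vec3 set)"
 shows "convex hull S = convex hull T \<longleftrightarrow> S = T"
proof
 assume "convex hull S = convex hull T"
 moreover have "S = {x. x extreme_point_of convex hull S}"
  using extreme_point_of_convex_hull_affine_independent[OF assms(1)] by blast
 moreover have "T = {x. x extreme_point_of convex hull T}"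
  using extreme_point_of_convex_hull_affine_independent[OF assms(2)] by blast
 ultimately show "S = T" by simp
qed simp

lemma triv_hull_eq: "triv (hull3 a b c) a b c ==> triv (hull3 x y z) x y z ==>
  hull3 a b c = hull3 x y z \<longleftrightarrow> {a, b, c} = {x, y, z}"
 by (simp add: hull_eq_iff triv_def)

lemma edge_cases:
 assumes T: "tetv K a b c d" and e: "e : edges K"
 obtains a' b' c' d' where "tetv K a' b' c' d'" "e = seg a' b'"
proof -
 obtain C where C: "C \<subseteq> {a, b, c, d}" "card C = 2" "e = convex hull C"
  using e tetv_edges_iff[OF T] by blast
 then obtain x y where xy: "C = {x, y}" "x ~= y" by (auto simp: card_2_iff)
 have "card ({a, b, c, d} - C) = 2"
  using C T by (subst card_Diff_subset) (auto simp: tetv_def finite_subset[OF C(1)])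
 then obtain z w where "{a, b, c, d} - C = {z, w}" by (auto simp: card_2_iff)
 then have "{x, y, z, w} = {a, b, c, d}" using C xy by blast
 then show thesis
  using C xy by (intro that[of x y z w] tetv_perm[OF T]) (auto simp: segment_convex_hull)
qed

lemma face_edge_cases:
 assumes T: "triv f a b c" and e: "e : edges f"
 obtains a' b' c' where "triv f a' b' c'" "e = seg a' b'"
proof -
 obtain C where C: "C \<subseteq> {a, b, c}" "card C = 2" "e = convex hull C"
  using e triv_edges_iff[OF T] by blast
 then obtain x where x: "x : {a, b, c}" "C = {a, b, c} - {x}"
  using card_Diff_one[of "{a, b, c}" C] T by (auto simp: triv_def)
 obtain y z where "C = {y, z}" using C(2) by (auto simp: card_2_iff)
 moreover from this x have "{y, z, x} = {a, b, c}" by blast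
 ultimately show thesis
  using C by (intro that[of y z x] triv_perm[OF T]) (auto simp: segment_convex_hull)
qed

lemma triv_edges:
 assumes T: "triv f a b c"
 shows "edges f = {seg a b, seg b c, seg a c}"
proof
 show "{seg a b, seg b c, seg a c} \<subseteq> edges f"
  using triv_edge[OF T] triv_edge[OF triv_swaps(3)[OF T]] triv_edge[OF triv_swaps(2)[OF T]] by auto
 show "edges f \<subseteq> {seg a b, seg b c, seg a c}"
 proof
  fix e assume "e : edges f"
  then obtain C where C: "C \<subseteq> {a, b, c}" "card C = 2" "e = convex hull C"
   using triv_edges_iff[OF T] by blast
  then obtain x where x: "x : {a, b, c}" "C = {a, b, c} - {x}"
   using card_Diff_one[of "{a, b, c}" C] T by (auto simp: triv_def)
  then have "C = {a, b} \<or> C = {b, c} \<or> C = {a, c}"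
   using triv_distinct[OF T] by auto
  then show "e : {seg a b, seg b c, seg a c}"
   using C(3) by (auto simp: segment_convex_hull)
 qed
qed

lemma triv_edges_sum:
 assumes T: "triv f a b c"
 shows "(\<Sum>e\<in>edges f. h e) = h (seg a b) + h (seg b c) + h (seg a c)"
 using triv_distinct[OF T] unfolding triv_edges[OF T] by (simp add: closed_segment_eq doubleton_eq_iff add.assoc)

lemma triv_rel_frontier:
 assumes T: "triv f a b c"
 shows "rel_frontier f = seg a b \<union> seg b c \<union> seg a c"
proof -
 have "rel_frontier f = \<Union>{convex hull ({a, b, c} - {x}) |x. x : {a, b, c}}"
  using T rel_frontier_convex_hull_cases[of "{a, b, c}"] by (simp add: triv_def)
 also have "\<dots> = (\<Union>x\<in>{a, b, c}. convex hull ({a, b, c} - {x}))" by blast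
 also have "\<dots> = convex hull {b, c} \<union> convex hull {a, c} \<union> convex hull {a, b}"
  using triv_distinct[OF T] by (simp add: insert_Diff_if Un_assoc)
 finally show ?thesis by (auto simp: segment_convex_hull)
qed

text \<open>The end points in \<open>edge_int\<close> come from a choice; a segment determines them
  up to order, and \<open>M1_swap\<close> removes the order.\<close>

lemma edge_int_eq: "edge_int (seg a b) g = norm (b - a) * M1 a b g"
proof -
 obtain x y where xy: "(SOME (x, y). seg a b = seg x y) = (x, y)" by fastforce
 have "case (SOME (x, y). seg a b = seg x y) of (x, y) => seg a b = seg x y"
  by (rule someI[of _ "(a, b)"]) simp
 then have "seg a b = seg x y" unfolding xy by (simp only: case_prod_conv)
 then have "(x = a & y = b) \<or> (x = b & y = a)" by (auto simp: closed_segment_eq doubleton_eq_iff)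
 moreover have "edge_int (seg a b) g = norm (y - x) * M1 x y g"
  unfolding edge_int_def xy by (simp add: M1_def)
 ultimately show ?thesis
  using M1_swap[of a b g] norm_minus_commute[of a b] by auto
qed

lemma cross_swaps:
 "norm (cross3 (c - a) (b - a)) = norm (cross3 (b - a) (c - a))"
 "norm (cross3 (a - b) (c - b)) = norm (cross3 (b - a) (c - a))"
proof -
 show "norm (cross3 (c - a) (b - a)) = norm (cross3 (b - a) (c - a))"
  by (metis cross_skew norm_minus_cancel)
 have "cross3 (a - b) (c - b) = - cross3 (b - a) (c - a)"
  by (simp add: cross3_simps forall_3)
 then show "norm (cross3 (a - b) (c - b)) = norm (cross3 (b - a) (c - a))" by simp
qed

lemma face_int_eq:
 assumes T: "triv f a b c" and g: "cont g"
 shows "face_int f g = norm (cross3 (b - a) (c - a)) * M2 a b c g"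
proof -
 define I where "I a b c = norm (cross3 (b - a) (c - a)) * M2 a b c g" for a b c
 have I1: "I a b c = I a c b" for a b c using M2_swap[OF g] by (simp add: I_def cross_swaps)
 have I2: "I a b c = I b a c" for a b c using M2_swap'[OF g] by (simp add: I_def cross_swaps)
 have f: "f = hull3 a b c" using T by (simp add: triv_def)
 obtain x y z where xyz: "(SOME (x, y, z). f = hull3 x y z) = (x, y, z)"
  by (metis prod_cases3)
 have "case (SOME (x, y, z). f = hull3 x y z) of (x, y, z) => f = hull3 x y z"
  by (rule someI[of _ "(a, b, c)"]) (simp add: f)
 then have *: "hull3 a b c = hull3 x y z" unfolding xyz unfolding f by (simp only: case_prod_conv)
 have "{a, b, c} \<subseteq> {x, y, z}"
 proof
  fix v assume "v : {a, b, c}"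
  then have "v extreme_point_of hull3 x y z"
   using T by (simp add: triv_def *[symmetric] extreme_point_of_convex_hull_affine_independent)
  then show "v : {x, y, z}" by (rule extreme_point_of_convex_hull)
 qed
 moreover have "card {x, y, z} <= 3" by (simp add: card_insert_if)
 ultimately have "{a, b, c} = {x, y, z}"
  using T by (intro card_seteq) (auto simp: triv_def)
 moreover from this have "card {x, y, z} = 3" using T by (simp add: triv_def)
 ultimately have "(x = a \<or> x = b \<or> x = c) & (y = a \<or> y = b \<or> y = c) & (z = a \<or> z = b \<or> z = c) & x ~= y & x ~= z & y ~= z"
  by (auto simp: card_insert_if split: if_splits)
 then have "I x y z = I a b c"
  using I1 I2 by metis
 then show ?thesis by (simp add: face_int_def xyz I_def M2_def)
qed

text \<open>The dual basis of \<open>p\<close>, \<open>q\<close> inside their plane. It reads off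
  plane coordinates and ignores normal displacement, and so extends functions from the plane to
  space.\<close>

lemma triangle_plane_coords:
 assumes "cross3 p q ~= 0"
 obtains p' q' where "p' <.> p = 1" "p' <.> q = 0" "q' <.> p = 0" "q' <.> q = 1" "p' <.> cross3 p q = 0" "q' <.> cross3 p q = 0"
proof -
 define N where "N = cross3 p q"
 have NN: "N <.> N ~= 0" using assms by (simp add: N_def)
 have 1: "cross3 q N <.> p = N <.> N" "cross3 N p <.> q = N <.> N"
  unfolding N_def by (metis cross_triple inner_commute)+
 have 2: "cross3 q N <.> q = 0" "cross3 N p <.> p = 0" "cross3 q N <.> N = 0" "cross3 N p <.> N = 0"
  by (simp_all add: dot_cross_self)
 show thesis
  by (rule that[of "(1 / (N <.> N)) *R cross3 q N" "(1 / (N <.> N)) *R cross3 N p"])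
   (use NN 1 2 in \<open>simp_all add: N_def[symmetric]\<close>)
qed

lemma unit_normal_cross:
 assumes "norm n = 1" "n <.> p = 0" "n <.> q = 0"
 shows "cross3 p q = (n <.> cross3 p q) *R n" "\<bar>n <.> cross3 p q\<bar> = norm (cross3 p q)"
proof -
 let ?N = "cross3 p q"
 have "cross3 n ?N = 0" by (simp add: Lagrange assms)
 then have "cross3 n (cross3 n ?N) = 0" by simp
 then have "(n <.> ?N) *R n - (n <.> n) *R ?N = 0" by (simp only: Lagrange[of n n ?N])
 then show *: "?N = (n <.> ?N) *R n" using assms(1) by (simp add: dot_square_norm)
 have "norm ?N = norm ((n <.> ?N) *R n)" using * by simp
 then show "\<bar>n <.> ?N\<bar> = norm ?N" using assms(1) by simp
qed

lemma unit_normal_triv: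
 assumes "triv f a b c" "unit_normal f n"
 shows "norm n = 1" "n <.> (b - a) = 0" "n <.> (c - a) = 0"
proof -
 have "a : f" "b : f" "c : f" using assms(1) by (auto simp: triv_def hull_inc)
 then show "norm n = 1" "n <.> (b - a) = 0" "n <.> (c - a) = 0"
  using assms(2) by (auto simp: unit_normal_def)
qed

lemma unit_tangent_seg:
 assumes "unit_tangent (seg a b) s" "a ~= b"
 obtains \<kappa> where "s = \<kappa> *R (b - a)" "\<kappa> ~= 0" "norm s = 1"
proof -
 have "y - x : span {b - a}" if xy: "x : seg a b" "y : seg a b" for x y
 proof -
  obtain t where t: "x = pt1 a b t" using segment_point[OF xy(1)] by blast
  obtain u where u: "y = pt1 a b u" using segment_point[OF xy(2)] by blast
  have "y - x = (u - t) *R (b - a)" by (simp add: t u algebra_simps)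
  then show ?thesis by (simp add: span_base span_scale)
 qed
 then have "{y - x |x y. x : seg a b & y : seg a b} \<subseteq> span {b - a}" by blast
 then have "span {y - x |x y. x : seg a b & y : seg a b} \<subseteq> span {b - a}"
  by (rule span_minimal) (rule subspace_span)
 then have "s : span {b - a}" using assms(1) unfolding unit_tangent_def by blast
 then obtain \<kappa> where "s = \<kappa> *R (b - a)" by (auto simp: span_singleton)
 moreover have "norm s = 1" using assms(1) by (simp add: unit_tangent_def)
 ultimately show thesis by (intro that[of \<kappa>]) auto
qed

lemma triv_span:
 assumes "triv f a b c"
 shows "span {y - x |x y. x : f & y : f} = {\<alpha> *R (b - a) + \<beta> *R (c - a) |\<alpha> \<beta>. True}"
proof
 have pts: "a : f" "b : f" "c : f" using assms by (auto simp: triv_def hull_inc)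
 have sp: "{\<alpha> *R (b - a) + \<beta> *R (c - a) |\<alpha> \<beta>. True} = span {b - a, c - a}"
  by (auto simp: span_insert span_singleton diff_eq_eq) (metis add.commute)+
 show "span {y - x |x y. x : f & y : f} \<subseteq> {\<alpha> *R (b - a) + \<beta> *R (c - a) |\<alpha> \<beta>. True}"
  unfolding sp
 proof (intro span_minimal subspace_span subsetI)
  fix z assume "z : {y - x |x y. x : f & y : f}"
  then obtain x y where z: "z = y - x" and "x : f" "y : f" by blast
  then obtain t u t' u' where xy: "x = pt2 a b c t u" "y = pt2 a b c t' u'"
   using assms unfolding triv_def triangle_points by blast
  have "z = (t' - t) *R (b - a) + (u' - u) *R (c - a)" unfolding z xy by (simp add: algebra_simps)
  then show "z : span {b - a, c - a}" by (simp add: span_base span_scale span_add)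
 qed
 show "{\<alpha> *R (b - a) + \<beta> *R (c - a) |\<alpha> \<beta>. True} \<subseteq> span {y - x |x y. x : f & y : f}"
  unfolding sp using pts by (intro span_minimal subspace_span) (auto intro!: span_base)
qed

text \<open>The candidate is the normalised Gram-Schmidt residue of \<open>c - a\<close> against
  \<open>b - a\<close>. In the plane of \<open>f\<close> only its negative is also a unit normal to
  the edge, and the sign condition at \<open>c\<close> excludes it, as the description in
  \<open>conormal\<close> requires.\<close>

lemma conormal_triv:
 assumes T: "triv f a b c"
 shows "norm (conormal f (seg a b)) = 1"
  "conormal f (seg a b) <.> (b - a) = 0"
  "conormal f (seg a b) <.> (c - a) > 0"
  "\<exists>\<alpha> \<beta>. conormal f (seg a b) = \<alpha> *R (b - a) + \<beta> *R (c - a)"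
proof -
 let ?e = "seg a b"
 define p q where "p = b - a" and "q = c - a"
 define w where "w = q - ((q <.> p) / (p <.> p)) *R p"
 have p0: "p <.> p ~= 0" using triv_distinct[OF T] by (simp add: p_def)
 have N: "cross3 p q ~= 0" using triv_cross[OF T] by (simp add: p_def q_def)
 have w0: "w ~= 0"
 proof
  assume "w = 0"
  then have "q = ((q <.> p) / (p <.> p)) *R p" by (simp add: w_def)
  then have "cross3 p q = 0" by (metis cross_mult_right cross_refl scaleR_zero_right)
  then show False using N by simp
 qed
 have wp: "w <.> p = 0" using p0 by (simp add: w_def inner_diff_left)
 have wq: "w <.> q = w <.> w" using wp by (simp add: w_def inner_diff_right)
 define m where "m = (1 / norm w) *R w"
 have m: "norm m = 1" "m <.> p = 0" "m <.> q > 0"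
  using w0 wp by (auto simp: m_def wq)
 have ab: "m = (- ((q <.> p) / (p <.> p)) / norm w) *R p + (1 / norm w) *R q"
  by (simp add: m_def w_def algebra_simps)
 then have ex: "\<exists>\<alpha> \<beta>. m = \<alpha> *R (b - a) + \<beta> *R (c - a)"
  unfolding p_def q_def by blast
 let ?P = "%m. norm m = 1 & m : span {y - x |x y. x : f & y : f} &
   (\<forall>x\<in>?e. \<forall>y\<in>?e. m <.> (y - x) = 0) & (\<forall>x\<in>?e. \<forall>y\<in>f. m <.> (y - x) \<ge> 0)"
 have "?P m"
 proof (intro conjI ballI)
  show "m : span {y - x |x y. x : f & y : f}"
   unfolding triv_span[OF T] using ex by blast
 next
  fix x y assume "x : ?e" "y : ?e"
  then obtain t u where "x = pt1 a b t" "y = pt1 a b u" by (metis segment_point)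
  then have "y - x = (u - t) *R p" by (simp add: p_def scaleR_left_diff_distrib)
  then show "m <.> (y - x) = 0" using m by simp
 next
  fix x y assume "x : ?e" "y : f"
  obtain t where "x = pt1 a b t" using \<open>x : ?e\<close> by (metis segment_point)
  moreover obtain t' u where "y = pt2 a b c t' u" "u \<ge> 0"
   using T \<open>y : f\<close> unfolding triv_def triangle_points by blast
  ultimately have "y - x = (t' - t) *R p + u *R q" "u \<ge> 0" by (simp_all add: p_def q_def scaleR_left_diff_distrib)
  then show "m <.> (y - x) \<ge> 0" using m by (simp add: inner_add_right)
 qed (rule m)
 moreover have "m' = m" if P: "?P m'" for m'
 proof -
  obtain \<alpha> \<beta> where m1: "m' = \<alpha> *R p + \<beta> *R q"
   using P unfolding triv_span[OF T] p_def q_def by blast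
  define \<gamma> where "\<gamma> = \<alpha> + \<beta> * ((q <.> p) / (p <.> p))"
  have m': "m' = \<gamma> *R p + \<beta> *R w"
   unfolding m1 \<gamma>_def w_def by (simp add: scaleR_left_distrib scaleR_right_diff_distrib)
  have "a : ?e" "b : ?e" "c : f" using T by (auto simp: triv_def hull_inc)
  then have "m' <.> p = 0" "m' <.> q \<ge> 0" using that by (auto simp: p_def q_def)
  then have "\<gamma> = 0" using p0 wp by (simp add: m' inner_add_left)
  then have "m' = \<beta> *R w" by (simp add: m')
  moreover have "\<beta> \<ge> 0"
  proof -
   have "0 <= \<beta> * (w <.> w)" using \<open>m' <.> q \<ge> 0\<close> by (simp add: calculation wq)
   moreover have "0 < w <.> w" using w0 by simp
   ultimately show ?thesis by (metis mult_neg_pos not_le)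
  qed
  moreover have "\<beta> * norm w = 1" using that calculation by simp
  ultimately show ?thesis using w0 by (simp add: m_def field_simps)
 qed
 ultimately have "conormal f ?e = m"
  unfolding conormal_def by (rule the_equality)
 then show "norm (conormal f (seg a b)) = 1"
  "conormal f (seg a b) <.> (b - a) = 0"
  "conormal f (seg a b) <.> (c - a) > 0"
  "\<exists>\<alpha> \<beta>. conormal f (seg a b) = \<alpha> *R (b - a) + \<beta> *R (c - a)"
  using m ex by (simp_all only: p_def q_def)
qed

lemma bary_triv:
 assumes T: "triv f a b c" and x: "x = pt2 a b c t u"
 shows "(\<Prod>v\<in>verts f. bary (verts f) v x) = t * u * (1 - t - u)"
proof -
 note ds = triv_distinct[OF T]
 define l where "l v = (if v = a then 1 - t - u else if v = b then t else if v = c then u else 0)" for v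
 have l: "(\<forall>w. w \<notin> {a, b, c} \<longrightarrow> l w = 0) & sum l {a, b, c} = 1 & (\<Sum>w\<in>{a, b, c}. l w *R w) = x"
  using ds by (auto simp: l_def x algebra_simps)
 have "h = l" if h: "(\<forall>w. w \<notin> {a, b, c} \<longrightarrow> h w = 0) & sum h {a, b, c} = 1 & (\<Sum>w\<in>{a, b, c}. h w *R w) = x" for h
 proof (rule ccontr)
  assume "h ~= l"
  then obtain v where "h v ~= l v" by blast
  moreover from this have "v : {a, b, c}" using h l by fastforce
  moreover have "(\<Sum>w\<in>{a, b, c}. h w - l w) = 0" "(\<Sum>w\<in>{a, b, c}. (h w - l w) *R w) = 0"
   using h l by (simp_all only: sum_subtractf scaleR_left_diff_distrib) simp_all
  ultimately have "affine_dependent {a, b, c}"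
   by (subst affine_dependent_explicit_finite) (auto intro!: exI[of _ "%w. h w - l w"])
  then show False using T by (simp add: triv_def)
 qed
 with l have the: "(THE h. (\<forall>w. w \<notin> {a, b, c} \<longrightarrow> h w = 0) & sum h {a, b, c} = 1 & (\<Sum>w\<in>{a, b, c}. h w *R w) = x) = l"
  by (intro the_equality)
 show ?thesis
  unfolding triv_verts[OF T] bary_def the using ds by (simp add: l_def)
qed

section \<open>The divergence theorem on a tetrahedron\<close>

lemma tetra_FTC:
 assumes T: "tetv K a b c d" and g: "smooth g"
 shows "integral K (dd (d - a) g) = \<bar>(d - a) <.> cross3 (b - a) (c - a)\<bar> * (M2 b c d g - M2 a b c g)"
proof -
 have cg: "cont g" using g by (rule smooth_cont)
 have K: "K = hull4 a b c d" using T by (simp add: tetv_def)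
 have inner: "integral {0..1 - t - u} (%w. dd (d - a) g (pt2 a b c t u + w *R (d - a)))
   = g (pt2 d b c t u) - g (pt2 a b c t u)"
  if "u : {0..1 - t}" for t u
 proof -
  let ?x = "pt2 a b c t u"
  have "((%w. dd (d - a) g (?x + w *R (d - a))) has_integral
    g (?x + (1 - t - u) *R (d - a)) - g (?x + 0 *R (d - a))) {0..1 - t - u}"
   using that by (intro fundamental_theorem_of_calculus smooth_has_vector_derivative g) auto
  moreover have "?x + (1 - t - u) *R (d - a) = pt2 d b c t u"
   by (simp add: algebra_simps)
  ultimately show ?thesis by (simp add: integral_unique)
 qed
 have "integral {0..1} (%t. integral {0..1 - t} (%u. integral {0..1 - t - u} (%w.
   dd (d - a) g (pt2 a b c t u + w *R (d - a))))) =
   integral {0..1} (%t. integral {0..1 - t} (%u. g (pt2 d b c t u) - g (pt2 a b c t u)))"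
  by (intro integral_cong inner)
 also have "\<dots> = integral {0..1} (%t. integral {0..1 - t} (%u. g (pt2 d b c t u))
   - integral {0..1 - t} (%u. g (pt2 a b c t u)))"
  by (intro integral_cong integral_diff integrable_line cg)
 also have "\<dots> = M2 d b c g - M2 a b c g"
  unfolding M2_def by (intro integral_diff integrable_continuous_real M2_inner cg)
 also have "M2 d b c g = M2 b c d g"
  using M2_swap[OF cg] M2_swap'[OF cg] by metis
 finally show ?thesis
  unfolding K by (simp only: integral_tetra[OF tetv_volume[OF T] smooth_cont[OF smooth_dd[OF g]]])
qed

text \<open>The sign that makes \<open>osign n K f *R n\<close> the outer normal of \<open>K\<close>
  on \<open>f\<close>.\<close>

definition osign :: "vec3 => vec3 set => vec3 set => real" where
 "osign n K f = (if \<forall>x\<in>K. \<forall>y\<in>f. n <.> (x - y) <= 0 then 1 else - 1)"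

lemma osign_square [simp]: "osign n K f * osign n K f = 1"
 by (simp add: osign_def)

lemma osign_tetv:
 assumes T: "tetv K a b c d" and n: "unit_normal (hull3 a b c) n"
 shows "osign n K (hull3 a b c) * (n <.> (d - a)) = - \<bar>n <.> (d - a)\<bar>"
  and "\<bar>(d - a) <.> cross3 (b - a) (c - a)\<bar> = norm (cross3 (b - a) (c - a)) * \<bar>n <.> (d - a)\<bar>"
  and "n <.> (d - a) ~= 0"
proof -
 note n' = unit_normal_triv[OF tetv_triv[OF T] n]
 have K: "K = hull4 a b c d" using T by (simp add: tetv_def)
 have "n <.> (x - y) <= 0" if neg: "n <.> (d - a) <= 0" and x: "x : K" and y: "y : hull3 a b c" for x y
 proof -
  obtain z where z: "z : tet" "x = a + (vec_of z $ 1 *R (b - a) + vec_of z $ 2 *R (c - a) + vec_of z $ 3 *R (d - a))"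
   using x unfolding K tetra_image by blast
  obtain t u where y: "y = pt2 a b c t u"
   using y unfolding triangle_points by blast
  have "n <.> (x - y) = snd (snd z) * (n <.> (d - a))"
   unfolding z(2) y using n' by (simp add: inner_diff_right inner_add_right)
  moreover have "snd (snd z) \<ge> 0" using z(1) by (auto simp: tet_def)
  ultimately show ?thesis using neg by (simp add: mult_nonneg_nonpos)
 qed
 moreover have "d : K" "a : hull3 a b c" by (auto simp: K hull_inc)
 ultimately show "osign n K (hull3 a b c) * (n <.> (d - a)) = - \<bar>n <.> (d - a)\<bar>"
  unfolding osign_def by (cases "n <.> (d - a) <= 0") auto
 have "(d - a) <.> cross3 (b - a) (c - a) = (n <.> cross3 (b - a) (c - a)) * (n <.> (d - a))"
  using unit_normal_cross(1)[OF n'] by (metis inner_commute inner_scaleR_right)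
 then show *: "\<bar>(d - a) <.> cross3 (b - a) (c - a)\<bar> = norm (cross3 (b - a) (c - a)) * \<bar>n <.> (d - a)\<bar>"
  using unit_normal_cross(2)[OF n'] by (simp add: abs_mult)
 show "n <.> (d - a) ~= 0" using * tetv_volume[OF T] by auto
qed

lemma tetv_faces_sum:
 assumes T: "tetv K a b c d"
 shows "(\<Sum>f\<in>faces K. h f) = h (hull3 a b c) + h (hull3 a b d) + h (hull3 a c d) + h (hull3 b c d)"
proof -
 note ds = tetv_distinct[OF T]
 note v = tetv_triv[OF T] tetv_triv[OF tetv_perm[OF T, of a b d c]] tetv_triv[OF tetv_perm[OF T, of a c d b]]
   tetv_triv[OF tetv_perm[OF T, of b c d a]]
 have v: "triv (hull3 a b c) a b c" "triv (hull3 a b d) a b d" "triv (hull3 a c d) a c d"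
  "triv (hull3 b c d) b c d" using v by auto
 have "hull3 a b c ~= hull3 a b d" "hull3 a b c ~= hull3 a c d"
  "hull3 a b c ~= hull3 b c d" "hull3 a b d ~= hull3 a c d"
  "hull3 a b d ~= hull3 b c d" "hull3 a c d ~= hull3 b c d"
  using ds by (auto simp only: triv_hull_eq[OF v(1) v(2)] triv_hull_eq[OF v(1) v(3)] triv_hull_eq[OF v(1) v(4)]
   triv_hull_eq[OF v(2) v(3)] triv_hull_eq[OF v(2) v(4)] triv_hull_eq[OF v(3) v(4)])
 then show ?thesis
  unfolding tetv_faces[OF T] by (simp add: add.assoc)
qed

text \<open>Two of the faces contain the direction \<open>d - a\<close> and drop out. Lines in this
  direction enter and leave through the other two, and for either of them twice the area times the
  height is the same determinant.\<close>

lemma gauss_edge: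
 assumes T: "tetv K a b c d" and g: "smooth g" and n: "!!f. f : faces K ==> unit_normal f (n f)"
 shows "integral K (dd (d - a) g) = (\<Sum>f\<in>faces K. osign (n f) K f * (n f <.> (d - a)) * face_int f g)"
proof -
 have cg: "cont g" using g by (rule smooth_cont)
 let ?V = "\<bar>(d - a) <.> cross3 (b - a) (c - a)\<bar>"
 have T2: "tetv K a b d c" and T3: "tetv K a c d b" and T4: "tetv K b c d a"
  by (rule tetv_perm[OF T]; blast)+
 note nf = n[OF tetv_face[OF T]] n[OF tetv_face[OF T2]] n[OF tetv_face[OF T3]] n[OF tetv_face[OF T4]]
 let ?f1 = "hull3 a b c" and ?f4 = "hull3 b c d"
 have 1: "osign (n ?f1) K ?f1 * (n ?f1 <.> (d - a)) * face_int ?f1 g = - ?V * M2 a b c g"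
  unfolding face_int_eq[OF tetv_triv[OF T] cg] osign_tetv(1)[OF T nf(1)] osign_tetv(2)[OF T nf(1)] by simp
 have 4: "osign (n ?f4) K ?f4 * (n ?f4 <.> (d - a)) * face_int ?f4 g = ?V * M2 b c d g"
 proof -
  have "n ?f4 <.> (d - a) = - (n ?f4 <.> (a - b))"
   using unit_normal_triv(3)[OF tetv_triv[OF T4] nf(4)] by (simp add: inner_diff_right)
  then have "osign (n ?f4) K ?f4 * (n ?f4 <.> (d - a)) = \<bar>n ?f4 <.> (a - b)\<bar>"
   using osign_tetv(1)[OF T4 nf(4)] by simp
  moreover have "(a - b) <.> cross3 (c - b) (d - b) = - ((d - a) <.> cross3 (b - a) (c - a))"
   by (simp add: cross3_def inner_vec_def sum_3 vector_def algebra_simps)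
  then have "?V = norm (cross3 (c - b) (d - b)) * \<bar>n ?f4 <.> (a - b)\<bar>"
   using osign_tetv(2)[OF T4 nf(4)] by simp
  ultimately show ?thesis
   unfolding face_int_eq[OF tetv_triv[OF T4] cg] by simp
 qed
 have 2: "n (hull3 a b d) <.> (d - a) = 0"
  using unit_normal_triv(3)[OF tetv_triv[OF T2] nf(2)] .
 have 3: "n (hull3 a c d) <.> (d - a) = 0"
  using unit_normal_triv(3)[OF tetv_triv[OF T3] nf(3)] .
 show ?thesis
  unfolding tetv_faces_sum[OF T] 1 4 2 3 tetra_FTC[OF T g] by (simp add: algebra_simps)
qed

lemma tetv_basis:
 assumes T: "tetv K a b c d"
 obtains \<alpha> \<beta> \<gamma> where "v = \<alpha> *R (b - a) + \<beta> *R (c - a) + \<gamma> *R (d - a)"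
proof -
 define L where "L y = y $ 1 *R (b - a) + y $ 2 *R (c - a) + y $ 3 *R (d - a)" for y :: vec3
 have lin: "linear L" unfolding L_def by (rule linearI) (auto simp: algebra_simps)
 have "det (matrix L) = (d - a) <.> cross3 (b - a) (c - a)"
  by (simp add: det_3 matrix_def L_def axis_def cross3_def inner_vec_def sum_3 vector_def) algebra
 then have "inj L" using tetv_volume[OF T] det_nz_iff_inj[OF lin] by simp
 then have "surj L" using lin by (intro linear_injective_imp_surjective) auto
 then obtain y where "v = L y" by (metis surjD)
 then show thesis using that L_def by blast
qed

lemma integral_K_linear:
 fixes f g :: "vec3 => real"
 assumes "compact K" "cont f" "cont g"
 shows "integral K (%x. f x + g x) = integral K f + integral K g"
  "integral K (%x. f x - g x) = integral K f - integral K g"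
proof -
 have "f integrable_on K" "g integrable_on K"
  using compact_absolutely_integrable[OF assms(1)] assms(2,3)
  by (meson continuous_on_subset set_lebesgue_integral_eq_integral(1) subset_UNIV)+
 then show "integral K (%x. f x + g x) = integral K f + integral K g"
  "integral K (%x. f x - g x) = integral K f - integral K g"
  by (auto intro: integral_add integral_diff)
qed

lemma tetv_compact: "tetv K a b c d ==> compact K"
 by (simp add: tetv_def finite_imp_compact_convex_hull)

text \<open>Both sides are linear in \<open>v\<close>, and the three edge directions at
  \<open>a\<close> form a basis.\<close>

lemma gauss:
 assumes T: "tetv K a b c d" and g: "smooth g" and n: "!!f. f : faces K ==> unit_normal f (n f)"
 shows "integral K (dd v g) = (\<Sum>f\<in>faces K. osign (n f) K f * (n f <.> v) * face_int f g)"
proof -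
 obtain \<alpha> \<beta> \<gamma> where v: "v = \<alpha> *R (b - a) + \<beta> *R (c - a) + \<gamma> *R (d - a)"
  by (rule tetv_basis[OF T])
 have T3: "tetv K a c d b" and T2: "tetv K a b d c" by (rule tetv_perm[OF T]; blast)+
 have c: "cont (dd w g)" for w using g by (intro smooth_cont smooth_dd)
 note K = tetv_compact[OF T]
 have "dd v g = (%x. \<alpha> * dd (b - a) g x + \<beta> * dd (c - a) g x + \<gamma> * dd (d - a) g x)"
  unfolding v using g by (simp add: dd_dir_add dd_dir_scaleR)
 then have "integral K (dd v g) = \<alpha> * integral K (dd (b - a) g) + \<beta> * integral K (dd (c - a) g) + \<gamma> * integral K (dd (d - a) g)"
  by (simp add: integral_K_linear[OF K] c continuous_intros)
 also have "\<dots> = (\<Sum>f\<in>faces K. osign (n f) K f * (n f <.> v) * face_int f g)"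
 proof -
  have "(\<Sum>f\<in>faces K. osign (n f) K f * (n f <.> v) * face_int f g) =
    (\<Sum>f\<in>faces K. \<alpha> * (osign (n f) K f * (n f <.> (b - a)) * face_int f g)
     + \<beta> * (osign (n f) K f * (n f <.> (c - a)) * face_int f g)
     + \<gamma> * (osign (n f) K f * (n f <.> (d - a)) * face_int f g))"
   unfolding v by (intro sum.cong) (auto simp: distrib_left distrib_right inner_add_right)
  then show ?thesis
   by (simp only: gauss_edge[OF T g n] gauss_edge[OF T2 g n] gauss_edge[OF T3 g n] sum_distrib_left sum.distrib)
 qed
 finally show ?thesis .
qed

text \<open>Component \<open>i\<close> of Stokes' theorem. Scaled by lengths and by twice the area,
  all directions become combinations of edge vectors, and the claim follows from
  \<open>M2_FTC\<close> and \<open>M2_FTC'\<close>.\<close>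

lemma stokes_triangle:
 assumes T: "triv f a b c" and n: "unit_normal f n" and g: "smooth g"
 shows "face_int f (%x. dd (cross3 (axis i 1) n) g x)
  = (\<Sum>e\<in>edges f. cross3 (conormal f e) n $ i * edge_int e g)"
proof -
 have cg: "cont g" using g by (rule smooth_cont)
 define p q N where "p = b - a" and "q = c - a" and "N = cross3 p q"
 note n' = unit_normal_triv[OF T n]
 define k where "k = n <.> N"
 have Nn: "N = k *R n" and k: "\<bar>k\<bar> = norm N"
  using unit_normal_cross[OF n'] by (auto simp: N_def p_def q_def k_def)
 have k0: "k ~= 0" using k triv_cross[OF T] by (auto simp: N_def p_def q_def)
 have kk: "norm N = k * sgn k" using k by (simp add: abs_sgn)
 define s where "s = sgn k"
 have ss: "s * s = 1" using k0 by (auto simp: s_def sgn_if)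
 \<comment> \<open>The sign \<open>s\<close> tells whether \<open>n\<close> agrees with the
   orientation of \<open>a, b, c\<close>, and \<open>\<sigma>\<close> whether the relabelling
   preserves this orientation.\<close>
 have conorm: "(norm (b' - a')) *R cross3 (conormal f (seg a' b')) n = (\<sigma> * s) *R (b' - a')"
  if T': "triv f a' b' c'" and \<sigma>: "cross3 (b' - a') (c' - a') = \<sigma> *R N" "\<sigma> * \<sigma> = 1" for a' b' c' \<sigma>
 proof -
  let ?m = "conormal f (seg a' b')" and ?p = "b' - a'"
  note m = conormal_triv[OF T']
  have p0: "?p ~= 0" using triv_distinct[OF T'] by simp
  obtain \<alpha> \<beta> where ab: "?m = \<alpha> *R ?p + \<beta> *R (c' - a')" using m(4) by blast
  have nm: "n <.> ?m = 0"
   unfolding ab using unit_normal_triv[OF T' n] by (simp add: inner_add_right)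
  have pm: "cross3 ?p ?m = (\<beta> * \<sigma> * k) *R n"
   unfolding ab using \<sigma> Nn by (simp add: cross_add_right cross_mult_right)
  have "?p <.> ?p = ?p <.> ?p * (?m <.> ?m)" using m(1) by (simp add: dot_square_norm)
  have "cross3 ?m (cross3 ?p ?m) = ?p"
   using m(1,2) by (simp add: Lagrange dot_square_norm)
  then have mn: "(\<beta> * \<sigma> * k) *R cross3 ?m n = ?p"
   by (simp add: pm cross_mult_right)
  have "?m <.> (c' - a') * \<beta> = 1"
  proof -
   have "?m <.> ?m = ?m <.> (\<alpha> *R ?p + \<beta> *R (c' - a'))" using ab by simp
   also have "\<dots> = \<beta> * (?m <.> (c' - a'))" using m(2) by (simp add: inner_add_right)
   finally show ?thesis using m(1) by (simp add: dot_square_norm mult.commute)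
  qed
  then have \<beta>: "\<beta> > 0" using m(3) by (metis mult_pos_neg not_less_iff_gr_or_eq mult_zero_right zero_less_one less_numeral_extra(3) less_asym)
  have n1: "norm (cross3 ?m n) = 1"
   using norm_cross_dot[of ?m n] nm m(1) n'(1) by (simp add: inner_commute power2_eq_1_iff)
    (metis norm_ge_zero not_one_le_zero neg_0_le_iff_le order.trans zero_le_one le_minus_one_simps(3))
  have "norm ?p = \<bar>\<beta> * \<sigma> * k\<bar>" using mn n1 by (metis mult.right_neutral norm_scaleR)
  also have "\<dots> = \<beta> * \<bar>k\<bar>"
   using \<beta> \<sigma>(2) by (simp add: abs_mult) (metis abs_mult_self_eq abs_one abs_square_eq_1 mult.right_neutral power2_eq_square)
  finally have np: "norm ?p = \<beta> * (k * s)" using k kk by (simp add: s_def)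
  have "(\<sigma> * s) *R ?p = (\<sigma> * s) *R ((\<beta> * \<sigma> * k) *R cross3 ?m n)" by (simp only: mn)
  also have "\<dots> = ((\<sigma> * \<sigma>) * (\<beta> * (k * s))) *R cross3 ?m n" by (simp add: mult_ac)
  finally show ?thesis using \<sigma>(2) np by simp
 qed
 have e1: "norm (b - a) *R cross3 (conormal f (seg a b)) n = s *R p"
  using conorm[OF T, of 1] by (simp add: N_def p_def q_def)
 have "cross3 (c - b) (a - b) = 1 *R N"
  by (simp add: N_def p_def q_def cross3_simps forall_3)
 from conorm[OF triv_swaps(3)[OF T] this]
 have e2: "norm (c - b) *R cross3 (conormal f (seg b c)) n = s *R (q - p)"
  by (simp add: p_def q_def)
 have "cross3 (c - a) (b - a) = (- 1) *R N"
  unfolding N_def p_def q_def by (subst cross_skew) simp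
 from conorm[OF triv_swaps(2)[OF T] this]
 have e3: "norm (c - a) *R cross3 (conormal f (seg a c)) n = (- s) *R q"
  by (simp add: q_def)
 have nth: "(cross3 x n $ i) * (norm w * M) = y $ i * M" if "norm w *R cross3 x n = y" for w x y :: vec3 and M
 proof -
  have "norm w * cross3 x n $ i = y $ i" using arg_cong[OF that, of "%v. v $ i"] by simp
  then have "norm w * cross3 x n $ i * M = y $ i * M" by simp
  then show ?thesis by (simp only: mult_ac)
 qed
 have R: "(\<Sum>e\<in>edges f. cross3 (conormal f e) n $ i * edge_int e g)
   = s * (p $ i * M1 a b g + (q - p) $ i * M1 b c g - q $ i * M1 a c g)"
  unfolding triv_edges_sum[OF T] edge_int_eq nth[OF e1] nth[OF e2] nth[OF e3]
  by (simp add: algebra_simps)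
 have "norm N *R cross3 (axis i 1) n = s *R cross3 (axis i 1) N"
 proof -
  have "cross3 (axis i 1) N = k *R cross3 (axis i 1) n" by (subst Nn) (simp add: cross_mult_right)
  moreover have "norm N *R cross3 (axis i 1) n = (s * k) *R cross3 (axis i 1) n"
   by (simp only: kk s_def mult.commute)
  ultimately show ?thesis by simp
 qed
 also have "cross3 (axis i 1) N = q $ i *R p - p $ i *R q"
  unfolding N_def by (simp add: Lagrange inner_axis')
 finally have dir: "norm N *R cross3 (axis i 1) n = s *R (q $ i *R p - p $ i *R q)" .
 have "face_int f (%x. dd (cross3 (axis i 1) n) g x) = M2 a b c (%x. norm N * dd (cross3 (axis i 1) n) g x)"
  using g by (subst face_int_eq[OF T]) (auto simp: M2_cmult N_def p_def q_def intro!: smooth_cont)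
 also have "(%x. norm N * dd (cross3 (axis i 1) n) g x) = dd (s *R (q $ i *R p - p $ i *R q)) g"
  unfolding dir[symmetric] using g by (simp add: dd_dir_scaleR)
 also have "\<dots> = (%x. (s * q $ i) * dd (b - a) g x - (s * p $ i) * dd (c - a) g x)"
  unfolding p_def[symmetric] q_def[symmetric]
  using g by (simp add: dd_dir_scaleR dd_dir_diff right_diff_distrib mult.assoc)
 also have "M2 a b c \<dots> = (s * q $ i) * (M1 b c g - M1 a c g) - (s * p $ i) * (M1 b c g - M1 a b g)"
  using g by (subst M2_diff) (auto simp: M2_cmult M2_FTC M2_FTC' intro!: continuous_intros smooth_cont)
 also have "\<dots> = s * (p $ i * M1 a b g + (q - p) $ i * M1 b c g - q $ i * M1 a c g)"
  by (simp add: algebra_simps)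
 finally show ?thesis using R by simp
qed

section \<open>Bilinear forms of matrix fields\<close>

lemma smooth_divide [simp, intro]: "smooth f ==> smooth (%x. f x / (c :: real))"
 unfolding divide_inverse by (rule smooth_mult) auto

lemma dd_cdiv: "smooth f ==> dd v (%x. f x / c :: real) = (%x. dd v f x / c)"
 unfolding divide_inverse by (rule dd_linear[OF bounded_linear_mult_left])

text \<open>The scalar form of a matrix field with both vectors kept free. Identities between the
  operators become identities between directional derivatives of such forms, valid in every
  frame.\<close>

definition bf :: "(vec3 => mat3) => vec3 => vec3 => vec3 => real" where
 "bf S x y = (%z. x <.> (S z *v y))"

lemma bl_form: "bounded_linear (%A::mat3. x <.> (A *v y))"
 by (intro linear_linearI linearI)
   (simp_all add: matrix_vector_mult_add_rdistrib inner_add_right scaleR_matrix_vector_assoc[symmetric])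

lemma smooth_bf [simp, intro]: "smooth S ==> smooth (bf S x y)"
 unfolding bf_def by (rule smooth_linear[OF bl_form])

lemma dd_bf: "smooth S ==> dd v (bf S x y) z = x <.> (dd v S z *v y)"
 unfolding bf_def by (simp add: dd_linear[OF bl_form])

lemma bf_lin:
 "bf S (x + x') y = (%z. bf S x y z + bf S x' y z)"
 "bf S x (y + y') = (%z. bf S x y z + bf S x y' z)"
 "bf S (x - x') y = (%z. bf S x y z - bf S x' y z)"
 "bf S x (y - y') = (%z. bf S x y z - bf S x y' z)"
 "bf S (c *R x) y = (%z. c * bf S x y z)"
 "bf S x (c *R y) = (%z. c * bf S x y z)"
 "bf S (- x) y = (%z. - bf S x y z)"
 "bf S x (- y) = (%z. - bf S x y z)"
 "bf S 0 y = (%z. 0)" "bf S x 0 = (%z. 0)"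
 by (simp_all add: bf_def inner_add_left inner_diff_left matrix_vector_right_distrib inner_add_right
   matrix_vector_mult_diff_distrib inner_diff_right matrix_vector_mult_scaleR fun_eq_iff
   linear_neg[OF matrix_vector_mul_linear] inner_minus_left)

lemma form_axis: "axis i 1 <.> (A *v axis j 1) = (A :: mat3) $ i $ j"
 by (simp add: inner_axis' matrix_vector_mult_basis column_def)

lemma bf_axis: "bf S (axis i 1) (axis j 1) = (%z. S z $ i $ j)"
 by (simp add: bf_def form_axis)

lemma mat_eqI: "(!!x y. x <.> (A *v y) = x <.> (B *v y)) ==> A = (B :: mat3)"
 by (simp add: vec_eq_iff form_axis[symmetric])

lemma transpose_form: "x <.> (transpose A *v y) = y <.> ((A :: mat3) *v x)"
 by (metis dot_lmul_matrix inner_commute transpose_matrix_vector)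

lemma transpose_form' [simp]: "x <.> (y v* (A :: mat3)) = y <.> (A *v x)"
 by (metis dot_lmul_matrix inner_commute)

lemma Sym_form: "A : Sym \<longleftrightarrow> (\<forall>x y. x <.> (A *v y) = y <.> (A *v x))"
proof
 show "A : Sym ==> \<forall>x y. x <.> (A *v y) = y <.> (A *v x)"
  unfolding Sym_def using transpose_form[of _ A] by simp
 assume "\<forall>x y. x <.> (A *v y) = y <.> (A *v x)"
 then have "transpose A = A" by (intro mat_eqI) (simp only: transpose_form)
 then show "A : Sym" by (simp add: Sym_def)
qed

lemma subspace_Sym: "subspace Sym"
 by (auto simp: subspace_def Sym_form matrix_vector_mult_add_rdistrib inner_add_right scaleR_matrix_vector_assoc[symmetric])

lemma bf_Sym: "(!!z. S z : Sym) ==> bf S x y = bf S y x"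
 by (simp add: bf_def Sym_form fun_eq_iff)

lemma Qp_vec: "Qp n *v x = x - (n <.> x) *R n"
 by (simp add: vec_eq_iff Qp_def matrix_vector_mult_def inner_vec_def sum_3 forall_3 algebra_simps)

lemma Qp_form: "x <.> (Qp n *v y) = (Qp n *v x) <.> y"
 by (simp add: Qp_vec inner_diff_left inner_diff_right inner_commute)

lemma Qp_conj_form: "x <.> ((Qp n ** A ** Qp n) *v y) = (Qp n *v x) <.> (A *v (Qp n *v y))"
 by (simp add: matrix_vector_mul_assoc[symmetric] Qp_form)

lemma Qp_fix: "n <.> x = 0 ==> Qp n *v x = x"
 by (simp add: Qp_vec)

lemma Qp_orth: "norm n = 1 ==> n <.> (Qp n *v x) = 0"
 by (simp add: Qp_vec inner_diff_right dot_square_norm)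

lemma vgrad_form: assumes "smooth v" shows "x <.> (vgrad v z *v y) = x <.> dd y v z"
proof -
 have "vgrad v z *v y = dd y v z"
  using assms by (simp add: vec_eq_iff vgrad_def matrix_vector_mult_def dd_eq_sum_pd[of v y] mult.commute)
 then show ?thesis by simp
qed

lemma eps_form: assumes "smooth v" shows "x <.> (eps v z *v y) = (x <.> dd y v z + y <.> dd x v z) / 2"
 using assms
 by (simp add: eps_def scaleR_matrix_vector_assoc[symmetric] matrix_vector_mult_add_rdistrib inner_add_right
   vgrad_form transpose_form add_divide_distrib)

lemma smooth_vec:
 fixes v :: "vec3 => 'a::euclidean_space^3"
 assumes "!!i. smooth (%z. v z $ i)" shows "smooth v"
proof -
 have l: "linear (axis i :: 'a => 'a^3)" for i
  by (rule linearI) (auto simp: vec_eq_iff axis_def)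
 have "smooth (%z. axis i (v z $ i))" for i
  by (rule smooth_linear[OF linear_linearI[OF l[of i]] assms[of i]])
 then have "smooth (%z. \<Sum>i\<in>UNIV. axis i (v z $ i))"
  by (rule smooth_sum)
 moreover have "(\<Sum>i\<in>UNIV. axis i (x $ i)) = x" for x :: "'a^3"
  by (simp add: vec_eq_iff axis_def)
 ultimately show ?thesis by simp
qed

lemma smooth_mat: "(!!i j. smooth (%z. S z $ i $ j)) ==> smooth (S :: vec3 => mat3)"
 by (intro smooth_vec)

lemma smooth_eps [simp, intro]: assumes "smooth v" shows "smooth (eps v)"
proof (rule smooth_mat)
 fix i j
 have "(%z. eps v z $ i $ j) = (%z. (pd j v z $ i + pd i v z $ j) / 2)"
  by (simp add: eps_def vgrad_def transpose_def fun_eq_iff)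
 then show "smooth (%z. eps v z $ i $ j)"
  using assms by (simp only: smooth_pd smooth_nth smooth_divide smooth_add)
qed

lemma bf_eps: "smooth u ==> bf (eps u) x y = (%z. (dd y (%z. x <.> u z) z + dd x (%z. y <.> u z) z) / 2)"
 by (simp add: bf_def eps_form dd_cinner fun_eq_iff)

lemma eps_Sym: "smooth u ==> eps u z : Sym"
 by (simp add: Sym_form eps_form add.commute)

lemma hess_form:
 assumes "smooth q" shows "x <.> (hess q z *v y) = dd x (dd y q) z"
proof -
 have "dd x (dd y q) z = (\<Sum>i\<in>UNIV. x $ i * (\<Sum>j\<in>UNIV. y $ j * pd i (pd j q) z))"
 proof -
  have "dd x (dd y q) z = (\<Sum>i\<in>UNIV. x $ i * pd i (dd y q) z)"
   using assms by (simp add: dd_eq_sum_pd[of "dd y q" x])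
  moreover have "pd i (dd y q) z = (\<Sum>j\<in>UNIV. y $ j * pd i (pd j q) z)" for i
   using assms by (simp add: dd_eq_sum_pd[of q y] pd_def dd_sum dd_cmult)
  ultimately show ?thesis by simp
 qed
 then show ?thesis
  by (simp add: hess_def inner_vec_def matrix_vector_mult_def mult.commute)
qed

lemma eps_f_form: "smooth v ==> x <.> (eps_f n v z *v y) =
  ((Qp n *v x) <.> dd (Qp n *v y) v z + (Qp n *v y) <.> dd (Qp n *v x) v z) / 2"
 by (simp add: eps_f_def Qp_conj_form eps_form)

lemma hess_f_form: "smooth q ==> x <.> (hess_f n q z *v y) = dd (Qp n *v x) (dd (Qp n *v y) q) z"
 by (simp add: hess_f_def Qp_conj_form hess_form)

lemma smooth_mv [simp, intro]:
 fixes S :: "vec3 => mat3"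
 assumes "smooth S" shows "smooth (%z. S z *v y)"
proof (rule smooth_linear[OF _ assms])
 show "bounded_linear (%A::mat3. A *v y)"
  by (intro linear_linearI linearI) (simp_all add: matrix_vector_mult_add_rdistrib scaleR_matrix_vector_assoc[symmetric])
qed

lemma smooth_Mv [simp, intro]: "smooth v ==> smooth (%z. (A :: mat3) *v v z)"
 by (rule smooth_linear[OF matrix_vector_mul_bounded_linear])

lemma dd_mv: "smooth S ==> x <.> dd v (%z. S z *v y) z = dd v (bf S x y) z"
 unfolding bf_def by (simp add: dd_cinner)

lemma Lam_form:
 assumes "smooth S"
 shows "x <.> (Lam n S z *v y) = dd (Qp n *v y) (bf S (Qp n *v x) n) z + dd (Qp n *v x) (bf S (Qp n *v y) n) z
  - dd n (bf S (Qp n *v x) (Qp n *v y)) z"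
proof -
 have "x <.> (Lam n S z *v y) = 2 * (x <.> (eps_f n (%y. S y *v n) z *v y)) - x <.> ((Qp n ** dd n S z ** Qp n) *v y)"
  by (simp add: Lam_def scaleR_matrix_vector_assoc[symmetric] matrix_vector_mult_diff_rdistrib inner_diff_right)
 then show ?thesis
  using assms by (simp add: eps_f_form Qp_conj_form dd_mv dd_bf[of S n])
qed

lemma sgrad_form: "smooth q ==> w <.> sgrad q z = dd w q z"
 by (simp add: dd_eq_sum_pd[of q w] sgrad_def inner_vec_def)

lemma Gam_form:
 assumes "smooth S"
 shows "w <.> Gam s S z = 2 * dd s (bf S (Qp s *v w) s) z - dd (Qp s *v w) (bf S s s) z"
proof -
 have "w <.> dd s (%y. Qp s *v (S y *v s)) z = (Qp s *v w) <.> dd s (%y. S y *v s) z"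
  using assms by (simp add: dd_linear[OF matrix_vector_mul_bounded_linear] Qp_form)
 moreover have "w <.> (Qp s *v sgrad (bf S s s) z) = dd (Qp s *v w) (bf S s s) z"
  using assms by (simp add: Qp_form sgrad_form)
 ultimately show ?thesis
  using assms by (simp add: Gam_def inner_diff_right dd_mv bf_def)
qed

lemma rot_perp_bf: "rot_perp s \<mu> \<nu> S z = dd \<mu> (bf S s \<nu>) z - dd \<nu> (bf S s \<mu>) z"
 by (simp add: rot_perp_def bf_def)

section \<open>The curl operators evaluated on cross products\<close>

lemma levi_civita_cross:
 "(\<Sum>j\<in>UNIV. cross3 r t $ j * (\<Sum>m\<in>UNIV. \<Sum>p\<in>UNIV. levi_civita j m p * g m p)) =
  (\<Sum>m\<in>UNIV. \<Sum>p\<in>UNIV. (r $ m * t $ p - t $ m * r $ p) * g m p)"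
 by (simp add: levi_civita_def cross3_def inner_vec_def vector_def axis_def sum_3 algebra_simps)

lemma smooth_mcurl [simp, intro]:
 assumes "smooth S" shows "smooth (mcurl S)"
proof (rule smooth_mat)
 fix i j show "smooth (%z. mcurl S z $ i $ j)"
  using assms by (simp add: mcurl_def smooth_pd smooth_nth smooth_mult smooth_sum)
qed

lemma mcurl_form:
 assumes S: "smooth S"
 shows "bf (mcurl S) x (cross3 r t) = (%z. dd r (bf S x t) z - dd t (bf S x r) z)"
proof
 fix z
 let ?g = "%m p. \<Sum>i\<in>UNIV. x $ i * pd m S z $ i $ p"
 have *: "dd u (bf S x v) z = (\<Sum>m\<in>UNIV. \<Sum>p\<in>UNIV. u $ m * v $ p * ?g m p)" for u v
 proof -
  have "dd u (bf S x v) z = x <.> ((\<Sum>m\<in>UNIV. u $ m *R pd m S z) *v v)"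
   using S by (simp add: dd_bf dd_eq_sum_pd[of S u])
  also have "\<dots> = (\<Sum>m\<in>UNIV. \<Sum>p\<in>UNIV. u $ m * v $ p * ?g m p)"
   by (simp add: inner_vec_def matrix_vector_mult_def sum_3 algebra_simps)
  finally show ?thesis .
 qed
 have "bf (mcurl S) x (cross3 r t) z = (\<Sum>j\<in>UNIV. cross3 r t $ j * (\<Sum>m\<in>UNIV. \<Sum>p\<in>UNIV. levi_civita j m p * ?g m p))"
  by (simp add: bf_def mcurl_def inner_vec_def matrix_vector_mult_def sum_3 algebra_simps)
 also have "\<dots> = dd r (bf S x t) z - dd t (bf S x r) z"
  unfolding levi_civita_cross * by (simp add: sum_subtractf[symmetric] left_diff_distrib algebra_simps)
 finally show "bf (mcurl S) x (cross3 r t) z = dd r (bf S x t) z - dd t (bf S x r) z" .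
qed

lemma smooth_transpose [simp, intro]: "smooth S ==> smooth (%z. transpose (S z :: mat3))"
 by (rule smooth_mat) (simp add: transpose_def smooth_nth)

lemma smooth_mcurl_star [simp, intro]: "smooth S ==> smooth (mcurl_star S)"
 unfolding mcurl_star_def by (intro smooth_transpose smooth_mcurl)

lemma bf_transpose: "bf (%z. transpose (S z)) x y = bf S y x"
 by (simp add: bf_def transpose_form)

lemma mcurl_star_form:
 "smooth S ==> bf (mcurl_star S) (cross3 p q) b = (%z. dd p (bf S q b) z - dd q (bf S p b) z)"
proof -
 assume S: "smooth S"
 have "bf (mcurl_star S) (cross3 p q) b = bf (mcurl (%y. transpose (S y))) b (cross3 p q)"
  by (simp add: bf_def mcurl_star_def transpose_form)
 also have "\<dots> = (%z. dd p (bf S q b) z - dd q (bf S p b) z)"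
  using S by (subst mcurl_form) (auto simp: bf_transpose)
 finally show ?thesis .
qed

lemma smooth_ccs [simp, intro]: "smooth S ==> smooth (ccs S)"
 unfolding ccs_def by (intro smooth_mcurl smooth_mcurl_star)

lemma ccs_form:
 assumes "smooth S"
 shows "bf (ccs S) (cross3 p q) (cross3 r t) z =
  dd p (dd r (bf S q t)) z - dd p (dd t (bf S q r)) z - dd q (dd r (bf S p t)) z + dd q (dd t (bf S p r)) z"
 using assms by (simp add: ccs_def mcurl_form mcurl_star_form dd_diff dd_commute[of _ p] dd_commute[of _ q])

lemma axis_cross:
 obtains p q where "axis (i :: 3) (1 :: real) = cross3 p q"
 using exhaust_3[of i] cross_basis by metis

lemma ccs_Sym:
 assumes "smooth S" "!!z. S z : Sym"
 shows "ccs S z : Sym"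
proof -
 have "ccs S z $ i $ j = ccs S z $ j $ i" for i j
 proof -
  obtain p q where i: "axis i (1::real) = cross3 p q" by (rule axis_cross)
  obtain r t where j: "axis j (1::real) = cross3 r t" by (rule axis_cross)
  have c: "bf S x y = bf S y x" for x y using assms(2) by (rule bf_Sym)
  have "bf (ccs S) (cross3 p q) (cross3 r t) z = bf (ccs S) (cross3 r t) (cross3 p q) z"
   unfolding ccs_form[OF assms(1)] c[of t q] c[of r q] c[of t p] c[of r p]
   using assms by (simp add: dd_commute[of _ r] dd_commute[of _ t])
  then show ?thesis by (simp add: i[symmetric] j[symmetric] bf_axis)
 qed
 then show ?thesis by (simp add: Sym_def vec_eq_iff transpose_def)
qed

lemma mdiv_nth: "smooth T ==> mdiv T z $ i = (\<Sum>j\<in>UNIV. dd (axis j 1) (bf T (axis i 1) (axis j 1)) z)"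
 by (simp add: mdiv_def pd_def bf_axis dd_nth)

lemma mdiv_mcurl: assumes "smooth S" shows "mdiv (mcurl S) z = 0"
proof -
 have c: "dd u (dd v (bf S x y)) z = dd v (dd u (bf S x y)) z" for u v x y
  using assms by (simp add: dd_commute[of _ u v])
 let ?e = "%i::3. axis i (1::real)"
 have e: "?e 1 = cross3 (?e 2) (?e 3)" "?e 2 = cross3 (?e 3) (?e 1)" "?e 3 = cross3 (?e 1) (?e 2)"
  by (simp_all add: cross_basis)
 have "bf (mcurl S) x (?e 1) = (%z. dd (?e 2) (bf S x (?e 3)) z - dd (?e 3) (bf S x (?e 2)) z)"
  "bf (mcurl S) x (?e 2) = (%z. dd (?e 3) (bf S x (?e 1)) z - dd (?e 1) (bf S x (?e 3)) z)"
  "bf (mcurl S) x (?e 3) = (%z. dd (?e 1) (bf S x (?e 2)) z - dd (?e 2) (bf S x (?e 1)) z)" for x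
  using mcurl_form[OF assms] e by metis+
 then have "mdiv (mcurl S) z $ i = 0" for i
  using assms c[of "?e 1" "?e 2"] c[of "?e 1" "?e 3"] c[of "?e 2" "?e 3"]
  by (simp add: mdiv_nth sum_3 dd_diff)
 then show ?thesis by (simp add: vec_eq_iff)
qed

lemma mdiv_ccs: "smooth S ==> mdiv (ccs S) z = 0"
 unfolding ccs_def by (intro mdiv_mcurl smooth_mcurl_star)

lemma ccs_eps: assumes "smooth u" shows "ccs (eps u) z = 0"
proof -
 have c: "dd x (dd y f) = dd y (dd x f)" if "smooth f" for x y and f :: "vec3 => real"
  using that by (rule dd_commute)
 have "bf (ccs (eps u)) (cross3 p q) (cross3 r t) z = 0" for p q r t
  using assms
  by (simp add: ccs_form bf_eps dd_cdiv dd_add dd_commute[of _ p q] dd_commute[of _ p r] dd_commute[of _ p t]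
   dd_commute[of _ q r] dd_commute[of _ q t] dd_commute[of _ r t] add_divide_distrib)
 then have "ccs (eps u) z $ i $ j = 0" for i j
  by (metis axis_cross bf_axis)
 then show ?thesis by (simp add: vec_eq_iff)
qed

text \<open>The gradient term of \<open>Gam\<close> cancels the derivatives across the edge. What
  remains is a second derivative along the edge, within reach of the edge moments and vertex values
  of \<open>u\<close>.\<close>

lemma Gam_eps:
 assumes u: "smooth u"
 shows "w <.> Gam s (eps u) z = dd s (dd s (%z. (Qp s *v w) <.> u z)) z"
 using u by (simp add: Gam_form bf_eps dd_cdiv dd_add dd_commute[of _ "Qp s *v w" s] add_divide_distrib diff_divide_distrib)

text \<open>The normal derivatives of the tangential components of \<open>u\<close> cancel, so only
  the normal component enters the moments of \<open>Lam\<close>.\<close>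

lemma Lam_eps:
 assumes u: "smooth u"
 shows "Lam n (eps u) z = hess_f n (%y. n <.> u y) z"
proof (rule mat_eqI)
 fix x y
 show "x <.> (Lam n (eps u) z *v y) = x <.> (hess_f n (%y. n <.> u y) z *v y)"
  using u by (simp add: Lam_form hess_f_form bf_eps dd_cdiv dd_add
   dd_commute[of _ n "Qp n *v x"] dd_commute[of _ n "Qp n *v y"] dd_commute[of _ "Qp n *v y" "Qp n *v x"] add_divide_distrib diff_divide_distrib)
qed

lemma eps_f_Qp:
 assumes u: "smooth u" and n: "norm n = 1"
 shows "Qp n ** eps u z ** Qp n = eps_f n (%y. Qp n *v u y) z"
proof (rule mat_eqI)
 fix x y
 have "Qp n *v (Qp n *v x) = Qp n *v x" for x
  using n by (simp add: Qp_fix Qp_orth)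
 then have "(Qp n *v x) <.> dd v (%y. Qp n *v u y) z = (Qp n *v x) <.> dd v u z" for x v
  using u by (simp add: dd_linear[OF matrix_vector_mul_bounded_linear] Qp_form)
 then show "x <.> ((Qp n ** eps u z ** Qp n) *v y) = x <.> (eps_f n (%y. Qp n *v u y) z *v y)"
  using u by (simp add: Qp_conj_form eps_form eps_f_form)
qed

lemma rot_perp_eps:
 assumes u: "smooth u"
 shows "rot_perp s \<mu> \<nu> (eps u) z = (1/2) * dd s (%z. dd \<mu> (%z. \<nu> <.> u z) z - dd \<nu> (%z. \<mu> <.> u z) z) z"
 using u by (simp add: rot_perp_bf bf_eps dd_cdiv dd_add dd_diff
   dd_commute[of _ \<mu> \<nu>] dd_commute[of _ \<mu> s] dd_commute[of _ \<nu> s] add_divide_distrib diff_divide_distrib)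

text \<open>The tangential components of \<open>(ccs S) n\<close> are the surface curl of \<open>\<Lambda>\<^sub>f(S)\<close>.\<close>
lemma ccs_tangential:
 assumes S: "smooth S" "!!z. S z : Sym" and n: "n <.> p = 0" "n <.> q = 0" "n <.> w = 0"
 shows "bf (ccs S) (cross3 p q) (cross3 w n) z = dd p (bf (Lam n S) q w) z - dd q (bf (Lam n S) p w) z"
proof -
 have L: "bf (Lam n S) x w = (%z. dd w (bf S x n) z + dd x (bf S w n) z - dd n (bf S x w) z)" if "n <.> x = 0" for x
  using S(1) that n(3) by (simp add: bf_def[of "Lam n S"] Lam_form Qp_fix)
 show ?thesis
  using S(1) unfolding L[OF n(1)] L[OF n(2)]
  by (simp add: ccs_form dd_add dd_diff dd_commute[of _ q p])
qed

section \<open>Polynomials on lines and planes\<close>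

lemma polyi_vec:
 fixes v :: "vec3 => 'a::euclidean_space^3"
 assumes "!!i. polyi UNIV k (%z. v z $ i)" shows "polyi UNIV k v"
proof -
 have l: "linear (axis i :: 'a => 'a^3)" for i
  by (rule linearI) (auto simp: vec_eq_iff axis_def)
 have "polyi UNIV k (%z. axis i (v z $ i))" for i
  by (rule polyi_linear[OF assms[of i] l[of i]]) auto
 then have "polyi UNIV k (%z. \<Sum>i\<in>UNIV. axis i (v z $ i))"
  by (intro polyi_sum) auto
 moreover have "(\<Sum>i\<in>UNIV. axis i (x $ i)) = x" for x :: "'a^3"
  by (simp add: vec_eq_iff axis_def)
 ultimately show ?thesis by simp
qed

lemma linear_nth: "linear (%x::'a::real_normed_vector^3. x $ i)"
 by (rule linearI) auto

lemma polyi_nth: "polyi UNIV k v ==> polyi UNIV k (%z. (v z :: 'a::real_normed_vector^3) $ i)"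
 by (rule polyi_linear[OF _ linear_nth]) auto

lemma linear_sym: "linear (%A::mat3. (1/2) *R (A + transpose A))"
 by (rule linearI) (auto simp: transpose_def vec_eq_iff algebra_simps)

lemma polyi_Sym:
 assumes "polyi UNIV k S" "!!z. S z : Sym" shows "polyi Sym k S"
proof -
 have "polyi Sym k (%z. (1/2) *R (S z + transpose (S z)))"
  by (rule polyi_linear[OF assms(1) linear_sym])
   (auto simp: Sym_def transpose_def vec_eq_iff add.commute)
 moreover have "(1/2) *R (S z + transpose (S z)) = S z" for z
  using assms(2)[of z] by (simp add: Sym_def scaleR_2[symmetric])
 ultimately show ?thesis by simp
qed

lemma polyi_eps:
 assumes "polyi UNIV k u" shows "polyi Sym (k - 1) (eps u)"
proof (rule polyi_Sym)
 have "polyi UNIV (k - 1) (%z. (1/2) *R (pd j u z $ i + pd i u z $ j))" for i j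
  by (intro polyi_scale polyi.add polyi_nth polyi_pd assms) auto
 moreover have "(%z. eps u z $ i $ j) = (%z. (1/2) *R (pd j u z $ i + pd i u z $ j))" for i j
  by (simp add: eps_def vgrad_def transpose_def fun_eq_iff)
 ultimately show "polyi UNIV (k - 1) (eps u)"
  by (intro polyi_vec) simp
 show "eps u z : Sym" for z using polyi_smooth[OF assms] by (rule eps_Sym)
qed

lemma polyi_mcurl:
 assumes "polyi UNIV k S" shows "polyi UNIV (k - 1) (mcurl S)"
proof (intro polyi_vec)
 fix i j
 have "polyi UNIV (k - 1) (%z. \<Sum>m\<in>UNIV. \<Sum>p\<in>UNIV. levi_civita j m p *R pd m S z $ i $ p)"
  by (intro polyi_sum polyi_scale polyi_nth polyi_pd assms) auto
 then show "polyi UNIV (k - 1) (%z. mcurl S z $ i $ j)"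
  by (simp add: mcurl_def)
qed

lemma polyi_transpose: "polyi UNIV k S ==> polyi UNIV k (%z. transpose (S z :: mat3))"
 by (rule polyi_linear[where X = UNIV]) (auto intro!: linearI simp: transpose_def vec_eq_iff)

lemma polyi_ccs:
 assumes "polyi Sym k S" shows "polyi Sym (k - 2) (ccs S)"
proof (rule polyi_Sym)
 have "polyi UNIV k S" using assms by (rule polyi_subset) simp
 then have "polyi UNIV (k - 1 - 1) (ccs S)"
  unfolding ccs_def mcurl_star_def by (intro polyi_mcurl polyi_transpose)
 then show "polyi UNIV (k - 2) (ccs S)" by (simp add: numeral_2_eq_2)
 show "ccs S z : Sym" for z
  using polyi_smooth[OF assms] polyi_val[OF assms subspace_Sym] by (rule ccs_Sym)
qed

lemma polyi_bf:
 assumes "polyi X k S" shows "polyi UNIV k (bf S x y)"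
 unfolding bf_def
 by (rule polyi_linear[OF assms bounded_linear.linear[OF bl_form]]) auto

lemma polyi_0_const: assumes "polyi X 0 p" shows "p x = p y"
proof -
 have "k = 0 ==> p x = p y" if "polyi X k p" for k
  using that by (induction rule: polyi.induct) auto
 with assms show ?thesis by simp
qed

lemma line_factor:
 assumes P: "polyi X k p" "subspace X" and v: "v ~= 0" and z: "p (a + t0 *R v) = 0"
 obtains q where "polyi X (k - 1) q" "!!t. p (a + t *R v) = (t - t0) *R q (a + t *R v)"
proof -
 define c where "c = (1 / (v <.> v)) *R v"
 have cv: "c <.> v = 1" using v by (simp add: c_def)
 \<comment> \<open>\<open>P'\<close> agrees with \<open>p\<close> on the line and is constant across
   it, so that a zero on the line becomes a zero plane as needed for the division.\<close>
 define P' where "P' x = p (a + ((c <.> (x - a)) *R v))" for x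
 have "linear (%x. (c <.> x) *R v)"
  by (rule linearI) (auto simp: inner_add_right scaleR_left_distrib)
 from polyi_compose_affine[OF P this, of "a - (c <.> a) *R v"]
 have "polyi X k P'"
  by (simp add: P'_def[abs_def] inner_diff_right scaleR_left_diff_distrib algebra_simps)
 from polyi_division[OF this P(2), of c "- (c <.> a) - t0" v]
 obtain q where q: "polyi X (k - 1) q"
  "!!x. P' x - P' (x - (c <.> x + (- (c <.> a) - t0)) *R v) = (c <.> x + (- (c <.> a) - t0)) *R q x"
  by blast
 show thesis
 proof (rule that[OF q(1)])
  fix t
  let ?x = "a + t *R v"
  have e: "c <.> ?x + (- (c <.> a) - t0) = t - t0" using cv by (simp add: inner_add_right)
  have "P' ?x = p ?x" using cv by (simp add: P'_def)
  moreover have "P' (?x - (t - t0) *R v) = p (a + t0 *R v)"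
   using cv by (simp add: P'_def inner_diff_right inner_add_right)
  ultimately show "p ?x = (t - t0) *R q ?x"
   using q(2)[of ?x] z unfolding e by simp
 qed
qed

text \<open>Each zero splits off a linear factor and lowers the degree, while infinitely many zeros
  remain for the quotient.\<close>

lemma line_zero:
 assumes "polyi X k p" "subspace X" "infinite {t. p (a + t *R v) = 0}"
 shows "p (a + t *R v) = 0"
proof (cases "v = 0")
 case True
 have "{t. p (a + t *R v) = 0} ~= {}" using assms(3) by (metis finite.emptyI)
 with True show ?thesis by auto
next
 case v: False
 show ?thesis using assms(1,3)
 proof (induction k arbitrary: p t)
  case 0
  then have "{t. p (a + t *R v) = 0} ~= {}" by (metis finite.emptyI)
  then obtain t0 where "p (a + t0 *R v) = 0" by blast
  then show ?case using polyi_0_const[OF 0(1)] by metis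
 next
  case (Suc k)
  then have "{t. p (a + t *R v) = 0} ~= {}" by (metis finite.emptyI)
  then obtain t0 where t0: "p (a + t0 *R v) = 0" by blast
  obtain q where q: "polyi X k q" "!!t. p (a + t *R v) = (t - t0) *R q (a + t *R v)"
   using line_factor[OF Suc.prems(1) assms(2) v t0] by auto
  have "{t. p (a + t *R v) = 0} \<subseteq> insert t0 {t. q (a + t *R v) = 0}"
   using q(2) by auto
  then have "infinite {t. q (a + t *R v) = 0}"
   using Suc.prems(2) by (meson finite_insert finite_subset)
  from Suc.IH[OF q(1) this] q(2) show ?case by simp
 qed
qed

lemma line_zero_interval:
 assumes "polyi X k p" "subspace X" "l < r" "!!t. l < t ==> t < r ==> p (a + t *R v) = 0"
 shows "p (a + t *R v) = 0"
proof (rule line_zero[OF assms(1,2)])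
 have "{l<..<r} \<subseteq> {t. p (a + t *R v) = 0}" using assms(4) by auto
 then show "infinite {t. p (a + t *R v) = 0}"
  using infinite_Ioo[OF assms(3)] finite_subset by blast
qed

lemma segment_zero:
 assumes "polyi X k p" "subspace X" "!!x. x : seg a b ==> p x = 0"
 shows "p (pt1 a b t) = 0"
 by (rule line_zero_interval[OF assms(1,2), of 0 1]) (auto intro!: assms(3) on_segment)

lemma segment_factor:
 assumes P: "polyi X (k + 2) p" "subspace X" and ab: "a ~= b" "p a = 0" "p b = 0"
 obtains q where "polyi X k q" "!!t. p (pt1 a b t) = (t * (1 - t)) *R q (pt1 a b t)"
proof -
 have v: "b - a ~= 0" using ab by simp
 obtain q1 where q1: "polyi X (k + 1) q1" "!!t. p (pt1 a b t) = (t - 0) *R q1 (pt1 a b t)"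
  using line_factor[OF P v, of a 0] ab by auto
 have "q1 (pt1 a b 1) = 0" using q1(2)[of 1] ab by simp
 then obtain q2 where q2: "polyi X k q2" "!!t. q1 (pt1 a b t) = (t - 1) *R q2 (pt1 a b t)"
  using line_factor[OF q1(1) P(2) v, of a 1] by auto
 show thesis
 proof (rule that)
  show "polyi X k (%x. (-1) *R q2 x)" using P(2) q2(1) by (rule polyi_scale)
  show "p (pt1 a b t) = (t * (1 - t)) *R ((-1) *R q2 (pt1 a b t))" for t
   unfolding q1(2) q2(2) by (simp add: algebra_simps)
 qed
qed

lemma plane_factor:
 assumes P: "polyi X k P" "subspace X" and pq: "cross3 p q ~= 0" and \<alpha>\<beta>: "\<alpha> ~= 0 \<or> \<beta> ~= 0"
  and z: "!!t u. \<alpha> * t + \<beta> * u + \<gamma> = 0 ==> P (a + t *R p + u *R q) = 0"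
 obtains Q where "polyi X (k - 1) Q"
  "!!t u. P (a + t *R p + u *R q) = (\<alpha> * t + \<beta> * u + \<gamma>) *R Q (a + t *R p + u *R q)"
proof -
 obtain p' q' where d: "p' <.> p = 1" "p' <.> q = 0" "q' <.> p = 0" "q' <.> q = 1"
  by (rule triangle_plane_coords[OF pq])
 define P' where "P' x = P (a + (p' <.> (x - a)) *R p + (q' <.> (x - a)) *R q)" for x
 have "linear (%x. (p' <.> x) *R p + (q' <.> x) *R q)"
  by (rule linearI) (auto simp: inner_add_right scaleR_left_distrib scaleR_right_distrib)
 from polyi_compose_affine[OF P this, of "a - (p' <.> a) *R p - (q' <.> a) *R q"]
 have P': "polyi X k P'"
  by (simp add: P'_def[abs_def] inner_diff_right scaleR_left_diff_distrib algebra_simps)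
 define c where "c = \<alpha> *R p' + \<beta> *R q'"
 define s where "s = \<alpha> * \<alpha> + \<beta> * \<beta>"
 have s: "s ~= 0" using \<alpha>\<beta> by (auto simp: s_def add_nonneg_eq_0_iff)
 \<comment> \<open>Along \<open>v\<close> the linear form \<open>\<alpha> t + \<beta> u\<close> has
   derivative 1, so subtracting \<open>l *R v\<close> leads to its zero line.\<close>
 define v where "v = (\<alpha> / s) *R p + (\<beta> / s) *R q"
 obtain Q where Q: "polyi X (k - 1) Q"
  "!!x. P' x - P' (x - (c <.> x + (\<gamma> - c <.> a)) *R v) = (c <.> x + (\<gamma> - c <.> a)) *R Q x"
  using polyi_division[OF P' P(2), of c "\<gamma> - c <.> a" v] by blast
 show thesis
 proof (rule that[OF Q(1)])
  fix t u
  let ?x = "a + t *R p + u *R q"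
  define l where "l = \<alpha> * t + \<beta> * u + \<gamma>"
  have e: "c <.> ?x + (\<gamma> - c <.> a) = l"
   by (simp add: c_def l_def inner_add_left inner_add_right d)
  have 1: "P' ?x = P ?x" by (simp add: P'_def inner_add_right d)
  have "P' (?x - l *R v) = P (a + (t - l * (\<alpha> / s)) *R p + (u - l * (\<beta> / s)) *R q)"
   by (simp add: P'_def v_def inner_add_right inner_diff_right d)
  also have "\<dots> = 0"
  proof (rule z)
   have "l * (\<alpha> * (\<alpha> / s)) + l * (\<beta> * (\<beta> / s)) = l"
    using s by (simp add: distrib_left[symmetric] s_def[symmetric] add_divide_distrib[symmetric])
   then show "\<alpha> * (t - l * (\<alpha> / s)) + \<beta> * (u - l * (\<beta> / s)) + \<gamma> = 0"
    by (simp add: l_def algebra_simps)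
  qed
  finally show "P ?x = l *R Q ?x"
   using Q(2)[of ?x] unfolding e 1 by simp
 qed
qed

text \<open>The three barycentric factors are split off in turn. Each quotient still vanishes on the
  open remaining edges, and being a polynomial it then vanishes on their whole lines, which is what
  the next division requires.\<close>

lemma triangle_factor:
 assumes P: "polyi X (k + 3) P" "subspace X" and pq: "cross3 (b - a) (c - a) ~= 0"
  and z: "!!x. x : seg a b \<union> seg b c \<union> seg a c ==> P x = 0"
 obtains Q where "polyi X k Q"
  "!!t u. P (pt2 a b c t u) = (t * u * (1 - t - u)) *R Q (pt2 a b c t u)"
proof -
 let ?x = "%t u. pt2 a b c t u"
 have z1: "P (?x 0 u) = 0" for u
  using segment_zero[OF P, of a c u] z by simp
 have z2: "P (?x t 0) = 0" for t
  using segment_zero[OF P, of a b t] z by simp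
 have z3: "P (?x t (1 - t)) = 0" for t
 proof -
  have "?x t (1 - t) = pt1 b c (1 - t)" by (simp add: algebra_simps)
  then show ?thesis using segment_zero[OF P, of b c "1 - t"] z by simp
 qed
 obtain Q1 where Q1: "polyi X (k + 2) Q1" "!!t u. P (?x t u) = t *R Q1 (?x t u)"
  using plane_factor[OF P pq, of 1 0 0] z1 by auto
 have y2: "Q1 (?x t 0) = 0" for t
 proof -
  have "Q1 (pt1 a b t) = 0"
  proof (rule line_zero_interval[OF Q1(1) P(2), of 0 1])
   fix t :: real assume "0 < t" "t < 1"
   then show "Q1 (pt1 a b t) = 0" using z2[of t] Q1(2)[of t 0] by simp
  qed simp
  then show ?thesis by simp
 qed
 have y3: "Q1 (?x t (1 - t)) = 0" for t
 proof -
  have e: "?x t (1 - t) = pt1 c b t" for t by (simp add: algebra_simps)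
  have "Q1 (pt1 c b t) = 0"
  proof (rule line_zero_interval[OF Q1(1) P(2), of 0 1])
   fix t :: real assume "0 < t" "t < 1"
   then show "Q1 (pt1 c b t) = 0" using z3[of t] Q1(2)[of t "1 - t"] by (simp add: e)
  qed simp
  then show ?thesis by (simp add: e)
 qed
 obtain Q2 where Q2: "polyi X (k + 1) Q2" "!!t u. Q1 (?x t u) = u *R Q2 (?x t u)"
  using plane_factor[OF Q1(1) P(2) pq, of 0 1 0] y2 by auto
 have x3: "Q2 (?x t (1 - t)) = 0" for t
 proof -
  have e: "?x t (1 - t) = pt1 c b t" for t by (simp add: algebra_simps)
  have "Q2 (pt1 c b t) = 0"
  proof (rule line_zero_interval[OF Q2(1) P(2), of 0 1])
   fix t :: real assume "0 < t" "t < 1"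
   then show "Q2 (pt1 c b t) = 0" using y3[of t] Q2(2)[of t "1 - t"] by (simp add: e)
  qed simp
  then show ?thesis by (simp add: e)
 qed
 have "Q2 (?x t u) = 0" if "(-1) * t + (-1) * u + 1 = 0" for t u
 proof -
  have "u = 1 - t" using that by simp
  then show ?thesis using x3 by simp
 qed
 then obtain Q3 where Q3: "polyi X k Q3" "!!t u. Q2 (?x t u) = ((-1) * t + (-1) * u + 1) *R Q3 (?x t u)"
  using plane_factor[OF Q2(1) P(2) pq, where \<alpha> = "-1" and \<beta> = "-1" and \<gamma> = 1 and a = a]
  by (metis (no_types, lifting) add_diff_cancel_right' neg_equal_0_iff_equal zero_neq_one)
 show thesis
 proof (rule that[OF Q3(1)])
  show "P (?x t u) = (t * u * (1 - t - u)) *R Q3 (?x t u)" for t u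
   unfolding Q1(2) Q2(2) Q3(2) by (simp add: algebra_simps)
 qed
qed

text \<open>Every point of the plane lies on a line through the barycentre, and such a line meets
  the triangle in an interval.\<close>

lemma triangle_zero:
 assumes P: "polyi X k P" "subspace X" and z: "!!x. x : hull3 a b c ==> P x = 0"
 shows "P (pt2 a b c t u) = 0"
proof -
 let ?x = "%t u. pt2 a b c t u"
 define g where "g = ?x (1/3) (1/3)"
 define v where "v = (t - 1/3) *R (b - a) + (u - 1/3) *R (c - a)"
 \<comment> \<open>So small that up to parameter \<open>r\<close> no barycentric coordinate changes
   by 1/3 or more.\<close>
 define r where "r = 1 / (3 * (1 + \<bar>t\<bar> + \<bar>u\<bar>))"
 have "P (g + 1 *R v) = 0"
 proof (rule line_zero_interval[OF P, of 0 r])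
  show "0 < r" by (simp add: r_def add_pos_nonneg)
  fix s assume s: "0 < s" "s < r"
  have pos: "0 < 1 + \<bar>t\<bar> + \<bar>u\<bar>" by (simp add: add_pos_nonneg)
  have b: "s * (1 + \<bar>t\<bar> + \<bar>u\<bar>) < 1/3"
  proof -
   have "s * (1 + \<bar>t\<bar> + \<bar>u\<bar>) < r * (1 + \<bar>t\<bar> + \<bar>u\<bar>)"
    using s(2) pos by (rule mult_strict_right_mono)
   also have "\<dots> = 1/3" using pos unfolding r_def by (simp add: nonzero_eq_divide_eq)
   finally show ?thesis .
  qed
  have ab: "\<bar>s * x\<bar> <= s * (1 + \<bar>t\<bar> + \<bar>u\<bar>)" if "\<bar>x\<bar> <= 1 + \<bar>t\<bar> + \<bar>u\<bar>" for x
   using s(1) that by (simp add: abs_mult mult_left_mono)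
  have "\<bar>s * (t - 1/3)\<bar> < 1/3" "\<bar>s * (u - 1/3)\<bar> < 1/3" "\<bar>s * (t + u - 2/3)\<bar> < 1/3"
   by (rule le_less_trans[OF ab b], linarith)+
  note small = this
  have sum: "s * (t - 1/3) + s * (u - 1/3) = s * (t + u - 2/3)" by (simp add: algebra_simps)
  have "0 <= 1/3 + s * (t - 1/3)" "0 <= 1/3 + s * (u - 1/3)"
   "1/3 + s * (t - 1/3) + (1/3 + s * (u - 1/3)) <= 1"
   using small sum by linarith+
  then have "P (?x (1/3 + s * (t - 1/3)) (1/3 + s * (u - 1/3))) = 0"
   by (intro z in_triangle)
  moreover have "g + s *R v = ?x (1/3 + s * (t - 1/3)) (1/3 + s * (u - 1/3))"
   by (simp add: g_def v_def scaleR_left_distrib scaleR_right_distrib)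
  ultimately show "P (g + s *R v) = 0"
   by simp
 qed
 moreover have "g + 1 *R v = ?x t u" by (simp add: g_def v_def scaleR_left_diff_distrib)
 ultimately show ?thesis by simp
qed

section \<open>Antiderivatives and potentials with degree bounds\<close>

lemma dd_compose_affine:
 assumes "smooth G" "linear A"
 shows "dd v (%x. G (b + A x)) x = dd (A v) G (b + A x)"
proof (rule dd_eqI)
 have "((%x. b + A x) has_derivative A) (at x)"
  using has_derivative_add[OF has_derivative_const bounded_linear_imp_has_derivative[OF linear_linearI[OF assms(2)]]] by simp
 from has_derivative_compose[OF this smooth_has_derivative[OF assms(1)]]
 show "((%x. G (b + A x)) has_derivative (%v. dd (A v) G (b + A x))) (at x)" .
qed

lemma antiderivative_axis:
 fixes g :: "vec3 => real"
 assumes "polyi UNIV k g"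
 obtains G where "polyi UNIV (Suc k) G" "pd 1 G = g"
proof -
 obtain c where c: "g = (%x. \<Sum>\<alpha>\<in>mono_ix k. mono_fun \<alpha> x *R c \<alpha>)"
  using polyi_imp_polys[OF subspace_UNIV assms] by (auto simp: polys_alt)
 define M where "M \<alpha> x = mono_fun (Suc (fst \<alpha>), snd \<alpha>) x *R (c \<alpha> / real (Suc (fst \<alpha>)))" for \<alpha> x
 have M: "polyi UNIV (Suc k) (M \<alpha>)" if "\<alpha> : mono_ix k" for \<alpha>
 proof -
  obtain i j l where \<alpha>: "\<alpha> = (i, j, l)" by (cases \<alpha>)
  have "polyi UNIV (Suc i + j + l) (M \<alpha>)"
   unfolding M_def[abs_def] \<alpha> mono_fun_def prod.case fst_conv snd_conv by (rule polyi_monomial) simp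
  then show ?thesis
   using that by (intro polyi_mono[of "Suc i + j + l" "Suc k"]) (auto simp: \<alpha> mono_ix_def)
 qed
 have d: "pd 1 (M \<alpha>) = (%x. mono_fun \<alpha> x *R c \<alpha>)" if "\<alpha> : mono_ix k" for \<alpha>
 proof
  fix x :: vec3
  note Ms = polyi_smooth[OF M[OF that]]
  obtain i j l where \<alpha>: "\<alpha> = (i, j, l)" by (cases \<alpha>)
  let ?C = "x $ 2 ^ j * x $ 3 ^ l * (c \<alpha> / real (Suc i))"
  have "M \<alpha> (x + t *R axis 1 1) = (x $ 1 + t) ^ Suc i * ?C" for t
   by (simp add: M_def \<alpha> mono_fun_def axis_def)
  moreover have "((%t. M \<alpha> (x + t *R axis 1 1)) has_real_derivative pd 1 (M \<alpha>) (x + 0 *R axis 1 1)) (at 0)"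
   unfolding pd_def has_real_derivative_iff_has_vector_derivative by (rule smooth_has_vector_derivative[OF Ms])
  moreover have "((%t. (x $ 1 + t) ^ Suc i * ?C) has_real_derivative real (Suc i) * x $ 1 ^ i * ?C) (at 0)"
   by (auto intro!: derivative_eq_intros simp del: of_nat_Suc power_Suc)
  ultimately have "pd 1 (M \<alpha>) x = real (Suc i) * x $ 1 ^ i * ?C"
   using DERIV_unique by fastforce
  then show "pd 1 (M \<alpha>) x = mono_fun \<alpha> x *R c \<alpha>"
   by (simp add: \<alpha> mono_fun_def del: of_nat_Suc)
 qed
 show thesis
 proof (rule that)
  show "polyi UNIV (Suc k) (%x. \<Sum>\<alpha>\<in>mono_ix k. M \<alpha> x)"
   by (intro polyi_sum M) auto
  have "pd 1 (%x. \<Sum>\<alpha>\<in>mono_ix k. M \<alpha> x) = (%x. \<Sum>\<alpha>\<in>mono_ix k. pd 1 (M \<alpha>) x)"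
   unfolding pd_def by (rule dd_sum) (rule polyi_smooth[OF M])
  then show "pd 1 (%x. \<Sum>\<alpha>\<in>mono_ix k. M \<alpha> x) = g" by (simp add: d c)
 qed
qed

lemma antiderivative:
 fixes g :: "vec3 => real"
 assumes g: "polyi UNIV k g" and pq: "cross3 p q ~= 0"
 obtains G where "polyi UNIV (Suc k) G" "dd p G = g"
proof -
 let ?N = "cross3 p q"
 obtain p' q' where d: "p' <.> p = 1" "p' <.> q = 0" "q' <.> p = 0" "q' <.> q = 1" "p' <.> ?N = 0" "q' <.> ?N = 0"
  by (rule triangle_plane_coords[OF pq])
 define N' where "N' = (1 / (?N <.> ?N)) *R ?N"
 have N': "N' <.> p = 0" "N' <.> q = 0" "N' <.> ?N = 1" using pq by (simp_all add: N'_def dot_cross_self)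
 \<comment> \<open>Linear coordinates in which \<open>p\<close> is the first axis; \<open>A\<close>
   is the inverse.\<close>
 define F where "F y = y $ 1 *R p + y $ 2 *R q + y $ 3 *R ?N" for y :: vec3
 define A where "A x = (vector [p' <.> x, q' <.> x, N' <.> x] :: vec3)" for x
 have F: "linear F" unfolding F_def by (rule linearI) (auto simp: algebra_simps)
 have A: "linear A" unfolding A_def by (rule linearI) (auto simp: vec_eq_iff forall_3 inner_add_right)
 have AF: "A (F y) = y" for y
  by (simp add: A_def F_def vec_eq_iff forall_3 inner_add_right d N')
 then have "inj F" by (rule inj_on_inverseI)
 then have "surj F" using F by (intro linear_injective_imp_surjective) auto
 then have FA: "F (A x) = x" for x by (metis AF surjD)
 have "polyi UNIV k (%y. g (0 + F y))"
  by (rule polyi_compose_affine[OF g subspace_UNIV F])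
 then obtain G where G: "polyi UNIV (Suc k) G" "pd 1 G = (%y. g (0 + F y))"
  by (rule antiderivative_axis)
 have Ap: "A p = axis 1 1" using AF[of "axis 1 1"] by (simp add: F_def axis_def)
 show thesis
 proof (rule that)
  show "polyi UNIV (Suc k) (%x. G (0 + A x))"
   by (rule polyi_compose_affine[OF G(1) subspace_UNIV A])
  show "dd p (%x. G (0 + A x)) = g"
  proof
   fix x
   have "dd p (%x. G (0 + A x)) x = dd (A p) G (0 + A x)"
    by (rule dd_compose_affine[OF polyi_smooth[OF G(1)] A])
   also have "\<dots> = g x" using G(2) by (simp add: Ap pd_def[symmetric] FA)
   finally show "dd p (%x. G (0 + A x)) x = g x" .
  qed
 qed
qed

text \<open>The Poincare lemma for polynomials. The integrability condition comes from a trace and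
  holds on one plane only, hence so does the conclusion.\<close>

lemma plane_potential:
 fixes P Q :: "vec3 => real"
 assumes P: "polyi UNIV k P" and Q: "polyi UNIV k Q" and pq: "cross3 p q ~= 0"
  and curl: "!!t u. dd q P (a + t *R p + u *R q) = dd p Q (a + t *R p + u *R q)"
 obtains \<phi> where "polyi UNIV (Suc k) \<phi>"
  "!!t u. dd p \<phi> (a + t *R p + u *R q) = P (a + t *R p + u *R q)"
  "!!t u. dd q \<phi> (a + t *R p + u *R q) = Q (a + t *R p + u *R q)"
proof -
 obtain p' q' where d: "p' <.> p = 1" "p' <.> q = 0" "q' <.> p = 0" "q' <.> q = 1"
  by (rule triangle_plane_coords[OF pq])
 have qp: "cross3 q p ~= 0" using pq by (metis cross_skew neg_equal_0_iff_equal)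
 obtain A where A: "polyi UNIV (Suc k) A" "dd p A = P" by (rule antiderivative[OF P pq])
 \<comment> \<open>What \<open>A\<close> misses of \<open>Q\<close>. By the condition
   \<open>curl\<close> it does not change in direction \<open>p\<close> on the plane, so it can be
   integrated in direction \<open>q\<close> alone.\<close>
 define R where "R x = Q x - dd q A x" for x
 have R: "polyi UNIV k R"
  unfolding R_def[abs_def] using polyi_dd[OF A(1), of q] Q by (intro polyi_diff) auto
 obtain H where H: "polyi UNIV (Suc k) H" "dd q H = R" by (rule antiderivative[OF R qp])
 have lin: "linear (%x. (q' <.> x) *R q)"
  by (rule linearI) (auto simp: inner_add_right scaleR_left_distrib)
 let ?b = "a - (q' <.> a) *R q"
 \<comment> \<open>\<open>H\<close> evaluated at the \<open>q\<close> coordinate only: constant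
   along \<open>p\<close>, so that adding it leaves the derivative along \<open>p\<close>
   intact.\<close>
 define H0 where "H0 x = H (?b + (q' <.> x) *R q)" for x
 have H0: "polyi UNIV (Suc k) H0"
  unfolding H0_def[abs_def] by (rule polyi_compose_affine[OF H(1) subspace_UNIV lin])
 have dH: "dd v H0 x = dd ((q' <.> v) *R q) H (?b + (q' <.> x) *R q)" for v x
  unfolding H0_def[abs_def] by (rule dd_compose_affine[OF polyi_smooth[OF H(1)] lin])
 note sm = polyi_smooth[OF A(1)] polyi_smooth[OF H0] polyi_smooth[OF H(1)] polyi_smooth[OF R] polyi_smooth[OF Q]
 have Rp: "dd p R (a + t *R p + u *R q) = 0" for t u
  using sm curl[of t u] unfolding R_def[abs_def]
  by (simp add: dd_diff dd_commute[of A p q] A(2))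
 have Rt: "R (a + t *R p + u *R q) = R (a + u *R q)" for t u
 proof -
  have "DERIV (%t. R ((a + u *R q) + t *R p)) t :> dd p R ((a + u *R q) + t *R p)" for t
   unfolding has_real_derivative_iff_has_vector_derivative by (rule smooth_has_vector_derivative[OF sm(4)])
  moreover have "dd p R ((a + u *R q) + t *R p) = 0" for t
   using Rp[of t u] by (simp add: add.assoc add.commute[of "u *R q"])
  ultimately have "\<forall>t. DERIV (%t. R ((a + u *R q) + t *R p)) t :> 0" by simp
  from DERIV_isconst_all[OF this, of t 0]
  have "R ((a + u *R q) + t *R p) = R ((a + u *R q) + 0 *R p)" .
  then show ?thesis by (simp add: add.assoc add.commute[of "u *R q"])
 qed
 show thesis
 proof (rule that)
  show "polyi UNIV (Suc k) (%x. A x + H0 x)" by (intro polyi.add A H0)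
  show "dd p (%x. A x + H0 x) (a + t *R p + u *R q) = P (a + t *R p + u *R q)" for t u
   using sm by (simp add: dd_add A(2) dH d dd_dir_0)
  show "dd q (%x. A x + H0 x) (a + t *R p + u *R q) = Q (a + t *R p + u *R q)" for t u
  proof -
   let ?x = "a + t *R p + u *R q"
   have "?b + (q' <.> ?x) *R q = a + u *R q"
    by (simp add: inner_add_right d scaleR_left_distrib)
   then have "dd q H0 ?x = R (a + u *R q)" by (simp only: dH d scaleR_one H(2))
   also have "\<dots> = Q ?x - dd q A ?x" unfolding Rt[of t u, symmetric] by (simp only: R_def)
   finally show ?thesis using sm by (simp add: dd_add)
  qed
 qed
qed

section \<open>Strains: degrees of freedom of \<open>\<epsilon>(w)\<close>\<close>

lemma M1_parts:
 assumes "smooth f" "smooth g"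
 shows "M1 a b (%x. f x * dd (b - a) g x) = f b * g b - f a * g a - M1 a b (%x. dd (b - a) f x * g x)"
proof -
 have "M1 a b (%x. f x * dd (b - a) g x) + M1 a b (%x. dd (b - a) f x * g x) = M1 a b (dd (b - a) (%x. f x * g x))"
  using assms by (subst M1_add[symmetric]) (auto simp: dd_mult intro!: smooth_cont)
 then show ?thesis using M1_FTC[of "%x. f x * g x" a b] assms by simp
qed

lemma M2_parts:
 assumes "smooth f" "smooth g"
 shows "M2 a b c (%x. f x * dd (c - a) g x) = M1 b c (%x. f x * g x) - M1 a b (%x. f x * g x) - M2 a b c (%x. dd (c - a) f x * g x)"
  and "M2 a b c (%x. f x * dd (b - a) g x) = M1 b c (%x. f x * g x) - M1 a c (%x. f x * g x) - M2 a b c (%x. dd (b - a) f x * g x)"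
proof -
 have *: "M2 a b c (%x. f x * dd v g x) + M2 a b c (%x. dd v f x * g x) = M2 a b c (dd v (%x. f x * g x))" for v
  using assms by (subst M2_add[symmetric]) (auto simp: dd_mult intro!: smooth_cont)
 have s: "smooth (%x. f x * g x)" using assms by auto
 show "M2 a b c (%x. f x * dd (c - a) g x) = M1 b c (%x. f x * g x) - M1 a b (%x. f x * g x) - M2 a b c (%x. dd (c - a) f x * g x)"
  using *[of "c - a"] M2_FTC[OF s, of a b c] by simp
 show "M2 a b c (%x. f x * dd (b - a) g x) = M1 b c (%x. f x * g x) - M1 a c (%x. f x * g x) - M2 a b c (%x. dd (b - a) f x * g x)"
  using *[of "b - a"] M2_FTC'[OF s, of a b c] by simp
qed

lemma subspace_range_mv: "subspace (range ((*v) (A :: mat3)))"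
 by (rule linear_subspace_image[OF matrix_vector_mul_linear subspace_UNIV])

lemma polyi_scaleR_const:
 assumes "polyi UNIV k (f :: vec3 => real)" "c : X" "subspace X"
 shows "polyi X k (%x. f x *R c)"
 using polyi_scalar_mult[OF assms(1) polyi.const[OF assms(2)] assms(3)] by simp

lemma inner_expand: "x <.> y = (\<Sum>i\<in>UNIV. y $ i * (axis i 1 <.> x))" for x y :: vec3
 unfolding inner_vec_def[of x y] by (simp add: inner_axis' mult.commute)

lemma M1_sum: "finite I ==> (!!i. i : I ==> cont (f i)) ==> M1 a b (%x. \<Sum>i\<in>I. f i x) = (\<Sum>i\<in>I. M1 a b (f i))"
 unfolding M1_def by (intro integral_sum integrable_line)

lemma M2_sum: "finite I ==> (!!i. i : I ==> cont (f i)) ==> M2 a b c (%x. \<Sum>i\<in>I. f i x) = (\<Sum>i\<in>I. M2 a b c (f i))"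
proof (induction I rule: finite_induct)
 case empty
 then show ?case by (simp add: M2_def)
next
 case (insert i I)
 then show ?case by (simp add: M2_add continuous_intros)
qed

lemma W_vdofs_0:
 assumes "\<forall>d\<in>W_vdofs x. d u = 0" "smooth u"
 shows "u x = 0" "dd v u x = 0"
proof -
 show "u x = 0" using assms(1) by (force simp: W_vdofs_def vec_eq_iff)
 have "pd j u x = 0" for j using assms(1) by (force simp: W_vdofs_def vec_eq_iff)
 then show "dd v u x = 0" using assms(2) by (simp add: dd_eq_sum_pd[of u v])
qed

lemma eps_vdofs:
 assumes u: "smooth u" and "\<forall>d\<in>W_vdofs x. d u = 0"
 shows "\<forall>d\<in>Th_vdofs x. d (eps u) = 0"
proof -
 have "eps u x = 0"
  by (rule mat_eqI) (simp add: eps_form[OF u] W_vdofs_0[OF assms(2,1)])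
 then show ?thesis by (auto simp: Th_vdofs_def ccs_eps[OF u])
qed

lemma W_edofs_0:
 assumes "\<forall>d\<in>W_edofs (seg a b). d u = 0" "a ~= b" "polyi UNIV 3 \<psi>"
 shows "M1 a b (%x. \<psi> x * (w <.> u x)) = 0"
proof -
 have "(%x. \<psi> x *R w) : polys 3 UNIV"
  using polyi_scaleR_const[OF assms(3), of w UNIV] by (simp add: polys_iff)
 then have "(%u. edge_int (seg a b) (%x. u x <.> (\<psi> x *R w))) : W_edofs (seg a b)"
  unfolding W_edofs_def by (intro CollectI exI[of _ "%x. \<psi> x *R w"]) simp
 with assms(1) have "edge_int (seg a b) (%x. u x <.> (\<psi> x *R w)) = 0"
  by (rule bspec)
 then show ?thesis using assms(2) by (simp add: edge_int_eq inner_commute)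
qed

text \<open>The boundary terms vanish at the vertices, and integration by parts differentiates the
  weight: once from degree 4, or twice from degree 5, to degree 3, which is the degree of the
  weights in \<open>W_edofs\<close>.\<close>

lemma eps_edofs:
 assumes u: "smooth u" and ab: "a ~= b" and s: "unit_tangent (seg a b) s"
  and va: "\<forall>d\<in>W_vdofs a. d u = 0" and vb: "\<forall>d\<in>W_vdofs b. d u = 0"
  and e: "\<forall>d\<in>W_edofs (seg a b). d u = 0"
 shows "\<forall>d\<in>Th_edofs (%_. s) (%_. \<mu>) (%_. \<nu>) (seg a b). d (eps u) = 0"
proof -
 let ?e = "seg a b"
 obtain \<kappa> where \<kappa>: "s = \<kappa> *R (b - a)" "\<kappa> ~= 0" by (rule unit_tangent_seg[OF s ab])
 define p where "p = b - a"
 have sp: "s = \<kappa> *R p" by (simp add: \<kappa> p_def)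
 note A = W_vdofs_0[OF va u] and B = W_vdofs_0[OF vb u]
 have "M1 a b (%x. v x * dd s (%x. s <.> u x) x) = 0" if "polyi UNIV 4 v" for v
 proof -
  have "polyi UNIV 3 (dd p v)" using polyi_dd[OF that, of p] by simp
  from W_edofs_0[OF e ab this, of s]
  have "M1 a b (%x. v x * dd p (%x. s <.> u x) x) = 0"
   unfolding p_def using M1_parts[of v "%x. s <.> u x" a b] u A B polyi_smooth[OF that] by simp
  then have "\<kappa> * M1 a b (%x. v x * dd p (%x. s <.> u x) x) = 0" by simp
  then show ?thesis
   unfolding M1_cmult[symmetric] sp using u by (simp add: dd_dir_scaleR mult_ac)
 qed
 note moment = this
 have eq: "s <.> (eps u x *v s) * v x = v x * dd s (%x. s <.> u x) x" for v x
  unfolding eps_form[OF u] using u by (simp add: dd_cinner)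
 have 1: "edge_int ?e (%x. (s <.> (eps u x *v s)) * v x) = 0" if "v : polys 4 UNIV" for v
  unfolding edge_int_eq eq using moment that by (simp add: polys_iff)
 have *: "M1 a b (%x. \<psi> x * dd s (dd s (%z. w <.> u z)) x) = 0" if \<psi>: "polyi UNIV 5 \<psi>" for \<psi> w
 proof -
  have d1: "polyi UNIV 4 (dd p \<psi>)" using polyi_dd[OF \<psi>, of p] by simp
  have d2: "polyi UNIV 3 (dd p (dd p \<psi>))" using polyi_dd[OF d1, of p] by simp
  note sm = polyi_smooth[OF \<psi>]
  have "M1 a b (%x. \<psi> x * dd p (dd p (%z. w <.> u z)) x) = 0"
   using M1_parts[of \<psi> "dd p (%z. w <.> u z)" a b] M1_parts[of "dd p \<psi>" "%z. w <.> u z" a b]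
    W_edofs_0[OF e ab d2, of w] u A B sm
   by (simp add: p_def[symmetric] dd_cinner)
  then have "\<kappa> * \<kappa> * M1 a b (%x. \<psi> x * dd p (dd p (%z. w <.> u z)) x) = 0" by simp
  then show ?thesis
   unfolding M1_cmult[symmetric] sp using u by (simp add: dd_dir_scaleR dd_cmult mult_ac)
 qed
 have 2: "edge_int ?e (%x. Gam s (eps u) x <.> v x) = 0" if v: "v : polys 5 (range ((*v) (Qp s)))" for v
 proof -
  have pv: "polyi UNIV 5 v"
   using v polyi_subset[OF _ subset_UNIV] by (simp add: polys_iff[OF subspace_range_mv])
  have "Gam s (eps u) x <.> v x = (\<Sum>i\<in>UNIV. v x $ i * dd s (dd s (%z. (Qp s *v axis i 1) <.> u z)) x)" for x
   by (subst inner_expand) (simp add: Gam_eps[OF u])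
  then have "M1 a b (%x. Gam s (eps u) x <.> v x) = (\<Sum>i\<in>UNIV. M1 a b (%x. v x $ i * dd s (dd s (%z. (Qp s *v axis i 1) <.> u z)) x))"
   using u polyi_smooth[OF pv] by (simp only:) (intro M1_sum smooth_cont; auto)
  also have "\<dots> = 0" using * polyi_nth[OF pv] by (intro sum.neutral) auto
  finally show ?thesis by (simp add: edge_int_eq)
 qed
 have 3: "edge_int ?e (%x. (Qp s ** ccs (eps u) x) <.> W x) = 0" for W
  by (simp add: ccs_eps[OF u] edge_int_eq M1_def)
 \<comment> \<open>Here \<open>h\<close> is a component of the curl of \<open>u\<close>, and
   \<open>rot_perp\<close> is half its derivative along the edge; the integral is a difference of
   vertex values.\<close>
 have 4: "edge_int ?e (rot_perp s \<mu> \<nu> (eps u)) = 0"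
 proof -
  define h where "h z = dd \<mu> (%z. \<nu> <.> u z) z - dd \<nu> (%z. \<mu> <.> u z) z" for z
  have h: "smooth h" "h a = 0" "h b = 0"
   unfolding h_def[abs_def] using u A B by (auto simp: dd_cinner)
  have "rot_perp s \<mu> \<nu> (eps u) = (%z. (1/2) * (\<kappa> * dd (b - a) h z))"
   using h by (simp add: rot_perp_eps[OF u] fun_eq_iff h_def[symmetric] \<kappa> dd_dir_scaleR)
  then show ?thesis
   using M1_FTC[OF h(1), of a b] h by (simp only: edge_int_eq M1_cmult) simp
 qed
 show ?thesis using 1 2 3 4 unfolding Th_edofs_def by blast
qed

lemma tangential_span:
 assumes N: "cross3 p q ~= 0" and n: "norm n = 1" "n <.> p = 0" "n <.> q = 0" "n <.> y = 0"
 obtains \<alpha> \<beta> where "y = \<alpha> *R p + \<beta> *R q"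
proof -
 let ?N = "cross3 p q"
 have NN: "?N <.> ?N ~= 0" using N by simp
 have "?N <.> y = 0" using unit_normal_cross(1)[OF n(1-3)] n(4) by (metis inner_scaleR_left mult_zero_right)
 then have "(?N <.> ?N) *R y = cross3 ?N (cross3 y ?N)" by (simp only: Lagrange[of ?N y ?N]) simp
 also have "cross3 y ?N = (y <.> q) *R p - (y <.> p) *R q" by (simp add: Lagrange)
 also have "cross3 ?N ((y <.> q) *R p - (y <.> p) *R q) =
   ((y <.> p) * (q <.> q) - (y <.> q) * (p <.> q)) *R p + ((y <.> q) * (p <.> p) - (y <.> p) * (q <.> p)) *R q"
  by (simp add: cross_skew[of ?N] Lagrange cross_mult_right Cross3.right_diff_distrib inner_diff_right algebra_simps)
 finally have *: "(?N <.> ?N) *R y = \<dots>" .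
 have "y = (1 / (?N <.> ?N)) *R ((?N <.> ?N) *R y)" using NN by simp
 then show thesis unfolding * scaleR_add_right scaleR_scaleR by (rule that)
qed

lemma tangential_edge:
 assumes T: "triv f a b c" and n: "unit_normal f n" and y: "n <.> y = 0"
 obtains \<gamma> \<delta> where "y = \<gamma> *R (b - a) + \<delta> *R conormal f (seg a b)"
proof -
 note m = conormal_triv[OF T] and n' = unit_normal_triv[OF T n]
 obtain \<alpha> \<beta> where ab: "conormal f (seg a b) = \<alpha> *R (b - a) + \<beta> *R (c - a)" using m(4) by blast
 have "\<beta> ~= 0"
 proof
  assume "\<beta> = 0"
  then have "conormal f (seg a b) <.> conormal f (seg a b) = 0" using ab m(2)
   by (metis add.right_neutral inner_scaleR_right mult_zero_right scaleR_zero_left)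
  then show False using m(1) by simp
 qed
 obtain x z where "y = x *R (b - a) + z *R (c - a)"
  by (rule tangential_span[OF triv_cross[OF T] n' y])
 then have "y = (x - z / \<beta> * \<alpha>) *R (b - a) + (z / \<beta>) *R conormal f (seg a b)"
  unfolding ab using \<open>\<beta> ~= 0\<close> by (simp add: algebra_simps)
 then show thesis by (rule that)
qed

lemma conormal_orth_normal:
 assumes T: "triv f a b c" and n: "unit_normal f n"
 shows "n <.> conormal f (seg a b) = 0"
 using conormal_triv(4)[OF T] unit_normal_triv[OF T n] by (auto simp: inner_add_right)

lemma face_edges_labelled:
 assumes "triv f a b c"
 shows "!!P. (!!a b c. triv f a b c ==> P a b) ==> P a b & P b c & P a c"
 using assms triv_swaps[OF assms] by blast

text \<open>Two of the four families of moments are degrees of freedom of \<open>u\<close> after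
  \<open>eps_f_Qp\<close> and \<open>Lam_eps\<close>. The edge moments and face means reduce to the
  mean of the conormal derivative of the normal component on each edge.\<close>

lemma eps_fdofs:
 assumes u: "smooth u" and T: "triv f a b c" and n: "unit_normal f n"
  and s: "!!e. e : edges f ==> unit_tangent e (s e)"
  and v: "!!x. x : verts f ==> \<forall>d\<in>W_vdofs x. d u = 0"
  and d: "\<forall>d\<in>W_fdofs (%_. n) f. d u = 0"
 shows "\<forall>d\<in>Th_fdofs (%_. n) s f. d (eps u) = 0"
proof -
 let ?\<phi> = "%y. n <.> u y"
 have \<phi>: "smooth ?\<phi>" using u by auto
 have n1: "norm n = 1" using n by (simp add: unit_normal_def)
 have 1: "face_int f (%x. (Qp n ** eps u x ** Qp n) <.> eps_f n v x) = 0"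
  if "v : bubble_polys f 4 (range ((*v) (Qp n)))" for v
  unfolding eps_f_Qp[OF u n1]
 proof (rule bspec[OF d])
  show "(%w. face_int f (%x. eps_f n (%y. Qp n *v w y) x <.> eps_f n v x)) : W_fdofs (%_. n) f"
   unfolding W_fdofs_def by (rule UnI1, rule UnI1, rule CollectI, rule exI[of _ v]) (simp add: that)
 qed
 have m: "M1 a b (dd (conormal f (seg a b)) ?\<phi>) = 0" if T: "triv f a b c" for a b c
 proof -
  have "edge_int (seg a b) (dd (conormal f (seg a b)) ?\<phi>) = 0"
  proof (rule bspec[OF d])
   show "(%w. edge_int (seg a b) (dd (conormal f (seg a b)) (%y. n <.> w y))) : W_fdofs (%_. n) f"
    unfolding W_fdofs_def
    by (rule UnI1, rule UnI2, rule CollectI, rule exI[of _ "seg a b"]) (simp add: triv_edge[OF T])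
  qed
  then show ?thesis using triv_distinct[OF T] by (simp add: edge_int_eq)
 qed
 have vx: "!!v. dd v u a = 0 & dd v u b = 0" "u a = 0 & u b = 0" if T: "triv f a b c" for a b c
 proof -
  have "a : verts f" "b : verts f" using triv_verts[OF T] by auto
  from W_vdofs_0[OF v[OF this(1)] u] W_vdofs_0[OF v[OF this(2)] u]
  show "!!v. dd v u a = 0 & dd v u b = 0" "u a = 0 & u b = 0" by auto
 qed
 have 2: "edge_int e (%x. (s e <.> (Lam n (eps u) x *v conormal f e)) * v x) = 0"
  if e: "e : edges f" and pv: "v : polys 1 UNIV" for e v
 proof -
  obtain a b c where T: "triv f a b c" and e': "e = seg a b"
   by (rule face_edge_cases[OF T e])
  let ?m = "conormal f e"
  obtain \<kappa> where \<kappa>: "s e = \<kappa> *R (b - a)"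
   using unit_tangent_seg[of a b "s e"] s[OF e] triv_distinct[OF T] e' by blast
  have Q: "Qp n *v s e = s e" "Qp n *v ?m = ?m"
   using unit_normal_triv[OF T n] conormal_orth_normal[OF T n] by (auto simp: Qp_fix \<kappa>[unfolded e'] e')
  have p1: "polyi UNIV 1 v" using pv by (simp add: polys_iff)
  \<comment> \<open>A weight of degree 1 has a constant derivative along the edge, so after
    integration by parts only the mean of the conormal derivative remains.\<close>
  have "polyi UNIV 0 (dd (b - a) v)" using polyi_dd[OF p1, of "b - a"] by simp
  then have "dd (b - a) v x = dd (b - a) v a" for x by (rule polyi_0_const)
  then obtain k where "dd (b - a) v = (%x. k)" by blast
  then have "M1 a b (%x. dd (b - a) v x * dd ?m ?\<phi> x) = k * M1 a b (dd ?m ?\<phi>)"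
   by (simp only: M1_cmult)
  then have "M1 a b (%x. v x * dd (b - a) (dd ?m ?\<phi>) x) = 0"
   using M1_parts[of v "dd ?m ?\<phi>" a b] \<phi> polyi_smooth[OF p1] m[OF T] vx[OF T] u e' by (simp add: dd_cinner)
  then have "M1 a b (%x. \<kappa> * (v x * dd (b - a) (dd ?m ?\<phi>) x)) = 0" by (simp add: M1_cmult)
  moreover have "(s e <.> (Lam n (eps u) x *v ?m)) * v x = \<kappa> * (v x * dd (b - a) (dd ?m ?\<phi>) x)" for x
   unfolding Lam_eps[OF u] hess_f_form[OF \<phi>] Q using \<phi> by (simp add: \<kappa> dd_dir_scaleR)
  ultimately show ?thesis by (simp only: e' edge_int_eq mult_zero_right)
 qed
 \<comment> \<open>A tangential derivative has a part along the edge, whose mean is a difference of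
   vertex values, and a conormal part, whose mean is a degree of freedom.\<close>
 have t: "M1 a b (dd y ?\<phi>) = 0" if T: "triv f a b c" and y: "n <.> y = 0" for a b c y
 proof -
  obtain \<gamma> \<delta> where y: "y = \<gamma> *R (b - a) + \<delta> *R conormal f (seg a b)"
   by (rule tangential_edge[OF T n y])
  then have "dd y ?\<phi> = (%x. \<gamma> * dd (b - a) ?\<phi> x + \<delta> * dd (conormal f (seg a b)) ?\<phi> x)"
   using \<phi> by (simp add: dd_dir_add dd_dir_scaleR)
  then have "M1 a b (dd y ?\<phi>) = \<gamma> * M1 a b (dd (b - a) ?\<phi>) + \<delta> * M1 a b (dd (conormal f (seg a b)) ?\<phi>)"
   using \<phi> by (simp add: M1_add M1_cmult smooth_cont continuous_intros)
  then show ?thesis using m[OF T] M1_FTC[OF \<phi>, of a b] vx[OF T] by simp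
 qed
 have 3: "face_int f (%x. Lam n (eps u) x $ i $ j) = 0" for i j
 proof -
  let ?x = "Qp n *v axis i 1" and ?y = "Qp n *v axis j 1"
  have Lij: "(%x. Lam n (eps u) x $ i $ j) = dd ?x (dd ?y ?\<phi>)"
   by (simp only: Lam_eps[OF u] form_axis[symmetric] hess_f_form[OF \<phi>])
  obtain \<alpha> \<beta> where x: "?x = \<alpha> *R (b - a) + \<beta> *R (c - a)"
   by (rule tangential_span[OF triv_cross[OF T] unit_normal_triv[OF T n] Qp_orth[OF n1]])
  define g where "g = dd ?y ?\<phi>"
  have g: "smooth g" using \<phi> by (simp add: g_def)
  have "dd ?x g = (%z. \<alpha> * dd (b - a) g z + \<beta> * dd (c - a) g z)"
   unfolding x using g by (simp add: dd_dir_add dd_dir_scaleR)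
  then have "M2 a b c (dd ?x g) = \<alpha> * (M1 b c g - M1 a c g) + \<beta> * (M1 b c g - M1 a b g)"
   using g by (simp add: M2_add M2_cmult M2_FTC M2_FTC' smooth_cont continuous_intros)
  moreover have "M1 a b g = 0 & M1 b c g = 0 & M1 a c g = 0"
   unfolding g_def using face_edges_labelled[OF T, of "%a b. M1 a b (dd ?y ?\<phi>) = 0"] t[OF _ Qp_orth[OF n1]] by blast
  ultimately have "M2 a b c (dd ?x g) = 0" by simp
  then show ?thesis
   unfolding Lij g_def[symmetric] using face_int_eq[OF T smooth_cont[OF smooth_dd[OF g]]] by simp
 qed
 have 4: "face_int f (%x. Lam n (eps u) x <.> hess_f n v x) = 0" if "v : Ef f" for v
  unfolding Lam_eps[OF u]
 proof (rule bspec[OF d])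
  show "(%w. face_int f (%x. hess_f n (%y. n <.> w y) x <.> hess_f n v x)) : W_fdofs (%_. n) f"
   unfolding W_fdofs_def by (rule UnI2, rule CollectI, rule exI[of _ v]) (simp add: that)
 qed
 show ?thesis using 1 2 3 4 unfolding Th_fdofs_def by auto
qed

lemma eps_kdofs:
 assumes u: "smooth u" and d: "\<forall>d\<in>W_kdofs K. d u = 0"
 shows "\<forall>d\<in>Th_kdofs n K. d (eps u) = 0"
proof -
 have "integral K (%x. ccs (eps u) x <.> T x) = 0" for T by (simp add: ccs_eps[OF u])
 with d show ?thesis by (auto simp: Th_kdofs_def W_kdofs_def)
qed

section \<open>Stresses: degrees of freedom of \<open>curl curl\<^sup>* S\<close>\<close>

definition outer :: "vec3 => vec3 => mat3" where
 "outer x y = (\<chi> i j. x $ i * y $ j)"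

lemma inner_outer: "A <.> outer x y = x <.> ((A :: mat3) *v y)"
 by (simp add: outer_def inner_vec_def matrix_vector_mult_def sum_3 algebra_simps)

lemma Qp_outer: "Qp n ** outer x y = outer (Qp n *v x) y"
 by (simp add: outer_def matrix_matrix_mult_def matrix_vector_mult_def vec_eq_iff sum_distrib_right mult.assoc)

lemma outer_Sym: "outer x y + outer y x : Sym"
 by (simp add: Sym_def outer_def transpose_def vec_eq_iff mult.commute)

lemma subspace_Qp_Sym: "subspace ((**) (Qp s) ` Sym)"
proof (rule linear_subspace_image[OF _ subspace_Sym])
 show "linear ((**) (Qp s))"
  by (rule linearI) (auto simp: matrix_matrix_mult_def vec_eq_iff sum.distrib algebra_simps sum_distrib_left)
qed

lemma Th_vdofs_0:
 assumes "\<forall>d\<in>Th_vdofs x. d S = 0"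
 shows "S x = 0" "ccs S x = 0" "bf S y z x = 0"
proof -
 have "(%S. S x $ i $ j) : Th_vdofs x" "(%S. ccs S x $ i $ j) : Th_vdofs x" for i j
  unfolding Th_vdofs_def by blast+
 with assms have "S x $ i $ j = 0" "ccs S x $ i $ j = 0" for i j by (metis (no_types, lifting))+
 then show "S x = 0" "ccs S x = 0" by (simp_all add: vec_eq_iff)
 then show "bf S y z x = 0" by (simp add: bf_def)
qed

text \<open>Only the frame at \<open>e\<close> enters, so a single edge can be treated with constant
  frame functions.\<close>

lemma Th_edofs_const: "Th_edofs s \<mu> \<nu> e = Th_edofs (%_. s e) (%_. \<mu> e) (%_. \<nu> e) e"
 by (simp add: Th_edofs_def)

section \<open>Strains with zero degrees of freedom on an edge\<close>

locale edge_dofs =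
 fixes S :: "vec3 => mat3" and a b s \<mu> \<nu> :: vec3
 assumes S: "smooth S" and symm: "!!x. S x : Sym" and ab: "a ~= b"
  and s: "unit_tangent (seg a b) s"
  and frame: "norm \<mu> = 1" "norm \<nu> = 1" "\<mu> <.> \<nu> = 0" "\<mu> <.> s = 0" "\<nu> <.> s = 0"
  and va: "\<forall>d\<in>Th_vdofs a. d S = 0" and vb: "\<forall>d\<in>Th_vdofs b. d S = 0"
  and ed: "\<forall>d\<in>Th_edofs (%_. s) (%_. \<mu>) (%_. \<nu>) (seg a b). d S = 0"
begin

text \<open>The edge vector takes the place of the unit tangent: the edge vectors of a triangle add
  up to zero, and results on its edges can then be combined without norms.\<close>

definition p where "p = b - a"

lemma scale: obtains \<kappa> where "s = \<kappa> *R p" "\<kappa> ~= 0" "norm s = 1"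
 using unit_tangent_seg[OF s ab] unfolding p_def by blast

lemma bf_comm: "bf S x y = bf S y x"
 using symm by (rule bf_Sym)

lemma E1:
 assumes \<psi>: "polyi UNIV 4 \<psi>" shows "M1 a b (%x. \<psi> x * bf S p p x) = 0"
proof -
 obtain \<kappa> where \<kappa>: "s = \<kappa> *R p" "\<kappa> ~= 0" by (rule scale)
 have "(%S. edge_int (seg a b) (%x. (s <.> (S x *v s)) * \<psi> x)) : Th_edofs (%_. s) (%_. \<mu>) (%_. \<nu>) (seg a b)"
  unfolding Th_edofs_def by (rule UnI1, rule UnI1, rule UnI1, rule CollectI, rule exI[of _ \<psi>]) (simp add: polys_iff \<psi>)
 with ed have "edge_int (seg a b) (%x. (s <.> (S x *v s)) * \<psi> x) = 0" by (rule bspec)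
 moreover have "(s <.> (S x *v s)) * \<psi> x = (\<kappa> * \<kappa>) * (\<psi> x * bf S p p x)" for x
  unfolding \<kappa> by (simp add: bf_def matrix_vector_mult_scaleR)
 ultimately show ?thesis using ab \<kappa> by (simp only: edge_int_eq M1_cmult) simp
qed

text \<open>For \<open>w\<close> along the edge the expression is a multiple of the derivative of
  \<open>bf S p p\<close>, whose moments of degree 5 reduce to \<open>E1\<close> by parts. With the
  degrees of freedom for normal \<open>w\<close> this covers all directions.\<close>

lemma E2:
 assumes \<psi>: "polyi UNIV 5 \<psi>"
 shows "M1 a b (%x. \<psi> x * (2 * dd p (bf S w p) x - dd w (bf S p p) x)) = 0"
proof -
 obtain \<kappa> where \<kappa>: "s = \<kappa> *R p" "\<kappa> ~= 0" and s1: "norm s = 1" by (rule scale)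
 let ?w = "Qp s *v w"
 have m: "(%x. \<psi> x *R ?w) : polys 5 (range ((*v) (Qp s)))"
  using polyi_scaleR_const[OF \<psi>, of ?w "range ((*v) (Qp s))"] subspace_range_mv
  by (simp add: polys_iff[OF subspace_range_mv])
 have "(%S. edge_int (seg a b) (%x. Gam s S x <.> (\<psi> x *R ?w))) : Th_edofs (%_. s) (%_. \<mu>) (%_. \<nu>) (seg a b)"
  unfolding Th_edofs_def by (rule UnI1, rule UnI1, rule UnI2, rule CollectI, rule exI[of _ "%x. \<psi> x *R ?w"]) (simp add: m)
 with ed have "edge_int (seg a b) (%x. Gam s S x <.> (\<psi> x *R ?w)) = 0" by (rule bspec)
 moreover have "Qp s *v ?w = ?w" using s1 by (simp add: Qp_fix Qp_orth)
 then have "(%x. Gam s S x <.> (\<psi> x *R ?w)) = (%x. \<psi> x * (2 * dd s (bf S ?w s) x - dd ?w (bf S s s) x))"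
  by (simp add: inner_commute[of "Gam s S _"] Gam_form[OF S])
 ultimately have "norm (b - a) * M1 a b (%x. \<psi> x * (2 * dd s (bf S ?w s) x - dd ?w (bf S s s) x)) = 0"
  by (simp only: edge_int_eq)
 then have 1: "M1 a b (%x. \<psi> x * (2 * dd s (bf S ?w s) x - dd ?w (bf S s s) x)) = 0"
  using ab by simp
 have d: "polyi UNIV 4 (dd p \<psi>)" using polyi_dd[OF \<psi>, of p] by simp
 have 2: "M1 a b (%x. \<psi> x * dd p (bf S p p) x) = 0"
  using M1_parts[of \<psi> "bf S p p" a b] E1[OF d] polyi_smooth[OF \<psi>] S Th_vdofs_0(3)[OF va] Th_vdofs_0(3)[OF vb]
  by (simp add: p_def)
 have w: "w = ?w + (s <.> w) *R s" by (simp add: Qp_vec)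
 have "(\<kappa> * \<kappa>) * (\<psi> x * (2 * dd p (bf S w p) x - dd w (bf S p p) x)) =
   \<psi> x * (2 * dd s (bf S ?w s) x - dd ?w (bf S s s) x) + ((s <.> w) * \<kappa> * \<kappa> * \<kappa>) * (\<psi> x * dd p (bf S p p) x)" for x
 proof -
  have "2 * dd s (bf S w s) x - dd w (bf S s s) x = 2 * dd s (bf S ?w s) x - dd ?w (bf S s s) x + (s <.> w) * dd s (bf S s s) x"
   by (subst (1 2) w) (simp add: bf_lin dd_add dd_cmult dd_dir_add dd_dir_scaleR S algebra_simps)
  moreover have "2 * dd s (bf S w s) x - dd w (bf S s s) x = (\<kappa> * \<kappa>) * (2 * dd p (bf S w p) x - dd w (bf S p p) x)"
   by (simp add: \<kappa>(1) bf_lin dd_cmult dd_dir_scaleR S algebra_simps)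
  moreover have "dd s (bf S s s) x = \<kappa> * \<kappa> * \<kappa> * dd p (bf S p p) x"
   by (simp add: \<kappa>(1) bf_lin dd_cmult dd_dir_scaleR S)
  ultimately have "(\<kappa> * \<kappa>) * (2 * dd p (bf S w p) x - dd w (bf S p p) x) =
    2 * dd s (bf S ?w s) x - dd ?w (bf S s s) x + (s <.> w) * (\<kappa> * \<kappa> * \<kappa> * dd p (bf S p p) x)"
   by (simp only:)
  from arg_cong[OF this, of "%z. \<psi> x * z"] show ?thesis
   by (simp only: distrib_left mult_ac)
 qed
 moreover have "smooth \<psi>" using polyi_smooth[OF \<psi>] .
 ultimately have "(\<kappa> * \<kappa>) * M1 a b (%x. \<psi> x * (2 * dd p (bf S w p) x - dd w (bf S p p) x)) =
  M1 a b (%x. \<psi> x * (2 * dd s (bf S ?w s) x - dd ?w (bf S s s) x)) + ((s <.> w) * \<kappa> * \<kappa> * \<kappa>) * M1 a b (%x. \<psi> x * dd p (bf S p p) x)"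
  unfolding M1_cmult[symmetric] using S by (subst M1_add[symmetric]) (auto intro!: smooth_cont)
 then show ?thesis using 1 2 \<kappa> by simp
qed

lemma perp_span:
 assumes "m <.> p = 0" obtains \<alpha> \<beta> where "m = \<alpha> *R \<mu> + \<beta> *R \<nu>"
proof -
 obtain \<kappa> where \<kappa>: "s = \<kappa> *R p" "\<kappa> ~= 0" and s1: "norm s = 1" by (rule scale)
 have "cross3 \<mu> \<nu> ~= 0"
  using norm_cross_dot[of \<mu> \<nu>] frame by auto
 moreover have "s <.> m = 0" using assms by (simp add: \<kappa> inner_commute)
 ultimately show thesis
  using tangential_span[of \<mu> \<nu> s m] s1 frame(4,5) that by (metis inner_commute)
qed

text \<open>The expression is bilinear and antisymmetric in \<open>m\<close>, \<open>n\<close>,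
  hence a determinant times its value for the basis \<open>\<mu>\<close>,
  \<open>\<nu>\<close>.\<close>

lemma E3:
 assumes "m <.> p = 0" "n <.> p = 0"
 shows "M1 a b (%x. dd m (bf S p n) x - dd n (bf S p m) x) = 0"
proof -
 obtain \<kappa> where \<kappa>: "s = \<kappa> *R p" "\<kappa> ~= 0" by (rule scale)
 obtain \<alpha> \<beta> where m: "m = \<alpha> *R \<mu> + \<beta> *R \<nu>" by (rule perp_span[OF assms(1)])
 obtain \<gamma> \<delta> where n: "n = \<gamma> *R \<mu> + \<delta> *R \<nu>" by (rule perp_span[OF assms(2)])
 have "(%S. edge_int (seg a b) (rot_perp s \<mu> \<nu> S)) : Th_edofs (%_. s) (%_. \<mu>) (%_. \<nu>) (seg a b)"
  unfolding Th_edofs_def by (rule UnI2) simp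
 with ed have "edge_int (seg a b) (rot_perp s \<mu> \<nu> S) = 0" by (rule bspec)
 then have 1: "M1 a b (rot_perp s \<mu> \<nu> S) = 0" using ab by (simp add: edge_int_eq)
 have "\<kappa> * (dd m (bf S p n) x - dd n (bf S p m) x) = (\<alpha> * \<delta> - \<beta> * \<gamma>) * rot_perp s \<mu> \<nu> S x" for x
  unfolding rot_perp_bf m n \<kappa>(1)
  by (simp add: bf_lin dd_add dd_cmult dd_dir_add dd_dir_scaleR S algebra_simps)
 then have "\<kappa> * M1 a b (%x. dd m (bf S p n) x - dd n (bf S p m) x) = (\<alpha> * \<delta> - \<beta> * \<gamma>) * M1 a b (rot_perp s \<mu> \<nu> S)"
  by (simp only: M1_cmult[symmetric])
 then show ?thesis using 1 \<kappa>(2) by simp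
qed

lemma E4:
 assumes "polyi UNIV 2 v" and w: "w <.> p = 0"
 shows "M1 a b (%x. bf (ccs S) y w x * v x) = 0"
proof -
 obtain \<kappa> where \<kappa>: "s = \<kappa> *R p" "\<kappa> ~= 0" and s1: "norm s = 1" by (rule scale)
 have sw: "s <.> w = 0" using w by (simp add: \<kappa> inner_commute)
 have QT: "(Qp s ** T) <.> (Qp s ** (outer x z + outer z x)) = (Qp s *v x) <.> (T *v z) + (Qp s *v z) <.> (T *v x)" for T x z
 proof -
  have "Qp s *v (Qp s *v x) = Qp s *v x" for x using s1 by (simp add: Qp_fix Qp_orth)
  then show ?thesis
   by (simp add: matrix_add_ldistrib Qp_outer inner_add_right inner_outer matrix_vector_mul_assoc[symmetric] Qp_form)
 qed
 \<comment> \<open>The weight \<open>y w' + w y'\<close> produces two forms. For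
   \<open>y = s\<close> the first one drops out, and for \<open>y\<close> normal to the edge the two
   agree by symmetry.\<close>
 have *: "M1 a b (%x. ((Qp s *v y) <.> (ccs S x *v w) + w <.> (ccs S x *v y)) * v x) = 0" for y
 proof -
  let ?M = "outer y w + outer w y"
  have W: "(%x. v x *R (Qp s ** ?M)) : polys 2 ((**) (Qp s) ` Sym)"
   using polyi_scaleR_const[OF assms(1), of "Qp s ** ?M" "(**) (Qp s) ` Sym"] outer_Sym[of y w] subspace_Qp_Sym
   by (simp add: polys_iff[OF subspace_Qp_Sym])
  have "(%S. edge_int (seg a b) (%x. (Qp s ** ccs S x) <.> (v x *R (Qp s ** ?M)))) : Th_edofs (%_. s) (%_. \<mu>) (%_. \<nu>) (seg a b)"
   unfolding Th_edofs_def by (rule UnI1, rule UnI2, rule CollectI, rule exI[of _ "%x. v x *R (Qp s ** ?M)"]) (simp add: W)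
  with ed have "edge_int (seg a b) (%x. (Qp s ** ccs S x) <.> (v x *R (Qp s ** ?M))) = 0" by (rule bspec)
  moreover have "(%x. (Qp s ** ccs S x) <.> (v x *R (Qp s ** ?M))) = (%x. ((Qp s *v y) <.> (ccs S x *v w) + w <.> (ccs S x *v y)) * v x)"
   using sw by (simp only: inner_scaleR_right QT Qp_fix mult.commute)
  ultimately have "norm (b - a) * M1 a b (%x. ((Qp s *v y) <.> (ccs S x *v w) + w <.> (ccs S x *v y)) * v x) = 0"
   by (simp only: edge_int_eq)
  then show ?thesis using ab by simp
 qed
 have c: "x <.> (ccs S z *v y) = y <.> (ccs S z *v x)" for x y z
  using ccs_Sym[OF S symm, of z] by (simp add: Sym_form)
 have "Qp s *v s = 0" using s1 by (simp add: Qp_vec dot_square_norm)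
 then have 1: "M1 a b (%x. bf (ccs S) s w x * v x) = 0"
  using *[of s] by (simp add: bf_def c[where x = w and y = s])
 have "Qp s *v (Qp s *v y) = Qp s *v y" using s1 by (simp add: Qp_fix Qp_orth)
 then have "M1 a b (%x. (2 * bf (ccs S) (Qp s *v y) w x) * v x) = 0"
  using *[of "Qp s *v y"] by (simp add: bf_def c[where x = w and y = "Qp s *v y"])
 then have 2: "M1 a b (%x. bf (ccs S) (Qp s *v y) w x * v x) = 0"
  by (simp add: M1_cmult mult.assoc)
 have "bf (ccs S) y w x * v x = bf (ccs S) (Qp s *v y) w x * v x + (s <.> y) * (bf (ccs S) s w x * v x)" for x
  by (simp add: bf_def Qp_vec inner_diff_left algebra_simps)
 moreover have "smooth v" using polyi_smooth[OF assms(1)] .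
 ultimately show ?thesis
  using 1 2 S by (simp add: M1_add M1_cmult smooth_cont continuous_intros)
qed

end

lemma ccs_vdofs:
 assumes "\<forall>d\<in>Th_vdofs x. d S = 0" shows "\<forall>d\<in>Sg_vdofs x. d (ccs S) = 0"
 using Th_vdofs_0(2)[OF assms] by (auto simp: Sg_vdofs_def)

lemma ccs_edofs:
 assumes "edge_dofs S a b (s e) \<mu> \<nu>" and e: "e = seg a b"
  and f: "nm e <.> s e = 0" "np e <.> s e = 0"
 shows "\<forall>d\<in>Sg_edofs s nm np e. d (ccs S) = 0"
proof -
 interpret edge_dofs S a b "s e" \<mu> \<nu> by fact
 obtain \<kappa> where \<kappa>: "s e = \<kappa> *R p" "\<kappa> ~= 0" by (rule scale)
 have "nm e <.> p = 0" "np e <.> p = 0" using f \<kappa> by auto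
 \<comment> \<open>In all five pairs of \<open>Sg_edofs\<close> the second vector is normal to the
   edge, as \<open>E4\<close> requires.\<close>
 then have "edge_int e (%x. (y <.> (ccs S x *v w)) * v x) = 0"
  if "w = nm e \<or> w = np e" "v : polys 2 UNIV" for y w v
  using that E4[of v w y] by (auto simp: polys_iff e edge_int_eq bf_def)
 then show ?thesis unfolding Sg_edofs_def by auto
qed

lemma Lam_bf:
 assumes "smooth S" "n <.> x = 0" "n <.> y = 0"
 shows "bf (Lam n S) x y = (%z. dd y (bf S x n) z + dd x (bf S y n) z - dd n (bf S x y) z)"
 using assms by (simp add: bf_def[of "Lam n S"] Lam_form Qp_fix)

lemma smooth_Lam: assumes "smooth S" shows "smooth (Lam n S)"
proof (rule smooth_mat)
 fix i j
 have "(%z. Lam n S z $ i $ j) = (%z. dd (Qp n *v axis j 1) (bf S (Qp n *v axis i 1) n) z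
  + dd (Qp n *v axis i 1) (bf S (Qp n *v axis j 1) n) z - dd n (bf S (Qp n *v axis i 1) (Qp n *v axis j 1)) z)"
  by (simp only: form_axis[symmetric] Lam_form[OF assms])
 then show "smooth (%z. Lam n S z $ i $ j)" using assms by (simp add: smooth_dd smooth_bf smooth_add smooth_diff)
qed

section \<open>Strains with zero degrees of freedom on a face\<close>

locale face_dofs =
 fixes S :: "vec3 => mat3" and f :: "vec3 set" and n :: vec3 and s \<mu> \<nu> :: "vec3 set => vec3"
 assumes S: "smooth S" and symm: "!!x. S x : Sym"
  and n: "unit_normal f n"
  and s: "!!e. e : edges f ==> unit_tangent e (s e)"
  and frame: "!!e. e : edges f ==> norm (\<mu> e) = 1 & norm (\<nu> e) = 1 & \<mu> e <.> \<nu> e = 0 & \<mu> e <.> s e = 0 & \<nu> e <.> s e = 0"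
  and vd: "!!x. x : verts f ==> \<forall>d\<in>Th_vdofs x. d S = 0"
  and ed: "!!e. e : edges f ==> \<forall>d\<in>Th_edofs s \<mu> \<nu> e. d S = 0"
  and fd: "\<forall>d\<in>Th_fdofs (%_. n) s f. d S = 0"
begin

lemma bf_comm: "bf S x y = bf S y x"
 using symm by (rule bf_Sym)

lemma edge: "triv f a b c ==> edge_dofs S a b (s (seg a b)) (\<mu> (seg a b)) (\<nu> (seg a b))"
proof -
 assume T: "triv f a b c"
 have e: "seg a b : edges f" by (rule triv_edge[OF T])
 have v: "a : verts f" "b : verts f" using triv_verts[OF T] by auto
 show ?thesis
  using ed[OF e] frame[OF e] s[OF e] vd[OF v(1)] vd[OF v(2)] triv_distinct(1)[OF T] S symm
  unfolding Th_edofs_const[of s] by unfold_locales blast+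
qed

text \<open>For the edge component of \<open>w\<close> the form is the expression of
  \<open>E2\<close> in direction \<open>n\<close>. For the conormal component, weights of mean zero
  are degrees of freedom, and the mean is a difference of vertex values plus a term covered by
  \<open>E3\<close>.\<close>

lemma Lam_edge:
 assumes T: "triv f a b c" and w: "n <.> w = 0" and \<psi>: "polyi UNIV 1 \<psi>"
 shows "M1 a b (%x. \<psi> x * bf (Lam n S) (b - a) w x) = 0"
proof -
 let ?e = "seg a b"
 interpret E: edge_dofs S a b "s ?e" "\<mu> ?e" "\<nu> ?e" by (rule edge[OF T])
 define m where "m = conormal f ?e"
 have sm: "smooth \<psi>" using \<psi> by (rule polyi_smooth)
 note L = smooth_bf[OF smooth_Lam[OF S]]
 note p = E.p_def
 have np: "n <.> E.p = 0" using unit_normal_triv[OF T n] by (simp add: p)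
 have nm: "n <.> m = 0" unfolding m_def by (rule conormal_orth_normal[OF T n])
 have mp: "m <.> E.p = 0" unfolding m_def p by (rule conormal_triv(2)[OF T])
 obtain \<gamma> \<delta> where w': "w = \<gamma> *R E.p + \<delta> *R m"
  unfolding m_def p by (rule tangential_edge[OF T n w])
 have 1: "M1 a b (%x. \<psi> x * bf (Lam n S) E.p E.p x) = 0"
 proof -
  have "bf (Lam n S) E.p E.p x = 2 * dd E.p (bf S n E.p) x - dd n (bf S E.p E.p) x" for x
   by (simp add: Lam_bf[OF S np np] bf_comm[of n])
  then show ?thesis using E.E2[OF polyi_mono[OF _ \<psi>], of n] by simp
 qed
 have 2: "M1 a b (bf (Lam n S) E.p m) = 0"
 proof -
  have "bf (Lam n S) E.p m = (%x. dd E.p (bf S m n) x + (dd m (bf S E.p n) x - dd n (bf S E.p m) x))"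
   by (simp add: Lam_bf[OF S np nm] fun_eq_iff)
  moreover have "M1 a b (dd E.p (bf S m n)) = 0"
   unfolding p using M1_FTC[of "bf S m n" a b] S Th_vdofs_0(3)[OF E.va] Th_vdofs_0(3)[OF E.vb] by simp
  ultimately show ?thesis
   using E.E3[of m n] mp np S by (simp add: M1_add smooth_cont inner_commute)
 qed
 have 3: "M1 a b (%x. \<psi> x * bf (Lam n S) E.p m x) = 0"
 proof -
  obtain \<kappa> where \<kappa>: "s ?e = \<kappa> *R E.p" "\<kappa> ~= 0" by (rule E.scale)
  \<comment> \<open>Removing the mean makes the weight admissible; \<open>M1\<close> of a constant
    is that constant, and the removed part is covered by the mean value above.\<close>
  define v where "v x = \<psi> x - M1 a b \<psi>" for x
  have "polyi UNIV 1 v" unfolding v_def[abs_def] by (intro polyi_diff \<psi> polyi_const) auto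
  moreover have "M1 a b v = 0"
   unfolding v_def[abs_def] using sm by (subst M1_diff) (auto simp: smooth_cont M1_def)
  ultimately have v: "v : polys 1 UNIV" "edge_int ?e v = 0"
   by (simp_all only: polys_iff[OF subspace_UNIV] edge_int_eq mult_zero_right)
  have "(%S. edge_int ?e (%x. (s ?e <.> (Lam n S x *v conormal f ?e)) * v x)) : Th_fdofs (%_. n) s f"
   unfolding Th_fdofs_def by (rule UnI1, rule UnI1, rule UnI2, rule CollectI, rule exI[of _ ?e], rule exI[of _ v])
    (simp only: v triv_edge[OF T] simp_thms)
  with fd have "edge_int ?e (%x. (s ?e <.> (Lam n S x *v m)) * v x) = 0" unfolding m_def by (rule bspec)
  moreover have "(s ?e <.> (Lam n S x *v m)) * v x = \<kappa> * (v x * bf (Lam n S) E.p m x)" for x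
   by (simp add: \<kappa>(1) bf_def)
  ultimately have "M1 a b (%x. v x * bf (Lam n S) E.p m x) = 0"
   using E.ab \<kappa>(2) by (simp add: edge_int_eq M1_cmult)
  moreover have "v x * bf (Lam n S) E.p m x = \<psi> x * bf (Lam n S) E.p m x - M1 a b \<psi> * bf (Lam n S) E.p m x" for x
   by (simp add: v_def left_diff_distrib)
  ultimately show ?thesis
   using 2 sm L by (simp add: M1_diff M1_cmult smooth_cont continuous_intros)
 qed
 have "\<psi> x * bf (Lam n S) (b - a) w x = \<gamma> * (\<psi> x * bf (Lam n S) E.p E.p x) + \<delta> * (\<psi> x * bf (Lam n S) E.p m x)" for x
  by (simp add: p[symmetric] w' bf_lin algebra_simps)
 then show ?thesis
  using 1 3 sm L by (simp add: M1_add M1_cmult smooth_cont continuous_intros)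
qed

lemma Lam_mean:
 assumes T: "triv f a b c" shows "M2 a b c (bf (Lam n S) x y) = 0"
proof -
 note L = smooth_Lam[OF S, of n]
 have 1: "M2 a b c (%z. Lam n S z $ i $ j) = 0" for i j
 proof -
  have "(%S. face_int f (%x. Lam n S x $ i $ j)) : Th_fdofs (%_. n) s f"
   unfolding Th_fdofs_def by blast
  with fd have "face_int f (%x. Lam n S x $ i $ j) = 0" by (rule bspec)
  then show ?thesis
   using face_int_eq[OF T, of "%x. Lam n S x $ i $ j"] L triv_cross[OF T] by (simp add: smooth_cont)
 qed
 have "bf (Lam n S) x y = (%z. \<Sum>i\<in>UNIV. \<Sum>j\<in>UNIV. (x $ i * y $ j) * Lam n S z $ i $ j)"
  by (simp add: bf_def inner_vec_def matrix_vector_mult_def fun_eq_iff sum_3 algebra_simps)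
 then have "M2 a b c (bf (Lam n S) x y) = (\<Sum>i\<in>UNIV. \<Sum>j\<in>UNIV. (x $ i * y $ j) * M2 a b c (%z. Lam n S z $ i $ j))"
  using L by (simp add: M2_sum M2_cmult smooth_cont continuous_intros continuous_on_sum)
 then show ?thesis by (simp add: 1)
qed

lemma poly1_dd: "polyi UNIV 1 (\<psi> :: vec3 => real) ==> dd v \<psi> = (%x. dd v \<psi> 0)"
 using polyi_0_const[of UNIV "dd v \<psi>"] polyi_dd[of UNIV 1 \<psi> v] by auto

text \<open>\<open>ccs_tangential\<close> makes the integrand a surface curl of \<open>Lam\<close>.
  Integration by parts against a weight of degree 1 leaves means of \<open>Lam\<close> over the face
  and edge terms of the form treated in \<open>Lam_edge\<close>.\<close>

lemma tangential_moment:
 assumes T: "triv f a b c" and w: "n <.> w = 0" and \<psi>: "polyi UNIV 1 \<psi>"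
 shows "M2 a b c (%x. \<psi> x * bf (ccs S) (cross3 (b - a) (c - a)) (cross3 w n) x) = 0"
proof -
 note sm = polyi_smooth[OF \<psi>] smooth_bf[OF smooth_Lam[OF S]]
 note n' = unit_normal_triv[OF T n]
 define P Q where "P = bf (Lam n S) (b - a) w" and "Q = bf (Lam n S) (c - a) w"
 have PQ: "smooth P" "smooth Q" using sm by (simp_all add: P_def Q_def)
 have "bf (ccs S) (cross3 (b - a) (c - a)) (cross3 w n) x = dd (b - a) Q x - dd (c - a) P x" for x
  unfolding P_def Q_def by (rule ccs_tangential[OF S symm n'(2,3) w])
 then have "M2 a b c (%x. \<psi> x * bf (ccs S) (cross3 (b - a) (c - a)) (cross3 w n) x)
   = M2 a b c (%x. \<psi> x * dd (b - a) Q x) - M2 a b c (%x. \<psi> x * dd (c - a) P x)"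
  using sm PQ by (simp add: right_diff_distrib M2_diff smooth_cont)
 moreover have "M2 a b c (%x. dd v \<psi> x * P x) = 0" "M2 a b c (%x. dd v \<psi> x * Q x) = 0" for v
 proof -
  obtain k where "dd v \<psi> = (%x. k)" using poly1_dd[OF \<psi>, of v] by blast
  then show "M2 a b c (%x. dd v \<psi> x * P x) = 0" "M2 a b c (%x. dd v \<psi> x * Q x) = 0"
   unfolding P_def Q_def by (simp_all add: M2_cmult Lam_mean[OF T])
 qed
 moreover have "M1 a b (%x. \<psi> x * P x) = 0" unfolding P_def by (rule Lam_edge[OF T w \<psi>])
 moreover have "M1 a c (%x. \<psi> x * Q x) = 0" unfolding Q_def by (rule Lam_edge[OF triv_swaps(2)[OF T] w \<psi>])
 \<comment> \<open>On the third edge the two boundary terms combine to the form with first direction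
   \<open>c - b\<close>, the vector of that edge.\<close>
 moreover have "M1 b c (%x. \<psi> x * Q x) - M1 b c (%x. \<psi> x * P x) = 0"
 proof -
  have "M1 b c (%x. \<psi> x * Q x) - M1 b c (%x. \<psi> x * P x) = M1 b c (%x. \<psi> x * Q x - \<psi> x * P x)"
   using sm PQ by (subst M1_diff) (auto intro!: smooth_cont)
  also have "(%x. \<psi> x * Q x - \<psi> x * P x) = (%x. \<psi> x * bf (Lam n S) (c - b) w x)"
   by (simp add: P_def Q_def bf_lin algebra_simps)
  finally show ?thesis using Lam_edge[OF triv_swaps(3)[OF T] w \<psi>] by simp
 qed
 ultimately show ?thesis
  using M2_parts(2)[OF sm(1) PQ(2), of a b c] M2_parts(1)[OF sm(1) PQ(1), of a b c] by simp
qed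

text \<open>The doubly normal component is a second order expression in the tangential entries
  \<open>A\<close>, \<open>B\<close>, \<open>C\<close>. One integration by parts moves a derivative
  to the weight, and the means of \<open>g1\<close> and \<open>g2\<close> that appear are edge
  integrals again; \<open>E1\<close> and \<open>E2\<close> relate all of these.\<close>

lemma normal_moment:
 assumes T: "triv f a b c" and \<psi>: "polyi UNIV 1 \<psi>"
 shows "M2 a b c (%x. \<psi> x * bf (ccs S) (cross3 (b - a) (c - a)) (cross3 (b - a) (c - a)) x) = 0"
proof -
 define p q where "p = b - a" and "q = c - a"
 define A B C where "A = bf S p p" and "B = bf S p q" and "C = bf S q q"
 note sm = polyi_smooth[OF \<psi>]
 have sS: "smooth A" "smooth B" "smooth C" using S by (simp_all add: A_def B_def C_def)
 define cp cq where "cp = dd p \<psi> 0" and "cq = dd q \<psi> 0"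
 have dp: "dd p \<psi> = (%x. cp)" and dq: "dd q \<psi> = (%x. cq)"
  unfolding cp_def cq_def by (rule poly1_dd[OF \<psi>])+
 interpret Eab: edge_dofs S a b "s (seg a b)" "\<mu> (seg a b)" "\<nu> (seg a b)" by (rule edge[OF T])
 interpret Eac: edge_dofs S a c "s (seg a c)" "\<mu> (seg a c)" "\<nu> (seg a c)" by (rule edge[OF triv_swaps(2)[OF T]])
 interpret Ebc: edge_dofs S b c "s (seg b c)" "\<mu> (seg b c)" "\<nu> (seg b c)" by (rule edge[OF triv_swaps(3)[OF T]])
 have rq: "Eab.p = p" "Eac.p = q" "Ebc.p = q - p" by (simp_all add: Eab.p_def Eac.p_def Ebc.p_def p_def q_def)
 have v0: "bf S x y a = 0" "bf S x y b = 0" "bf S x y c = 0" for x y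
  using Th_vdofs_0(3)[OF Eab.va] Th_vdofs_0(3)[OF Eab.vb] Th_vdofs_0(3)[OF Eac.vb] by blast+
 have \<psi>5: "polyi UNIV 5 \<psi>" by (rule polyi_mono[OF _ \<psi>]) simp
 have 14: "polyi UNIV 4 (%x. 1 :: real)" by (rule polyi_const) simp
 have BC: "bf S q p = B" unfolding B_def by (rule bf_comm)
 have co: "cont g" if "smooth g" for g :: "vec3 => real" using that by (rule smooth_cont)
 have A0: "M1 a b A = 0" using Eab.E1[OF 14] by (simp add: rq A_def)
 have C0: "M1 a c C = 0" using Eac.E1[OF 14] by (simp add: rq C_def)
 have R0: "M1 b c C - 2 * M1 b c B + M1 b c A = 0"
 proof -
  have "bf S (q - p) (q - p) x = C x - 2 * B x + A x" for x
   by (simp add: bf_lin A_def B_def C_def bf_comm[of q p])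
  then show ?thesis
   using Ebc.E1[OF 14] sS by (simp add: rq M1_add M1_diff M1_cmult co)
 qed
 have m1: "M1 a b (%x. \<psi> x * dd q A x) = - 2 * cp * M1 a b B" "M1 a b (%x. \<psi> x * dd p B x) = - cp * M1 a b B"
 proof -
  show B1: "M1 a b (%x. \<psi> x * dd p B x) = - cp * M1 a b B"
   using M1_parts[OF sm sS(2), of a b] v0 by (simp add: p_def[symmetric] dp M1_cmult B_def)
  have "M1 a b (%x. \<psi> x * (2 * dd p B x - dd q A x)) = 0"
   using Eab.E2[OF \<psi>5, of q] by (simp add: rq BC A_def)
  moreover have "(%x. \<psi> x * (2 * dd p B x - dd q A x)) = (%x. 2 * (\<psi> x * dd p B x) - \<psi> x * dd q A x)"
   by (simp add: algebra_simps)
  ultimately show "M1 a b (%x. \<psi> x * dd q A x) = - 2 * cp * M1 a b B"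
   using sm sS B1 by (simp add: M1_diff M1_cmult co)
 qed
 have m2: "M1 a c (%x. \<psi> x * dd p C x) = - 2 * cq * M1 a c B" "M1 a c (%x. \<psi> x * dd q B x) = - cq * M1 a c B"
 proof -
  show B1: "M1 a c (%x. \<psi> x * dd q B x) = - cq * M1 a c B"
   using M1_parts[OF sm sS(2), of a c] v0 by (simp add: q_def[symmetric] dq M1_cmult B_def)
  have "M1 a c (%x. \<psi> x * (2 * dd q B x - dd p C x)) = 0"
   using Eac.E2[OF \<psi>5, of p] by (simp add: rq B_def C_def)
  moreover have "(%x. \<psi> x * (2 * dd q B x - dd p C x)) = (%x. 2 * (\<psi> x * dd q B x) - \<psi> x * dd p C x)"
   by (simp add: algebra_simps)
  ultimately show "M1 a c (%x. \<psi> x * dd p C x) = - 2 * cq * M1 a c B"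
   using sm sS B1 by (simp add: M1_diff M1_cmult co)
 qed
 have m3: "M1 b c (%x. \<psi> x * ((dd p C x - dd q B x) - (dd p B x - dd q A x))) = - (cq - cp) * (M1 b c B - M1 b c A)"
 proof -
  define D where "D x = B x - A x" for x
  have D: "smooth D" unfolding D_def[abs_def] using sS by auto
  have D': "bf S p (q - p) = D" by (simp add: bf_lin D_def A_def B_def fun_eq_iff)
  have RR: "bf S (q - p) (q - p) = (%x. C x - 2 * B x + A x)"
   by (simp add: bf_lin A_def B_def C_def bf_comm[of q p] fun_eq_iff)
  have "M1 b c (%x. \<psi> x * dd (c - b) D x) = - M1 b c (%x. dd (c - b) \<psi> x * D x)"
   using M1_parts[OF sm D, of b c] v0 by (simp add: D_def A_def B_def)
  also have "dd (c - b) \<psi> = (%x. cq - cp)"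
  proof -
   have "c - b = q - p" by (simp add: p_def q_def)
   then show ?thesis using sm by (simp add: dd_dir_diff dp dq)
  qed
  finally have 1: "M1 b c (%x. \<psi> x * dd (q - p) D x) = - (cq - cp) * (M1 b c B - M1 b c A)"
   using sS by (simp add: M1_cmult D_def[abs_def] M1_diff co p_def q_def) (simp add: algebra_simps)
  have "M1 b c (%x. \<psi> x * (2 * dd (q - p) D x - dd p (%x. C x - 2 * B x + A x) x)) = 0"
   using Ebc.E2[OF \<psi>5, of p] by (simp add: rq D' RR)
  \<comment> \<open>The integrand is the derivative of \<open>D\<close> along \<open>b c\<close>
    minus the expression of \<open>E2\<close> for this edge and the direction
    \<open>p\<close>.\<close>
  moreover have "\<psi> x * ((dd p C x - dd q B x) - (dd p B x - dd q A x)) =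
    \<psi> x * dd (q - p) D x - \<psi> x * (2 * dd (q - p) D x - dd p (%x. C x - 2 * B x + A x) x)" for x
   using sS D by (simp add: D_def[abs_def] dd_dir_diff dd_diff dd_add dd_cmult) (simp add: algebra_simps)
  ultimately show ?thesis
   using 1 sm sS D by (simp add: M1_diff co)
 qed
 define g1 g2 where "g1 x = dd p C x - dd q B x" and "g2 x = dd p B x - dd q A x" for x
 have g: "smooth g1" "smooth g2" using sS by (auto simp: g1_def[abs_def] g2_def[abs_def])
 have T': "bf (ccs S) (cross3 p q) (cross3 p q) x = dd p g1 x - dd q g2 x" for x
  unfolding ccs_form[OF S] using sS by (simp add: g1_def[abs_def] g2_def[abs_def] dd_diff A_def[symmetric] B_def[symmetric] C_def[symmetric] BC)
 have G1: "M2 a b c g1 = M1 b c C - M1 a c C - (M1 b c B - M1 a b B)"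
  unfolding g1_def[abs_def] p_def q_def using sS by (simp add: M2_diff M2_FTC M2_FTC' co)
 have G2: "M2 a b c g2 = M1 b c B - M1 a c B - (M1 b c A - M1 a b A)"
  unfolding g2_def[abs_def] p_def q_def using sS by (simp add: M2_diff M2_FTC M2_FTC' co)
 have e1: "M1 a b (%x. \<psi> x * g2 x) = cp * M1 a b B"
  using m1 sm sS by (simp add: g2_def right_diff_distrib M1_diff co)
 have e2: "M1 a c (%x. \<psi> x * g1 x) = - cq * M1 a c B"
  using m2 sm sS by (simp add: g1_def right_diff_distrib M1_diff co)
 have e3: "M1 b c (%x. \<psi> x * g1 x) - M1 b c (%x. \<psi> x * g2 x) = - (cq - cp) * (M1 b c B - M1 b c A)"
  using m3 sm g by (simp add: g1_def[symmetric] g2_def[symmetric] right_diff_distrib M1_diff co)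
 have "M2 a b c (%x. \<psi> x * bf (ccs S) (cross3 p q) (cross3 p q) x) = M2 a b c (%x. \<psi> x * dd p g1 x) - M2 a b c (%x. \<psi> x * dd q g2 x)"
  using sm g by (simp add: T' right_diff_distrib M2_diff co)
 also have "\<dots> = (M1 b c (%x. \<psi> x * g1 x) - M1 b c (%x. \<psi> x * g2 x)) - M1 a c (%x. \<psi> x * g1 x) + M1 a b (%x. \<psi> x * g2 x) - cp * M2 a b c g1 + cq * M2 a b c g2"
  using M2_parts(2)[OF sm g(1), of a b c] M2_parts(1)[OF sm g(2), of a b c]
  by (simp add: p_def[symmetric] q_def[symmetric] dp dq M2_cmult)
 \<comment> \<open>The terms with \<open>cq\<close> cancel; those with \<open>cp\<close> form the
   mean of \<open>bf S (c - b) (c - b)\<close> on \<open>b c\<close>, which is zero by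
   \<open>R0\<close>.\<close>
 also have "\<dots> = - cp * (M1 b c C - 2 * M1 b c B + M1 b c A)"
  unfolding e1 e2 e3 G1 G2 A0 C0 by (simp add: algebra_simps)
 finally show ?thesis by (simp add: R0 p_def q_def)
qed

text \<open>Splits \<open>y\<close> into a normal part, for \<open>normal_moment\<close>, and a
  tangential part in the form \<open>cross3 w n\<close>, for
  \<open>tangential_moment\<close>.\<close>

lemma ccs_moment:
 assumes T: "triv f a b c" and \<psi>: "polyi UNIV 1 \<psi>"
 shows "M2 a b c (%x. \<psi> x * bf (ccs S) y n x) = 0"
proof -
 let ?N = "cross3 (b - a) (c - a)"
 note n' = unit_normal_triv[OF T n]
 define k where "k = n <.> ?N"
 have N: "?N = k *R n" and k0: "k ~= 0"
  using unit_normal_cross[OF n'] triv_cross[OF T] by (auto simp: k_def)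
 define w where "w = cross3 n y"
 have w: "n <.> w = 0" by (simp add: w_def dot_cross_self)
 have y: "y = (n <.> y) *R n + cross3 w n"
 proof -
  have "cross3 w n = - cross3 n (cross3 n y)" unfolding w_def by (rule cross_skew)
  also have "\<dots> = y - (n <.> y) *R n" using n'(1) by (simp add: Lagrange dot_square_norm)
  finally show ?thesis by simp
 qed
 have c: "bf (ccs S) (cross3 w n) n = bf (ccs S) n (cross3 w n)"
  using ccs_Sym[OF S symm] by (rule bf_Sym)
 have "k * k * (\<psi> x * bf (ccs S) y n x) =
   (n <.> y) * (\<psi> x * bf (ccs S) ?N ?N x) + k * (\<psi> x * bf (ccs S) ?N (cross3 w n) x)" for x
  by (subst y) (simp add: N bf_lin c algebra_simps)
 then have "k * k * M2 a b c (%x. \<psi> x * bf (ccs S) y n x) =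
   (n <.> y) * M2 a b c (%x. \<psi> x * bf (ccs S) ?N ?N x) + k * M2 a b c (%x. \<psi> x * bf (ccs S) ?N (cross3 w n) x)"
  unfolding M2_cmult[symmetric] using S polyi_smooth[OF \<psi>] by (subst M2_add[symmetric]) (auto intro!: smooth_cont)
 then show ?thesis
  using k0 tangential_moment[OF T w \<psi>] normal_moment[OF T \<psi>] by simp
qed

lemma ccs_fdofs:
 assumes T: "triv f a b c"
 shows "\<forall>d\<in>Sg_fdofs (%_. n) f. d (ccs S) = 0"
proof -
 have "face_int f (%x. (ccs S x *v n) <.> v x) = 0" if "v : polys 1 UNIV" for v
 proof -
  have v: "polyi UNIV 1 v" using that by (simp add: polys_iff)
  have eq: "(ccs S x *v n) <.> v x = (\<Sum>i\<in>UNIV. v x $ i * bf (ccs S) (axis i 1) n x)" for x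
   by (subst inner_expand) (simp add: bf_def)
  have "M2 a b c (%x. \<Sum>i\<in>UNIV. v x $ i * bf (ccs S) (axis i 1) n x) = 0"
   using polyi_nth[OF v] polyi_smooth[OF v] S by (subst M2_sum) (auto intro!: smooth_cont simp: ccs_moment[OF T])
  then show ?thesis
   using S polyi_smooth[OF v] unfolding eq by (subst face_int_eq[OF T]) (auto intro!: smooth_cont)
 qed
 then show ?thesis unfolding Sg_fdofs_def by blast
qed

end

text \<open>Serves three kinds of weights: coordinate functions for the averages of
  \<open>ccs S\<close>, components of affine fields in \<open>mdiv_moment\<close>, and test
  functions in \<open>Sg_parts\<close>.\<close>

lemma gauss_matrix:
 assumes T: "tetv K a b c d" and S: "smooth S" and \<phi>: "smooth \<phi>"
  and n: "!!f. f : faces K ==> unit_normal f (n f)"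
 shows "integral K (%x. \<phi> x * (y <.> mdiv S x) + (\<Sum>k\<in>UNIV. pd k \<phi> x * bf S y (axis k 1) x))
  = (\<Sum>f\<in>faces K. osign (n f) K f * face_int f (%x. \<phi> x * bf S y (n f) x))"
proof -
 define g where "g k x = \<phi> x * bf S y (axis k 1) x" for k :: 3 and x
 have g: "smooth (g k)" for k using S \<phi> unfolding g_def[abs_def] by auto
 have "\<phi> x * (y <.> mdiv S x) + (\<Sum>k\<in>UNIV. pd k \<phi> x * bf S y (axis k 1) x) = (\<Sum>k\<in>UNIV. dd (axis k 1) (g k) x)" for x
 proof -
  have "y <.> mdiv S x = (\<Sum>k\<in>UNIV. dd (axis k 1) (bf S y (axis k 1)) x)"
  proof -
   have "bf S y (axis k 1) = (%x. \<Sum>i\<in>UNIV. y $ i * bf S (axis i 1) (axis k 1) x)" for k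
    by (simp add: bf_axis) (simp add: bf_def inner_vec_def matrix_vector_mult_basis column_def)
   then have "dd (axis k 1) (bf S y (axis k 1)) x = (\<Sum>i\<in>UNIV. y $ i * dd (axis k 1) (bf S (axis i 1) (axis k 1)) x)" for k
    using S by (simp add: dd_sum dd_cmult)
   then show ?thesis
    using S by (simp add: inner_vec_def mdiv_nth sum_3 algebra_simps)
  qed
  then show ?thesis
   using S \<phi> by (simp add: g_def[abs_def] dd_mult pd_def sum.distrib sum_distrib_left)
 qed
 then have "integral K (%x. \<phi> x * (y <.> mdiv S x) + (\<Sum>k\<in>UNIV. pd k \<phi> x * bf S y (axis k 1) x)) = (\<Sum>k\<in>UNIV. integral K (dd (axis k 1) (g k)))"
  using g by (simp add: sum_3 integral_K_linear[OF tetv_compact[OF T]] smooth_cont continuous_intros)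
 also have "\<dots> = (\<Sum>f\<in>faces K. \<Sum>k\<in>UNIV. osign (n f) K f * (n f <.> axis k 1) * face_int f (g k))"
 proof -
  have "integral K (dd (axis k 1) (g k)) = (\<Sum>f\<in>faces K. osign (n f) K f * (n f <.> axis k 1) * face_int f (g k))" for k
   by (rule gauss[OF T g n])
  then show ?thesis by (simp only:) (rule sum.swap)
 qed
 also have "\<dots> = (\<Sum>f\<in>faces K. osign (n f) K f * face_int f (%x. \<phi> x * bf S y (n f) x))"
 proof (rule sum.cong[OF refl])
  fix f assume "f : faces K"
  then obtain a' b' c' d' where T': "tetv K a' b' c' d'" "f = convex hull {a', b', c'}" by (rule face_cases[OF T])
  then have tr: "triv f a' b' c'" using tetv_triv by blast
  have "\<phi> x * bf S y (n f) x = (\<Sum>k\<in>UNIV. (n f $ k) * g k x)" for x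
   by (simp add: g_def bf_def inner_vec_def matrix_vector_mult_def sum_3 axis_def algebra_simps)
  then have "M2 a' b' c' (%x. \<phi> x * bf S y (n f) x) = (\<Sum>k\<in>UNIV. n f $ k * M2 a' b' c' (g k))"
   using g by (simp add: M2_sum M2_cmult smooth_cont continuous_intros)
  then have "face_int f (%x. \<phi> x * bf S y (n f) x) = (\<Sum>k\<in>UNIV. n f $ k * face_int f (g k))"
   using S \<phi> g by (subst (1 2) face_int_eq[OF tr]) (auto intro!: smooth_cont simp: sum_distrib_left mult_ac)
  then show "(\<Sum>k\<in>UNIV. osign (n f) K f * (n f <.> axis k 1) * face_int f (g k)) = osign (n f) K f * face_int f (%x. \<phi> x * bf S y (n f) x)"
   by (simp add: inner_axis sum_distrib_left mult.assoc)
 qed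
 finally show ?thesis .
qed

section \<open>Traces determined by the degrees of freedom on a face\<close>

lemma on_seg_param: "(!!t. t : {0..1} ==> P (pt1 a b t)) ==> x : seg a b ==> P x"
 by (metis segment_point)

text \<open>The zeros at the ends split off the edge bubble. The quotient \<open>q\<close> is an
  admissible weight, and \<open>q x * g x\<close> is the bubble times a square.\<close>

lemma moment_zero_1:
 assumes g: "polyi UNIV (k + 2) g" and ab: "a ~= b" "g a = 0" "g b = 0"
  and m: "!!\<psi>. polyi UNIV k \<psi> ==> M1 a b (%x. \<psi> x * g x) = 0" and x: "x : seg a b"
 shows "g x = 0"
proof -
 obtain q where q: "polyi UNIV k q" "!!t. g (pt1 a b t) = (t * (1 - t)) *R q (pt1 a b t)"
  using segment_factor[OF g subspace_UNIV ab] by blast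
 have c: "cont (%x. q x * g x)"
  using polyi_smooth[OF g] polyi_smooth[OF q(1)] by (intro smooth_cont smooth_mult)
 have nn: "0 <= q x * g x" if "x : seg a b" for x
 proof (rule on_seg_param[OF _ that])
  fix t :: real assume "t : {0..1}"
  then show "0 <= q (pt1 a b t) * g (pt1 a b t)"
   by (simp add: q(2) mult.left_commute[of "q _"] zero_le_mult_iff)
 qed
 have z: "q x * g x = 0" by (rule M1_eq_0D[OF c nn m[OF q(1)] x])
 obtain t where "x = pt1 a b t" using x by (rule segment_point)
 with z q(2)[of t] show ?thesis by auto
qed

text \<open>As in \<open>moment_zero_1\<close>, with double zeros at the ends: the squared bubble is
  a factor, and the degree may exceed that of the weights by 4.\<close>

lemma moment_zero_hermite:
 assumes g: "polyi UNIV (k + 2 + 2) g" and ab: "a ~= b" "g a = 0" "g b = 0" "dd (b - a) g a = 0" "dd (b - a) g b = 0"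
  and m: "!!\<psi>. polyi UNIV k \<psi> ==> M1 a b (%x. \<psi> x * g x) = 0" and x: "x : seg a b"
 shows "g x = 0"
proof -
 obtain q where q: "polyi UNIV (k + 2) q" "!!t. g (pt1 a b t) = (t * (1 - t)) *R q (pt1 a b t)"
  using segment_factor[OF g subspace_UNIV ab(1-3)] by blast
 let ?q = "%t. q (pt1 a b t)"
 have dq: "((%t. ?q t) has_real_derivative dd (b - a) q (pt1 a b t)) (at t)" for t
  unfolding has_real_derivative_iff_has_vector_derivative by (rule smooth_has_vector_derivative[OF polyi_smooth[OF q(1)]])
 have d1: "((%t. g (pt1 a b t)) has_real_derivative dd (b - a) g (pt1 a b t)) (at t)" for t
  unfolding has_real_derivative_iff_has_vector_derivative by (rule smooth_has_vector_derivative[OF polyi_smooth[OF g]])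
 have d2: "((%t. t * (1 - t) * ?q t) has_real_derivative (1 - 2 * t) * ?q t + t * (1 - t) * dd (b - a) q (pt1 a b t)) (at t)" for t
  by (rule derivative_eq_intros dq refl | simp add: algebra_simps)+
 have dd: "dd (b - a) g (pt1 a b t) = (1 - 2 * t) * ?q t + t * (1 - t) * dd (b - a) q (pt1 a b t)" for t
 proof -
  have gq: "(%t. g (pt1 a b t)) = (%t. t * (1 - t) * ?q t)" by (simp add: q(2))
  show ?thesis by (rule DERIV_unique[OF d1[of t, unfolded gq] d2])
 qed
 \<comment> \<open>At an end point the derivative of \<open>g\<close> is the value of
   \<open>q\<close> up to sign.\<close>
 have "q a = 0" "q b = 0" using dd[of 0] dd[of 1] ab by simp_all
 obtain r where r: "polyi UNIV k r" "!!t. ?q t = (t * (1 - t)) *R r (pt1 a b t)"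
  using segment_factor[OF q(1) subspace_UNIV ab(1) \<open>q a = 0\<close> \<open>q b = 0\<close>] by blast
 have c: "cont (%x. r x * g x)"
  using polyi_smooth[OF g] polyi_smooth[OF r(1)] by (intro smooth_cont smooth_mult)
 have gt: "g (pt1 a b t) = (t * (1 - t))\<^sup>2 * r (pt1 a b t)" for t
  by (simp add: q(2) r(2) power2_eq_square)
 have nn: "0 <= r x * g x" if "x : seg a b" for x
  by (rule on_seg_param[OF _ that]) (simp add: gt mult.left_commute[of "r _"])
 have z: "r x * g x = 0" by (rule M1_eq_0D[OF c nn m[OF r(1)] x])
 obtain t where "x = pt1 a b t" using x by (rule segment_point)
 with z gt[of t] show ?thesis by auto
qed

lemma triangle_param:
 assumes "triv f a b c" "x : f"
 obtains t u where "x = pt2 a b c t u" "0 <= t" "0 <= u" "t + u <= 1"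
 using assms unfolding triv_def triangle_points by blast

lemma triv_mem: "triv f a b c ==> 0 <= t ==> 0 <= u ==> t + u <= 1 ==> pt2 a b c t u : f"
 unfolding triv_def using in_triangle by blast

lemma triv_seg_sub: assumes "triv f a b c" shows "seg a b \<subseteq> f" "seg b c \<subseteq> f" "seg a c \<subseteq> f"
 using assms unfolding triv_def segment_convex_hull by (auto intro: hull_mono[THEN subsetD, rotated])

lemma moment_zero_2:
 assumes g: "polyi UNIV (k + 3) g" and T: "triv f a b c"
  and z: "!!x. x : seg a b \<union> seg b c \<union> seg a c ==> g x = 0"
  and m: "!!\<psi>. polyi UNIV k \<psi> ==> M2 a b c (%x. \<psi> x * g x) = 0" and x: "x : f"
 shows "g x = 0"
proof -
 have f: "f = hull3 a b c" using T by (simp add: triv_def)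
 obtain q where q: "polyi UNIV k q"
  "!!t u. g (pt2 a b c t u) = (t * u * (1 - t - u)) *R q (pt2 a b c t u)"
  using triangle_factor[OF g subspace_UNIV triv_cross[OF T] z] by blast
 have c: "cont (%x. q x * g x)"
  using polyi_smooth[OF g] polyi_smooth[OF q(1)] by (intro smooth_cont smooth_mult)
 have nn: "0 <= q y * g y" if y: "y : hull3 a b c" for y
 proof -
  obtain t u where "y = pt2 a b c t u" "0 <= t" "0 <= u" "t + u <= 1"
   using triangle_param[OF T] y f by blast
  then show ?thesis by (simp add: q(2) mult.left_commute[of "q _"] zero_le_mult_iff)
 qed
 have z: "q x * g x = 0" by (rule M2_eq_0D[OF c nn m[OF q(1)]]) (use x f in auto)
 obtain t u where "x = pt2 a b c t u" using triangle_param[OF T x] by blast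
 with z q(2)[of t u] show ?thesis by auto
qed

lemma face_int_cong:
 assumes T: "triv f a b c" and "cont g" "cont h" "!!x. x : f ==> g x = h x"
 shows "face_int f g = face_int f h"
 using assms by (simp add: face_int_eq[OF T]) (metis M2_cong T triv_def)

lemma face_int_norm_0:
 fixes A :: "vec3 => mat3"
 assumes T: "triv f a b c" and A: "smooth A" and z: "face_int f (%x. A x <.> A x) = 0" and x: "x : f"
 shows "A x = 0"
proof -
 have c: "cont (%x. A x <.> A x)" using A by (intro smooth_cont smooth_inner)
 have "M2 a b c (%x. A x <.> A x) = 0" using z triv_cross[OF T] by (simp add: face_int_eq[OF T c])
 moreover have "x : hull3 a b c" using x T by (simp add: triv_def)
 ultimately have "A x <.> A x = 0" by (rule M2_eq_0D[OF c inner_ge_zero])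
 then show ?thesis by simp
qed

lemma zero_on_line:
 fixes g :: "vec3 => real"
 assumes g: "smooth g" and "g y = 0" "0 <= h" "!!t. 0 <= t ==> t <= h ==> dd v g (y + t *R v) = 0"
 shows "g (y + h *R v) = 0"
proof -
 have "((%t. dd v g (y + t *R v)) has_integral g (y + h *R v) - g (y + 0 *R v)) {0..h}"
  using assms by (intro fundamental_theorem_of_calculus smooth_has_vector_derivative g) auto
 moreover have "((%t. dd v g (y + t *R v)) has_integral 0) {0..h}"
  using assms by (intro has_integral_is_0) auto
 ultimately have "g (y + h *R v) - g (y + 0 *R v) = 0" by (rule has_integral_unique)
 with assms(2) show ?thesis by simp
qed

lemma affine_on_line:
 fixes g :: "vec3 => real"
 assumes g: "smooth g" and g0: "g y = 0" and h: "0 <= h"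
  and d: "!!t. 0 <= t ==> t <= h ==> dd v (dd v g) (y + t *R v) = 0" and t: "0 <= t" "t <= h"
 shows "g (y + t *R v) = t * dd v g y"
proof -
 have c: "dd v g (y + t *R v) = dd v g y" if "0 <= t" "t <= h" for t
 proof -
  define g1 where "g1 x = dd v g x - dd v g y" for x
  have g1: "smooth g1" unfolding g1_def[abs_def] using g by auto
  have "g1 (y + t *R v) = 0"
   using that g d by (intro zero_on_line[OF g1]) (auto simp: g1_def[abs_def] dd_diff)
  then show ?thesis by (simp add: g1_def)
 qed
 have "((%t. dd v g (y + t *R v)) has_integral g (y + t *R v) - g (y + 0 *R v)) {0..t}"
  using t by (intro fundamental_theorem_of_calculus smooth_has_vector_derivative g) auto
 moreover have "((%t. dd v g (y + t *R v)) has_integral t * dd v g y) {0..t}"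
 proof (rule has_integral_eq)
  show "((%_. dd v g y) has_integral t * dd v g y) {0..t}"
   using has_integral_const_real[of "dd v g y" 0 t] t by simp
 qed (use c t in auto)
 ultimately have "g (y + t *R v) - g (y + 0 *R v) = t * dd v g y" by (rule has_integral_unique)
 with g0 show ?thesis by simp
qed

lemma affine_ends:
 fixes g :: "vec3 => real"
 assumes g: "smooth g" and "g y = 0" "0 <= h" "g (y + h *R v) = 0"
  and d: "!!t. 0 <= t ==> t <= h ==> dd v (dd v g) (y + t *R v) = 0" and t: "0 <= t" "t <= h"
 shows "g (y + t *R v) = 0"
proof (cases "h = 0")
 case True
 with t assms(2) show ?thesis by simp
next
 case False
 have "h * dd v g y = 0" using affine_on_line[OF g assms(2,3) d, of h] assms by simp
 with False have "dd v g y = 0" by simp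
 with affine_on_line[OF g assms(2,3) d t] show ?thesis by simp
qed

lemma seg_affine_zero:
 fixes g :: "vec3 => real"
 assumes g: "smooth g" and "g a = 0" "g b = 0" "!!x. x : seg a b ==> dd (b - a) (dd (b - a) g) x = 0"
  and x: "x : seg a b"
 shows "g x = 0"
proof (rule on_seg_param[OF _ x])
 fix t :: real assume t: "t : {0..1}"
 show "g (pt1 a b t) = 0"
 proof (rule affine_ends[OF g assms(2), of 1 "b - a" t])
  show "g (pt1 a b 1) = 0" by (simp add: assms(3))
  show "dd (b - a) (dd (b - a) g) (pt1 a b w) = 0" if "0 <= w" "w <= 1" for w
   using that by (intro assms(4) on_segment) simp
 qed (use t in auto)
qed

lemma polyi_Mv: "polyi UNIV k u ==> polyi (range ((*v) A)) k (%x. (A :: mat3) *v u x)"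
 by (rule polyi_linear[OF _ matrix_vector_mul_linear]) auto

lemma polyi_cinner: "polyi UNIV k u ==> polyi UNIV k (%x. c <.> u x)"
 by (rule polyi_linear[OF _ bounded_linear.linear[OF bounded_linear_inner_right]]) auto

lemma W_edge_trace:
 assumes u: "polyi UNIV 7 u" and ab: "a ~= b"
  and va: "\<forall>d\<in>W_vdofs a. d u = 0" and vb: "\<forall>d\<in>W_vdofs b. d u = 0"
  and e: "\<forall>d\<in>W_edofs (seg a b). d u = 0" and x: "x : seg a b"
 shows "u x = 0"
proof -
 note sm = polyi_smooth[OF u]
 have "w <.> u x = 0" for w
 \<comment> \<open>Degree 7 with double zeros at both ends leaves a cofactor of degree 3, the degree
   of the weights in \<open>W_edofs\<close>.\<close>
 proof (rule moment_zero_hermite[where k = 3, OF _ ab _ _ _ _ _ x])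
  show "polyi UNIV (3 + 2 + 2) (%x. w <.> u x)" using polyi_cinner[OF u] by simp
  show "w <.> u a = 0" "w <.> u b = 0" "dd (b - a) (%x. w <.> u x) a = 0" "dd (b - a) (%x. w <.> u x) b = 0"
   using W_vdofs_0[OF va sm] W_vdofs_0[OF vb sm] sm by (simp_all add: dd_cinner)
  show "M1 a b (%x. \<psi> x * (w <.> u x)) = 0" if "polyi UNIV 3 \<psi>" for \<psi>
   by (rule W_edofs_0[OF e ab that])
 qed
 from this[of "u x"] show ?thesis by simp
qed

lemma bubble_polysI:
 assumes T: "triv f a b c" and v: "polyi X (k + 3) v" "subspace X"
  and z: "!!x. x : seg a b \<union> seg b c \<union> seg a c ==> v x = 0"
 shows "v : bubble_polys f k X"
proof -
 obtain q where q: "polyi X k q"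
  "!!t u. v (pt2 a b c t u) = (t * u * (1 - t - u)) *R q (pt2 a b c t u)"
  using triangle_factor[OF v triv_cross[OF T] z] by blast
 have "v x = (\<Prod>w\<in>verts f. bary (verts f) w x) *R q x" if xf: "x : f" for x
 proof -
  obtain t u where x: "x = pt2 a b c t u" using triangle_param[OF T xf] by blast
  show ?thesis unfolding bary_triv[OF T x] unfolding x q(2) ..
 qed
 then show ?thesis
  using v q(1) unfolding bubble_polys_def by (auto simp: polys_iff)
qed

lemma smooth_eps_f [intro]: assumes "smooth v" shows "smooth (eps_f n v)"
proof (rule smooth_mat)
 fix i j
 have "(%z. eps_f n v z $ i $ j) = (%z. ((Qp n *v axis i 1) <.> dd (Qp n *v axis j 1) v z + (Qp n *v axis j 1) <.> dd (Qp n *v axis i 1) v z) / 2)"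
  by (simp only: form_axis[symmetric] eps_f_form[OF assms])
 then show "smooth (%z. eps_f n v z $ i $ j)" using assms by (simp add: smooth_divide)
qed

lemma smooth_hess_f [intro]: assumes "smooth q" shows "smooth (hess_f n q)"
proof (rule smooth_mat)
 fix i j
 have "(%z. hess_f n q z $ i $ j) = dd (Qp n *v axis i 1) (dd (Qp n *v axis j 1) q)"
  by (simp only: form_axis[symmetric] hess_f_form[OF assms])
 then show "smooth (%z. hess_f n q z $ i $ j)" using assms by simp
qed

text \<open>On lines in direction \<open>c - a\<close> the component of \<open>v\<close> in that direction is constant.\<close>
lemma korn_direction:
 assumes T: "triv f a b c" and n: "unit_normal f n" and v: "smooth v"
  and z: "!!x. x : seg a b ==> v x = 0" and e: "!!x. x : f ==> eps_f n v x = 0" and x: "x : f"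
 shows "(c - a) <.> v x = 0"
proof -
 obtain t u where tu: "x = pt2 a b c t u" "0 <= t" "0 <= u" "t + u <= 1"
  by (rule triangle_param[OF T x])
 let ?y = "pt1 a b t"
 have Q: "Qp n *v (c - a) = c - a" using unit_normal_triv[OF T n] by (simp add: Qp_fix)
 have "(%x. (c - a) <.> v x) (?y + u *R (c - a)) = 0"
 proof (rule zero_on_line)
  show "smooth (%x. (c - a) <.> v x)" using v by auto
  show "(c - a) <.> v ?y = 0" using z[OF on_segment[of t a b]] tu by simp
  fix w assume "0 <= w" "w <= u"
  then have "?y + w *R (c - a) : f" using tu by (intro triv_mem[OF T]) auto
  from e[OF this] have "(c - a) <.> (eps_f n v (?y + w *R (c - a)) *v (c - a)) = 0" by simp
  then show "dd (c - a) (%x. (c - a) <.> v x) (?y + w *R (c - a)) = 0"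
   unfolding eps_f_form[OF v] Q using v by (simp add: dd_cinner)
 qed (use tu in auto)
 then show ?thesis by (simp add: tu(1))
qed

lemma tangential_zero:
 assumes T: "triv f a b c" and n: "unit_normal f n" and y: "n <.> y = 0" "(b - a) <.> y = 0" "(c - a) <.> y = 0"
 shows "y = 0"
proof -
 obtain \<alpha> \<beta> where "y = \<alpha> *R (b - a) + \<beta> *R (c - a)"
  by (rule tangential_span[OF triv_cross[OF T] unit_normal_triv[OF T n] y(1)])
 then have "y <.> y = \<alpha> * ((b - a) <.> y) + \<beta> * ((c - a) <.> y)"
  by (metis inner_add_left inner_scaleR_left)
 then show ?thesis using y by simp
qed

lemma EfI:
 assumes "polyi UNIV 7 \<phi>" "triv f a b c"
  and "!!x. x : seg a b \<union> seg b c \<union> seg a c ==> \<phi> x = 0"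
  and "!!a b c. triv f a b c ==> M1 a b (dd (conormal f (seg a b)) \<phi>) = 0"
 shows "\<phi> : Ef f"
proof -
 have "edge_int e (dd (conormal f e) \<phi>) = 0" if e: "e : edges f" for e
 proof -
  obtain a' b' c' where "triv f a' b' c'" "e = seg a' b'" by (rule face_edge_cases[OF assms(2) e])
  with assms(4) show ?thesis by (simp add: edge_int_eq)
 qed
 then show ?thesis using assms by (simp add: Ef_def polys_iff triv_rel_frontier[OF assms(2)])
qed

text \<open>As \<open>u\<close> vanishes on the edges, its tangential part is a bubble field and its
  normal component lies in \<open>Ef f\<close>; both may be tested against themselves. Zero surface
  strain gives a zero tangential part by \<open>korn_direction\<close>, and zero Hessian makes the
  normal component affine on chords whose ends lie on edges.\<close>

lemma W_face_trace:
 assumes u: "polyi UNIV 7 u" and T: "triv f a b c" and n: "unit_normal f n"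
  and vd: "!!x. x : verts f ==> \<forall>d\<in>W_vdofs x. d u = 0"
  and ed: "!!e. e : edges f ==> \<forall>d\<in>W_edofs e. d u = 0"
  and fd: "\<forall>d\<in>W_fdofs (%_. n) f. d u = 0" and x: "x : f"
 shows "u x = 0"
proof -
 have n1: "norm n = 1" using n by (simp add: unit_normal_def)
 note sm = polyi_smooth[OF u]
 have e1: "u x = 0" if T: "triv f a b c" and "x : seg a b" for a b c x
  using W_edge_trace[OF u triv_distinct(1)[OF T] vd vd ed[OF triv_edge[OF T]]] that triv_verts[OF T] by simp
 have z: "u x = 0" if "x : seg a b \<union> seg b c \<union> seg a c" for x
  using that e1[OF T] e1[OF triv_swaps(3)[OF T]] e1[OF triv_swaps(2)[OF T]] by blast
 let ?v = "%x. Qp n *v u x" and ?\<phi> = "%x. n <.> u x"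
 have v: "polyi (range ((*v) (Qp n))) (4 + 3) ?v" using polyi_Mv[OF u] by simp
 have vs: "smooth ?v" using sm by auto
 have "?v : bubble_polys f 4 (range ((*v) (Qp n)))"
  by (rule bubble_polysI[OF T v subspace_range_mv]) (simp add: z)
 then have "(%w. face_int f (%x. eps_f n (%y. Qp n *v w y) x <.> eps_f n ?v x)) : W_fdofs (%_. n) f"
  unfolding W_fdofs_def by (intro UnI1 CollectI exI[of _ ?v]) simp
 with fd have "face_int f (%x. eps_f n ?v x <.> eps_f n ?v x) = 0" by (rule bspec)
 from face_int_norm_0[OF T smooth_eps_f[OF vs] this]
 have e0: "eps_f n ?v x = 0" if "x : f" for x using that .
 have "(c - a) <.> ?v x = 0"
  by (rule korn_direction[OF T n vs _ e0 x]) (simp add: z)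
 moreover have "(b - a) <.> ?v x = 0"
  by (rule korn_direction[OF triv_swaps(2)[OF T] n vs _ e0 x]) (simp add: z)
 ultimately have v0: "?v x = 0"
  using tangential_zero[OF T n Qp_orth[OF n1]] by blast
 have \<phi>: "polyi UNIV 7 ?\<phi>" by (rule polyi_cinner[OF u])
 have \<phi>s: "smooth ?\<phi>" using sm by auto
 have "?\<phi> : Ef f"
 proof (rule EfI[OF \<phi> T])
  fix a b c assume T: "triv f a b c"
  have "(%w. edge_int (seg a b) (dd (conormal f (seg a b)) (%y. n <.> w y))) : W_fdofs (%_. n) f"
   unfolding W_fdofs_def
   by (rule UnI1, rule UnI2, rule CollectI, rule exI[of _ "seg a b"]) (simp add: triv_edge[OF T])
  with fd have "edge_int (seg a b) (dd (conormal f (seg a b)) ?\<phi>) = 0" by (rule bspec)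
  then show "M1 a b (dd (conormal f (seg a b)) ?\<phi>) = 0" using triv_distinct[OF T] by (simp add: edge_int_eq)
 qed (simp add: z)
 then have "(%w. face_int f (%x. hess_f n (%y. n <.> w y) x <.> hess_f n ?\<phi> x)) : W_fdofs (%_. n) f"
  unfolding W_fdofs_def by (intro UnI2 CollectI exI[of _ ?\<phi>]) simp
 with fd have "face_int f (%x. hess_f n ?\<phi> x <.> hess_f n ?\<phi> x) = 0" by (rule bspec)
 from face_int_norm_0[OF T smooth_hess_f[OF \<phi>s] this]
 have h0: "hess_f n ?\<phi> x = 0" if "x : f" for x using that .
 obtain t r where tr: "x = pt2 a b c t r" "0 <= t" "0 <= r" "t + r <= 1"
  by (rule triangle_param[OF T x])
 have Q: "Qp n *v (c - a) = c - a" using unit_normal_triv[OF T n] by (simp add: Qp_fix)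
 have "?\<phi> ((pt1 a b t) + r *R (c - a)) = 0"
 proof (rule affine_ends[OF \<phi>s, of _ "1 - t"])
  have "pt1 a b t : seg a b" using tr by (intro on_segment) auto
  then show "?\<phi> (pt1 a b t) = 0" by (simp add: z)
  have "(pt1 a b t) + (1 - t) *R (c - a) = pt1 c b t" by (simp add: algebra_simps)
  moreover have "pt1 c b t : seg b c" using tr on_segment[of t c b] by (simp add: closed_segment_commute)
  ultimately show "?\<phi> ((pt1 a b t) + (1 - t) *R (c - a)) = 0" by (simp add: z)
  fix w assume "0 <= w" "w <= 1 - t"
  then have "(pt1 a b t) + w *R (c - a) : f" using tr by (intro triv_mem[OF T]) auto
  from h0[OF this] have "(c - a) <.> (hess_f n ?\<phi> ((pt1 a b t) + w *R (c - a)) *v (c - a)) = 0" by simp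
  then show "dd (c - a) (dd (c - a) ?\<phi>) ((pt1 a b t) + w *R (c - a)) = 0"
   unfolding hess_f_form[OF \<phi>s] Q .
 qed (use tr in auto)
 then have "n <.> u x = 0" by (simp add: tr(1))
 with v0 show ?thesis by (simp add: Qp_vec)
qed

lemma Sg_edge_moment:
 assumes "\<forall>d\<in>Sg_edofs s nm np (seg a b). d T = 0" "a ~= b" "polyi UNIV 2 \<psi>"
  and "(x, y) : {(s (seg a b), nm (seg a b)), (s (seg a b), np (seg a b)),
   (nm (seg a b), nm (seg a b)), (np (seg a b), np (seg a b)), (nm (seg a b), np (seg a b))}"
 shows "M1 a b (%z. \<psi> z * bf T x y z) = 0"
proof -
 let ?e = "seg a b"
 have "(%T. edge_int ?e (%z. (x <.> (T z *v y)) * \<psi> z)) : Sg_edofs s nm np ?e"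
  unfolding Sg_edofs_def
  by (rule CollectI, rule exI[of _ x], rule exI[of _ y], rule exI[of _ \<psi>]) (use assms(3,4) in \<open>simp add: polys_iff\<close>)
 with assms(1) have "edge_int ?e (%z. (x <.> (T z *v y)) * \<psi> z) = 0" by (rule bspec)
 then show ?thesis using assms(2) by (simp add: edge_int_eq bf_def mult.commute)
qed

text \<open>The five pairs determine every component of \<open>T\<close> except the doubly
  tangential one, which does not occur since \<open>n\<close> is normal to the edge. Degree 4 with
  zeros at the ends matches weights of degree 2.\<close>

lemma Sg_edge_trace:
 fixes e
 assumes T: "polyi Sym 4 T" and ab: "a ~= b" and e: "e = seg a b"
  and s: "unit_tangent e (s e)" and f: "nm e <.> s e = 0" "np e <.> s e = 0" "nm e ~= np e" "independent {nm e, np e}"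
  and va: "\<forall>d\<in>Sg_vdofs a. d T = 0" and vb: "\<forall>d\<in>Sg_vdofs b. d T = 0"
  and ed: "\<forall>d\<in>Sg_edofs s nm np e. d T = 0" and n: "n <.> s e = 0" and x: "x : e"
 shows "bf T y n x = 0"
proof -
 have sym: "bf T y z = bf T z y" for y z
  using polyi_val[OF T subspace_Sym] by (rule bf_Sym)
 have z: "bf T y z a = 0" "bf T y z b = 0" for y z
 proof -
  have "(%T. T x $ i $ j) : Sg_vdofs x" for x i j unfolding Sg_vdofs_def by blast
  with va vb have "T a $ i $ j = 0" "T b $ i $ j = 0" for i j by (metis (no_types, lifting))+
  then have "T a = 0" "T b = 0" by (simp_all add: vec_eq_iff)
  then show "bf T y z a = 0" "bf T y z b = 0" by (simp_all add: bf_def)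
 qed
 have P: "bf T y z x = 0"
  if "(y, z) : {(s e, nm e), (s e, np e), (nm e, nm e), (np e, np e), (nm e, np e)}" for y z
 proof (rule moment_zero_1[where k = 2, OF _ ab z])
  show "polyi UNIV (2 + 2) (bf T y z)" using polyi_bf[OF T] by simp
  show "M1 a b (%x. \<psi> x * bf T y z x) = 0" if "polyi UNIV 2 \<psi>" for \<psi>
   by (rule Sg_edge_moment[OF ed[unfolded e] ab that]) (use \<open>(y, z) : _\<close> e in auto)
  show "x : seg a b" using x e by simp
 qed
 have cr: "cross3 (nm e) (np e) ~= 0"
 proof
  assume "cross3 (nm e) (np e) = 0"
  then have "nm e = 0 \<or> np e = 0 \<or> (\<exists>c. np e = c *R nm e)" by (simp add: cross_eq_0 collinear_lemma)
  moreover have "0 \<notin> {nm e, np e}"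
  proof
   assume "0 : {nm e, np e}"
   then have "dependent {nm e, np e}" by (rule dependent_zero)
   then show False using f(4) by simp
  qed
  then have "nm e ~= 0" "np e ~= 0" by auto
  ultimately obtain c where "np e = c *R nm e" by blast
  then have "np e : span ({nm e, np e} - {np e})" using f(3) by (simp add: insert_Diff_if span_base span_scale)
  then show False using f(4) unfolding dependent_def by blast
 qed
 have s1: "norm (s e) = 1" using s by (simp add: unit_tangent_def)
 have sp: "\<exists>\<alpha> \<beta>. w = \<alpha> *R nm e + \<beta> *R np e" if "s e <.> w = 0" for w
  by (rule tangential_span[OF cr s1 _ _ that]) (use f in \<open>auto simp: inner_commute\<close>)
 obtain \<alpha> \<beta> where n': "n = \<alpha> *R nm e + \<beta> *R np e" using sp[of n] n by (auto simp: inner_commute)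
 obtain \<gamma> \<delta> where "Qp (s e) *v y = \<gamma> *R nm e + \<delta> *R np e" using sp[OF Qp_orth[OF s1]] by blast
 then have y': "y = (\<gamma> *R nm e + \<delta> *R np e) + (s e <.> y) *R s e" by (simp add: Qp_vec diff_eq_eq)
 show ?thesis
  by (subst y', subst n') (simp add: bf_lin P sym[of "np e" "nm e"])
qed

text \<open>Applied to differences of stresses in \<open>Sg_conf\<close>, and to \<open>ccs\<close>
  of a strain in \<open>ccs_trace\<close>. Degree 4 minus the cubic bubble leaves the weights of
  degree 1.\<close>

lemma Sg_face_trace:
 assumes T: "polyi Sym 4 T" and f: "triv f a b c" and n: "unit_normal f n"
  and s: "!!e. e : edges f ==> unit_tangent e (s e) & nm e <.> s e = 0 & np e <.> s e = 0 & nm e ~= np e & independent {nm e, np e}"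
  and vd: "!!x. x : verts f ==> \<forall>d\<in>Sg_vdofs x. d T = 0"
  and ed: "!!e. e : edges f ==> \<forall>d\<in>Sg_edofs s nm np e. d T = 0"
  and fd: "\<forall>d\<in>Sg_fdofs (%_. n) f. d T = 0" and x: "x : f"
 shows "bf T y n x = 0"
proof -
 have e1: "bf T y n x = 0" if f: "triv f a b c" and x: "x : seg a b" for a b c x
 proof -
  let ?e = "seg a b"
  have e: "?e : edges f" by (rule triv_edge[OF f])
  obtain \<kappa> where "s ?e = \<kappa> *R (b - a)"
   using unit_tangent_seg[of a b "s ?e"] s[OF e] triv_distinct[OF f] by blast
  then have "n <.> s ?e = 0" using unit_normal_triv[OF f n] by simp
  then show ?thesis
   using s[OF e] ed[OF e] vd triv_verts[OF f] x
   by (intro Sg_edge_trace[OF T triv_distinct(1)[OF f] refl, of s nm np]) auto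
 qed
 show ?thesis
 proof (rule moment_zero_2[where k = 1, OF _ f _ _ x])
  show "polyi UNIV (1 + 3) (bf T y n)" using polyi_bf[OF T] by simp
  show "bf T y n x = 0" if "x : seg a b \<union> seg b c \<union> seg a c" for x
   using that e1[OF f] e1[OF triv_swaps(3)[OF f]] e1[OF triv_swaps(2)[OF f]] by blast
  show "M2 a b c (%x. \<psi> x * bf T y n x) = 0" if \<psi>: "polyi UNIV 1 \<psi>" for \<psi>
  proof -
   have "(%x. \<psi> x *R y) : polys 1 UNIV"
    using polyi_scaleR_const[OF \<psi>, of y UNIV] by (simp only: polys_iff[OF subspace_UNIV] subspace_UNIV UNIV_I simp_thms)
   then have "(%T. face_int f (%x. (T x *v n) <.> (\<psi> x *R y))) : Sg_fdofs (%_. n) f"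
    unfolding Sg_fdofs_def by (intro CollectI exI[of _ "%x. \<psi> x *R y"]) simp
   with fd have "face_int f (%x. (T x *v n) <.> (\<psi> x *R y)) = 0" by (rule bspec)
   moreover have "(%x. (T x *v n) <.> (\<psi> x *R y)) = (%x. \<psi> x * bf T y n x)"
    by (simp add: bf_def inner_commute)
   moreover have "cont (%x. \<psi> x * bf T y n x)"
    using polyi_smooth[OF T] polyi_smooth[OF \<psi>] by (intro smooth_cont) auto
   ultimately show ?thesis using triv_cross[OF f] by (simp add: face_int_eq[OF f])
  qed
 qed
qed

section \<open>Traces determined by the degrees of freedom of the strains\<close>

text \<open>Degree 6 is added to \<open>face_dofs\<close>, so that vanishing moments force vanishing
  traces. The normals \<open>nm\<close>, \<open>np\<close> enter because the trace of
  \<open>ccs S\<close> is taken from the stress degrees of freedom.\<close>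

locale face_trace = face_dofs +
 fixes a b c :: vec3 and nm np :: "vec3 set => vec3"
 assumes P6: "polyi Sym 6 S" and T: "triv f a b c"
  and nmp: "!!e. e : edges f ==> nm e <.> s e = 0 & np e <.> s e = 0 & nm e ~= np e & independent {nm e, np e}"
begin

definition "p = b - a"
definition "q = c - a"
text \<open>The parameters range over the whole plane of \<open>f\<close>: polynomial identities on
  it may be differentiated in tangential directions, also at boundary points of
  \<open>f\<close>.\<close>

definition "X t u = a + t *R p + u *R q"

lemma pq: "cross3 p q ~= 0" "norm n = 1" "n <.> p = 0" "n <.> q = 0"
 using triv_cross[OF T] unit_normal_triv[OF T n] by (simp_all add: p_def q_def)

lemma X_shift: "X t u + h *R (\<alpha> *R p + \<beta> *R q) = X (t + h * \<alpha>) (u + h * \<beta>)"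
 by (simp add: X_def algebra_simps)

lemma f_X: assumes "x : f" obtains t u where "x = X t u"
 using triangle_param[OF T assms] unfolding X_def p_def q_def by metis

lemma X_zero:
 assumes "polyi Y k g" "subspace Y" "!!x. x : f ==> g x = 0" shows "g (X t u) = 0"
 using assms(3) T unfolding X_def p_def q_def triv_def by (intro triangle_zero[OF assms(1,2)]) blast

lemma X_cong:
 fixes g h :: "vec3 => real"
 assumes "smooth g" "smooth h" "!!t u. g (X t u) = h (X t u)"
 shows "dd (\<alpha> *R p + \<beta> *R q) g (X t u) = dd (\<alpha> *R p + \<beta> *R q) h (X t u)"
 using assms by (intro dd_cong_line) (auto simp: X_shift)

lemma X_cong_p: "smooth (g :: vec3 => real) ==> smooth h ==> (!!t u. g (X t u) = h (X t u)) ==> dd p g (X t u) = dd p h (X t u)"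
 using X_cong[of g h 1 0] by simp

lemma X_cong_q: "smooth (g :: vec3 => real) ==> smooth h ==> (!!t u. g (X t u) = h (X t u)) ==> dd q g (X t u) = dd q h (X t u)"
 using X_cong[of g h 0 1] by simp

lemma tangential: assumes "n <.> y = 0" obtains \<alpha> \<beta> where "y = \<alpha> *R p + \<beta> *R q"
 by (rule tangential_span[OF pq assms])

lemma vert_zero: "triv f x y z ==> bf S v w x = 0"
 using Th_vdofs_0(3)[OF vd] triv_verts by blast

lemma edge_ss:
 assumes "triv f x y z" "w : seg x y" shows "bf S (y - x) (y - x) w = 0"
proof -
 interpret E: edge_dofs S x y "s (seg x y)" "\<mu> (seg x y)" "\<nu> (seg x y)"
  by (rule edge[OF assms(1)])
 show ?thesis
 proof (rule moment_zero_1[where k = 4, OF _ E.ab _ _ _ assms(2)])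
  show "polyi UNIV (4 + 2) (bf S (y - x) (y - x))" using polyi_bf[OF P6] by simp
  show "M1 x y (%w. \<psi> w * bf S (y - x) (y - x) w) = 0" if "polyi UNIV 4 \<psi>" for \<psi>
   using E.E1[OF that] by (simp add: E.p_def)
 qed (use vert_zero[OF assms(1)] vert_zero[OF triv_swaps(1)[OF assms(1)]] in auto)
qed

text \<open>The difference of the two sides has degree 5 and is therefore an admissible weight for
  its own moment.\<close>

lemma edge_sv:
 assumes "triv f x y z" "w : seg x y"
 shows "2 * dd (y - x) (bf S v (y - x)) w = dd v (bf S (y - x) (y - x)) w"
proof -
 interpret E: edge_dofs S x y "s (seg x y)" "\<mu> (seg x y)" "\<nu> (seg x y)"
  by (rule edge[OF assms(1)])
 define g where "g w = 2 * dd (y - x) (bf S v (y - x)) w - dd v (bf S (y - x) (y - x)) w" for w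
 have d: "polyi UNIV 5 (dd k (bf S v w))" for k v w
  using polyi_dd[OF polyi_bf[OF P6] subspace_UNIV, of k v w] by simp
 have "polyi UNIV 5 (%w. 2 *R dd (y - x) (bf S v (y - x)) w - dd v (bf S (y - x) (y - x)) w)"
  by (intro polyi_diff polyi_scale d subspace_UNIV)
 then have g: "polyi UNIV 5 g" by (simp add: g_def[abs_def])
 have "M1 x y (%w. g w * g w) = 0" using E.E2[OF g, of v] by (simp add: E.p_def g_def)
 moreover have "cont (%w. g w * g w)" using polyi_smooth[OF g] by (intro smooth_cont smooth_mult)
 ultimately have "g w * g w = 0" using assms(2) by (intro M1_eq_0D[of "%w. g w * g w" x y w]) auto
 then show ?thesis by (simp add: g_def)
qed

text \<open>The degrees of freedom of \<open>ccs S\<close> on the face vanish with those of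
  \<open>S\<close>, and they determine the normal trace of a stress. This is the integrability
  condition for the two potentials constructed below.\<close>

lemma ccs_trace: "bf (ccs S) y n (X t u) = 0"
proof -
 have C: "polyi Sym 4 (ccs S)" using polyi_ccs[OF P6] by simp
 have "bf (ccs S) y n x = 0" if x: "x : f" for x
 proof (rule Sg_face_trace[OF C T n _ _ _ _ x])
  show "unit_tangent e (s e) & nm e <.> s e = 0 & np e <.> s e = 0 & nm e ~= np e & independent {nm e, np e}" if "e : edges f" for e
   using s nmp that by blast
  show "\<forall>d\<in>Sg_vdofs x. d (ccs S) = 0" if "x : verts f" for x by (rule ccs_vdofs[OF vd[OF that]])
  show "\<forall>d\<in>Sg_edofs s nm np e. d (ccs S) = 0" if e: "e : edges f" for e
  proof -
   obtain a' b' c' where "triv f a' b' c'" "e = seg a' b'" by (rule face_edge_cases[OF T e])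
   then show ?thesis using ccs_edofs[OF _ _ _ _, of S a' b' s e "\<mu> e" "\<nu> e" nm np] edge nmp[OF e] by blast
  qed
  show "\<forall>d\<in>Sg_fdofs (%_. n) f. d (ccs S) = 0" by (rule ccs_fdofs[OF T])
 qed
 then show ?thesis by (rule X_zero[OF polyi_bf[OF C] subspace_UNIV])
qed

lemma ccs_trace_cross:
 shows "bf (ccs S) (cross3 p q) w (X t u) = 0" and "bf (ccs S) w (cross3 p q) (X t u) = 0"
proof -
 have N: "cross3 p q = (n <.> cross3 p q) *R n" using unit_normal_cross(1)[OF pq(2-4)] by simp
 show 1: "bf (ccs S) w (cross3 p q) (X t u) = 0" for w
  by (subst N) (simp add: bf_lin ccs_trace)
 show "bf (ccs S) (cross3 p q) w (X t u) = 0"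
  using 1[of w] bf_Sym[where S = "ccs S", OF ccs_Sym[OF S symm], of w "cross3 p q"] by simp
qed

definition "A = bf S p p"
definition "B = bf S p q"
definition "C = bf S q q"

lemma ABC: "polyi UNIV 6 A" "polyi UNIV 6 B" "polyi UNIV 6 C" "bf S q p = B" "bf S p p = A" "bf S p q = B" "bf S q q = C"
 using polyi_bf[OF P6] bf_comm[of q p] unfolding A_def B_def C_def by auto

lemma ABC_smooth [simp]: "smooth A" "smooth B" "smooth C"
 using ABC polyi_smooth by blast+

text \<open>Saint-Venant's compatibility theorem in the plane. The rotation \<open>\<omega>\<close>
  of the displacement is found first; then the rows \<open>(A, B + \<omega>)\<close> and
  \<open>(B - \<omega>, C)\<close> are curl free and have the potentials \<open>v1\<close> and
  \<open>v2\<close>.\<close>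

lemma tangential_potential:
 obtains v1 v2 \<omega> where "polyi UNIV 7 v1" "polyi UNIV 7 v2" "polyi UNIV 6 \<omega>" "v1 a = 0" "v2 a = 0" "\<omega> a = 0"
  "!!t u. dd p \<omega> (X t u) = dd q A (X t u) - dd p B (X t u)"
  "!!t u. dd q \<omega> (X t u) = dd q B (X t u) - dd p C (X t u)"
  "!!t u. dd p v1 (X t u) = A (X t u)" "!!t u. dd q v1 (X t u) = B (X t u) + \<omega> (X t u)"
  "!!t u. dd p v2 (X t u) = B (X t u) - \<omega> (X t u)" "!!t u. dd q v2 (X t u) = C (X t u)"
proof -
 have d: "polyi UNIV 5 (dd k A)" "polyi UNIV 5 (dd k B)" "polyi UNIV 5 (dd k C)" for k
  using polyi_dd[OF ABC(1) subspace_UNIV, of k] polyi_dd[OF ABC(2) subspace_UNIV, of k] polyi_dd[OF ABC(3) subspace_UNIV, of k] by simp_all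
 have i: "polyi UNIV 5 (%x. dd q A x - dd p B x)" "polyi UNIV 5 (%x. dd q B x - dd p C x)"
  by (intro polyi_diff d subspace_UNIV)+
 \<comment> \<open>Equality of the mixed derivatives of \<open>\<omega>\<close> amounts to the
   vanishing of the doubly normal component of \<open>ccs S\<close>.\<close>
 have sc: "dd q (%x. dd q A x - dd p B x) (X t u) = dd p (%x. dd q B x - dd p C x) (X t u)" for t u
  using ccs_trace_cross(1)[of "cross3 p q" t u] unfolding ccs_form[OF S] ABC by (simp add: dd_diff)
 obtain \<omega>0 where \<omega>0: "polyi UNIV (Suc 5) \<omega>0" "!!t u. dd p \<omega>0 (X t u) = dd q A (X t u) - dd p B (X t u)"
  "!!t u. dd q \<omega>0 (X t u) = dd q B (X t u) - dd p C (X t u)"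
  using plane_potential[OF i pq(1), of a] sc unfolding X_def by blast
 define \<omega> where "\<omega> x = \<omega>0 x - \<omega>0 a" for x
 have \<omega>: "polyi UNIV 6 \<omega>" unfolding \<omega>_def[abs_def] using \<omega>0(1) by (intro polyi_diff polyi_const) auto
 note s\<omega> = polyi_smooth[OF \<omega>] polyi_smooth[OF \<omega>0(1)]
 have d\<omega>: "dd k \<omega> = dd k \<omega>0" for k unfolding \<omega>_def[abs_def] using s\<omega> by (simp add: dd_diff)
 have j: "polyi UNIV 6 (%x. B x + \<omega> x)" "polyi UNIV 6 (%x. B x - \<omega> x)"
  by (intro polyi.add polyi_diff ABC \<omega> subspace_UNIV)+
 have "dd q A (X t u) = dd p (%x. B x + \<omega> x) (X t u)" for t u
  using s\<omega> by (simp add: dd_add d\<omega> \<omega>0)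
 then obtain w1 where w1: "polyi UNIV (Suc 6) w1" "!!t u. dd p w1 (X t u) = A (X t u)" "!!t u. dd q w1 (X t u) = B (X t u) + \<omega> (X t u)"
  using plane_potential[OF ABC(1) j(1) pq(1), of a] unfolding X_def by blast
 have "dd q (%x. B x - \<omega> x) (X t u) = dd p C (X t u)" for t u
  using s\<omega> by (simp add: dd_diff d\<omega> \<omega>0)
 then obtain w2 where w2: "polyi UNIV (Suc 6) w2" "!!t u. dd p w2 (X t u) = B (X t u) - \<omega> (X t u)" "!!t u. dd q w2 (X t u) = C (X t u)"
  using plane_potential[OF j(2) ABC(3) pq(1), of a] unfolding X_def by blast
 define v1 v2 where "v1 x = w1 x - w1 a" and "v2 x = w2 x - w2 a" for x
 have v: "polyi UNIV 7 v1" "polyi UNIV 7 v2"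
  unfolding v1_def[abs_def] v2_def[abs_def] using w1(1) w2(1) by (auto intro!: polyi_diff polyi_const)
 have dv: "dd k v1 = dd k w1" "dd k v2 = dd k w2" for k
  unfolding v1_def[abs_def] v2_def[abs_def] using polyi_smooth[OF w1(1)] polyi_smooth[OF w2(1)] by (simp_all add: dd_diff)
 show thesis
  by (rule that[OF v \<omega>]) (simp_all add: dv w1 w2 d\<omega> \<omega>0, simp_all add: v1_def v2_def \<omega>_def)
qed

lemma seg_X:
 shows "x : seg a b ==> \<exists>t. x = X t 0 & 0 <= t & t <= 1" and "x : seg a c ==> \<exists>t. x = X 0 t & 0 <= t & t <= 1"
  and "x : seg b c ==> \<exists>t. x = X (1 - t) t"
proof -
 show "x : seg a b ==> \<exists>t. x = X t 0 & 0 <= t & t <= 1" by (erule segment_point) (auto simp: X_def p_def)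
 show "x : seg a c ==> \<exists>t. x = X 0 t & 0 <= t & t <= 1" by (erule segment_point) (auto simp: X_def q_def)
 show "x : seg b c ==> \<exists>t. x = X (1 - t) t"
 proof (erule segment_point)
  fix t :: real assume "x = pt1 b c t"
  then have "x = X (1 - t) t" by (simp add: X_def p_def q_def algebra_simps)
  then show "\<exists>t. x = X (1 - t) t" ..
 qed
qed

lemma on_seg_X:
 "0 <= t ==> t <= 1 ==> X t 0 : seg a b" "0 <= t ==> t <= 1 ==> X 0 t : seg a c"
 using on_segment[of t a b] on_segment[of t a c] by (simp_all add: X_def p_def q_def)

lemma X_ends: "X 0 0 = a" "X 1 0 = b" "X 0 1 = c" by (simp_all add: X_def p_def q_def)

text \<open>A displacement is determined by its strain up to rigid motions of the plane. Normalised
  to vanish at \<open>a\<close> together with its rotation, the one with strain \<open>S\<close>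
  vanishes on all edges and is an admissible bubble field.\<close>

lemma bubble_potential:
 obtains v where "v : bubble_polys f 4 (range ((*v) (Qp n)))" "smooth v" "!!x. x : f ==> eps_f n v x = Qp n ** S x ** Qp n"
proof -
 obtain v1 v2 \<omega> where v: "polyi UNIV 7 v1" "polyi UNIV 7 v2" and \<omega>: "polyi UNIV 6 \<omega>" and z: "v1 a = 0" "v2 a = 0" "\<omega> a = 0"
  and d\<omega>: "!!t u. dd p \<omega> (X t u) = dd q A (X t u) - dd p B (X t u)"
  "!!t u. dd q \<omega> (X t u) = dd q B (X t u) - dd p C (X t u)"
  and dv: "!!t u. dd p v1 (X t u) = A (X t u)" "!!t u. dd q v1 (X t u) = B (X t u) + \<omega> (X t u)"
  "!!t u. dd p v2 (X t u) = B (X t u) - \<omega> (X t u)" "!!t u. dd q v2 (X t u) = C (X t u)"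
  using tangential_potential by metis
 note sm [simp] = polyi_smooth[OF v(1)] polyi_smooth[OF v(2)] polyi_smooth[OF \<omega>]
 have va: "B a = 0" unfolding B_def by (rule vert_zero[OF T])
 \<comment> \<open>Along this edge \<open>v1\<close> has derivative \<open>A\<close>, which is zero
   by \<open>edge_ss\<close>. The second derivative of \<open>v2\<close> is zero by
   \<open>edge_sv\<close>, and its initial slope is zero since \<open>B\<close> and
   \<open>\<omega>\<close> vanish at \<open>a\<close>.\<close>
 have ab: "v1 x = 0 & v2 x = 0" if "x : seg a b" for x
 proof -
  obtain t where t: "x = X t 0" "0 <= t" "t <= 1" using seg_X(1)[OF \<open>x : seg a b\<close>] by blast
  have e: "X w 0 = a + w *R p" for w by (simp add: X_def)
  have A0: "A (X w 0) = 0" if "0 <= w" "w <= 1" for w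
   using edge_ss[OF T on_seg_X(1)[OF that]] by (simp add: A_def p_def)
  have "v1 (a + t *R p) = 0"
   by (rule zero_on_line) (use z t A0 in \<open>auto simp: e[symmetric] dv\<close>)
  moreover have "v2 (a + t *R p) = t * dd p v2 a"
  proof (rule affine_on_line)
   fix w :: real assume w: "0 <= w" "w <= 1"
   have "dd p (dd p v2) (X w 0) = dd p (%x. B x - \<omega> x) (X w 0)"
    by (rule X_cong_p) (auto simp: dv)
   also have "\<dots> = 2 * dd p B (X w 0) - dd q A (X w 0)" by (simp add: dd_diff d\<omega>)
   also have "\<dots> = 0"
    using edge_sv[OF T on_seg_X(1)[OF w], of q] unfolding p_def[symmetric] ABC by simp
   finally show "dd p (dd p v2) (a + w *R p) = 0" by (simp add: e)
  qed (use t z in auto)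
  moreover have "dd p v2 a = 0" using dv(3)[of 0 0] by (simp add: X_ends va z)
  ultimately show ?thesis by (simp add: t(1) e)
 qed
 have ac: "v1 x = 0 & v2 x = 0" if "x : seg a c" for x
 proof -
  obtain t where t: "x = X 0 t" "0 <= t" "t <= 1" using seg_X(2)[OF \<open>x : seg a c\<close>] by blast
  have e: "X 0 w = a + w *R q" for w by (simp add: X_def)
  note T' = triv_swaps(2)[OF T]
  have C0: "C (X 0 w) = 0" if "0 <= w" "w <= 1" for w
   using edge_ss[OF T' on_seg_X(2)[OF that]] by (simp add: C_def q_def)
  have "v2 (a + t *R q) = 0"
   by (rule zero_on_line) (use z t C0 in \<open>auto simp: e[symmetric] dv\<close>)
  moreover have "v1 (a + t *R q) = t * dd q v1 a"
  proof (rule affine_on_line)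
   fix w :: real assume w: "0 <= w" "w <= 1"
   have "dd q (dd q v1) (X 0 w) = dd q (%x. B x + \<omega> x) (X 0 w)"
    by (rule X_cong_q) (auto simp: dv)
   also have "\<dots> = 2 * dd q B (X 0 w) - dd p C (X 0 w)" by (simp add: dd_add d\<omega>)
   also have "\<dots> = 0"
    using edge_sv[OF T' on_seg_X(2)[OF w], of p] unfolding q_def[symmetric] ABC by simp
   finally show "dd q (dd q v1) (a + w *R q) = 0" by (simp add: e)
  qed (use t z in auto)
  moreover have "dd q v1 a = 0" using dv(2)[of 0 0] by (simp add: X_ends va z)
  ultimately show ?thesis by (simp add: t(1) e)
 qed
 have r: "c - b = (-1) *R p + 1 *R q" by (simp add: p_def q_def)
 have r': "c - b = q - p" by (simp add: p_def q_def)
 have bc: "v1 x = 0 & v2 x = 0" if x: "x : seg b c" for x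
 proof -
  note T' = triv_swaps(3)[OF T]
  have dr: "dd (c - b) g (X t u) = dd q g (X t u) - dd p g (X t u)" if "smooth g" for g :: "vec3 => real" and t u
   using that by (simp add: r' dd_dir_diff)
  have RR: "bf S (c - b) (c - b) = (%x. C x - 2 * B x + A x)" and PR: "bf S p (c - b) = (%x. B x - A x)"
   unfolding r' by (simp_all add: bf_lin ABC fun_eq_iff)
  \<comment> \<open>Here both end values, known from the other two edges, take the place of an
    initial slope. Afterwards \<open>v2 - v1\<close> has the derivative
    \<open>bf S (c - b) (c - b)\<close>, from which \<open>\<omega>\<close> has cancelled.\<close>
  have v10: "v1 x = 0"
  proof (rule seg_affine_zero[OF sm(1) _ _ _ x])
   show "v1 b = 0" "v1 c = 0" using ab[of b] ac[of c] by auto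
   fix x assume x: "x : seg b c"
   obtain t where t: "x = X (1 - t) t" using seg_X(3)[OF x] by blast
   have "dd (c - b) (dd (c - b) v1) (X (1 - t) t) = dd (c - b) (%x. B x + \<omega> x - A x) (X (1 - t) t)"
    unfolding r by (rule X_cong) (auto simp: r[symmetric] r' dd_dir_diff dv)
   also have "\<dots> = 2 * dd (c - b) (%x. B x - A x) (X (1 - t) t) - dd p (%x. C x - 2 * B x + A x) (X (1 - t) t)"
    by (simp add: dr dd_add dd_diff dd_cmult d\<omega>)
   also have "\<dots> = 0"
    using edge_sv[OF T' x, of p] unfolding RR PR t by simp
   finally show "dd (c - b) (dd (c - b) v1) x = 0" by (simp add: t)
  qed
  obtain h where h: "x = pt1 b c h" "h : {0..1}" using x by (rule segment_point)
  have "(%x. v2 x - v1 x) (pt1 b c h) = 0"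
  proof (rule zero_on_line)
   show "v2 b - v1 b = 0" using ab[of b] by auto
   fix w :: real assume w: "0 <= w" "w <= h"
   then have x: "pt1 b c w : seg b c" using h by (intro on_segment) auto
   obtain t where t: "pt1 b c w = X (1 - t) t" using seg_X(3)[OF x] by blast
   show "dd (c - b) (%x. v2 x - v1 x) (pt1 b c w) = 0"
    using edge_ss[OF T' x] unfolding t RR by (simp add: dr dd_diff dv)
  qed (use h in auto)
  with v10 show ?thesis by (simp add: h(1))
 qed
 obtain p' q' where d: "p' <.> p = 1" "p' <.> q = 0" "q' <.> p = 0" "q' <.> q = 1" "p' <.> cross3 p q = 0" "q' <.> cross3 p q = 0"
  by (rule triangle_plane_coords[OF pq(1)])
 \<comment> \<open>In terms of the dual basis, \<open>v1\<close> and \<open>v2\<close> are the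
   products of \<open>v\<close> with \<open>p\<close> and \<open>q\<close>.\<close>
 define v where "v x = v1 x *R p' + v2 x *R q'" for x
 have N: "cross3 p q = (n <.> cross3 p q) *R n" using unit_normal_cross(1)[OF pq(2-4)] by simp
 have "n <.> p' = 0" "n <.> q' = 0"
  using d(5,6) pq(1) by (subst (asm) (1 2) N; simp add: inner_commute; metis N scale_eq_0_iff)+
 then have "p' : range ((*v) (Qp n))" "q' : range ((*v) (Qp n))" by (metis Qp_fix rangeI)+
 then have vp: "polyi (range ((*v) (Qp n))) 7 v"
  unfolding v_def[abs_def] by (intro polyi.add polyi_scaleR_const v subspace_range_mv)
 have sv: "smooth v" by (rule polyi_smooth[OF vp])
 have dd_v: "dd y v x = dd y v1 x *R p' + dd y v2 x *R q'" for y x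
  unfolding v_def[abs_def] by (simp add: dd_add dd_scaleR)
 show thesis
 proof (rule that[OF _ sv])
  show "v : bubble_polys f 4 (range ((*v) (Qp n)))"
   using vp by (intro bubble_polysI[OF T _ subspace_range_mv]) (auto simp: v_def dest: ab ac bc)
  fix x assume "x : f"
  then obtain t u where x: "x = X t u" by (rule f_X)
  show "eps_f n v x = Qp n ** S x ** Qp n"
  proof (rule mat_eqI)
   fix y w
   obtain \<alpha> \<beta> where y: "Qp n *v y = \<alpha> *R p + \<beta> *R q" by (rule tangential[OF Qp_orth[OF pq(2)]])
   obtain \<gamma> \<delta> where w: "Qp n *v w = \<gamma> *R p + \<delta> *R q" by (rule tangential[OF Qp_orth[OF pq(2)]])
   have i: "p <.> p' = 1" "q <.> p' = 0" "p <.> q' = 0" "q <.> q' = 1" using d by (simp_all add: inner_commute)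
   have 1: "y <.> ((Qp n ** S x ** Qp n) *v w) = \<alpha> * \<gamma> * A x + (\<alpha> * \<delta> + \<beta> * \<gamma>) * B x + \<beta> * \<delta> * C x"
    unfolding Qp_conj_form y w bf_def[of S, symmetric, THEN fun_cong] 
    by (simp add: bf_lin ABC algebra_simps)
   show "y <.> (eps_f n v x *v w) = y <.> ((Qp n ** S x ** Qp n) *v w)"
    unfolding 1 eps_f_form[OF sv] y w dd_v
    by (simp add: dd_dir_add dd_dir_scaleR inner_add_left inner_add_right i x dv) (simp add: algebra_simps)
  qed
 qed
qed

text \<open>With the potential as test field the degree of freedom is the squared norm of the
  tangential part.\<close>

lemma tangential_trace: assumes x: "x : f" shows "Qp n ** S x ** Qp n = 0"
proof -
 obtain v where v: "v : bubble_polys f 4 (range ((*v) (Qp n)))" "smooth v" "!!x. x : f ==> eps_f n v x = Qp n ** S x ** Qp n"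
  using bubble_potential by blast
 have sm: "smooth (%x. Qp n ** S x ** Qp n)"
  by (rule smooth_mat) (simp add: form_axis[symmetric] Qp_conj_form S)
 have "(%S. face_int f (%x. (Qp n ** S x ** Qp n) <.> eps_f n v x)) : Th_fdofs (%_. n) s f"
  unfolding Th_fdofs_def by (rule UnI1, rule UnI1, rule UnI1, rule CollectI, rule exI[of _ v]) (simp add: v(1))
 with fd have "face_int f (%x. (Qp n ** S x ** Qp n) <.> eps_f n v x) = 0" by (rule bspec)
 moreover have "face_int f (%x. (Qp n ** S x ** Qp n) <.> eps_f n v x) = face_int f (%x. (Qp n ** S x ** Qp n) <.> (Qp n ** S x ** Qp n))"
  using sm v by (intro face_int_cong[OF T]) (auto intro!: smooth_cont)
 ultimately show ?thesis using face_int_norm_0[OF T sm _ x] by simp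
qed

text \<open>By \<open>ccs_tangential\<close> the rows of \<open>Lam\<close> are curl free on the
  plane; their potentials form a curl free pair by symmetry of \<open>Lam\<close>, and the potential
  of this pair has \<open>Lam\<close> as its Hessian.\<close>

lemma Lam_potential:
 obtains \<psi> where "polyi UNIV 7 \<psi>" "\<psi> a = 0" "\<psi> b = 0" "\<psi> c = 0"
  "!!y w t u. n <.> y = 0 ==> n <.> w = 0 ==> dd y (dd w \<psi>) (X t u) = bf (Lam n S) y w (X t u)"
proof -
 define L where "L = bf (Lam n S)"
 have L: "polyi UNIV 5 (L y w)" if "n <.> y = 0" "n <.> w = 0" for y w
 proof -
  have d: "polyi UNIV 5 (dd k (bf S v w))" for k v w
   using polyi_dd[OF polyi_bf[OF P6] subspace_UNIV, of k v w] by simp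
  show ?thesis unfolding L_def Lam_bf[OF S that] by (intro polyi_diff polyi.add d subspace_UNIV)
 qed
 have Lc: "L y w = L w y" if "n <.> y = 0" "n <.> w = 0" for y w
  unfolding L_def Lam_bf[OF S that] Lam_bf[OF S that(2,1)] by (simp add: fun_eq_iff bf_comm[of y w])
 note Lp = L[OF pq(3,3)] L[OF pq(3,4)] L[OF pq(4,4)]
 note sL [simp] = polyi_smooth[OF Lp(1)] polyi_smooth[OF Lp(2)] polyi_smooth[OF Lp(3)]
 have t: "dd p (L q w) (X t u) = dd q (L p w) (X t u)" if "n <.> w = 0" for w t u
  using ccs_tangential[OF S symm pq(3,4) that, of "X t u"] ccs_trace_cross(1)[of "cross3 w n" t u] by (simp add: L_def)
 have c1: "dd q (L p p) (X t u) = dd p (L p q) (X t u)" for t u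
  using t[OF pq(3)] Lc[OF pq(3,4)] by simp
 have c2: "dd q (L p q) (X t u) = dd p (L q q) (X t u)" for t u
  using t[OF pq(4)] by simp
 obtain \<phi>1 where \<phi>1: "polyi UNIV (Suc 5) \<phi>1" "!!t u. dd p \<phi>1 (X t u) = L p p (X t u)" "!!t u. dd q \<phi>1 (X t u) = L p q (X t u)"
  using plane_potential[OF Lp(1,2) pq(1), of a] c1 unfolding X_def by blast
 obtain \<phi>2 where \<phi>2: "polyi UNIV (Suc 5) \<phi>2" "!!t u. dd p \<phi>2 (X t u) = L p q (X t u)" "!!t u. dd q \<phi>2 (X t u) = L q q (X t u)"
  using plane_potential[OF Lp(2,3) pq(1), of a] c2 unfolding X_def by blast
 have "dd q \<phi>1 (X t u) = dd p \<phi>2 (X t u)" for t u by (simp add: \<phi>1 \<phi>2)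
 then obtain \<psi>0 where \<psi>0: "polyi UNIV (Suc (Suc 5)) \<psi>0" "!!t u. dd p \<psi>0 (X t u) = \<phi>1 (X t u)" "!!t u. dd q \<psi>0 (X t u) = \<phi>2 (X t u)"
  using plane_potential[OF \<phi>1(1) \<phi>2(1) pq(1), of a] unfolding X_def by blast
 note s\<psi> [simp] = polyi_smooth[OF \<phi>1(1)] polyi_smooth[OF \<phi>2(1)] polyi_smooth[OF \<psi>0(1)]
 obtain p' q' where d: "p' <.> p = 1" "p' <.> q = 0" "q' <.> p = 0" "q' <.> q = 1" "p' <.> cross3 p q = 0" "q' <.> cross3 p q = 0"
  by (rule triangle_plane_coords[OF pq(1)])
 \<comment> \<open>The gradient of the affine interpolant at the vertices; subtracting that
   interpolant does not change second derivatives.\<close>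
 define g where "g = (\<psi>0 b - \<psi>0 a) *R p' + (\<psi>0 c - \<psi>0 a) *R q'"
 define l where "l x = g <.> x + (\<psi>0 a - g <.> a)" for x
 have l: "polyi UNIV (Suc 0) l" unfolding l_def[abs_def] by (rule polyi_affine)
 have sl [simp]: "smooth l" by (rule polyi_smooth[OF l])
 have dl: "dd y l = (%x. g <.> y)" for y
  unfolding l_def[abs_def] by (simp add: dd_add dd_cinner dd_id fun_eq_iff)
 have lX: "l a = \<psi>0 a" "l b = \<psi>0 b" "l c = \<psi>0 c"
 proof -
  have "g <.> p = \<psi>0 b - \<psi>0 a" "g <.> q = \<psi>0 c - \<psi>0 a" using d by (simp_all add: g_def inner_add_left)
  then show "l a = \<psi>0 a" "l b = \<psi>0 b" "l c = \<psi>0 c" by (simp_all add: l_def p_def q_def inner_diff_right)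
 qed
 define \<psi> where "\<psi> x = \<psi>0 x - l x" for x
 have \<psi>: "polyi UNIV 7 \<psi>"
  unfolding \<psi>_def[abs_def] using \<psi>0(1) polyi_mono[OF _ l, of 7] by (intro polyi_diff) auto
 have d1: "dd y \<psi> = (%x. dd y \<psi>0 x - g <.> y)" for y
  unfolding \<psi>_def[abs_def] by (simp add: dd_diff dl fun_eq_iff)
 have d2: "dd y (dd w \<psi>) = dd y (dd w \<psi>0)" for y w
  unfolding d1 by (simp add: dd_diff fun_eq_iff)
 show thesis
 proof (rule that[OF \<psi>])
  show "\<psi> a = 0" "\<psi> b = 0" "\<psi> c = 0" by (simp_all add: \<psi>_def lX)
  fix y w t u assume y: "n <.> y = 0" and w: "n <.> w = 0"
  have h: "dd p (dd p \<psi>0) (X t u) = L p p (X t u)" "dd q (dd p \<psi>0) (X t u) = L p q (X t u)"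
   "dd p (dd q \<psi>0) (X t u) = L p q (X t u)" "dd q (dd q \<psi>0) (X t u) = L q q (X t u)"
   using X_cong_p[of "dd p \<psi>0" \<phi>1 t u] X_cong_q[of "dd p \<psi>0" \<phi>1 t u] X_cong_p[of "dd q \<psi>0" \<phi>2 t u] X_cong_q[of "dd q \<psi>0" \<phi>2 t u]
   by (simp_all add: \<psi>0 \<phi>1 \<phi>2)
  obtain \<alpha> \<beta> where y': "y = \<alpha> *R p + \<beta> *R q" by (rule tangential[OF y])
  obtain \<gamma> \<delta> where w': "w = \<gamma> *R p + \<delta> *R q" by (rule tangential[OF w])
  have 1: "L y w (X t u) = \<alpha> * \<gamma> * L p p (X t u) + (\<alpha> * \<delta> + \<beta> * \<gamma>) * L p q (X t u) + \<beta> * \<delta> * L q q (X t u)"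
   using Lc[OF pq(4,3)] by (simp add: y' w' L_def bf_lin algebra_simps)
  have "dd w \<psi>0 = (%x. \<gamma> * dd p \<psi>0 x + \<delta> * dd q \<psi>0 x)"
   by (simp add: w' dd_dir_add dd_dir_scaleR fun_eq_iff)
  then have "dd y (dd w \<psi>0) (X t u) = \<gamma> * (\<alpha> * L p p (X t u) + \<beta> * L p q (X t u)) + \<delta> * (\<alpha> * L p q (X t u) + \<beta> * L q q (X t u))"
   by (simp add: y' dd_dir_add dd_dir_scaleR dd_add dd_cmult h)
  then show "dd y (dd w \<psi>) (X t u) = bf (Lam n S) y w (X t u)"
   unfolding d2 L_def[symmetric] 1 by (simp add: algebra_simps)
 qed
qed

text \<open>The point is that the potential lies in \<open>Ef f\<close>, so that the last family of
  moments becomes the squared norm of \<open>Lam\<close>. It vanishes on an edge because it is zero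
  at the ends and has zero second derivative there by \<open>edge_sv\<close>.\<close>

lemma Lam_trace: assumes x: "x : f" shows "Lam n S x = 0"
proof -
 obtain \<psi> where \<psi>: "polyi UNIV 7 \<psi>" and z: "\<psi> a = 0" "\<psi> b = 0" "\<psi> c = 0"
  and dX: "!!y w t u. n <.> y = 0 ==> n <.> w = 0 ==> dd y (dd w \<psi>) (X t u) = bf (Lam n S) y w (X t u)"
  using Lam_potential by metis
 note sm [simp] = polyi_smooth[OF \<psi>]
 have d: "dd y (dd w \<psi>) x = bf (Lam n S) y w x" if "n <.> y = 0" "n <.> w = 0" "x : f" for y w x
  using dX[OF that(1,2)] f_X[OF that(3)] by metis
 have e: "\<psi> x = 0" if T': "triv f y w v" and x: "x : seg y w" for y w v x
 proof (rule seg_affine_zero[OF sm _ _ _ x])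
  have "y : {a, b, c}" "w : {a, b, c}" using triv_verts[OF T] triv_verts[OF T'] by auto
  then show "\<psi> y = 0" "\<psi> w = 0" using z by auto
  fix x assume x: "x : seg y w"
  have o: "n <.> (w - y) = 0" using unit_normal_triv[OF T' n] by simp
  have "dd (w - y) (dd (w - y) \<psi>) x = bf (Lam n S) (w - y) (w - y) x"
   by (rule d[OF o o]) (use triv_seg_sub[OF T'] x in auto)
  also have "\<dots> = 2 * dd (w - y) (bf S n (w - y)) x - dd n (bf S (w - y) (w - y)) x"
   by (simp add: Lam_bf[OF S o o] bf_comm[of n])
  also have "\<dots> = 0" using edge_sv[OF T' x, of n] by simp
  finally show "dd (w - y) (dd (w - y) \<psi>) x = 0" .
 qed
 have e1: "dd (w - y) \<psi> x = 0" if T': "triv f y w v" and x: "x : seg y w" for y w v x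
 proof -
  obtain h where h: "x = pt1 y w h" using x by (rule segment_point)
  have l: "\<psi> (pt1 y w t) = 0" for t by (rule segment_zero[OF \<psi> subspace_UNIV e[OF T']])
  have "x + t *R (w - y) = pt1 y w (h + t)" for t by (simp add: h algebra_simps)
  then have "dd (w - y) \<psi> x = dd (w - y) (%x. 0) x" by (intro dd_cong_line) (auto simp: l)
  then show ?thesis by simp
 qed
 have v0: "dd (\<alpha> *R (w - y) + \<beta> *R (v - y)) \<psi> y = 0" if T': "triv f y w v" for y w v \<alpha> \<beta>
  using e1[OF T', of y] e1[OF triv_swaps(2)[OF T'], of y] by (simp add: dd_dir_add dd_dir_scaleR)
 have "\<psi> : Ef f"
 proof (rule EfI[OF \<psi> T])
  show "\<psi> x = 0" if "x : seg a b \<union> seg b c \<union> seg a c" for x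
   using that e[OF T] e[OF triv_swaps(3)[OF T]] e[OF triv_swaps(2)[OF T]] by blast
  fix y w v assume T': "triv f y w v"
  define m where "m = conormal f (seg y w)"
  have nm: "n <.> m = 0" unfolding m_def by (rule conormal_orth_normal[OF T' n])
  have o: "n <.> (w - y) = 0" using unit_normal_triv[OF T' n] by simp
  have m0: "dd m \<psi> y = 0" using conormal_triv(4)[OF T'] v0[OF T'] unfolding m_def by metis
  have "m = conormal f (seg w y)" by (simp add: m_def closed_segment_commute)
  then have m1: "dd m \<psi> w = 0" using conormal_triv(4)[OF triv_swaps(1)[OF T']] v0[OF triv_swaps(1)[OF T']] by metis
  define k where "k = (1 / ((w - y) <.> (w - y))) *R (w - y)"
  have kw: "k <.> (w - y) = 1" using triv_distinct(1)[OF T'] by (simp add: k_def)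
  \<comment> \<open>\<open>\<theta>\<close> has derivative 1 along the edge. Integration by parts
    turns the mean of the conormal derivative into a moment that \<open>Lam_edge\<close>
    annihilates; at the vertices all tangential derivatives of the potential are zero.\<close>
  define \<theta> where "\<theta> x = k <.> x + 0" for x
  have \<theta>: "polyi UNIV 1 \<theta>" unfolding \<theta>_def[abs_def] using polyi_affine[of k 0] by simp
  have d\<theta>: "dd (w - y) \<theta> = (%x. 1)" unfolding \<theta>_def[abs_def] by (simp add: dd_cinner dd_id kw fun_eq_iff)
  have "M1 y w (%x. \<theta> x * dd (w - y) (dd m \<psi>) x) = M1 y w (%x. \<theta> x * bf (Lam n S) (w - y) m x)"
   using d[OF o nm] triv_seg_sub[OF T'] by (intro M1_cong) auto
  also have "\<dots> = 0" by (rule Lam_edge[OF T' nm \<theta>])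
  finally have "M1 y w (%x. \<theta> x * dd (w - y) (dd m \<psi>) x) = 0" .
  then show "M1 y w (dd (conormal f (seg y w)) \<psi>) = 0"
   using M1_parts[OF polyi_smooth[OF \<theta>], of "dd m \<psi>" y w] by (simp add: m0 m1 d\<theta> m_def[symmetric])
 qed
 then have "(%S. face_int f (%x. Lam n S x <.> hess_f n \<psi> x)) : Th_fdofs (%_. n) s f"
  unfolding Th_fdofs_def by (intro UnI2 CollectI exI[of _ \<psi>]) simp
 with fd have "face_int f (%x. Lam n S x <.> hess_f n \<psi> x) = 0" by (rule bspec)
 moreover have "hess_f n \<psi> x = Lam n S x" if "x : f" for x
 proof (rule mat_eqI)
  fix y w
  have o: "n <.> (Qp n *v y) = 0" "n <.> (Qp n *v w) = 0" by (rule Qp_orth[OF pq(2)])+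
  show "y <.> (hess_f n \<psi> x *v w) = y <.> (Lam n S x *v w)"
   unfolding hess_f_form[OF sm] Lam_form[OF S] d[OF o that] Lam_bf[OF S o] ..
 qed
 then have "face_int f (%x. Lam n S x <.> hess_f n \<psi> x) = face_int f (%x. Lam n S x <.> Lam n S x)"
  using smooth_Lam[OF S] smooth_hess_f[OF sm] by (intro face_int_cong[OF T]) (auto intro!: smooth_cont)
 ultimately show ?thesis using face_int_norm_0[OF T smooth_Lam[OF S] _ x] by simp
qed

end

section \<open>Integration over the mesh\<close>

lemma in_tetra:
 fixes a b c d :: vec3
 assumes "0 <= t" "0 <= u" "0 <= w" "t + u + w <= 1"
 shows "pt2 a b c t u + w *R (d - a) : hull4 a b c d"
proof (cases "w = 1")
 case True
 then have "t = 0" "u = 0" using assms by auto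
 with True show ?thesis by (simp add: hull_inc)
next
 case False
 define k where "k = 1 - w"
 have k: "k > 0" using False assms by (simp add: k_def)
 let ?z = "pt2 a b c (t / k) (u / k)"
 have "t / k + u / k <= 1" using k assms by (simp add: add_divide_distrib[symmetric] k_def)
 then have "?z : hull3 a b c" using k assms by (intro in_triangle) auto
 then have z: "?z : hull4 a b c d" using hull_mono[of "{a, b, c}" "{a, b, c, d}" convex] by blast
 have "k *R ?z + w *R d : hull4 a b c d"
  using k assms by (intro convexD[OF convex_convex_hull z]) (auto simp: hull_inc k_def)
 moreover have "k *R ?z = k *R a + t *R (b - a) + u *R (c - a)"
  using k by (simp add: scaleR_right_distrib)
 then have "k *R ?z + w *R d = pt2 a b c t u + w *R (d - a)"
  by (simp add: k_def algebra_simps)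
 ultimately show ?thesis by simp
qed

text \<open>The segment from the centre of the common face to \<open>d\<close> starts inside \<open>K'\<close>, and \<open>K \<inter> K'\<close> is a
 face of \<open>K\<close>.\<close>
lemma same_side:
 assumes K: "tetv K a b c d" and K': "tetv K' a b c d'" and F: "(K \<inter> K') face_of K"
  and n: "n <.> (b - a) = 0" "n <.> (c - a) = 0" and side: "(n <.> (d - a)) * (n <.> (d' - a)) > 0"
 shows "d : K'"
proof -
 obtain \<alpha> \<beta> \<gamma> where d: "d - a = \<alpha> *R (b - a) + \<beta> *R (c - a) + \<gamma> *R (d' - a)" by (rule tetv_basis[OF K'])
 have "n <.> (d - a) = \<gamma> * (n <.> (d' - a))" by (simp add: d n inner_add_right)
 with side have "\<gamma> * (n <.> (d' - a))\<^sup>2 > 0" by (simp add: power2_eq_square)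
 then have \<gamma>: "\<gamma> > 0" by (simp add: zero_less_mult_iff)
 define M where "M = 1 + \<bar>\<alpha>\<bar> + \<bar>\<beta>\<bar> + \<bar>\<gamma>\<bar>"
 \<comment> \<open>Small enough for the barycentric coordinates of \<open>x\<close> with respect to
   \<open>K'\<close> to stay nonnegative.\<close>
 define t where "t = 1 / (6 * M)"
 have M: "M \<ge> 1" by (simp add: M_def)
 have t: "0 < t" "t < 1" "t * M = 1 / 6" using M by (simp_all add: t_def)
 have tM: "t * (1 + \<bar>\<alpha>\<bar> + \<bar>\<beta>\<bar> + \<bar>\<gamma>\<bar>) = 1/6" using t(3) by (simp add: M_def)
 have ta: "t * \<alpha> <= t * \<bar>\<alpha>\<bar>" "- (t * \<alpha>) <= t * \<bar>\<alpha>\<bar>" "t * \<beta> <= t * \<bar>\<beta>\<bar>" "- (t * \<beta>) <= t * \<bar>\<beta>\<bar>" "t * \<gamma> <= t * \<bar>\<gamma>\<bar>"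
  using t mult_left_mono[of "- \<alpha>" "\<bar>\<alpha>\<bar>" t] mult_left_mono[of "- \<beta>" "\<bar>\<beta>\<bar>" t] by (simp_all add: mult_left_mono)
 have tp: "0 <= t * \<bar>\<alpha>\<bar>" "0 <= t * \<bar>\<beta>\<bar>" "0 <= t * \<bar>\<gamma>\<bar>" using t by simp_all
 define g where "g = pt2 a b c (1/3) (1/3)"
 have gf: "g : hull3 a b c" unfolding g_def by (rule in_triangle) auto
 have gK: "g : K" "g : K'"
  using gf hull_mono[of "{a, b, c}" "{a, b, c, d}" convex] hull_mono[of "{a, b, c}" "{a, b, c, d'}" convex] K K'
  by (auto simp: tetv_def)
 have dK: "d : K" using K by (simp add: tetv_def hull_inc)
 define x where "x = (1 - t) *R g + t *R d"
 have "d = a + (\<alpha> *R (b - a) + \<beta> *R (c - a) + \<gamma> *R (d' - a))" using d by (simp add: algebra_simps)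
 then have "x = a + ((1 - t) / 3 + t * \<alpha>) *R (b - a) + ((1 - t) / 3 + t * \<beta>) *R (c - a) + (t * \<gamma>) *R (d' - a)"
  unfolding x_def g_def
  by (simp only: scaleR_right_distrib scaleR_left_distrib scaleR_scaleR)
    (simp add: algebra_simps)
 also have "\<dots> : K'"
 proof -
  have tM': "t + t * \<bar>\<alpha>\<bar> + t * \<bar>\<beta>\<bar> + t * \<bar>\<gamma>\<bar> = 1 / 6" using tM by (simp only: distrib_left mult_1_right)
  have "0 <= (1 - t) / 3 + t * \<alpha>" "0 <= (1 - t) / 3 + t * \<beta>" "0 <= t * \<gamma>"
   "((1 - t) / 3 + t * \<alpha>) + ((1 - t) / 3 + t * \<beta>) + t * \<gamma> <= 1"
  proof -
   define A B G where "A = t * \<bar>\<alpha>\<bar>" and "B = t * \<bar>\<beta>\<bar>" and "G = t * \<bar>\<gamma>\<bar>"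
   note * = ta[folded A_def B_def G_def] tM'[folded A_def B_def G_def] tp[folded A_def B_def G_def] t(1,2)
   have "(1 - t) / 3 = 1/3 - t/3" by (simp add: diff_divide_distrib)
   then show "0 <= (1 - t) / 3 + t * \<alpha>" "0 <= (1 - t) / 3 + t * \<beta>"
    "((1 - t) / 3 + t * \<alpha>) + ((1 - t) / 3 + t * \<beta>) + t * \<gamma> <= 1"
    using * by linarith+
   show "0 <= t * \<gamma>" using t \<gamma> by simp
  qed
  then show ?thesis using K' unfolding tetv_def by (metis in_tetra)
 qed
 finally have xK': "x : K'" .
 have "x : K" unfolding x_def using K gK dK t by (auto simp: tetv_def intro!: convexD[OF convex_convex_hull])
 then have xF: "x : K \<inter> K'" using xK' by blast
 have "n <.> (d - g) ~= 0" using side n by (auto simp: g_def inner_diff_right inner_add_right)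
 then have "g ~= d" by auto
 then have "x : open_segment g d" using t by (auto simp: x_def in_segment)
 with F xF gK dK show ?thesis unfolding face_of_def by blast
qed

section \<open>The triangulated domain\<close>

locale mesh =
 fixes \<Omega> :: "vec3 set" and \<T> :: "vec3 set set" and n s nm np \<mu> \<nu> :: "vec3 set => vec3"
 assumes domain: "polyhedral_domain \<Omega>" and mesh: "simplicial_mesh \<Omega> \<T>" and frame: "frame_choice \<T> n s nm np \<mu> \<nu>"
begin

lemma finite_mesh: "finite \<T>" and Union_mesh: "\<Union>\<T> = closure \<Omega>" and open_domain: "open \<Omega>"
 and mesh_face: "K : \<T> ==> K' : \<T> ==> (K \<inter> K') face_of K"
 using mesh domain by (simp_all add: simplicial_mesh_def triangulation_def polyhedral_domain_def)

lemma mesh_tetv: assumes "K : \<T>" obtains a b c d where "tetv K a b c d"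
 using mesh assms simplex_3_tetv unfolding simplicial_mesh_def by metis

lemma mesh_compact: "K : \<T> ==> compact K" and mesh_convex: "K : \<T> ==> convex K" and mesh_closed: "K : \<T> ==> closed K"
 by (metis mesh_tetv tetv_compact, metis mesh_tetv tetv_def convex_convex_hull, metis mesh_tetv tetv_compact compact_imp_closed)

lemma mesh_interior: assumes "K : \<T>" shows "interior K ~= {}"
proof
 assume 0: "interior K = {}"
 have "3 simplex K" using mesh assms by (simp add: simplicial_mesh_def)
 then have "aff_dim K = 3" by (rule aff_dim_simplex)
 then have "affine hull K = UNIV" using aff_dim_eq_full[of K] by simp
 then have "rel_interior K = interior K" by (rule rel_interior_interior)
 moreover have "rel_interior K ~= {}"
  using mesh_convex[OF assms] rel_interior_eq_empty \<open>aff_dim K = 3\<close> by fastforce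
 ultimately show False using 0 by simp
qed

text \<open>A face of \<open>K\<close> that meets the relative interior of \<open>K\<close> is all
  of \<open>K\<close>; applied to the common face this gives both inclusions.\<close>

lemma mesh_interior_unique:
 assumes K: "K : \<T>" "K' : \<T>" and x: "x : interior K" "x : K'" shows "K = K'"
proof -
 have sub: "K \<subseteq> K'" if K: "K : \<T>" "K' : \<T>" and x: "x : interior K" "x : K'" for K K'
 proof -
  have "rel_interior K = interior K" using x by (intro rel_interior_nonempty_interior) auto
  then have "(K \<inter> K') \<inter> rel_interior K ~= {}" using x interior_subset by fastforce
  then show ?thesis using subset_of_face_of[OF mesh_face[OF K] order_refl] by blast
 qed
 have "K \<subseteq> K'" by (rule sub[OF K x])
 moreover have "x : interior K'" using interior_mono[OF \<open>K \<subseteq> K'\<close>] x by blast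
 then have "K' \<subseteq> K" using x interior_subset by (intro sub[OF K(2,1)]) auto
 ultimately show ?thesis by blast
qed

lemma glue_eq: assumes "K : \<T>" "x : interior K" shows "glue \<T> u x = u K x"
proof -
 have "(THE K. K : \<T> & x : interior K) = K"
  using assms interior_subset mesh_interior_unique by (intro the_equality) blast+
 with assms show ?thesis by (auto simp: glue_def)
qed

text \<open>The mesh covers \<open>closure \<Omega>\<close>, whereas the function spaces integrate
  over \<open>\<Omega>\<close>.\<close>

lemma negligible_frontier: "negligible (closure \<Omega> - \<Omega>)"
proof -
 obtain F where F: "finite F" "\<forall>P\<in>F. polytope P & aff_dim P = 2" "frontier \<Omega> = \<Union>F"
  using domain by (auto simp: polyhedral_domain_def)
 have "negligible P" if P: "P : F" for P
 proof -
  have "interior P = {}"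
  proof (rule ccontr)
   assume "interior P ~= {}"
   then have "aff_dim P = int DIM(vec3)" by (rule aff_dim_nonempty_interior)
   with F P show False by simp
  qed
  then show ?thesis using F P polytope_imp_convex negligible_convex_interior by blast
 qed
 then have "negligible (frontier \<Omega>)" unfolding F(3) using F(1) by (intro negligible_Union) auto
 then show ?thesis by (rule negligible_subset) (use open_domain interior_open in \<open>auto simp: frontier_def\<close>)
qed

text \<open>Reduces integrals of glued functions to sums over tetrahedra. The values of
  \<open>h\<close> are prescribed only in the interiors, hence the frontiers of the tetrahedra and
  of the domain have to be negligible.\<close>

lemma LINT_pieces:
 fixes h :: "vec3 => real"
 assumes h: "!!K x. K : \<T> ==> x : interior K ==> h x = g K x" and g: "!!K. K : \<T> ==> cont (g K)"
 shows "integrable (lebesgue_on \<Omega>) h" and "(LINT x|lebesgue_on \<Omega>. h x) = (\<Sum>K\<in>\<T>. integral K (g K))"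
proof -
 have fr: "negligible (frontier K)" if "K : \<T>" for K
  by (rule negligible_convex_frontier[OF mesh_convex[OF that]])
 have eq: "h x = g K x" if "K : \<T>" "x : K - frontier K" for K x
 proof -
  have "x : interior K" using that(2) closure_subset[of K] by (auto simp: frontier_def)
  then show ?thesis by (rule h[OF that(1)])
 qed
 have gK: "g K absolutely_integrable_on K" if "K : \<T>" for K
  using mesh_compact[OF that] g[OF that] by (intro compact_absolutely_integrable) (auto intro: continuous_on_subset)
 have hK: "h absolutely_integrable_on K" if "K : \<T>" for K
  by (rule absolutely_integrable_spike[OF gK[OF that] fr[OF that] eq[OF that]])
 have iK: "(h has_integral integral K (g K)) K" if "K : \<T>" for K
  by (rule has_integral_spike[OF fr[OF that] eq[OF that] integrable_integral[OF set_lebesgue_integral_eq_integral(1)[OF gK[OF that]]]])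
 have U: "h absolutely_integrable_on \<Union>A" if "finite A" "A \<subseteq> \<T>" for A
  using that by (induction A) (auto intro: absolutely_integrable_Un[OF hK])
 have nn: "pairwise (%K K'. negligible (K \<inter> K')) \<T>"
 proof (rule pairwiseI)
  fix K K' assume K: "K : \<T>" "K' : \<T>" "K ~= K'"
  have "K \<inter> K' \<subseteq> frontier K"
   using mesh_interior_unique[OF K(1,2)] K(3) closure_subset[of K] unfolding frontier_def by blast
  then show "negligible (K \<inter> K')" using fr[OF K(1)] negligible_subset by blast
 qed
 have I: "(h has_integral (\<Sum>K\<in>\<T>. integral K (g K))) (\<Union>\<T>)"
  by (rule has_integral_Union[OF finite_mesh iK nn])
 have n: "negligible {x : \<Union>\<T> - \<Omega>. h x ~= 0}" "negligible {x : \<Omega> - \<Union>\<T>. h x ~= 0}"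
 proof -
  show "negligible {x : \<Union>\<T> - \<Omega>. h x ~= 0}"
   by (rule negligible_subset[OF negligible_frontier]) (auto simp: Union_mesh)
  have "{x : \<Omega> - \<Union>\<T>. h x ~= 0} = {}" unfolding Union_mesh using closure_subset[of \<Omega>] by blast
  then show "negligible {x : \<Omega> - \<Union>\<T>. h x ~= 0}" by (simp only: negligible_empty)
 qed
 have Om: "\<Omega> : sets lebesgue" using open_domain by simp
 have "h absolutely_integrable_on \<Omega>"
  using U[OF finite_mesh order_refl] Om closure_subset unfolding Union_mesh by (rule set_integrable_subset)
 then show *: "integrable (lebesgue_on \<Omega>) h"
  using Om by (simp add: integrable_restrict_space set_integrable_def)
 have "(h has_integral (\<Sum>K\<in>\<T>. integral K (g K))) \<Omega>"
  using I has_integral_spike_set_eq[OF n] by blast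
 then show "(LINT x|lebesgue_on \<Omega>. h x) = (\<Sum>K\<in>\<T>. integral K (g K))"
  unfolding lebesgue_integral_eq_integral[OF * Om] by (rule integral_unique)
qed

lemma L2_glue:
 fixes u :: "vec3 set => vec3 => 'b::euclidean_space"
 assumes u: "!!K. K : \<T> ==> cont (u K)" shows "L2 \<Omega> (glue \<T> u)"
proof -
 have "(%x. glue \<T> u x <.> i) : borel_measurable (lebesgue_on \<Omega>)" for i
 proof -
  have "cont (%x. u K x <.> i)" if "K : \<T>" for K
   using u[OF that] by (intro continuous_on_inner continuous_on_const)
  then have "integrable (lebesgue_on \<Omega>) (%x. glue \<T> u x <.> i)"
   using LINT_pieces(1)[of "%x. glue \<T> u x <.> i" "%K x. u K x <.> i"] glue_eq[of _ _ u] by simp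
  then show ?thesis by (rule borel_measurable_integrable)
 qed
 moreover have "cont (%x. (norm (u K x))\<^sup>2)" if "K : \<T>" for K
  using u[OF that] by (intro continuous_on_power continuous_on_norm)
 then have "integrable (lebesgue_on \<Omega>) (%x. (norm (glue \<T> u x))\<^sup>2)"
  using LINT_pieces(1)[of "%x. (norm (glue \<T> u x))\<^sup>2" "%K x. (norm (u K x))\<^sup>2"] glue_eq[of _ _ u] by simp
 ultimately show ?thesis unfolding L2_def by (subst borel_measurable_euclidean_space) blast
qed

lemma mesh_normal: "K : \<T> ==> f : faces K ==> unit_normal f (n f)"
 using frame by (simp add: frame_choice_def)

text \<open>Two tetrahedra on the same side of a common face contain each other's opposite vertices,
  by \<open>same_side\<close>.\<close>

lemma osign_unique:
 assumes K: "K : \<T>" "K' : \<T>" and f: "f : faces K" "f : faces K'" and eq: "osign (n f) K f = osign (n f) K' f"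
 shows "K = K'"
proof -
 have nf: "unit_normal f (n f)" by (rule mesh_normal[OF K(1) f(1)])
 obtain a b c d where T: "tetv K a b c d" and f1: "f = hull3 a b c" using mesh_tetv[OF K(1)] face_cases[OF _ f(1)] by metis
 obtain a' b' c' d' where T0: "tetv K' a' b' c' d'" and f2: "f = convex hull {a', b', c'}" using mesh_tetv[OF K(2)] face_cases[OF _ f(2)] by metis
 have "{a, b, c} = {a', b', c'}" using triv_hull_eq[OF tetv_triv[OF T] tetv_triv[OF T0]] f1 f2 by simp
 then have T': "tetv K' a b c d'" by (intro tetv_perm[OF T0]) auto
 note t = unit_normal_triv[OF tetv_triv[OF T] nf[unfolded f1]]
 have o: "osign (n f) K f * (n f <.> (d - a)) = - \<bar>n f <.> (d - a)\<bar>" "n f <.> (d - a) ~= 0"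
  "osign (n f) K f * (n f <.> (d' - a)) = - \<bar>n f <.> (d' - a)\<bar>" "n f <.> (d' - a) ~= 0"
  using osign_tetv(1,3)[OF T nf[unfolded f1]] osign_tetv(1,3)[OF T' nf[unfolded f1]] eq by (simp_all add: f1)
 have "(osign (n f) K f * osign (n f) K f) * ((n f <.> (d - a)) * (n f <.> (d' - a))) = \<bar>n f <.> (d - a)\<bar> * \<bar>n f <.> (d' - a)\<bar>"
  using arg_cong2[OF o(1,3), of "(*)"] by (simp only: mult_ac minus_mult_minus)
 then have side: "(n f <.> (d - a)) * (n f <.> (d' - a)) > 0" using o(2,4) by simp
 have n2: "n f <.> (b - a) = 0" "n f <.> (c - a) = 0" using t by (simp_all add: f1)
 have d: "d : K'" by (rule same_side[OF T T' mesh_face[OF K] n2 side])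
 have d': "d' : K" by (rule same_side[OF T' T mesh_face[OF K(2,1)] n2]) (use side in \<open>simp add: mult.commute\<close>)
 have "K \<subseteq> K'" unfolding T[unfolded tetv_def, THEN conjunct1]
  using d T' mesh_convex[OF K(2)] by (intro hull_minimal) (auto simp: tetv_def hull_inc)
 moreover have "K' \<subseteq> K" unfolding T'[unfolded tetv_def, THEN conjunct1]
  using d' T mesh_convex[OF K(1)] by (intro hull_minimal) (auto simp: tetv_def hull_inc)
 ultimately show ?thesis by blast
qed

text \<open>A point of \<open>\<Omega>\<close> in the relative interior of \<open>f\<close> is
  pushed off \<open>f\<close> to the wanted side; the tetrahedron that contains the pushed point has
  \<open>f\<close> as a face.\<close>

lemma osign_exists:
 assumes K0: "K0 : \<T>" and f: "f : faces K0" and x: "x : f" "x : \<Omega>" and \<sigma>: "\<sigma> = 1 \<or> \<sigma> = - 1"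
 shows "\<exists>K\<in>\<T>. f : faces K & osign (n f) K f = \<sigma>"
proof -
 have nf: "unit_normal f (n f)" by (rule mesh_normal[OF K0 f])
 have ff: "f face_of K0" "aff_dim f = 2" using f by (simp_all add: faces_def)
 have "closure (rel_interior f) = closure f" by (rule convex_closure_rel_interior[OF face_of_imp_convex[OF ff(1) ]])
 then have "\<Omega> \<inter> closure (rel_interior f) ~= {}" using x closure_subset by blast
 then obtain y where y: "y : \<Omega>" "y : rel_interior f" using open_Int_closure_eq_empty[OF open_domain] by blast
 have yf: "y : f" using y rel_interior_subset by blast
 \<comment> \<open>Removing the closed tetrahedra that miss \<open>y\<close> ensures that any
   tetrahedron containing a point of \<open>U\<close> also contains \<open>y\<close>.\<close>
 define U where "U = \<Omega> - \<Union>{K : \<T>. y \<notin> K}"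
 have "open U" unfolding U_def using finite_mesh mesh_closed by (intro open_Diff open_domain closed_Union) auto
 moreover have "y : U" using y by (auto simp: U_def)
 ultimately obtain e where e: "e > 0" "ball y e \<subseteq> U" by (rule openE)
 define z where "z = y - (\<sigma> * (e / 2)) *R n f"
 have n1: "norm (n f) = 1" using nf by (simp add: unit_normal_def)
 have "z : ball y e" using e \<sigma> n1 by (auto simp: z_def dist_norm)
 then have zU: "z : U" using e by blast
 then have "z : \<Union>\<T>" using closure_subset unfolding Union_mesh U_def by blast
 then obtain K where K: "K : \<T>" "z : K" by blast
 have yK: "y : K" using zU K by (auto simp: U_def)
 have "(K0 \<inter> K) \<inter> rel_interior f ~= {}" using y yf yK face_of_imp_subset[OF ff(1)] by blast
 then have sub: "f \<subseteq> K0 \<inter> K" using subset_of_face_of[OF mesh_face[OF K0 K(1)] face_of_imp_subset[OF ff(1)]] by blast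
 then have "f face_of (K0 \<inter> K)" using face_of_subset[OF ff(1)] by blast
 moreover have "(K0 \<inter> K) face_of K" using mesh_face[OF K(1) K0] by (simp add: Int_commute)
 ultimately have fK: "f : faces K" using ff(2) face_of_trans unfolding faces_def by blast
 obtain a b c d where T: "tetv K a b c d" and f1: "f = hull3 a b c" using mesh_tetv[OF K(1)] face_cases[OF _ fK] by metis
 have nz: "n f <.> (z - y) = - (\<sigma> * (e / 2))" using n1 by (simp add: z_def dot_square_norm)
 have "osign (n f) K f = \<sigma>"
 proof (cases "\<sigma> = 1")
  case False
  then have "n f <.> (z - y) > 0" using \<sigma> e nz by auto
  then have "\<not> (\<forall>x\<in>K. \<forall>y\<in>f. n f <.> (x - y) <= 0)" using K yf by fastforce
  then show ?thesis using False \<sigma> by (simp add: osign_def)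
 next
  case True
  show ?thesis
  proof (rule ccontr)
   assume "osign (n f) K f ~= \<sigma>"
   then have "osign (n f) K f = - 1" using True by (simp add: osign_def split: if_splits)
   then have d: "n f <.> (d - a) \<ge> 0" using osign_tetv(1)[OF T nf[unfolded f1]] by (simp add: f1)
   have "a : f" "b : f" "c : f" by (simp_all add: f1 hull_inc)
   then have i: "n f <.> (a - y) = 0" "n f <.> (b - y) = 0" "n f <.> (c - y) = 0" using nf yf by (auto simp: unit_normal_def)
   have "K \<subseteq> {x. n f <.> x \<ge> n f <.> y}"
    unfolding T[unfolded tetv_def, THEN conjunct1]
    using i d by (intro hull_minimal convex_halfspace_ge) (auto simp: inner_diff_right)
   then have "n f <.> (z - y) \<ge> 0" using K by (auto simp: inner_diff_right)
   with nz True e show False by simp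
  qed
 qed
 with K fK show ?thesis by blast
qed

definition "around f = {K : \<T>. f : faces K}"

lemma finite_around: "finite (around f)"
 unfolding around_def using finite_mesh by simp

text \<open>A face that meets \<open>\<Omega>\<close> lies between exactly two tetrahedra, one on
  each side.\<close>

lemma osign_sum:
 assumes K0: "K0 : \<T>" and f: "f : faces K0" and x: "f \<inter> \<Omega> ~= {}"
 shows "(\<Sum>K\<in>around f. osign (n f) K f) = 0"
proof -
 obtain x where x: "x : f" "x : \<Omega>" using x by blast
 obtain K1 where K1: "K1 : \<T>" "f : faces K1" "osign (n f) K1 f = 1" using osign_exists[OF K0 f x] by blast
 obtain K2 where K2: "K2 : \<T>" "f : faces K2" "osign (n f) K2 f = - 1" using osign_exists[OF K0 f x] by blast
 have "around f = {K1, K2}"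
 proof
  show "{K1, K2} \<subseteq> around f" using K1 K2 by (simp add: around_def)
  show "around f \<subseteq> {K1, K2}"
  proof
   fix K assume "K : around f"
   then have K: "K : \<T>" "f : faces K" by (simp_all add: around_def)
   have "osign (n f) K f = 1 \<or> osign (n f) K f = - 1" by (simp add: osign_def)
   then show "K : {K1, K2}" using osign_unique[OF K(1) K1(1) K(2) K1(2)] osign_unique[OF K(1) K2(1) K(2) K2(2)] K1 K2 by auto
  qed
 qed
 moreover have "K1 ~= K2" using K1 K2 by auto
 ultimately show ?thesis using K1 K2 by simp
qed

definition "mesh_faces = (\<Union>K\<in>\<T>. faces K)"

lemma finite_faces: "K : \<T> ==> finite (faces K)"
 by (metis mesh_tetv tetv_faces finite.emptyI finite.insertI)

lemma finite_mesh_faces: "finite mesh_faces"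
 unfolding mesh_faces_def using finite_mesh finite_faces by blast

lemma face_sum_swap: "(\<Sum>K\<in>\<T>. \<Sum>f\<in>faces K. h K f) = (\<Sum>f\<in>mesh_faces. \<Sum>K\<in>around f. (h K f :: real))"
proof -
 have "(\<Sum>K\<in>\<T>. \<Sum>f\<in>faces K. h K f) = (\<Sum>K\<in>\<T>. \<Sum>f | f : mesh_faces & f : faces K. h K f)"
  by (intro sum.cong refl) (auto simp: mesh_faces_def)
 also have "\<dots> = (\<Sum>f\<in>mesh_faces. \<Sum>K | K : \<T> & f : faces K. h K f)"
  by (rule sum.swap_restrict[OF finite_mesh finite_mesh_faces])
 finally show ?thesis by (simp add: around_def)
qed

text \<open>The cancellation common to the first order integrations by parts: faces meeting
  \<open>\<Omega>\<close> occur twice with opposite signs, the remaining ones lie where test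
  functions vanish.\<close>

lemma mesh_sum:
 fixes H :: "vec3 set => vec3 set => real"
 assumes c: "!!K K' f. K : \<T> ==> K' : \<T> ==> f : faces K ==> f : faces K' ==> f \<inter> \<Omega> ~= {} ==> H K f = H K' f"
  and z: "!!K f. K : \<T> ==> f : faces K ==> f \<inter> \<Omega> = {} ==> H K f = 0"
 shows "(\<Sum>K\<in>\<T>. \<Sum>f\<in>faces K. osign (n f) K f * H K f) = 0"
 unfolding face_sum_swap
proof (rule sum.neutral, rule ballI)
 fix f assume "f : mesh_faces"
 then obtain K0 where K0: "K0 : \<T>" "f : faces K0" by (auto simp: mesh_faces_def)
 show "(\<Sum>K\<in>around f. osign (n f) K f * H K f) = 0"
 proof (cases "f \<inter> \<Omega> = {}")
  case True
  then show ?thesis using z by (auto simp: around_def intro!: sum.neutral)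
 next
  case False
  have "(\<Sum>K\<in>around f. osign (n f) K f * H K f) = (\<Sum>K\<in>around f. osign (n f) K f * H K0 f)"
   using c[OF _ K0(1) _ K0(2) False] by (intro sum.cong) (auto simp: around_def)
  then show ?thesis using osign_sum[OF K0 False] by (simp add: sum_distrib_right[symmetric])
 qed
qed

end

section \<open>Additivity of the degrees of freedom\<close>

text \<open>The form of linearity used below. Degrees of freedom are evaluated on smooth fields, and
  only differences are formed: of two pieces, or of a field and its interpolant.\<close>

definition sub_op :: "((vec3 => 'a::real_normed_vector) => vec3 => 'b::real_normed_vector) => bool" where
 "sub_op L \<longleftrightarrow> (\<forall>u v. smooth u \<longrightarrow> smooth v \<longrightarrow> L (%x. u x - v x) = (%x. L u x - L v x)) & (\<forall>u. smooth u \<longrightarrow> smooth (L u))"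

definition subtractive :: "((vec3 => 'a::real_normed_vector) => real) => bool" where
 "subtractive d \<longleftrightarrow> (\<forall>u v. smooth u \<longrightarrow> smooth v \<longrightarrow> d (%x. u x - v x) = d u - d v)"

lemma sub_opI:
 "(!!u v x. smooth u ==> smooth v ==> L (%x. u x - v x) x = L u x - L v x) ==> (!!u. smooth u ==> smooth (L u)) ==> sub_op L"
 unfolding sub_op_def by blast

lemma sub_op_diff: "sub_op L ==> smooth u ==> smooth v ==> L (%x. u x - v x) = (%x. L u x - L v x)"
 and sub_op_smooth: "sub_op L ==> smooth u ==> smooth (L u)"
 by (auto simp: sub_op_def)

lemma subtractiveD: "subtractive d ==> smooth u ==> smooth v ==> d (%x. u x - v x) = d u - d v"
 by (simp add: subtractive_def)

lemma sub_op_id: "sub_op (%w. w)"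
 by (simp add: sub_op_def)

lemma sub_op_comp: "sub_op L ==> sub_op M ==> sub_op (%w. M (L w))"
 by (auto simp: sub_op_def)

lemma sub_op_lin: "bounded_linear f ==> sub_op (%w x. f (w x))"
 by (rule sub_opI) (auto simp: bounded_linear.linear linear_diff intro: smooth_linear)

lemma sub_op_then_lin: "sub_op L ==> bounded_linear f ==> sub_op (%w x. f (L w x))"
 using sub_op_comp[OF _ sub_op_lin] by blast

lemma sub_op_dd: "sub_op (dd v)"
 by (rule sub_opI) (auto simp: dd_diff)

lemma sub_op_eps: "sub_op eps"
proof (rule sub_opI)
 fix u v :: "vec3 => vec3" and x assume s: "smooth u" "smooth v"
 then have s': "smooth (%x. u x - v x)" by auto
 show "eps (%x. u x - v x) x = eps u x - eps v x"
  by (rule mat_eqI) (simp add: matrix_vector_mult_diff_rdistrib inner_diff_right eps_form s s' dd_diff diff_divide_distrib add_divide_distrib)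
qed (rule smooth_eps)

lemma sub_op_mcurl: "sub_op mcurl"
 by (rule sub_opI) (auto simp: mcurl_def pd_def dd_diff vec_eq_iff right_diff_distrib sum_subtractf)

lemma sub_op_transpose: "sub_op (%S x. transpose (S x :: mat3))"
 by (rule sub_opI, simp add: transpose_def vec_eq_iff, rule smooth_transpose)

lemma sub_op_ccs: "sub_op ccs"
proof -
 have "sub_op (%S. mcurl (%x. transpose (mcurl (%y. transpose (S y)) x)))"
  by (rule sub_op_comp[OF sub_op_comp[OF sub_op_comp[OF sub_op_transpose sub_op_mcurl] sub_op_transpose] sub_op_mcurl])
 moreover have "ccs = (%S. mcurl (%x. transpose (mcurl (%y. transpose (S y)) x)))"
  by (simp add: fun_eq_iff ccs_def mcurl_star_def[abs_def])
 ultimately show ?thesis by simp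
qed

lemma mdiv_diff: "smooth u ==> smooth v ==> mdiv (%x. u x - v x) = (%x. mdiv u x - mdiv v x)"
 by (simp add: mdiv_def[abs_def] pd_def dd_diff vec_eq_iff sum_subtractf fun_eq_iff)

lemma bl_bf: "bounded_linear (%A. x <.> ((A :: mat3) *v y))"
proof (rule linear_conv_bounded_linear[THEN iffD1], rule linearI)
 show "x <.> ((A + B) *v y) = x <.> (A *v y) + x <.> (B *v y)" for A B :: mat3
  by (simp add: matrix_vector_mult_add_rdistrib inner_add_right)
 show "x <.> ((r *R A) *v y) = r *R (x <.> (A *v y))" for r and A :: mat3
  by (simp add: scaleR_matrix_vector_assoc[symmetric])
qed

lemma bf_diff: "bf (%z. S z - S' z) x y = (%z. bf S x y z - bf S' x y z)"
 by (simp add: bf_def matrix_vector_mult_diff_rdistrib inner_diff_right)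

lemma sub_op_Lam: "sub_op (Lam n)"
proof (rule sub_opI)
 fix u v :: "vec3 => mat3" and x assume s: "smooth u" "smooth v"
 then have s': "smooth (%x. u x - v x)" by auto
 show "Lam n (%x. u x - v x) x = Lam n u x - Lam n v x"
  by (rule mat_eqI) (simp add: matrix_vector_mult_diff_rdistrib inner_diff_right Lam_form s s' bf_diff dd_diff)
qed (rule smooth_Lam)

lemma sub_op_Gam: "sub_op (Gam s)"
proof (rule sub_opI)
 fix u v :: "vec3 => mat3" and x assume s: "smooth u" "smooth v"
 then have s': "smooth (%x. u x - v x)" by auto
 have "w <.> Gam s (%x. u x - v x) x = w <.> (Gam s u x - Gam s v x)" for w
  by (simp add: inner_diff_right Gam_form s s' bf_diff dd_diff)
 then show "Gam s (%x. u x - v x) x = Gam s u x - Gam s v x"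
  using vector_eq_ldot by blast
next
 fix S :: "vec3 => mat3" assume S: "smooth S"
 show "smooth (Gam s S)"
 proof (rule smooth_vec)
  fix i
  have "(%z. Gam s S z $ i) = (%z. 2 * dd s (bf S (Qp s *v axis i 1) s) z - dd (Qp s *v axis i 1) (bf S s s) z)"
   by (simp only: Gam_form[OF S, symmetric]) (simp add: inner_axis')
  then show "smooth (%z. Gam s S z $ i)" using S by simp
 qed
qed

lemma sub_op_rot_perp: "sub_op (rot_perp s \<mu> \<nu>)"
 by (rule sub_opI) (auto simp: rot_perp_bf[abs_def] bf_diff dd_diff)

lemma sub_op_eps_f: "sub_op (eps_f n)"
proof (rule sub_opI)
 fix u v :: "vec3 => vec3" and x assume s: "smooth u" "smooth v"
 then have s': "smooth (%x. u x - v x)" by auto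
 show "eps_f n (%x. u x - v x) x = eps_f n u x - eps_f n v x"
  by (rule mat_eqI) (simp add: matrix_vector_mult_diff_rdistrib inner_diff_right eps_f_form s s' dd_diff diff_divide_distrib add_divide_distrib)
qed (rule smooth_eps_f)

lemma sub_op_hess_f: "sub_op (hess_f n)"
proof (rule sub_opI)
 fix u v :: "vec3 => real" and x assume s: "smooth u" "smooth v"
 then have s': "smooth (%x. u x - v x)" by auto
 show "hess_f n (%x. u x - v x) x = hess_f n u x - hess_f n v x"
  by (rule mat_eqI) (simp add: matrix_vector_mult_diff_rdistrib inner_diff_right hess_f_form s s' dd_diff)
qed (rule smooth_hess_f)

lemma sub_inner: "subtractive I ==> sub_op L ==> smooth q ==> subtractive (%w. I (%x. L w x <.> q x))"
 by (auto simp: subtractive_def sub_op_diff sub_op_smooth inner_diff_left)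

lemma sub_mult:
 fixes q :: "vec3 => real"
 shows "subtractive I ==> sub_op L ==> smooth q ==> subtractive (%w. I (%x. L w x * q x))"
 by (auto simp: subtractive_def sub_op_diff sub_op_smooth left_diff_distrib)

lemma sub_plain: "subtractive I ==> sub_op L ==> subtractive (%w. I (L w))"
 by (auto simp: subtractive_def sub_op_diff sub_op_smooth)

lemma sub_edge: "subtractive (edge_int (seg a b))"
 by (auto simp: subtractive_def edge_int_eq M1_diff smooth_cont right_diff_distrib)

lemma sub_face: assumes T: "triv f a b c" shows "subtractive (face_int f)"
 unfolding subtractive_def
proof (intro allI impI)
 fix u v :: "vec3 => real" assume "smooth u" "smooth v"
 then show "face_int f (%x. u x - v x) = face_int f u - face_int f v"
  by (simp add: face_int_eq[OF T] M2_diff smooth_cont smooth_diff right_diff_distrib)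
qed

lemma sub_tetra: assumes T: "tetv K a b c d" shows "subtractive (integral K)"
 by (auto simp: subtractive_def integral_K_linear[OF tetv_compact[OF T]] smooth_cont)

lemma sub_edges: "triv f a b c ==> e : edges f ==> subtractive (edge_int e)"
 by (erule (1) face_edge_cases) (simp add: sub_edge)

lemma polys_smooth: "q : polys k X ==> smooth q"
 using polyi_smooth[of UNIV k q] polys_iff[of UNIV q k] by (auto simp: polys_def)

lemma bubble_smooth: "q : bubble_polys f k X ==> smooth q"
 and Ef_smooth: "\<phi> : Ef f ==> smooth \<phi>"
 and P70_smooth: "v : P70 K ==> smooth v"
 and M4_smooth: "U : M4 m K ==> smooth U"
 using polys_smooth by (auto simp: bubble_polys_def Ef_def P70_def M4_def)

lemma sub_W_v: "d : W_vdofs x ==> subtractive d"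
 by (auto simp: W_vdofs_def subtractive_def pd_def dd_diff)

lemma sub_W_e: "d : W_edofs (seg a b) ==> subtractive d"
 unfolding W_edofs_def using sub_inner[OF sub_edge sub_op_id polys_smooth] by blast

lemma sub_W_f: assumes T: "triv f a b c" and d: "d : W_fdofs n f" shows "subtractive d"
proof -
 have L1: "sub_op (%w. eps_f (n f) (%y. Qp (n f) *v w y))"
  by (rule sub_op_comp[OF sub_op_lin[OF matrix_vector_mul_bounded_linear] sub_op_eps_f])
 have nl: "sub_op (%w y. n f <.> w y)" by (rule sub_op_lin[OF bounded_linear_inner_right])
 have L2: "sub_op (%w. dd v (%y. n f <.> w y))" for v by (rule sub_op_comp[OF nl sub_op_dd])
 have L3: "sub_op (%w. hess_f (n f) (%y. n f <.> w y))" by (rule sub_op_comp[OF nl sub_op_hess_f])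
 show ?thesis
  using d sub_inner[OF sub_face[OF T] L1 smooth_eps_f[OF bubble_smooth]] sub_plain[OF sub_edges[OF T] L2]
   sub_inner[OF sub_face[OF T] L3 smooth_hess_f[OF Ef_smooth]]
  unfolding W_fdofs_def by blast
qed

lemma sub_W_k: assumes T: "tetv K a b c d0" and d: "d : W_kdofs K" shows "subtractive d"
 using d sub_inner[OF sub_tetra[OF T] sub_op_eps smooth_eps[OF P70_smooth]] unfolding W_kdofs_def by blast

lemma bl_nth2: "bounded_linear (%A. (A :: mat3) $ i $ j)"
 by (rule bounded_linear_compose[OF bounded_linear_vec_nth bounded_linear_vec_nth])

lemma bl_Qp: "bounded_linear (%A. Qp s ** (A :: mat3))" "bounded_linear (%A. Qp n ** (A :: mat3) ** Qp n)"
 by (rule linear_conv_bounded_linear[THEN iffD1], rule linearI,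
   auto simp: vec_eq_iff matrix_matrix_mult_def sum.distrib algebra_simps sum_distrib_left sum_distrib_right)+

lemma sub_Th_v: "d : Th_vdofs x ==> subtractive d"
 by (auto simp: Th_vdofs_def subtractive_def sub_op_diff[OF sub_op_ccs])

lemma sub_Th_e: assumes d: "d : Th_edofs s \<mu> \<nu> (seg a b)" shows "subtractive d"
proof -
 define e where "e = seg a b"
 have I: "subtractive (edge_int e)" unfolding e_def by (rule sub_edge)
 have 1: "subtractive (%S. edge_int e (%x. (s e <.> (S x *v s e)) * v x))" if "v : polys 4 UNIV" for v
  by (rule sub_mult[OF I sub_op_lin[OF bl_bf] polys_smooth[OF that]])
 have 2: "subtractive (%S. edge_int e (%x. Gam (s e) S x <.> v x))" if "v : polys 5 (range ((*v) (Qp (s e))))" for v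
  by (rule sub_inner[OF I sub_op_Gam polys_smooth[OF that]])
 have 3: "subtractive (%S. edge_int e (%x. (Qp (s e) ** ccs S x) <.> W x))" if "W : polys 2 ((**) (Qp (s e)) ` Sym)" for W
  by (rule sub_inner[OF I sub_op_then_lin[OF sub_op_ccs bl_Qp(1)] polys_smooth[OF that]])
 have 4: "subtractive (%S. edge_int e (rot_perp (s e) (\<mu> e) (\<nu> e) S))"
  by (rule sub_plain[OF I sub_op_rot_perp])
 show ?thesis using d 1 2 3 4 unfolding e_def[symmetric] Th_edofs_def by blast
qed

lemma sub_Th_f: assumes T: "triv f a b c" and d: "d : Th_fdofs n s f" shows "subtractive d"
 using d sub_inner[OF sub_face[OF T] sub_op_lin[OF bl_Qp(2)] smooth_eps_f[OF bubble_smooth]]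
  sub_mult[OF sub_edges[OF T] sub_op_then_lin[OF sub_op_Lam bl_bf] polys_smooth]
  sub_plain[OF sub_face[OF T] sub_op_then_lin[OF sub_op_Lam bl_nth2]]
  sub_inner[OF sub_face[OF T] sub_op_Lam smooth_hess_f[OF Ef_smooth]]
 unfolding Th_fdofs_def by blast

lemma sub_Th_k: assumes T: "tetv K a b c d0" and d: "d : Th_kdofs n K" shows "subtractive d"
 using d sub_inner[OF sub_tetra[OF T] sub_op_ccs M4_smooth] sub_inner[OF sub_tetra[OF T] sub_op_id smooth_eps[OF P70_smooth]]
 unfolding Th_kdofs_def by blast

lemma sub_Sg_v: "d : Sg_vdofs x ==> subtractive d"
 by (auto simp: Sg_vdofs_def subtractive_def)

lemma sub_Sg_e: assumes d: "d : Sg_edofs s nm np (seg a b)" shows "subtractive d"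
 using d sub_mult[OF sub_edge sub_op_lin[OF bl_bf] polys_smooth] unfolding Sg_edofs_def by blast

lemma sub_Sg_f: assumes T: "triv f a b c" and d: "d : Sg_fdofs n f" shows "subtractive d"
proof -
 have "bounded_linear (%A. (A :: mat3) *v y)" for y
  by (rule linear_conv_bounded_linear[THEN iffD1], rule linearI)
   (auto simp: matrix_vector_mult_add_rdistrib scaleR_matrix_vector_assoc[symmetric])
 then show ?thesis
  using d sub_inner[OF sub_face[OF T] sub_op_lin polys_smooth] unfolding Sg_fdofs_def by blast
qed

lemma sub_Sg_k: assumes T: "tetv K a b c d0" and d: "d : Sg_kdofs n K" shows "subtractive d"
proof -
 have "subtractive (%T. integral K (%x. (T x :: mat3) $ i $ j) / measure lebesgue K)" for i j
  using sub_plain[OF sub_tetra[OF T] sub_op_lin[OF bl_nth2[of i j]]] by (simp add: subtractive_def diff_divide_distrib)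
 then show ?thesis
  using d sub_inner[OF sub_tetra[OF T] sub_op_id M4_smooth] unfolding Sg_kdofs_def by blast
qed

section \<open>Traces on the faces of the mesh\<close>

lemma faces_verts: "f : faces K ==> verts f \<subseteq> verts K"
 unfolding faces_def verts_def using extreme_point_of_face by blast

lemma faces_edges: "f : faces K ==> edges f \<subseteq> edges K"
 unfolding faces_def edges_def using face_of_trans by blast

lemma fe_spaceD:
 assumes "u : fe_space \<T> P vd ed fd" "K : \<T>" "K' : \<T>"
 shows "u K : P" "x : verts K ==> x : verts K' ==> d : vd x ==> d (u K) = d (u K')"
  "e : edges K ==> e : edges K' ==> d : ed e ==> d (u K) = d (u K')"
  "f : faces K ==> f : faces K' ==> d : fd f ==> d (u K) = d (u K')"
 using assms unfolding fe_space_def broken_def by blast+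

lemma fe_space_zero: "u : fe_space \<T> P vd ed fd ==> K \<notin> \<T> ==> u K = (%x. 0)"
 by (simp add: fe_space_def broken_def)

context mesh
begin

lemma mesh_edge: assumes "K : \<T>" "e : edges K" obtains a b where "a ~= b" "e = seg a b" "a : verts K" "b : verts K"
proof -
 obtain a b c d where "tetv K a b c d" "e = seg a b" using mesh_tetv[OF assms(1)] edge_cases[OF _ assms(2)] by metis
 then show thesis using that[of a b] tetv_distinct[of K a b c d] tetv_verts[of K a b c d] by auto
qed

lemma mesh_triv: assumes "K : \<T>" "f : faces K" obtains a b c where "triv f a b c"
 using mesh_tetv[OF assms(1)] face_cases[OF _ assms(2)] tetv_triv by metis

lemma mesh_frame:
 assumes "K : \<T>" "e : edges K"
 shows "unit_tangent e (s e)" "nm e <.> s e = 0" "np e <.> s e = 0" "nm e ~= np e" "independent {nm e, np e}"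
  "norm (\<mu> e) = 1" "norm (\<nu> e) = 1" "\<mu> e <.> \<nu> e = 0" "\<mu> e <.> s e = 0" "\<nu> e <.> s e = 0"
 using frame assms unfolding frame_choice_def by blast+

definition "W_space = W_h \<T> n"
definition "Th_space = Th_h \<T> n s \<mu> \<nu>"
definition "Sg_space = Sg_h \<T> n s nm np"

lemma W_piece: "w : W_space ==> K : \<T> ==> polyi UNIV 7 (w K)"
 and Th_piece: "S : Th_space ==> K : \<T> ==> polyi Sym 6 (S K)"
 and Sg_piece: "T : Sg_space ==> K : \<T> ==> polyi Sym 4 (T K)"
 and Sg_piece_div: "T : Sg_space ==> K : \<T> ==> mdiv (T K) : polys 1 UNIV"
 using fe_spaceD(1)[of _ \<T>] polys_iff[OF subspace_UNIV] polys_iff[OF subspace_Sym]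
 unfolding W_space_def W_h_def Th_space_def Th_h_def Sg_space_def Sg_h_def W_loc_def Th_loc_def Sg_loc_def by blast+

lemma fe_diff:
 assumes u: "u : fe_space \<T> P vd ed fd" and K: "K : \<T>" "K' : \<T>" and sm: "smooth (u K)" "smooth (u K')"
  and sub: "!!x d. d : vd x ==> subtractive d" "!!a b d. d : ed (seg a b) ==> subtractive d"
   "!!f a b c d. triv f a b c ==> d : fd f ==> subtractive d"
 shows "x : verts K ==> x : verts K' ==> \<forall>d\<in>vd x. d (%x. u K x - u K' x) = 0"
  "e : edges K ==> e : edges K' ==> \<forall>d\<in>ed e. d (%x. u K x - u K' x) = 0"
  "f : faces K ==> f : faces K' ==> \<forall>d\<in>fd f. d (%x. u K x - u K' x) = 0"
proof -
 note D = fe_spaceD(2-4)[OF u K]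
 show "\<forall>d\<in>vd x. d (%x. u K x - u K' x) = 0" if "x : verts K" "x : verts K'"
  by (rule ballI) (simp only: D(1)[OF that] subtractiveD[OF sub(1) sm] diff_self)
 show "\<forall>d\<in>ed e. d (%x. u K x - u K' x) = 0" if e: "e : edges K" "e : edges K'"
 proof -
  obtain a b where ab: "e = seg a b" by (rule mesh_edge[OF K(1) e(1)])
  show ?thesis by (rule ballI) (simp only: D(2)[OF e] subtractiveD[OF sub(2)[where a = a and b = b, folded ab] sm] diff_self)
 qed
 show "\<forall>d\<in>fd f. d (%x. u K x - u K' x) = 0" if f: "f : faces K" "f : faces K'"
 proof -
  obtain a b c where T: "triv f a b c" by (rule mesh_triv[OF K(1) f(1)])
  show ?thesis by (rule ballI) (simp only: D(3)[OF f] subtractiveD[OF sub(3)[OF T] sm] diff_self)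
 qed
qed

lemma W_diff:
 assumes w: "w : W_space" and K: "K : \<T>" "K' : \<T>"
 shows "x : verts K ==> x : verts K' ==> \<forall>d\<in>W_vdofs x. d (%x. w K x - w K' x) = 0"
  "e : edges K ==> e : edges K' ==> \<forall>d\<in>W_edofs e. d (%x. w K x - w K' x) = 0"
  "f : faces K ==> f : faces K' ==> \<forall>d\<in>W_fdofs n f. d (%x. w K x - w K' x) = 0"
 by (rule fe_diff[OF w[unfolded W_space_def W_h_def] K polyi_smooth[OF W_piece[OF w K(1)]] polyi_smooth[OF W_piece[OF w K(2)]]];
  (assumption | erule sub_W_v sub_W_e | erule (1) sub_W_f))+

lemma Th_diff:
 assumes w: "S : Th_space" and K: "K : \<T>" "K' : \<T>"
 shows "x : verts K ==> x : verts K' ==> \<forall>d\<in>Th_vdofs x. d (%x. S K x - S K' x) = 0"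
  "e : edges K ==> e : edges K' ==> \<forall>d\<in>Th_edofs s \<mu> \<nu> e. d (%x. S K x - S K' x) = 0"
  "f : faces K ==> f : faces K' ==> \<forall>d\<in>Th_fdofs n s f. d (%x. S K x - S K' x) = 0"
 by (rule fe_diff[OF w[unfolded Th_space_def Th_h_def] K polyi_smooth[OF Th_piece[OF w K(1)]] polyi_smooth[OF Th_piece[OF w K(2)]]];
  (assumption | erule sub_Th_v sub_Th_e | erule (1) sub_Th_f))+

lemma Sg_diff:
 assumes w: "T : Sg_space" and K: "K : \<T>" "K' : \<T>"
 shows "x : verts K ==> x : verts K' ==> \<forall>d\<in>Sg_vdofs x. d (%x. T K x - T K' x) = 0"
  "e : edges K ==> e : edges K' ==> \<forall>d\<in>Sg_edofs s nm np e. d (%x. T K x - T K' x) = 0"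
  "f : faces K ==> f : faces K' ==> \<forall>d\<in>Sg_fdofs n f. d (%x. T K x - T K' x) = 0"
 by (rule fe_diff[OF w[unfolded Sg_space_def Sg_h_def] K polyi_smooth[OF Sg_piece[OF w K(1)]] polyi_smooth[OF Sg_piece[OF w K(2)]]];
  (assumption | erule sub_Sg_v sub_Sg_e | erule (1) sub_Sg_f))+

lemma W_conf:
 assumes w: "w : W_space" and K: "K : \<T>" "K' : \<T>" and f: "f : faces K" "f : faces K'" and x: "x : f"
 shows "w K x = w K' x"
proof -
 obtain a b c where T: "triv f a b c" by (rule mesh_triv[OF K(1) f(1)])
 have "(%x. w K x - w K' x) x = 0"
 proof (rule W_face_trace[where u = "%x. w K x - w K' x", OF _ T mesh_normal[OF K(1) f(1)] _ _ _ x])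
  show "polyi UNIV 7 (%x. w K x - w K' x)" using W_piece[OF w] K by (intro polyi_diff subspace_UNIV) auto
  show "\<forall>d\<in>W_vdofs x. d (%x. w K x - w K' x) = 0" if "x : verts f" for x
   using that faces_verts[OF f(1)] faces_verts[OF f(2)] by (intro W_diff(1)[OF w K]) auto
  show "\<forall>d\<in>W_edofs e. d (%x. w K x - w K' x) = 0" if "e : edges f" for e
   using that faces_edges[OF f(1)] faces_edges[OF f(2)] by (intro W_diff(2)[OF w K]) auto
  show "\<forall>d\<in>W_fdofs (%_. n f) f. d (%x. w K x - w K' x) = 0"
   using W_diff(3)[OF w K f] by (simp add: W_fdofs_def)
 qed
 then show ?thesis by simp
qed

lemma Sg_conf:
 assumes w: "T : Sg_space" and K: "K : \<T>" "K' : \<T>" and f: "f : faces K" "f : faces K'" and x: "x : f"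
 shows "bf (T K) y (n f) x = bf (T K') y (n f) x"
proof -
 obtain a b c where T: "triv f a b c" by (rule mesh_triv[OF K(1) f(1)])
 have "bf (%x. T K x - T K' x) y (n f) x = 0"
 proof (rule Sg_face_trace[where T = "%x. T K x - T K' x" and s = s and nm = nm and np = np, OF _ T mesh_normal[OF K(1) f(1)] _ _ _ _ x])
  show "polyi Sym 4 (%x. T K x - T K' x)" using Sg_piece[OF w] K by (intro polyi_diff subspace_Sym) auto
  show "unit_tangent e (s e) & nm e <.> s e = 0 & np e <.> s e = 0 & nm e ~= np e & independent {nm e, np e}" if "e : edges f" for e
   using mesh_frame[OF K(1)] faces_edges[OF f(1)] that by blast
  show "\<forall>d\<in>Sg_vdofs x. d (%x. T K x - T K' x) = 0" if "x : verts f" for x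
   using that faces_verts[OF f(1)] faces_verts[OF f(2)] by (intro Sg_diff(1)[OF w K]) auto
  show "\<forall>d\<in>Sg_edofs s nm np e. d (%x. T K x - T K' x) = 0" if "e : edges f" for e
   using that faces_edges[OF f(1)] faces_edges[OF f(2)] by (intro Sg_diff(2)[OF w K]) auto
  show "\<forall>d\<in>Sg_fdofs (%_. n f) f. d (%x. T K x - T K' x) = 0"
   using Sg_diff(3)[OF w K f] by (simp add: Sg_fdofs_def)
 qed
 then show ?thesis by (simp add: bf_diff)
qed

lemma Th_face_dofs:
 assumes K: "K : \<T>" and f: "f : faces K" and S: "smooth S" "!!x. S x : Sym"
  and v: "!!x. x : verts f ==> \<forall>d\<in>Th_vdofs x. d S = 0" and e: "!!e. e : edges f ==> \<forall>d\<in>Th_edofs s \<mu> \<nu> e. d S = 0"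
  and fd: "\<forall>d\<in>Th_fdofs n s f. d S = 0"
 shows "face_dofs S f (n f) s \<mu> \<nu>"
proof
 show "\<forall>d\<in>Th_fdofs (%_. n f) s f. d S = 0" using fd by (simp add: Th_fdofs_def)
 show "unit_normal f (n f)" by (rule mesh_normal[OF K f])
 fix e assume E: "e : edges f"
 then have E': "e : edges K" using faces_edges[OF f] by blast
 show "unit_tangent e (s e)" by (rule mesh_frame(1)[OF K E'])
 show "norm (\<mu> e) = 1 & norm (\<nu> e) = 1 & \<mu> e <.> \<nu> e = 0 & \<mu> e <.> s e = 0 & \<nu> e <.> s e = 0"
  by (simp only: mesh_frame[OF K E'] simp_thms)
 show "\<forall>d\<in>Th_edofs s \<mu> \<nu> e. d S = 0" by (rule e[OF E])
qed (rule S v | assumption)+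

lemma Th_diff_face_dofs:
 assumes w: "S : Th_space" and K: "K : \<T>" "K' : \<T>" and f: "f : faces K" "f : faces K'"
 shows "face_dofs (%x. S K x - S K' x) f (n f) s \<mu> \<nu>"
proof (rule Th_face_dofs[OF K(1) f(1)])
 have P: "polyi Sym 6 (%x. S K x - S K' x)" using Th_piece[OF w] K by (intro polyi_diff subspace_Sym) auto
 show "smooth (%x. S K x - S K' x)" "!!x. S K x - S K' x : Sym"
  using polyi_smooth[OF P] polyi_val[OF P subspace_Sym] by auto
 show "\<forall>d\<in>Th_vdofs x. d (%x. S K x - S K' x) = 0" if "x : verts f" for x
  using that faces_verts[OF f(1)] faces_verts[OF f(2)] by (intro Th_diff(1)[OF w K]) auto
 show "\<forall>d\<in>Th_edofs s \<mu> \<nu> e. d (%x. S K x - S K' x) = 0" if "e : edges f" for e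
  using that faces_edges[OF f(1)] faces_edges[OF f(2)] by (intro Th_diff(2)[OF w K]) auto
 show "\<forall>d\<in>Th_fdofs n s f. d (%x. S K x - S K' x) = 0" by (rule Th_diff(3)[OF w K f])
qed

lemma Th_conf:
 assumes w: "S : Th_space" and K: "K : \<T>" "K' : \<T>" and f: "f : faces K" "f : faces K'" and x: "x : f"
 shows "n f <.> y = 0 ==> n f <.> z = 0 ==> bf (S K) y z x = bf (S K') y z x" and "Lam (n f) (S K) x = Lam (n f) (S K') x"
proof -
 obtain a b c where T: "triv f a b c" by (rule mesh_triv[OF K(1) f(1)])
 have P: "polyi Sym 6 (%x. S K x - S K' x)" using Th_piece[OF w] K by (intro polyi_diff subspace_Sym) auto
 interpret F: face_trace "%x. S K x - S K' x" f "n f" s \<mu> \<nu> a b c nm np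
 proof (rule face_trace.intro[OF Th_diff_face_dofs[OF w K f]], rule face_trace_axioms.intro[OF P T])
  fix e assume "e : edges f"
  then have E: "e : edges K" using faces_edges[OF f(1)] by blast
  show "nm e <.> s e = 0 & np e <.> s e = 0 & nm e ~= np e & independent {nm e, np e}"
   by (simp only: mesh_frame[OF K(1) E] simp_thms not_False_eq_True)
 qed
 show "bf (S K) y z x = bf (S K') y z x" if "n f <.> y = 0" "n f <.> z = 0"
 proof -
  have "y <.> ((Qp (n f) ** (S K x - S K' x) ** Qp (n f)) *v z) = 0" using F.tangential_trace[OF x] by simp
  then have "bf (%x. S K x - S K' x) y z x = 0" using that by (simp add: Qp_conj_form Qp_fix bf_def)
  then show ?thesis by (simp add: bf_diff)
 qed
 show "Lam (n f) (S K) x = Lam (n f) (S K') x"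
  using F.Lam_trace[OF x] sub_op_diff[OF sub_op_Lam, of "S K" "S K'" "n f"] polyi_smooth[OF Th_piece[OF w K(1)]] polyi_smooth[OF Th_piece[OF w K(2)]]
  by simp
qed

lemma edge_verts: "e : edges K ==> verts e \<subseteq> verts K"
 unfolding edges_def verts_def using extreme_point_of_face by blast

lemma verts_segment: "verts (seg a b) = {a, b}"
 by (auto simp: verts_def extreme_point_of_segment)

lemma eps_zero_edge:
 assumes K: "K : \<T>" "e : edges K" and u: "smooth u" and v: "!!x. x : verts e ==> \<forall>d\<in>W_vdofs x. d u = 0" and e: "\<forall>d\<in>W_edofs e. d u = 0"
 shows "\<forall>d\<in>Th_edofs s \<mu> \<nu> e. d (eps u) = 0"
proof -
 obtain a b where ab: "a ~= b" "e = seg a b" by (rule mesh_edge[OF K])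
 have "\<forall>d\<in>Th_edofs (%_. s e) (%_. \<mu> e) (%_. \<nu> e) (seg a b). d (eps u) = 0"
  using mesh_frame(1)[OF K] e unfolding ab(2) by (intro eps_edofs[OF u ab(1)] v) (auto simp: ab(2) verts_segment)
 then show ?thesis unfolding Th_edofs_const[of s] ab(2) .
qed

lemma eps_zero_face:
 assumes K: "K : \<T>" "f : faces K" and u: "smooth u" and v: "!!x. x : verts f ==> \<forall>d\<in>W_vdofs x. d u = 0" and f: "\<forall>d\<in>W_fdofs n f. d u = 0"
 shows "\<forall>d\<in>Th_fdofs n s f. d (eps u) = 0"
proof -
 obtain a b c where T: "triv f a b c" by (rule mesh_triv[OF K])
 have "\<forall>d\<in>Th_fdofs (%_. n f) s f. d (eps u) = 0"
 proof (rule eps_fdofs[OF u T mesh_normal[OF K] _ v])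
  show "unit_tangent e (s e)" if "e : edges f" for e using mesh_frame(1)[OF K(1)] faces_edges[OF K(2)] that by blast
  show "\<forall>d\<in>W_fdofs (%_. n f) f. d u = 0" using f by (simp add: W_fdofs_def)
 qed
 then show ?thesis by (simp add: Th_fdofs_def)
qed

lemma ccs_zero_edge:
 assumes K: "K : \<T>" "e : edges K" and S: "smooth S" "!!x. S x : Sym"
  and v: "!!x. x : verts e ==> \<forall>d\<in>Th_vdofs x. d S = 0" and e: "\<forall>d\<in>Th_edofs s \<mu> \<nu> e. d S = 0"
 shows "\<forall>d\<in>Sg_edofs s nm np e. d (ccs S) = 0"
proof -
 obtain a b where ab: "a ~= b" "e = seg a b" by (rule mesh_edge[OF K])
 have "edge_dofs S a b (s e) (\<mu> e) (\<nu> e)"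
 proof
  show "\<forall>d\<in>Th_vdofs a. d S = 0" "\<forall>d\<in>Th_vdofs b. d S = 0" by (intro v; simp add: ab verts_segment)+
  show "\<forall>d\<in>Th_edofs (%_. s e) (%_. \<mu> e) (%_. \<nu> e) (seg a b). d S = 0"
   using e unfolding Th_edofs_const[of s] ab(2) .
 qed (use S mesh_frame[OF K] ab in auto)
 then show ?thesis
  by (rule ccs_edofs[where s = s and nm = nm and np = np and e = e, OF _ ab(2) mesh_frame(2,3)[OF K]])
qed

lemma ccs_zero_face:
 assumes "K : \<T>" "f : faces K" "face_dofs S f (n f) s \<mu> \<nu>" shows "\<forall>d\<in>Sg_fdofs n f. d (ccs S) = 0"
proof -
 obtain a b c where T: "triv f a b c" by (rule mesh_triv[OF assms(1,2)])
 interpret F: face_dofs S f "n f" s \<mu> \<nu> by fact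
 show ?thesis using F.ccs_fdofs[OF T] by (simp add: Sg_fdofs_def)
qed

text \<open>Vertex, edge and face degrees of freedom of \<open>L u\<close> are single valued as soon
  as \<open>L\<close> maps differences of pieces to fields on which the shared ones vanish.\<close>

lemma fe_maps:
 assumes L: "sub_op L" and sm: "!!K. K : \<T> ==> smooth (u K)" and P: "!!K. K : \<T> ==> L (u K) : P"
  and z: "!!K. K \<notin> \<T> ==> u K = (%x. 0)"
  and sub: "!!x d. d : vd x ==> subtractive d" "!!a b d. d : ed (seg a b) ==> subtractive d"
   "!!f a b c d. triv f a b c ==> d : fd f ==> subtractive d"
  and v: "!!K K' x. K : \<T> ==> K' : \<T> ==> x : verts K ==> x : verts K' ==> \<forall>d\<in>vd x. d (L (%x. u K x - u K' x)) = 0"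
  and e: "!!K K' e. K : \<T> ==> K' : \<T> ==> e : edges K ==> e : edges K' ==> \<forall>d\<in>ed e. d (L (%x. u K x - u K' x)) = 0"
  and f: "!!K K' f. K : \<T> ==> K' : \<T> ==> f : faces K ==> f : faces K' ==> \<forall>d\<in>fd f. d (L (%x. u K x - u K' x)) = 0"
 shows "piecewise L u : fe_space \<T> P vd ed fd"
 unfolding fe_space_def broken_def piecewise_def
proof (intro CollectI conjI ballI allI impI)
 have "L (%x. 0) = (%x. 0)" using sub_op_diff[OF L, of "%x. 0" "%x. 0"] by simp
 then show "L (u K) = (%x. 0)" if "K \<notin> \<T>" for K using z[OF that] by simp
 fix K K' assume K: "K : \<T>" "K' : \<T>"
 have *: "d (L (u K)) = d (L (u K'))" if "subtractive d" "d (L (%x. u K x - u K' x)) = 0" for d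
  using subtractiveD[OF that(1) sub_op_smooth[OF L sm[OF K(1)]] sub_op_smooth[OF L sm[OF K(2)]]] that(2)
  by (simp add: sub_op_diff[OF L sm[OF K(1)] sm[OF K(2)]])
 show "d (L (u K)) = d (L (u K'))" if x: "x : verts K \<inter> verts K'" and d: "d : vd x" for x d
  by (rule *[OF sub(1)[OF d]], rule bspec[OF v[OF K] d]) (use x in auto)
 show "d (L (u K)) = d (L (u K'))" if x: "E : edges K \<inter> edges K'" and d: "d : ed E" for E d
 proof -
  obtain a b where "E = seg a b" using mesh_edge[OF K(1), of E] x by blast
  then have "subtractive d" using sub(2) d by blast
  then show ?thesis by (rule *, intro bspec[OF e[OF K] d]) (use x in auto)
 qed
 show "d (L (u K)) = d (L (u K'))" if x: "F : faces K \<inter> faces K'" and d: "d : fd F" for F d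
 proof -
  obtain a b c where "triv F a b c" using mesh_triv[OF K(1), of F] x by blast
  then have "subtractive d" using sub(3) d by blast
  then show ?thesis by (rule *, intro bspec[OF f[OF K] d]) (use x in auto)
 qed
qed (rule P)

lemma eps_maps: assumes w: "w : W_space" shows "piecewise eps w : Th_space"
 unfolding Th_space_def Th_h_def
proof (rule fe_maps[OF sub_op_eps polyi_smooth[OF W_piece[OF w]] _ fe_space_zero[OF w[unfolded W_space_def W_h_def]] sub_Th_v sub_Th_e sub_Th_f])
 show "eps (w K) : Th_loc" if "K : \<T>" for K
  using polyi_eps[OF W_piece[OF w that]] by (simp add: Th_loc_def polys_iff[OF subspace_Sym])
 fix K K' assume K: "K : \<T>" "K' : \<T>"
 have sD: "smooth (%x. w K x - w K' x)" using polyi_smooth[OF W_piece[OF w]] K by auto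
 note D = W_diff[OF w K]
 show "\<forall>d\<in>Th_vdofs x. d (eps (%x. w K x - w K' x)) = 0" if "x : verts K" "x : verts K'" for x
  by (rule eps_vdofs[OF sD D(1)[OF that]])
 show "\<forall>d\<in>Th_edofs s \<mu> \<nu> e. d (eps (%x. w K x - w K' x)) = 0" if e: "e : edges K" "e : edges K'" for e
  using edge_verts[OF e(1)] edge_verts[OF e(2)] by (intro eps_zero_edge[OF K(1) e(1) sD D(1) D(2)[OF e]]) auto
 show "\<forall>d\<in>Th_fdofs n s f. d (eps (%x. w K x - w K' x)) = 0" if f: "f : faces K" "f : faces K'" for f
  using faces_verts[OF f(1)] faces_verts[OF f(2)] by (intro eps_zero_face[OF K(1) f(1) sD D(1) D(3)[OF f]]) auto
qed auto

lemma ccs_maps: assumes w: "S : Th_space" shows "piecewise ccs S : Sg_space"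
 unfolding Sg_space_def Sg_h_def
proof (rule fe_maps[OF sub_op_ccs polyi_smooth[OF Th_piece[OF w]] _ fe_space_zero[OF w[unfolded Th_space_def Th_h_def]] sub_Sg_v sub_Sg_e sub_Sg_f])
 show "ccs (S K) : Sg_loc" if "K : \<T>" for K
 proof -
  have "mdiv (ccs (S K)) = (%x. 0)" using mdiv_ccs[OF polyi_smooth[OF Th_piece[OF w that]]] by (simp add: fun_eq_iff)
  then show ?thesis
   using polyi_ccs[OF Th_piece[OF w that]] polyi_const[of 0 UNIV] by (simp add: Sg_loc_def polys_iff[OF subspace_Sym] polys_iff[OF subspace_UNIV])
 qed
 fix K K' assume K: "K : \<T>" "K' : \<T>"
 have P: "polyi Sym 6 (%x. S K x - S K' x)" using Th_piece[OF w] K by (intro polyi_diff subspace_Sym) auto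
 note sD = polyi_smooth[OF P] polyi_val[OF P subspace_Sym]
 note D = Th_diff[OF w K]
 show "\<forall>d\<in>Sg_vdofs x. d (ccs (%x. S K x - S K' x)) = 0" if "x : verts K" "x : verts K'" for x
  by (rule ccs_vdofs[OF D(1)[OF that]])
 show "\<forall>d\<in>Sg_edofs s nm np e. d (ccs (%x. S K x - S K' x)) = 0" if e: "e : edges K" "e : edges K'" for e
  using edge_verts[OF e(1)] edge_verts[OF e(2)] by (intro ccs_zero_edge[OF K(1) e(1) sD D(1) D(2)[OF e]]) auto
 show "\<forall>d\<in>Sg_fdofs n f. d (ccs (%x. S K x - S K' x)) = 0" if f: "f : faces K" "f : faces K'" for f
  by (rule ccs_zero_face[OF K(1) f(1) Th_diff_face_dofs[OF w K f]])
qed auto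

end

section \<open>Weak derivatives of first order\<close>

lemma test_fun_smooth: "test_fun \<Omega> \<phi> ==> smooth \<phi>"
 by (simp add: test_fun_def)

lemma test_fun_zero:
 assumes "test_fun \<Omega> \<phi>" "x \<notin> \<Omega>" shows "\<phi> x = 0" "dd v \<phi> x = 0"
proof -
 obtain C where C: "C \<subseteq> \<Omega>" "compact C" "!!x. x \<notin> C ==> \<phi> x = 0" using assms(1) by (auto simp: test_fun_def)
 show "\<phi> x = 0" using C assms(2) by blast
 have "dd v \<phi> x = dd v (%x. 0) x"
  by (rule dd_cong_open[of "- C"]) (use C assms(2) compact_imp_closed in auto)
 then show "dd v \<phi> x = 0" by simp
qed

lemma face_int_zero:
 assumes T: "triv f a b c" and "smooth g" "!!x. x : f ==> g x = 0" shows "face_int f g = 0"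
proof -
 have "face_int f g = face_int f (%x. 0)" using assms by (intro face_int_cong[OF T]) (auto intro!: smooth_cont)
 also have "\<dots> = 0" by (simp add: face_int_eq[OF T] M2_def)
 finally show ?thesis .
qed

lemma face_int_cmult: "triv f a b c ==> smooth g ==> face_int f (%x. r * g x) = r * face_int f g"
 by (simp add: face_int_eq M2_cmult smooth_cont)

lemma face_int_sum:
 assumes "triv f a b c" "finite I" "!!i. i : I ==> smooth (g i)"
 shows "face_int f (%x. \<Sum>i\<in>I. g i x) = (\<Sum>i\<in>I. face_int f (g i))"
proof -
 have "smooth (%x. \<Sum>i\<in>I. g i x)" using assms(3) by (rule smooth_sum)
 then show ?thesis using assms by (simp add: face_int_eq M2_sum smooth_cont sum_distrib_left)
qed

lemma smooth_vgrad [simp, intro]: assumes "smooth v" shows "smooth (vgrad v)"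
proof (rule smooth_mat)
 fix i j
 have "(%z. vgrad v z $ i $ j) = (%z. dd (axis j 1) v z $ i)" by (simp add: vgrad_def pd_def)
 then show "smooth (%z. vgrad v z $ i $ j)" using assms by (simp add: smooth_nth)
qed

lemma smooth_mdiv [simp, intro]: assumes "smooth T" shows "smooth (mdiv T)"
proof (rule smooth_vec)
 fix i
 have "(%z. mdiv T z $ i) = (%z. \<Sum>j\<in>UNIV. dd (axis j 1) (bf T (axis i 1) (axis j 1)) z)"
  using assms by (simp add: mdiv_nth)
 then show "smooth (%z. mdiv T z $ i)" using assms by simp
qed

context mesh
begin

lemma outside_test: "test_fun \<Omega> \<phi> ==> A \<inter> \<Omega> = {} ==> x : A ==> \<phi> x = 0 & dd v \<phi> x = 0"
 using test_fun_zero by blast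

lemma W_smooth: "w : W_space ==> K : \<T> ==> smooth (w K)"
 and Th_smooth: "S : Th_space ==> K : \<T> ==> smooth (S K)"
 and Sg_smooth: "T : Sg_space ==> K : \<T> ==> smooth (T K)"
 using W_piece Th_piece Sg_piece polyi_smooth by blast+

lemma W_parts:
 assumes w: "w : W_space" and \<phi>: "test_fun \<Omega> \<phi>"
 shows "(\<Sum>K\<in>\<T>. integral K (%x. pd j (w K) x $ i * \<phi> x)) = - (\<Sum>K\<in>\<T>. integral K (%x. w K x $ i * pd j \<phi> x))"
proof -
 note s\<phi> = test_fun_smooth[OF \<phi>]
 define H where "H K f = (n f <.> axis j 1) * face_int f (%x. w K x $ i * \<phi> x)" for K f
 have "integral K (%x. pd j (w K) x $ i * \<phi> x) + integral K (%x. w K x $ i * pd j \<phi> x) = (\<Sum>f\<in>faces K. osign (n f) K f * H K f)"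
  if K: "K : \<T>" for K
 proof -
  note sw = W_smooth[OF w K]
  obtain a b c d where T: "tetv K a b c d" by (rule mesh_tetv[OF K])
  have sw': "smooth (%x. w K x $ i)" using sw by (rule smooth_nth)
  have "integral K (%x. pd j (w K) x $ i * \<phi> x) + integral K (%x. w K x $ i * pd j \<phi> x)
   = integral K (%x. pd j (w K) x $ i * \<phi> x + w K x $ i * pd j \<phi> x)"
   using sw sw' s\<phi> by (subst integral_K_linear[OF mesh_compact[OF K]]) (auto intro!: smooth_cont smooth_mult smooth_nth smooth_dd simp: pd_def)
  also have "(%x. pd j (w K) x $ i * \<phi> x + w K x $ i * pd j \<phi> x) = dd (axis j 1) (%x. w K x $ i * \<phi> x)"
   using sw sw' s\<phi> by (simp add: dd_mult pd_def dd_nth add.commute)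
  also have "integral K \<dots> = (\<Sum>f\<in>faces K. osign (n f) K f * (n f <.> axis j 1) * face_int f (%x. w K x $ i * \<phi> x))"
   by (rule gauss[OF T smooth_mult[OF sw' s\<phi>] mesh_normal[OF K]])
  finally show ?thesis by (simp add: H_def mult.assoc)
 qed
 then have "(\<Sum>K\<in>\<T>. integral K (%x. pd j (w K) x $ i * \<phi> x)) + (\<Sum>K\<in>\<T>. integral K (%x. w K x $ i * pd j \<phi> x))
   = (\<Sum>K\<in>\<T>. \<Sum>f\<in>faces K. osign (n f) K f * H K f)"
  unfolding sum.distrib[symmetric] by (rule sum.cong[OF refl])
 also have "\<dots> = 0"
 proof (rule mesh_sum)
  fix K K' f assume K: "K : \<T>" "K' : \<T>" and f: "f : faces K" "f : faces K'"
  obtain a b c where T: "triv f a b c" by (rule mesh_triv[OF K(1) f(1)])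
  have "face_int f (%x. w K x $ i * \<phi> x) = face_int f (%x. w K' x $ i * \<phi> x)"
   using W_smooth[OF w K(1)] W_smooth[OF w K(2)] s\<phi> W_conf[OF w K f]
   by (intro face_int_cong[OF T]) (auto intro!: smooth_cont smooth_mult smooth_nth)
  then show "H K f = H K' f" by (simp add: H_def)
 next
  fix K f assume K: "K : \<T>" "f : faces K" "f \<inter> \<Omega> = {}"
  obtain a b c where T: "triv f a b c" by (rule mesh_triv[OF K(1,2)])
  have "face_int f (%x. w K x $ i * \<phi> x) = 0"
   using W_smooth[OF w K(1)] s\<phi> outside_test[OF \<phi> K(3)] by (intro face_int_zero[OF T]) (auto intro!: smooth_mult smooth_nth)
  then show "H K f = 0" by (simp add: H_def)
 qed
 finally show ?thesis by simp
qed

lemma W_weak_grad: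
 assumes w: "w : W_space" shows "weak_grad \<Omega> (glue \<T> w) (glue \<T> (piecewise vgrad w))"
 unfolding weak_grad_def
proof (intro allI impI)
 fix \<phi> i j assume \<phi>: "test_fun \<Omega> \<phi>"
 note s\<phi> = test_fun_smooth[OF \<phi>]
 have 1: "(LINT x|lebesgue_on \<Omega>. glue \<T> (piecewise vgrad w) x $ i $ j * \<phi> x) = (\<Sum>K\<in>\<T>. integral K (%x. pd j (w K) x $ i * \<phi> x))"
  using W_smooth[OF w] s\<phi>
  by (intro LINT_pieces(2)) (auto simp: glue_eq piecewise_def vgrad_def pd_def intro!: smooth_cont smooth_mult smooth_nth smooth_dd)
 have 2: "(LINT x|lebesgue_on \<Omega>. glue \<T> w x $ i * pd j \<phi> x) = (\<Sum>K\<in>\<T>. integral K (%x. w K x $ i * pd j \<phi> x))"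
  using W_smooth[OF w] s\<phi>
  by (intro LINT_pieces(2)) (auto simp: glue_eq pd_def intro!: smooth_cont smooth_mult smooth_nth smooth_dd)
 show "(LINT x|lebesgue_on \<Omega>. glue \<T> (piecewise vgrad w) x $ i $ j * \<phi> x) = - (LINT x|lebesgue_on \<Omega>. glue \<T> w x $ i * pd j \<phi> x)"
  unfolding 1 2 by (rule W_parts[OF w \<phi>])
qed

lemma W_weak_eps:
 assumes w: "w : W_space" shows "weak_eps \<Omega> (glue \<T> w) (glue \<T> (piecewise eps w))"
 unfolding weak_eps_def
proof (intro allI impI)
 fix \<phi> i j assume \<phi>: "test_fun \<Omega> \<phi>"
 note s\<phi> = test_fun_smooth[OF \<phi>]
 have sp: "smooth (%x. pd j (w K) x $ i * \<phi> x)" "smooth (%x. w K x $ i * pd j \<phi> x)" if "K : \<T>" for K i j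
  using W_smooth[OF w that] s\<phi> by (auto intro!: smooth_mult smooth_nth smooth_dd simp: pd_def)
 have 1: "(LINT x|lebesgue_on \<Omega>. glue \<T> (piecewise eps w) x $ i $ j * \<phi> x)
  = (\<Sum>K\<in>\<T>. integral K (%x. (1/2) * (pd j (w K) x $ i * \<phi> x + pd i (w K) x $ j * \<phi> x)))"
 proof (intro LINT_pieces(2))
  fix K x assume "K : \<T>" "x : interior K"
  then show "glue \<T> (piecewise eps w) x $ i $ j * \<phi> x = (1/2) * (pd j (w K) x $ i * \<phi> x + pd i (w K) x $ j * \<phi> x)"
   by (simp add: glue_eq piecewise_def eps_def vgrad_def transpose_def distrib_right)
 qed (use sp in \<open>auto intro!: smooth_cont\<close>)
 have 2: "(LINT x|lebesgue_on \<Omega>. 1/2 * (glue \<T> w x $ i * pd j \<phi> x + glue \<T> w x $ j * pd i \<phi> x))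
  = (\<Sum>K\<in>\<T>. integral K (%x. (1/2) * (w K x $ i * pd j \<phi> x + w K x $ j * pd i \<phi> x)))"
  using sp by (intro LINT_pieces(2)) (auto simp: glue_eq intro!: smooth_cont)
 have lin: "(\<Sum>K\<in>\<T>. integral K (%x. (1/2) * (g K x + h K x))) = (1/2) * ((\<Sum>K\<in>\<T>. integral K (g K)) + (\<Sum>K\<in>\<T>. integral K (h K)))"
  if "!!K. K : \<T> ==> smooth (g K)" "!!K. K : \<T> ==> smooth (h K)" for g h :: "vec3 set => vec3 => real"
 proof -
  have "integral K (%x. (1/2) * (g K x + h K x)) = (1/2) * (integral K (g K) + integral K (h K))" if K: "K : \<T>" for K
   using integral_K_linear(1)[OF mesh_compact[OF K], of "g K" "h K"] \<open>!!K. K : \<T> ==> smooth (g K)\<close>[OF K] \<open>!!K. K : \<T> ==> smooth (h K)\<close>[OF K]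
   by (simp only: integral_mult_right smooth_cont)
  then show ?thesis by (simp add: sum_distrib_left[symmetric] sum.distrib[symmetric] sum_divide_distrib[symmetric])
 qed
 have L: "(\<Sum>K\<in>\<T>. integral K (%x. (1/2) * (pd j (w K) x $ i * \<phi> x + pd i (w K) x $ j * \<phi> x))) =
   (1/2) * ((\<Sum>K\<in>\<T>. integral K (%x. pd j (w K) x $ i * \<phi> x)) + (\<Sum>K\<in>\<T>. integral K (%x. pd i (w K) x $ j * \<phi> x)))"
  by (rule lin) (erule sp)+
 have R: "(\<Sum>K\<in>\<T>. integral K (%x. (1/2) * (w K x $ i * pd j \<phi> x + w K x $ j * pd i \<phi> x))) =
   (1/2) * ((\<Sum>K\<in>\<T>. integral K (%x. w K x $ i * pd j \<phi> x)) + (\<Sum>K\<in>\<T>. integral K (%x. w K x $ j * pd i \<phi> x)))"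
  by (rule lin) (erule sp)+
 have "(\<Sum>K\<in>\<T>. integral K (%x. (1/2) * (pd j (w K) x $ i * \<phi> x + pd i (w K) x $ j * \<phi> x)))
   = - (\<Sum>K\<in>\<T>. integral K (%x. (1/2) * (w K x $ i * pd j \<phi> x + w K x $ j * pd i \<phi> x)))"
  by (rule trans[OF L], rule trans[OF _ arg_cong[OF R[symmetric], of uminus]]) (simp only: W_parts[OF w \<phi>], simp add: algebra_simps)
 then show "(LINT x|lebesgue_on \<Omega>. glue \<T> (piecewise eps w) x $ i $ j * \<phi> x) =
   - (LINT x|lebesgue_on \<Omega>. 1/2 * (glue \<T> w x $ i * pd j \<phi> x + glue \<T> w x $ j * pd i \<phi> x))"
  unfolding 1 2 .
qed

lemma W_H1: assumes w: "w : W_space" shows "glue \<T> w : H1 \<Omega>"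
proof -
 have "L2 \<Omega> (glue \<T> w)" by (rule L2_glue) (intro smooth_cont W_smooth[OF w])
 moreover have "L2 \<Omega> (glue \<T> (piecewise vgrad w))"
  unfolding piecewise_def by (rule L2_glue) (intro smooth_cont smooth_vgrad W_smooth[OF w])
 ultimately show ?thesis unfolding H1_def using W_weak_grad[OF w] by blast
qed

lemma Sg_parts:
 assumes w: "T : Sg_space" and \<phi>: "test_fun \<Omega> \<phi>"
 shows "(\<Sum>K\<in>\<T>. integral K (%x. mdiv (T K) x $ i * \<phi> x)) = - (\<Sum>K\<in>\<T>. integral K (%x. \<Sum>j\<in>UNIV. T K x $ i $ j * pd j \<phi> x))"
proof -
 note s\<phi> = test_fun_smooth[OF \<phi>]
 define H where "H K f = face_int f (%x. \<phi> x * bf (T K) (axis i 1) (n f) x)" for K f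
 have "integral K (%x. mdiv (T K) x $ i * \<phi> x) + integral K (%x. \<Sum>j\<in>UNIV. T K x $ i $ j * pd j \<phi> x) = (\<Sum>f\<in>faces K. osign (n f) K f * H K f)"
  if K: "K : \<T>" for K
 proof -
  note sw = Sg_smooth[OF w K]
  obtain a b c d where T: "tetv K a b c d" by (rule mesh_tetv[OF K])
  have "integral K (%x. mdiv (T K) x $ i * \<phi> x) + integral K (%x. \<Sum>j\<in>UNIV. T K x $ i $ j * pd j \<phi> x)
   = integral K (%x. mdiv (T K) x $ i * \<phi> x + (\<Sum>j\<in>UNIV. T K x $ i $ j * pd j \<phi> x))"
   using sw s\<phi> by (subst integral_K_linear[OF mesh_compact[OF K]]) (auto intro!: smooth_cont smooth_mult smooth_nth smooth_dd smooth_sum simp: pd_def)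
  also have "(%x. mdiv (T K) x $ i * \<phi> x + (\<Sum>j\<in>UNIV. T K x $ i $ j * pd j \<phi> x))
   = (%x. \<phi> x * (axis i 1 <.> mdiv (T K) x) + (\<Sum>k\<in>UNIV. pd k \<phi> x * bf (T K) (axis i 1) (axis k 1) x))"
   by (simp add: bf_axis inner_axis' mult.commute)
  also have "integral K \<dots> = (\<Sum>f\<in>faces K. osign (n f) K f * H K f)"
   unfolding H_def by (rule gauss_matrix[OF T sw s\<phi> mesh_normal[OF K]])
  finally show ?thesis .
 qed
 then have "(\<Sum>K\<in>\<T>. integral K (%x. mdiv (T K) x $ i * \<phi> x)) + (\<Sum>K\<in>\<T>. integral K (%x. \<Sum>j\<in>UNIV. T K x $ i $ j * pd j \<phi> x))
   = (\<Sum>K\<in>\<T>. \<Sum>f\<in>faces K. osign (n f) K f * H K f)"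
  unfolding sum.distrib[symmetric] by (rule sum.cong[OF refl])
 also have "\<dots> = 0"
 proof (rule mesh_sum)
  fix K K' f assume K: "K : \<T>" "K' : \<T>" and f: "f : faces K" "f : faces K'"
  obtain a b c where T: "triv f a b c" by (rule mesh_triv[OF K(1) f(1)])
  show "H K f = H K' f"
   unfolding H_def using Sg_smooth[OF w K(1)] Sg_smooth[OF w K(2)] s\<phi> Sg_conf[OF w K f]
   by (intro face_int_cong[OF T]) (auto intro!: smooth_cont smooth_mult smooth_bf)
 next
  fix K f assume K: "K : \<T>" "f : faces K" "f \<inter> \<Omega> = {}"
  obtain a b c where T: "triv f a b c" by (rule mesh_triv[OF K(1,2)])
  show "H K f = 0"
   unfolding H_def using Sg_smooth[OF w K(1)] s\<phi> outside_test[OF \<phi> K(3)] by (intro face_int_zero[OF T]) (auto intro!: smooth_mult smooth_bf)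
 qed
 finally show ?thesis by simp
qed

lemma Sg_weak_div:
 assumes w: "T : Sg_space" shows "weak_div \<Omega> (glue \<T> T) (glue \<T> (piecewise mdiv T))"
 unfolding weak_div_def
proof (intro allI impI)
 fix \<phi> i assume \<phi>: "test_fun \<Omega> \<phi>"
 note s\<phi> = test_fun_smooth[OF \<phi>]
 have 1: "(LINT x|lebesgue_on \<Omega>. glue \<T> (piecewise mdiv T) x $ i * \<phi> x) = (\<Sum>K\<in>\<T>. integral K (%x. mdiv (T K) x $ i * \<phi> x))"
  using Sg_smooth[OF w] s\<phi>
  by (intro LINT_pieces(2)) (auto simp: glue_eq piecewise_def intro!: smooth_cont smooth_mult smooth_nth)
 have 2: "(LINT x|lebesgue_on \<Omega>. (\<Sum>j\<in>UNIV. glue \<T> T x $ i $ j * pd j \<phi> x)) = (\<Sum>K\<in>\<T>. integral K (%x. \<Sum>j\<in>UNIV. T K x $ i $ j * pd j \<phi> x))"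
  using Sg_smooth[OF w] s\<phi>
  by (intro LINT_pieces(2)) (auto simp: glue_eq pd_def intro!: smooth_cont smooth_mult smooth_nth smooth_dd smooth_sum)
 show "(LINT x|lebesgue_on \<Omega>. glue \<T> (piecewise mdiv T) x $ i * \<phi> x) = - (LINT x|lebesgue_on \<Omega>. (\<Sum>j\<in>UNIV. glue \<T> T x $ i $ j * pd j \<phi> x))"
  unfolding 1 2 by (rule Sg_parts[OF w \<phi>])
qed

lemma glue_Sym: "(!!K x. K : \<T> ==> u K x : Sym) ==> glue \<T> u x : Sym"
proof (cases "\<exists>K\<in>\<T>. x : interior K")
 case True
 then obtain K where K: "K : \<T>" "x : interior K" by blast
 assume "!!K x. K : \<T> ==> u K x : Sym"
 then show ?thesis unfolding glue_eq[OF K] using K by blast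
next
 case False
 then have "glue \<T> u x = 0" by (simp only: glue_def if_False)
 then show ?thesis using subspace_0[OF subspace_Sym] by simp
qed

lemma Sg_H_div: assumes w: "T : Sg_space" shows "glue \<T> T : H_div \<Omega>"
proof -
 have "L2 \<Omega> (glue \<T> T)" by (rule L2_glue) (intro smooth_cont Sg_smooth[OF w])
 moreover have "L2 \<Omega> (glue \<T> (piecewise mdiv T))"
  unfolding piecewise_def by (rule L2_glue) (intro smooth_cont smooth_mdiv Sg_smooth[OF w])
 moreover have "glue \<T> T x : Sym" for x
  using polyi_val[OF Sg_piece[OF w] subspace_Sym] by (rule glue_Sym)
 ultimately show ?thesis unfolding H_div_def using Sg_weak_div[OF w] by blast
qed

end

section \<open>Orientation of edges\<close>

lemma orthonormal_frame:
 assumes u: "norm s = 1" "norm m = 1" "norm n = 1" and o: "m <.> s = 0" "n <.> s = 0" "n <.> m = 0"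
 shows "v = (s <.> v) *R s + (m <.> v) *R m + (n <.> v) *R n"
  "cross3 m n = (s <.> cross3 m n) *R s" "(s <.> cross3 m n) * (s <.> cross3 m n) = 1"
proof -
 have uu: "s <.> s = 1" "m <.> m = 1" "n <.> n = 1" using u by (simp_all add: dot_square_norm)
 have o': "s <.> m = 0" "s <.> n = 0" "m <.> n = 0" using o by (simp_all add: inner_commute)
 have "cross3 m n <.> cross3 m n = 1" by (simp add: dot_cross uu o')
 then have N: "cross3 m n ~= 0" "norm (cross3 m n) = 1" by (auto simp: norm_eq_sqrt_inner)
 show c: "cross3 m n = (s <.> cross3 m n) *R s" by (rule unit_normal_cross(1)[OF u(1) o'(1,2)])
 have "\<bar>s <.> cross3 m n\<bar> = 1" using unit_normal_cross(2)[OF u(1) o'(1,2)] N by simp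
 then show "(s <.> cross3 m n) * (s <.> cross3 m n) = 1" using abs_mult_self_eq by (metis mult_1)
 define w where "w = v - ((s <.> v) *R s + (m <.> v) *R m + (n <.> v) *R n)"
 have "s <.> w = 0" "m <.> w = 0" "n <.> w = 0" by (simp_all add: w_def inner_diff_right inner_add_right uu o o')
 moreover obtain \<alpha> \<beta> where "w = \<alpha> *R m + \<beta> *R n"
  by (rule tangential_span[OF N(1) u(1) o'(1,2) \<open>s <.> w = 0\<close>])
 ultimately have "\<alpha> = 0" "\<beta> = 0" "w = \<alpha> *R m + \<beta> *R n" by (simp_all add: inner_add_right uu o o')
 then have "w = 0" by simp
 then show "v = (s <.> v) *R s + (m <.> v) *R m + (n <.> v) *R n" by (simp add: w_def)
qed

lemma face_frame:
 assumes T: "triv f a b c" and n: "unit_normal f n" and s: "unit_tangent (seg a b) s"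
 shows "norm s = 1" "norm (conormal f (seg a b)) = 1" "norm n = 1"
  "conormal f (seg a b) <.> s = 0" "n <.> s = 0" "n <.> conormal f (seg a b) = 0"
proof -
 obtain \<kappa> where \<kappa>: "s = \<kappa> *R (b - a)" "norm s = 1" by (rule unit_tangent_seg[OF s triv_distinct(1)[OF T]])
 show "norm s = 1" by fact
 show "norm (conormal f (seg a b)) = 1" by (rule conormal_triv(1)[OF T])
 show "norm n = 1" using unit_normal_triv[OF T n] by simp
 show "conormal f (seg a b) <.> s = 0" using conormal_triv(2)[OF T] by (simp add: \<kappa>)
 show "n <.> s = 0" using unit_normal_triv[OF T n] by (simp add: \<kappa>)
 show "n <.> conormal f (seg a b) = 0" by (rule conormal_orth_normal[OF T n])
qed

text \<open>Since the conormal points into \<open>f\<close>,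
  \<open>cross3 (conormal f e) (n f)\<close> is the boundary tangent that \<open>n f\<close> induces
  on \<open>e\<close>. The value 1 or -1 compares it with the fixed tangent.\<close>

definition orient :: "(vec3 set => vec3) => (vec3 set => vec3) => vec3 set => vec3 set => real" where
 "orient n s f e = s e <.> cross3 (conormal f e) (n f)"

text \<open>Evaluates a triple product in the frame of one of the two faces at the edge. It changes
  sign when \<open>c\<close> and \<open>d\<close> are exchanged, and this relates the signs of the
  two faces.\<close>

lemma orient_tetra_pair:
 assumes T: "tetv K a b c d" and n: "!!f. f : faces K ==> unit_normal f (n f)" and s: "unit_tangent (seg a b) (s (seg a b))"
 obtains r where "r > 0" "s (seg a b) <.> cross3 (c - a) (d - a) =
  - r * (osign (n (hull3 a b c)) K (hull3 a b c) * orient n s (hull3 a b c) (seg a b))"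
proof -
 let ?e = "seg a b" and ?f = "hull3 a b c"
 note F = tetv_triv[OF T]
 have nf: "unit_normal ?f (n ?f)" by (rule n[OF tetv_face[OF T]])
 define m where "m = conormal ?f ?e"
 note fr = face_frame[OF F nf s, folded m_def]
 note o = orthonormal_frame[OF fr]
 have nc: "n ?f <.> (c - a) = 0" using unit_normal_triv[OF F nf] by simp
 have mc: "m <.> (c - a) > 0" unfolding m_def by (rule conormal_triv(3)[OF F])
 have "cross3 (c - a) (d - a) = cross3 ((s ?e <.> (c - a)) *R s ?e + (m <.> (c - a)) *R m) (d - a)"
  using o(1)[of "c - a"] nc by simp
 then have "s ?e <.> cross3 (c - a) (d - a) = (s ?e <.> (c - a)) * (s ?e <.> cross3 (s ?e) (d - a)) + (m <.> (c - a)) * (s ?e <.> cross3 m (d - a))"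
  by (simp only: cross_add_left cross_mult_left inner_add_right inner_scaleR_right)
 also have "s ?e <.> cross3 (s ?e) (d - a) = 0" by (rule dot_cross_self)
 also have "s ?e <.> cross3 m (d - a) = (n ?f <.> (d - a)) * orient n s ?f ?e"
 proof -
  have "cross3 m (d - a) = cross3 m ((s ?e <.> (d - a)) *R s ?e + (m <.> (d - a)) *R m + (n ?f <.> (d - a)) *R n ?f)"
   using o(1)[of "d - a"] by simp
  then show ?thesis
   by (simp add: cross_add_right cross_mult_right inner_add_right orient_def m_def[symmetric] dot_cross_self)
 qed
 finally have D: "s ?e <.> cross3 (c - a) (d - a) = (m <.> (c - a)) * ((n ?f <.> (d - a)) * orient n s ?f ?e)" by simp
 let ?\<sigma> = "osign (n ?f) K ?f"
 have "n ?f <.> (d - a) = (?\<sigma> * ?\<sigma>) * (n ?f <.> (d - a))" by simp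
 also have "\<dots> = ?\<sigma> * (- \<bar>n ?f <.> (d - a)\<bar>)" using osign_tetv(1)[OF T nf] by (simp only: mult.assoc)
 finally have "s ?e <.> cross3 (c - a) (d - a) = (m <.> (c - a)) * ((?\<sigma> * (- \<bar>n ?f <.> (d - a)\<bar>)) * orient n s ?f ?e)"
  using D by simp
 then have "s ?e <.> cross3 (c - a) (d - a) = - ((m <.> (c - a)) * \<bar>n ?f <.> (d - a)\<bar>) * (?\<sigma> * orient n s ?f ?e)"
  by (simp add: mult_ac)
 moreover have "(m <.> (c - a)) * \<bar>n ?f <.> (d - a)\<bar> > 0" using mc osign_tetv(3)[OF T nf] by simp
 ultimately show thesis by (rule that[rotated])
qed

lemma faces_around_edge:
 assumes T: "tetv K a b c d"
 shows "{f : faces K. seg a b : edges f} = {hull3 a b c, hull3 a b d}"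
proof -
 have T2: "tetv K a b d c" by (rule tetv_perm[OF T]) auto
 have no: "seg a b \<notin> edges (convex hull C)" if C: "C \<subseteq> {a, b, c, d} - {x}" "x : {a, b}" for C x
 proof
  assume "seg a b : edges (convex hull C)"
  then have "seg a b \<subseteq> convex hull C" by (auto simp: edges_def dest: face_of_imp_subset)
  then have "x : convex hull C" using C(2) by auto
  then have "x : affine hull ({a, b, c, d} - {x})"
   using C convex_hull_subset_affine_hull hull_mono[OF C(1), of affine] by blast
  then have "affine_dependent {a, b, c, d}" unfolding affine_dependent_def using C(2) by blast
  then show False using T by (simp add: tetv_def)
 qed
 have "seg a b \<notin> edges (hull3 a c d)" "seg a b \<notin> edges (hull3 b c d)"
  using tetv_distinct[OF T] by (intro no[where x = b] no[where x = a]; auto)+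
 moreover have "seg a b : edges (hull3 a b c)" "seg a b : edges (hull3 a b d)"
  by (rule triv_edge[OF tetv_triv[OF T]], rule triv_edge[OF tetv_triv[OF T2]])
 ultimately show ?thesis unfolding tetv_faces[OF T] by auto
qed

text \<open>The boundary of the boundary is zero: oriented outwards, the two faces of
  \<open>K\<close> at \<open>e\<close> induce opposite orientations on \<open>e\<close>.\<close>

lemma orient_tetra:
 assumes T: "tetv K a b c d" and e: "e : edges K" and n: "!!f. f : faces K ==> unit_normal f (n f)" and s: "unit_tangent e (s e)"
 shows "(\<Sum>f | f : faces K & e : edges f. osign (n f) K f * orient n s f e) = 0"
proof -
 obtain a b c d where T: "tetv K a b c d" and e: "e = seg a b" by (rule edge_cases[OF T e])
 have T2: "tetv K a b d c" by (rule tetv_perm[OF T]) auto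
 let ?f = "hull3 a b c" and ?g = "hull3 a b d"
 note F = tetv_triv[OF T] and G = tetv_triv[OF T2]
 let ?F = "osign (n ?f) K ?f * orient n s ?f e" and ?G = "osign (n ?g) K ?g * orient n s ?g e"
 obtain r where r: "r > 0" "s e <.> cross3 (c - a) (d - a) = - r * ?F"
  using orient_tetra_pair[where n = n and s = s, OF T n] s unfolding e by blast
 obtain q where q: "q > 0" "s e <.> cross3 (d - a) (c - a) = - q * ?G"
  using orient_tetra_pair[where n = n and s = s, OF T2 n] s unfolding e by blast
 have "s e <.> cross3 (d - a) (c - a) = - (s e <.> cross3 (c - a) (d - a))"
  by (subst cross_skew) simp
 with r q have eq: "q * ?G = - (r * ?F)" by simp
 have sq: "(\<sigma> * t) * (\<sigma> * t) = 1" if "\<sigma> * \<sigma> = 1" "t * t = 1" for \<sigma> t :: real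
  using that by (metis mult.assoc mult.commute mult_1)
 have "?F * ?F = 1" "?G * ?G = 1"
  using orthonormal_frame(3)[OF face_frame[OF F n[OF tetv_face[OF T]] s[unfolded e]]]
   orthonormal_frame(3)[OF face_frame[OF G n[OF tetv_face[OF T2]] s[unfolded e]]]
  by (auto intro!: sq simp: orient_def e)
 then have F1: "?F = 1 \<or> ?F = -1" and G1: "?G = 1 \<or> ?G = -1" by (metis square_eq_1_iff)+
 have "?F + ?G = 0"
 proof -
  have "F + G = 0" if "q * G = - (r * F)" "F = 1 \<or> F = - 1" "G = 1 \<or> G = - 1" for F G
   using that r(1) q(1) by (elim disjE) auto
  from this[OF eq F1 G1] show ?thesis .
 qed
 moreover have "?f ~= ?g" using triv_hull_eq[OF F G] tetv_distinct[OF T] by auto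
 ultimately show ?thesis using faces_around_edge[OF T] by (simp add: e)
qed

section \<open>The weak incompatibility operator\<close>

text \<open>The face integrand left by two integrations by parts of \<open>ccs\<close>, with
  \<open>cross3 p q\<close> and \<open>cross3 r t\<close> in place of the row and column index: one
  part has a derivative on \<open>S\<close>, the other on \<open>\<phi>\<close>.\<close>

definition fint :: "(vec3 => mat3) => (vec3 => real) => vec3 => vec3 => vec3 => vec3 => vec3 => vec3 => real" where
 "fint S \<phi> n p q r t x =
   \<phi> x * ((n <.> p) * (dd r (bf S q t) x - dd t (bf S q r) x) - (n <.> q) * (dd r (bf S p t) x - dd t (bf S p r) x))
   - ((n <.> r) * (bf S q t x * dd p \<phi> x - bf S p t x * dd q \<phi> x) - (n <.> t) * (bf S q r x * dd p \<phi> x - bf S p r x * dd q \<phi> x))"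

text \<open>The integrand of \<open>weak_ccs\<close> for the same component; see
  \<open>levi_civita_sum_hpair\<close>.\<close>

definition hpair :: "(vec3 => mat3) => (vec3 => real) => vec3 => vec3 => vec3 => vec3 => vec3 => real" where
 "hpair S \<phi> p q r t x = bf S q t x * dd p (dd r \<phi>) x - bf S q r x * dd p (dd t \<phi>) x
   - bf S p t x * dd q (dd r \<phi>) x + bf S p r x * dd q (dd t \<phi>) x"

lemma smooth_hpair: "smooth S ==> smooth \<phi> ==> smooth (hpair S \<phi> p q r t)"
 unfolding hpair_def[abs_def] by (intro smooth_add smooth_diff smooth_mult smooth_bf smooth_dd)

lemma smooth_fint: "smooth S ==> smooth \<phi> ==> smooth (fint S \<phi> n p q r t)"
 unfolding fint_def[abs_def] by (intro smooth_diff smooth_mult smooth_bf smooth_dd smooth_const)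

lemma levi_civita_sum_hpair:
 assumes i: "axis i (1 :: real) = cross3 p q" and j: "axis j (1 :: real) = cross3 r t" and \<phi>: "smooth \<phi>"
 shows "(\<Sum>k\<in>UNIV. \<Sum>l\<in>UNIV. \<Sum>m\<in>UNIV. \<Sum>c\<in>UNIV. levi_civita i k l * levi_civita j m c * S x $ l $ c * pd k (pd m \<phi>) x)
   = hpair S \<phi> p q r t x"
proof -
 have contract: "(\<Sum>m\<in>UNIV. \<Sum>c\<in>UNIV. levi_civita j m c * g m c) = (\<Sum>m\<in>UNIV. \<Sum>c\<in>UNIV. (r $ m * t $ c - t $ m * r $ c) * g m c)"
  if "axis j (1 :: real) = cross3 r t" for j r t g
 proof -
  have "(\<Sum>m\<in>UNIV. \<Sum>c\<in>UNIV. levi_civita j m c * g m c) = (\<Sum>j'\<in>UNIV. axis j 1 $ j' * (\<Sum>m\<in>UNIV. \<Sum>c\<in>UNIV. levi_civita j' m c * g m c))"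
   by (simp add: axis_def if_distrib[of "%y. y * _"] cong: if_cong)
  then show ?thesis unfolding that levi_civita_cross .
 qed
 have dr: "dd v \<psi> x = (\<Sum>k\<in>UNIV. v $ k * pd k \<psi> x)" if "smooth \<psi>" for v and \<psi> :: "vec3 => real" and x
  using dd_eq_sum_pd[OF that, of v] by simp
 have sp: "smooth (pd k \<psi>)" if "smooth \<psi>" for k and \<psi> :: "vec3 => real" using that by (simp add: pd_def)
 have pdd: "pd k (dd v \<phi>) x = (\<Sum>m\<in>UNIV. v $ m * pd k (pd m \<phi>) x)" for k v
 proof -
  have "pd k (dd v \<phi>) x = dd v (pd k \<phi>) x"
   unfolding pd_def by (rule fun_cong[OF dd_commute[OF \<phi>]])
  also have "\<dots> = (\<Sum>m\<in>UNIV. v $ m * pd m (pd k \<phi>) x)" by (rule dr[OF sp[OF \<phi>]])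
  also have "\<dots> = (\<Sum>m\<in>UNIV. v $ m * pd k (pd m \<phi>) x)" unfolding pd_def using \<phi> by (simp add: dd_commute[of \<phi>])
  finally show ?thesis .
 qed
 define a where "a l v = (\<Sum>c\<in>UNIV. v $ c * S x $ l $ c)" for l and v :: vec3
 have inner: "(\<Sum>m\<in>UNIV. \<Sum>c\<in>UNIV. levi_civita j m c * (S x $ l $ c * pd k (pd m \<phi>) x)) =
   a l t * pd k (dd r \<phi>) x - a l r * pd k (dd t \<phi>) x" for k l
  unfolding contract[OF j] pdd a_def by (simp add: sum_3 algebra_simps)
 have ab: "bf S u v x = (\<Sum>l\<in>UNIV. u $ l * a l v)" for u v
  by (simp add: bf_def a_def inner_vec_def matrix_vector_mult_def mult.commute)
 have "(\<Sum>k\<in>UNIV. \<Sum>l\<in>UNIV. \<Sum>m\<in>UNIV. \<Sum>c\<in>UNIV. levi_civita i k l * levi_civita j m c * S x $ l $ c * pd k (pd m \<phi>) x)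
  = (\<Sum>k\<in>UNIV. \<Sum>l\<in>UNIV. levi_civita i k l * (\<Sum>m\<in>UNIV. \<Sum>c\<in>UNIV. levi_civita j m c * (S x $ l $ c * pd k (pd m \<phi>) x)))"
  by (simp only: sum_distrib_left mult.assoc)
 also have "\<dots> = (\<Sum>k\<in>UNIV. \<Sum>l\<in>UNIV. (p $ k * q $ l - q $ k * p $ l) * (a l t * pd k (dd r \<phi>) x - a l r * pd k (dd t \<phi>) x))"
  unfolding inner by (rule contract[OF i])
 also have "\<dots> = hpair S \<phi> p q r t x"
  unfolding hpair_def ab dr[OF smooth_dd[OF \<phi>]] by (simp add: sum_3 algebra_simps)
 finally show ?thesis .
qed

lemma ccs_parts:
 assumes T: "tetv K a b c d" and S: "smooth S" and \<phi>: "smooth \<phi>" and n: "!!f. f : faces K ==> unit_normal f (n f)"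
 shows "integral K (%x. bf (ccs S) (cross3 p q) (cross3 r t) x * \<phi> x - hpair S \<phi> p q r t x)
  = (\<Sum>f\<in>faces K. osign (n f) K f * face_int f (fint S \<phi> (n f) p q r t))"
proof -
 define g1 where "g1 x = \<phi> x * (dd r (bf S q t) x - dd t (bf S q r) x)" for x
 define g2 where "g2 x = \<phi> x * (dd r (bf S p t) x - dd t (bf S p r) x)" for x
 define h1 where "h1 x = bf S q t x * dd p \<phi> x - bf S p t x * dd q \<phi> x" for x
 define h2 where "h2 x = bf S q r x * dd p \<phi> x - bf S p r x * dd q \<phi> x" for x
 have sm: "smooth g1" "smooth g2" "smooth h1" "smooth h2"
  unfolding g1_def[abs_def] g2_def[abs_def] h1_def[abs_def] h2_def[abs_def]
  using S \<phi> by (auto intro!: smooth_diff smooth_mult smooth_bf smooth_dd)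
 have c: "dd p (dd r \<phi>) = dd r (dd p \<phi>)" "dd p (dd t \<phi>) = dd t (dd p \<phi>)" "dd q (dd r \<phi>) = dd r (dd q \<phi>)" "dd q (dd t \<phi>) = dd t (dd q \<phi>)"
  using \<phi> by (rule dd_commute)+
 \<comment> \<open>By the product rule the terms with one derivative on each factor cancel, so the
   difference is a sum of derivatives to which \<open>gauss\<close> applies.\<close>
 have "bf (ccs S) (cross3 p q) (cross3 r t) x * \<phi> x - hpair S \<phi> p q r t x = dd p g1 x - dd q g2 x - dd r h1 x + dd t h2 x" for x
  unfolding ccs_form[OF S] hpair_def c g1_def[abs_def] g2_def[abs_def] h1_def[abs_def] h2_def[abs_def]
  using S \<phi> by (simp add: dd_mult dd_diff) (simp add: algebra_simps)
 then have "integral K (%x. bf (ccs S) (cross3 p q) (cross3 r t) x * \<phi> x - hpair S \<phi> p q r t x)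
  = integral K (dd p g1) - integral K (dd q g2) - integral K (dd r h1) + integral K (dd t h2)"
  using sm by (simp add: integral_K_linear[OF tetv_compact[OF T]] smooth_cont continuous_intros)
 also have "\<dots> = (\<Sum>f\<in>faces K. osign (n f) K f * ((n f <.> p) * face_int f g1 - (n f <.> q) * face_int f g2
   - (n f <.> r) * face_int f h1 + (n f <.> t) * face_int f h2))"
 proof -
  have G: "integral K (dd v g) = (\<Sum>f\<in>faces K. osign (n f) K f * ((n f <.> v) * face_int f g))" if "smooth g" for v g
   using gauss[OF T that n, of v] by (simp add: mult.assoc)
  show ?thesis
   by (simp only: G[OF sm(1)] G[OF sm(2)] G[OF sm(3)] G[OF sm(4)] right_diff_distrib distrib_left sum.distrib sum_subtractf)
 qed
 also have "\<dots> = (\<Sum>f\<in>faces K. osign (n f) K f * face_int f (fint S \<phi> (n f) p q r t))"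
 proof (rule sum.cong[OF refl])
  fix f assume "f : faces K"
  then obtain a' b' c' d' where T': "tetv K a' b' c' d'" "f = convex hull {a', b', c'}" by (rule face_cases[OF T])
  then have tr: "triv f a' b' c'" using tetv_triv by blast
  have "fint S \<phi> (n f) p q r t = (%x. (n f <.> p) * g1 x - (n f <.> q) * g2 x - (n f <.> r) * h1 x + (n f <.> t) * h2 x)"
   by (simp add: fun_eq_iff fint_def g1_def g2_def h1_def h2_def algebra_simps)
  then have "face_int f (fint S \<phi> (n f) p q r t) = (n f <.> p) * face_int f g1 - (n f <.> q) * face_int f g2
   - (n f <.> r) * face_int f h1 + (n f <.> t) * face_int f h2"
   using sm by (simp add: face_int_eq[OF tr] M2_add M2_diff M2_cmult smooth_cont continuous_intros) (simp add: algebra_simps)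
  then show "osign (n f) K f * ((n f <.> p) * face_int f g1 - (n f <.> q) * face_int f g2 - (n f <.> r) * face_int f h1 + (n f <.> t) * face_int f h2)
   = osign (n f) K f * face_int f (fint S \<phi> (n f) p q r t)" by simp
 qed
 finally show ?thesis .
qed

text \<open>If the tangential part of \<open>J\<close> and \<open>\<Lambda> J\<close> vanish on a face then the face integrand is a tangential
 derivative, which leads to integrals over the edges of the face by Stokes' theorem.\<close>
lemma fint_trace:
 assumes J: "smooth J" "!!x. J x : Sym" and \<phi>: "smooth \<phi>" and n: "norm n = 1"
  and tan: "!!u v. n <.> u = 0 ==> n <.> v = 0 ==> bf J u v x = 0"
  and dtan: "!!r u v. n <.> r = 0 ==> n <.> u = 0 ==> n <.> v = 0 ==> dd r (bf J u v) x = 0"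
  and lam: "!!u v. n <.> u = 0 ==> n <.> v = 0 ==> dd n (bf J u v) x = dd v (bf J n u) x + dd u (bf J n v) x"
 shows "fint J \<phi> n p q r t x = dd (cross3 (cross3 p q) n) (%x. \<phi> x * bf J n (cross3 (cross3 r t) n) x) x"
proof -
 have nn: "n <.> n = 1" using n by (simp add: dot_square_norm)
 have cr: "cross3 (cross3 u v) n = (n <.> u) *R v - (n <.> v) *R u" for u v
 proof -
  have "cross3 (cross3 u v) n = - cross3 n (cross3 u v)" by (rule cross_skew)
  then show ?thesis by (simp add: Lagrange)
 qed
 define P Q R U where "P = Qp n *v p" and "Q = Qp n *v q" and "R = Qp n *v r" and "U = Qp n *v t"
 define \<alpha> \<beta> \<rho> \<theta> where "\<alpha> = n <.> p" and "\<beta> = n <.> q" and "\<rho> = n <.> r" and "\<theta> = n <.> t"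
 have o: "n <.> P = 0" "n <.> Q = 0" "n <.> R = 0" "n <.> U = 0" unfolding P_def Q_def R_def U_def by (rule Qp_orth[OF n])+
 have dec: "p = P + \<alpha> *R n" "q = Q + \<beta> *R n" "r = R + \<rho> *R n" "t = U + \<theta> *R n"
  by (simp_all add: P_def Q_def R_def U_def Qp_vec \<alpha>_def \<beta>_def \<rho>_def \<theta>_def)
 have sym: "bf J v n = bf J n v" for v using J(2) by (rule bf_Sym)
 \<comment> \<open>After splitting \<open>r\<close> and \<open>t\<close>, \<open>dtan\<close>
   removes the tangential derivatives of tangential components, and \<open>lam\<close> replaces
   their normal derivatives by tangential ones of components with a normal index.\<close>
 have key: "dd r (bf J (V + \<gamma> *R n) t) x - dd t (bf J (V + \<gamma> *R n) r) x
  = \<gamma> * (dd r (bf J n t) x - dd t (bf J n r) x) + (\<rho> * dd V (bf J n U) x - \<theta> * dd V (bf J n R) x)" if V: "n <.> V = 0" for V \<gamma>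
 proof -
  have 1: "dd r (bf J V t) x = \<theta> * dd R (bf J n V) x + \<rho> * (dd U (bf J n V) x + dd V (bf J n U) x) + \<rho> * \<theta> * dd n (bf J n V) x"
   unfolding dec(3,4) using J(1) by (simp add: bf_lin dd_add dd_cmult dd_dir_add dd_dir_scaleR sym dtan V o lam) (simp add: algebra_simps)
  have 2: "dd t (bf J V r) x = \<rho> * dd U (bf J n V) x + \<theta> * (dd R (bf J n V) x + dd V (bf J n R) x) + \<rho> * \<theta> * dd n (bf J n V) x"
   unfolding dec(3,4) using J(1) by (simp add: bf_lin dd_add dd_cmult dd_dir_add dd_dir_scaleR sym dtan V o lam) (simp add: algebra_simps)
  have 3: "dd k (bf J (V + \<gamma> *R n) l) x = dd k (bf J V l) x + \<gamma> * dd k (bf J n l) x" for k l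
   using J(1) by (simp add: bf_lin dd_add dd_cmult)
  show ?thesis unfolding 3 1 2 by (simp add: algebra_simps)
 qed
 define G where "G = dd r (bf J n t) x - dd t (bf J n r) x"
 have k1: "dd r (bf J q t) x - dd t (bf J q r) x = \<beta> * G + (\<rho> * dd Q (bf J n U) x - \<theta> * dd Q (bf J n R) x)"
  using key[OF o(2), of \<beta>] unfolding dec(2)[symmetric] G_def .
 have k2: "dd r (bf J p t) x - dd t (bf J p r) x = \<alpha> * G + (\<rho> * dd P (bf J n U) x - \<theta> * dd P (bf J n R) x)"
  using key[OF o(1), of \<alpha>] unfolding dec(1)[symmetric] G_def .
 have z: "cross3 (cross3 r t) n = \<rho> *R U - \<theta> *R R"
  unfolding cr \<rho>_def[symmetric] \<theta>_def[symmetric] by (subst dec(4), subst dec(3)) (simp add: algebra_simps)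
 have w: "cross3 (cross3 p q) n = \<alpha> *R Q - \<beta> *R P"
  unfolding cr \<alpha>_def[symmetric] \<beta>_def[symmetric] by (subst dec(2), subst dec(1)) (simp add: algebra_simps)
 have b: "bf J (V + \<gamma> *R n) l x = \<gamma> * bf J n l x" if "n <.> V = 0" "n <.> l = 0" for V \<gamma> l
  using that by (simp add: bf_lin tan)
 have zz: "\<rho> * bf J v t x - \<theta> * bf J v r x = bf J v (\<rho> *R U - \<theta> *R R) x" for v
  unfolding dec(3,4) by (simp add: bf_lin algebra_simps)
 have oz: "n <.> (\<rho> *R U - \<theta> *R R) = 0" by (simp add: inner_diff_right o)
 have bq: "bf J q (\<rho> *R U - \<theta> *R R) x = \<beta> * bf J n (\<rho> *R U - \<theta> *R R) x"
  unfolding dec(2) by (rule b[OF o(2) oz])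
 have bp: "bf J p (\<rho> *R U - \<theta> *R R) x = \<alpha> * bf J n (\<rho> *R U - \<theta> *R R) x"
  unfolding dec(1) by (rule b[OF o(1) oz])
 have dp: "dd p \<phi> x = dd P \<phi> x + \<alpha> * dd n \<phi> x" "dd q \<phi> x = dd Q \<phi> x + \<beta> * dd n \<phi> x"
  unfolding dec(1,2) using \<phi> by (simp_all add: dd_dir_add dd_dir_scaleR)
 define Z where "Z = bf J n (\<rho> *R U - \<theta> *R R) x"
 have "fint J \<phi> n p q r t x = \<phi> x * (\<alpha> * (\<beta> * G + (\<rho> * dd Q (bf J n U) x - \<theta> * dd Q (bf J n R) x)) - \<beta> * (\<alpha> * G + (\<rho> * dd P (bf J n U) x - \<theta> * dd P (bf J n R) x)))
   - ((\<rho> * bf J q t x - \<theta> * bf J q r x) * dd p \<phi> x - (\<rho> * bf J p t x - \<theta> * bf J p r x) * dd q \<phi> x)"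
  unfolding fint_def k1 k2 \<alpha>_def[symmetric] \<beta>_def[symmetric] \<rho>_def[symmetric] \<theta>_def[symmetric] by (simp add: algebra_simps)
 also have "\<dots> = \<phi> x * (\<alpha> * (\<rho> * dd Q (bf J n U) x - \<theta> * dd Q (bf J n R) x) - \<beta> * (\<rho> * dd P (bf J n U) x - \<theta> * dd P (bf J n R) x))
   - (\<beta> * Z * (dd P \<phi> x + \<alpha> * dd n \<phi> x) - \<alpha> * Z * (dd Q \<phi> x + \<beta> * dd n \<phi> x))"
  unfolding zz bq bp dp Z_def by (simp add: algebra_simps)
 \<comment> \<open>The two terms with \<open>dd n \<phi> x\<close> cancel, so that only tangential
   derivatives of \<open>\<phi>\<close> are left.\<close>
 also have "\<dots> = dd (\<alpha> *R Q - \<beta> *R P) (%x. \<phi> x * bf J n (\<rho> *R U - \<theta> *R R) x) x"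
 proof -
  have dz: "dd v (bf J n (\<rho> *R U - \<theta> *R R)) x = \<rho> * dd v (bf J n U) x - \<theta> * dd v (bf J n R) x" for v
   using J(1) by (simp add: bf_lin dd_diff dd_cmult)
  have sm: "smooth (%x. \<phi> x * bf J n (\<rho> *R U - \<theta> *R R) x)" using \<phi> J(1) by (intro smooth_mult smooth_bf)
  have dm: "dd v (%x. \<phi> x * bf J n (\<rho> *R U - \<theta> *R R) x) x = \<phi> x * (\<rho> * dd v (bf J n U) x - \<theta> * dd v (bf J n R) x) + dd v \<phi> x * Z" for v
   using dd_mult[OF \<phi> smooth_bf[OF J(1)], of v n "\<rho> *R U - \<theta> *R R"] by (simp add: dz Z_def)
  have dl: "dd (\<alpha> *R Q - \<beta> *R P) g x = \<alpha> * dd Q g x - \<beta> * dd P g x" if "smooth g" for g :: "vec3 => real"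
   using that by (simp add: dd_dir_diff dd_dir_scaleR)
  show ?thesis unfolding dl[OF sm] unfolding dm by (simp add: algebra_simps)
 qed
 finally show ?thesis unfolding w z .
qed

lemma frame_crosses:
 assumes u: "norm s = 1" "norm m = 1" "norm n = 1" and o: "m <.> s = 0" "n <.> s = 0" "n <.> m = 0"
 defines "\<tau> \<equiv> s <.> cross3 m n"
 shows "cross3 m n = \<tau> *R s" "cross3 s n = - \<tau> *R m" "cross3 s m = \<tau> *R n" "\<tau> * \<tau> = 1"
proof -
 note f = orthonormal_frame[OF u o, folded \<tau>_def]
 show c: "cross3 m n = \<tau> *R s" "\<tau> * \<tau> = 1" by (rule f)+
 have uu: "m <.> m = 1" "n <.> n = 1" using u by (simp_all add: dot_square_norm)
 have s: "s = \<tau> *R cross3 m n" by (simp add: c(1)) (simp add: c(2))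
 have 1: "cross3 (cross3 m n) n = - m"
  using cross_skew[of "cross3 m n" n] by (simp add: Lagrange uu o)
 have 2: "cross3 (cross3 m n) m = n"
  using cross_skew[of "cross3 m n" m] o(3) by (simp add: Lagrange uu inner_commute)
 show "cross3 s n = - \<tau> *R m" by (subst s) (simp add: cross_mult_left 1)
 show "cross3 s m = \<tau> *R n" by (subst s) (simp add: cross_mult_left 2)
qed

context mesh
begin

text \<open>For a face that meets \<open>\<Omega>\<close> this is, up to sign, the difference of the
  two pieces. As a signed sum over tetrahedra it stays linear in the pieces, which allows sums
  around an edge to be rearranged.\<close>

definition jump :: "(vec3 set => vec3 => mat3) => vec3 set => vec3 => mat3" where
 "jump S f x = (\<Sum>K\<in>around f. osign (n f) K f *R S K x)"

lemma around_mesh: "K : around f ==> K : \<T>" "K : around f ==> f : faces K"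
 by (simp_all add: around_def)

lemma bf_jump: "bf (jump S f) u v = (%x. \<Sum>K\<in>around f. osign (n f) K f * bf (S K) u v x)"
proof
 fix x
 have l: "linear (%A. u <.> ((A :: mat3) *v v))" by (rule bounded_linear.linear[OF bl_bf])
 show "bf (jump S f) u v x = (\<Sum>K\<in>around f. osign (n f) K f * bf (S K) u v x)"
  unfolding bf_def jump_def using linear_sum[OF l, of "%K. osign (n f) K f *R S K x" "around f"] linear_scale[OF l] by simp
qed

lemma jump_poly: assumes S: "S : Th_space" shows "polyi Sym 6 (jump S f)"
 unfolding jump_def[abs_def] using Th_piece[OF S] around_mesh
 by (intro polyi_sum polyi_scale subspace_Sym finite_around) auto

lemma dd_bf_jump:
 assumes S: "S : Th_space"
 shows "dd r (bf (jump S f) u v) = (%x. \<Sum>K\<in>around f. osign (n f) K f * dd r (bf (S K) u v) x)"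
proof -
 have s: "smooth (bf (S K) u v)" if "K : around f" for K
  using Th_smooth[OF S] around_mesh that by (intro smooth_bf) auto
 then have "dd r (bf (jump S f) u v) = (%x. \<Sum>K\<in>around f. dd r (%x. osign (n f) K f * bf (S K) u v x) x)"
  unfolding bf_jump by (intro dd_sum) (simp add: smooth_mult)
 also have "\<dots> = (%x. \<Sum>K\<in>around f. osign (n f) K f * dd r (bf (S K) u v) x)"
  using s by (intro ext sum.cong refl) (simp add: dd_cmult)
 finally show ?thesis .
qed

lemma around_sum:
 assumes f: "f : mesh_faces" "f \<inter> \<Omega> ~= {}" and H: "!!K K'. K : around f ==> K' : around f ==> H K = (H K' :: real)"
 shows "(\<Sum>K\<in>around f. osign (n f) K f * H K) = 0"
proof -
 obtain K0 where K0: "K0 : \<T>" "f : faces K0" using f by (auto simp: mesh_faces_def)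
 then have "K0 : around f" by (simp add: around_def)
 then have "(\<Sum>K\<in>around f. osign (n f) K f * H K) = (\<Sum>K\<in>around f. osign (n f) K f * H K0)"
  using H by (intro sum.cong refl) metis
 then show ?thesis using osign_sum[OF K0 f(2)] by (simp add: sum_distrib_right[symmetric])
qed

lemma jump_traces:
 assumes S: "S : Th_space" and f: "f : mesh_faces" "f \<inter> \<Omega> ~= {}" and x: "x : f"
 shows "n f <.> u = 0 ==> n f <.> v = 0 ==> bf (jump S f) u v x = 0"
  "n f <.> r = 0 ==> n f <.> u = 0 ==> n f <.> v = 0 ==> dd r (bf (jump S f) u v) x = 0"
  "n f <.> u = 0 ==> n f <.> v = 0 ==> dd (n f) (bf (jump S f) u v) x = dd v (bf (jump S f) (n f) u) x + dd u (bf (jump S f) (n f) v) x"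
  "x : verts f ==> bf (jump S f) y z x = 0"
proof -
 obtain K0 where K0: "K0 : \<T>" "f : faces K0" using f by (auto simp: mesh_faces_def)
 obtain a b c where T: "triv f a b c" by (rule mesh_triv[OF K0])
 have nf: "unit_normal f (n f)" by (rule mesh_normal[OF K0])
 note P = jump_poly[OF S, of f]
 have tan: "bf (jump S f) u v x = 0" if "n f <.> u = 0" "n f <.> v = 0" "x : f" for u v x
  unfolding bf_jump using Th_conf(1)[OF S] that around_mesh by (intro around_sum[OF f]) blast
 show "bf (jump S f) u v x = 0" if "n f <.> u = 0" "n f <.> v = 0" by (rule tan[OF that x])
 show "bf (jump S f) y z x = 0" if v: "x : verts f"
 proof -
  have SK: "S K x = S K' x" if K: "K : around f" "K' : around f" for K K'
  proof -
   have "(%S. S x $ i $ j) : Th_vdofs x" for i j unfolding Th_vdofs_def by blast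
   then have "S K x $ i $ j = S K' x $ i $ j" for i j
    using fe_spaceD(2)[OF S[unfolded Th_space_def Th_h_def] around_mesh(1)[OF K(1)] around_mesh(1)[OF K(2)], of x] v
     faces_verts[OF around_mesh(2)[OF K(1)]] faces_verts[OF around_mesh(2)[OF K(2)]] by blast
   then show ?thesis by (simp add: vec_eq_iff)
  qed
  have "bf (S K) y z x = bf (S K') y z x" if "K : around f" "K' : around f" for K K'
   unfolding bf_def SK[OF that] ..
  then show ?thesis unfolding bf_jump by (rule around_sum[OF f])
 qed
 show "dd r (bf (jump S f) u v) x = 0" if o: "n f <.> r = 0" "n f <.> u = 0" "n f <.> v = 0"
 proof -
  have B: "polyi UNIV 6 (bf (jump S f) u v)" by (rule polyi_bf[OF P])
  have plane: "bf (jump S f) u v (pt2 a b c t h) = 0" for t h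
   using tan[OF o(2,3)] T unfolding triv_def by (intro triangle_zero[OF B subspace_UNIV]) blast
  obtain t h where x': "x = pt2 a b c t h" by (rule triangle_param[OF T x])
  obtain \<alpha> \<beta> where r: "r = \<alpha> *R (b - a) + \<beta> *R (c - a)"
   by (rule tangential_span[OF triv_cross[OF T] unit_normal_triv[OF T nf] o(1)])
  have "x + k *R r = pt2 a b c (t + k * \<alpha>) (h + k * \<beta>)" for k
   by (simp add: x' r algebra_simps)
  then have "dd r (bf (jump S f) u v) x = dd r (%x. 0) x"
   using polyi_smooth[OF B] plane by (intro dd_cong_line) auto
  then show ?thesis by simp
 qed
 show "dd (n f) (bf (jump S f) u v) x = dd v (bf (jump S f) (n f) u) x + dd u (bf (jump S f) (n f) v) x"
  if o: "n f <.> u = 0" "n f <.> v = 0"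
 proof -
  have Sy: "bf (S K) w (n f) = bf (S K) (n f) w" if "K : around f" for K w
   by (rule bf_Sym) (rule polyi_val[OF Th_piece[OF S around_mesh(1)[OF that]] subspace_Sym])
  have "(\<Sum>K\<in>around f. osign (n f) K f * bf (Lam (n f) (S K)) u v x) = 0"
  proof (rule around_sum[OF f])
   fix K K' assume K: "K : around f" "K' : around f"
   show "bf (Lam (n f) (S K)) u v x = bf (Lam (n f) (S K')) u v x"
    unfolding bf_def Th_conf(2)[OF S around_mesh(1)[OF K(1)] around_mesh(1)[OF K(2)] around_mesh(2)[OF K(1)] around_mesh(2)[OF K(2)] x] ..
  qed
  moreover have "bf (Lam (n f) (S K)) u v x = dd v (bf (S K) (n f) u) x + dd u (bf (S K) (n f) v) x - dd (n f) (bf (S K) u v) x"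
   if "K : around f" for K
   using Lam_bf[OF Th_smooth[OF S around_mesh(1)[OF that]] o] by (simp add: Sy[OF that])
  ultimately have "(\<Sum>K\<in>around f. osign (n f) K f * (dd v (bf (S K) (n f) u) x + dd u (bf (S K) (n f) v) x - dd (n f) (bf (S K) u v) x)) = 0"
   by simp
  then show ?thesis
   unfolding dd_bf_jump[OF S] by (simp add: distrib_left right_diff_distrib sum.distrib sum_subtractf)
 qed
qed

definition "mesh_edges = (\<Union>f\<in>mesh_faces. edges f)"
definition "fan e = {f : mesh_faces. e : edges f}"

lemma finite_mesh_edges: "finite mesh_edges"
proof -
 have "finite (edges f)" if fm: "f : mesh_faces" for f
 proof -
  obtain K where "K : \<T>" "f : faces K" using fm by (auto simp: mesh_faces_def)
  then obtain a b c where "triv f a b c" by (rule mesh_triv)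
  then show ?thesis by (simp add: triv_edges)
 qed
 then show ?thesis unfolding mesh_edges_def using finite_mesh_faces by blast
qed

lemma finite_fan: "finite (fan e)"
 unfolding fan_def using finite_mesh_faces by simp

text \<open>Exchanging the sums leaves \<open>orient_tetra\<close> for each tetrahedron.
  \<open>H\<close> is an arbitrary quantity attached to the tetrahedra, so this also disposes of
  components of the jump about which nothing is known.\<close>

lemma fan_sum:
 assumes e: "unit_tangent e (s e)"
 shows "(\<Sum>f\<in>fan e. orient n s f e * (\<Sum>K\<in>around f. osign (n f) K f * H K)) = (0 :: real)"
proof -
 have "(\<Sum>f\<in>fan e. orient n s f e * (\<Sum>K\<in>around f. osign (n f) K f * H K))
  = (\<Sum>f\<in>fan e. \<Sum>K | K : \<T> & f : faces K. orient n s f e * (osign (n f) K f * H K))"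
  by (simp add: around_def sum_distrib_left)
 also have "\<dots> = (\<Sum>K\<in>\<T>. \<Sum>f | f : fan e & f : faces K. orient n s f e * (osign (n f) K f * H K))"
  by (rule sum.swap_restrict[OF finite_fan finite_mesh])
 also have "\<dots> = (\<Sum>K\<in>\<T>. 0)"
 proof (rule sum.cong[OF refl])
  fix K assume K: "K : \<T>"
  obtain a b c d where T: "tetv K a b c d" by (rule mesh_tetv[OF K])
  have eq: "{f. f : fan e & f : faces K} = {f. f : faces K & e : edges f}"
   using K by (auto simp: fan_def mesh_faces_def)
  have "(\<Sum>f | f : faces K & e : edges f. osign (n f) K f * orient n s f e) = 0"
  proof (cases "e : edges K")
   case True
   then show ?thesis using mesh_normal[OF K] e by (intro orient_tetra[OF T]) auto
  next
   case False
   then have "{f. f : faces K & e : edges f} = {}" using faces_edges by blast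
   then show ?thesis by (simp only: sum.empty)
  qed
  moreover have "(\<Sum>f | f : fan e & f : faces K. orient n s f e * (osign (n f) K f * H K))
    = (\<Sum>f | f : faces K & e : edges f. osign (n f) K f * orient n s f e) * H K"
   unfolding eq sum_distrib_right by (simp only: mult_ac)
  ultimately show "(\<Sum>f | f : fan e & f : faces K. orient n s f e * (osign (n f) K f * H K)) = 0" by simp
 qed
 finally show ?thesis by simp
qed

text \<open>In the frame of the edge each summand is a multiple of the component in directions
  \<open>n f\<close>, \<open>m f\<close> plus a term whose directions do not depend on
  \<open>f\<close>, which \<open>fan_sum\<close> annihilates. The sum of the first components is
  zero at \<open>a\<close> and constant along the edge, its tangential derivative being once more of
  the type in \<open>fan_sum\<close>.\<close>

lemma edge_vanish:
 assumes S: "S : Th_space" and e: "e : mesh_edges" and x: "x : e" and i: "e \<inter> \<Omega> ~= {}"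
 shows "(\<Sum>f\<in>fan e. orient n s f e * bf (jump S f) (n f) (cross3 y (n f)) x) = 0"
proof -
 obtain K0 f0 where K0: "K0 : \<T>" and f0: "f0 : faces K0" "e : edges f0" using e by (auto simp: mesh_edges_def mesh_faces_def)
 have eK: "e : edges K0" using f0 faces_edges by blast
 note mf = mesh_frame[OF K0 eK]
 obtain a b where ab: "a ~= b" "e = seg a b" by (rule mesh_edge[OF K0 eK])
 define m where "m f = conormal f e" for f
 define \<tau> where "\<tau> f = orient n s f e" for f
 obtain \<kappa> where \<kappa>: "s e = \<kappa> *R (b - a)" "\<kappa> ~= 0" by (rule unit_tangent_seg[OF mf(1)[unfolded ab(2)] ab(1), folded ab(2)])
 have F: "f : mesh_faces" "f \<inter> \<Omega> ~= {}" "e \<subseteq> f" "a : verts f" "norm (s e) = 1" "norm (m f) = 1" "norm (n f) = 1"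
   "m f <.> s e = 0" "n f <.> s e = 0" "n f <.> m f = 0" if f: "f : fan e" for f
 proof -
  show fm: "f : mesh_faces" using f by (simp add: fan_def)
  have ef: "e : edges f" using f by (simp add: fan_def)
  show sub: "e \<subseteq> f" using ef by (auto simp: edges_def dest: face_of_imp_subset)
  then show "f \<inter> \<Omega> ~= {}" using i by blast
  obtain K where K: "K : \<T>" "f : faces K" using fm by (auto simp: mesh_faces_def)
  obtain a0 b0 c0 where T0: "triv f a0 b0 c0" by (rule mesh_triv[OF K])
  obtain a' b' c' where T: "triv f a' b' c'" "e = seg a' b'" by (rule face_edge_cases[OF T0 ef])
  then have "{a, b} = {a', b'}" using ab closed_segment_eq by metis
  then show "a : verts f" using triv_verts[OF T(1)] by auto
  show "norm (s e) = 1" "norm (m f) = 1" "norm (n f) = 1" "m f <.> s e = 0" "n f <.> s e = 0" "n f <.> m f = 0"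
   unfolding m_def T(2) by (rule face_frame[OF T(1) mesh_normal[OF K] mf(1)[unfolded T(2)]])+
 qed
 have cr: "cross3 (m f) (n f) = \<tau> f *R s e" "cross3 (s e) (n f) = - \<tau> f *R m f" "cross3 (s e) (m f) = \<tau> f *R n f" "\<tau> f * \<tau> f = 1"
  if "f : fan e" for f
  using frame_crosses[OF F(5-10)[OF that]] unfolding \<tau>_def orient_def m_def by simp_all
 note jt = jump_traces[OF S F(1,2)]
 have "(\<Sum>f\<in>fan e. bf (jump S f) (n f) (m f) x) = 0"
 proof -
  define g where "g x = (\<Sum>f\<in>fan e. bf (jump S f) (n f) (m f) x)" for x
  have sJ: "smooth (bf (jump S f) u v)" for f u v using polyi_smooth[OF jump_poly[OF S]] by (rule smooth_bf)
  have sg: "smooth g" unfolding g_def[abs_def] using sJ by (intro smooth_sum) auto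
  have "dd (s e) g x = 0" if x: "x : e" for x
  proof -
   let ?\<sigma> = "s e <.> cross3 (\<mu> e) (\<nu> e)"
   have \<mu>\<nu>: "norm (s e) = 1" "norm (\<mu> e) = 1" "norm (\<nu> e) = 1" "\<mu> e <.> s e = 0" "\<nu> e <.> s e = 0" "\<nu> e <.> \<mu> e = 0"
    using mf by (simp_all add: unit_tangent_def inner_commute)
   note fr = orthonormal_frame[OF \<mu>\<nu>]
   define H where "H K = dd (\<mu> e) (bf (S K) (s e) (\<nu> e)) x - dd (\<nu> e) (bf (S K) (s e) (\<mu> e)) x" for K
   \<comment> \<open>Because \<open>Lam\<close> of the jump vanishes, this derivative is a rotation
     in the plane normal to the edge; up to a determinant it may be taken in the basis
     \<open>\<mu> e\<close>, \<open>\<nu> e\<close>, which is common to all faces of the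
     fan.\<close>
   have "dd (s e) (bf (jump S f) (n f) (m f)) x = - ?\<sigma> * (\<tau> f * (\<Sum>K\<in>around f. osign (n f) K f * H K))" if f: "f : fan e" for f
   proof -
    let ?J = "jump S f"
    have xf: "x : f" using x F(3)[OF f] by blast
    define \<alpha> \<beta> \<gamma> \<delta> where "\<alpha> = \<mu> e <.> m f" and "\<beta> = \<nu> e <.> m f" and "\<gamma> = \<mu> e <.> n f" and "\<delta> = \<nu> e <.> n f"
    have mm: "m f = \<alpha> *R \<mu> e + \<beta> *R \<nu> e" and nn: "n f = \<gamma> *R \<mu> e + \<delta> *R \<nu> e"
     using fr(1)[of "m f"] fr(1)[of "n f"] F(8,9)[OF f] by (simp_all add: \<alpha>_def \<beta>_def \<gamma>_def \<delta>_def inner_commute)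
    have sJ': "smooth (bf ?J u v)" for u v by (rule sJ)
    have Jn: "bf ?J (m f) (n f) = bf ?J (n f) (m f)" "bf ?J (n f) (s e) = bf ?J (s e) (n f)"
     using polyi_val[OF jump_poly[OF S] subspace_Sym] by (intro bf_Sym; blast)+
    have "dd (n f) (bf ?J (s e) (m f)) x = dd (m f) (bf ?J (n f) (s e)) x + dd (s e) (bf ?J (n f) (m f)) x"
     by (rule jt(3)[OF f f xf F(9,10)[OF f]])
    then have "dd (s e) (bf ?J (n f) (m f)) x = dd (n f) (bf ?J (s e) (m f)) x - dd (m f) (bf ?J (s e) (n f)) x"
     by (simp add: Jn)
    also have "\<dots> = (\<beta> * \<gamma> - \<alpha> * \<delta>) * (dd (\<mu> e) (bf ?J (s e) (\<nu> e)) x - dd (\<nu> e) (bf ?J (s e) (\<mu> e)) x)"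
     unfolding mm nn using sJ'
     by (simp add: bf_lin dd_add dd_cmult dd_dir_add dd_dir_scaleR) (simp add: algebra_simps)
    also have "dd (\<mu> e) (bf ?J (s e) (\<nu> e)) x - dd (\<nu> e) (bf ?J (s e) (\<mu> e)) x = (\<Sum>K\<in>around f. osign (n f) K f * H K)"
     by (simp add: dd_bf_jump[OF S] H_def right_diff_distrib sum_subtractf)
    also have "\<beta> * \<gamma> - \<alpha> * \<delta> = - ?\<sigma> * \<tau> f"
    proof -
     have "\<tau> f = s e <.> cross3 (\<alpha> *R \<mu> e + \<beta> *R \<nu> e) (\<gamma> *R \<mu> e + \<delta> *R \<nu> e)"
      unfolding \<tau>_def orient_def m_def[symmetric] by (simp only: mm nn)
     also have "\<dots> = (\<alpha> * \<delta> - \<beta> * \<gamma>) * ?\<sigma>"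
      using cross_skew[of "\<nu> e" "\<mu> e"]
      by (simp add: cross_add_left cross_add_right cross_mult_left cross_mult_right inner_add_right algebra_simps)
     finally have "- ?\<sigma> * \<tau> f = - ?\<sigma> * ((\<alpha> * \<delta> - \<beta> * \<gamma>) * ?\<sigma>)" by (rule arg_cong)
     also have "\<dots> = (\<beta> * \<gamma> - \<alpha> * \<delta>) * (?\<sigma> * ?\<sigma>)" by (simp add: algebra_simps)
     finally show ?thesis unfolding fr(3) by simp
    qed
    finally show ?thesis by (simp only: mult.assoc)
   qed
   then have "dd (s e) g x = - ?\<sigma> * (\<Sum>f\<in>fan e. \<tau> f * (\<Sum>K\<in>around f. osign (n f) K f * H K))"
    unfolding g_def[abs_def] sum_distrib_left using sJ by (simp add: dd_sum)
   then show ?thesis using fan_sum[OF mf(1), of H] unfolding \<tau>_def by simp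
  qed
  then have d: "dd (b - a) g x = 0" if "x : e" for x
   using that sg \<kappa>(2) unfolding \<kappa>(1) by (simp add: dd_dir_scaleR)
  obtain h where h: "x = pt1 a b h" "h : {0..1}" using x unfolding ab(2) by (rule segment_point)
  have "g a = 0"
   unfolding g_def
  proof (rule sum.neutral, rule ballI)
   fix f assume f: "f : fan e"
   have "a : f" using F(3)[OF f] by (auto simp: ab(2))
   then show "bf (jump S f) (n f) (m f) a = 0" by (rule jt(4)[OF f f _ F(4)[OF f]])
  qed
  then have "g (pt1 a b h) = 0"
  proof (rule zero_on_line[OF sg])
   show "dd (b - a) g (pt1 a b t) = 0" if "0 <= t" "t <= h" for t
    using that h(2) by (intro d) (auto simp: ab(2) intro!: on_segment)
  qed (use h in auto)
  then show ?thesis by (simp add: h(1) g_def)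
 qed
 note C = this
 have "orient n s f e * bf (jump S f) (n f) (cross3 y (n f)) x
   = - (s e <.> y) * bf (jump S f) (n f) (m f) x + \<tau> f * bf (jump S f) (cross3 (s e) y) (s e) x" if f: "f : fan e" for f
 proof -
  let ?J = "jump S f"
  have xf: "x : f" using x F(3)[OF f] by blast
  have y: "y = (s e <.> y) *R s e + (m f <.> y) *R m f + (n f <.> y) *R n f"
   by (rule orthonormal_frame(1)[OF F(5-10)[OF f]])
  have "cross3 y (n f) = (s e <.> y) *R cross3 (s e) (n f) + (m f <.> y) *R cross3 (m f) (n f)"
   by (subst y) (simp add: cross_add_left cross_mult_left)
  then have 1: "cross3 y (n f) = (- (s e <.> y) * \<tau> f) *R m f + ((m f <.> y) * \<tau> f) *R s e"
   by (simp add: cr[OF f])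
  have "cross3 (s e) y = (m f <.> y) *R cross3 (s e) (m f) + (n f <.> y) *R cross3 (s e) (n f)"
   by (subst y) (simp add: cross_add_right cross_mult_right)
  then have 2: "cross3 (s e) y = ((m f <.> y) * \<tau> f) *R n f + (- (n f <.> y) * \<tau> f) *R m f"
   by (simp add: cr[OF f])
  have z: "bf ?J (m f) (s e) x = 0" by (rule jt(1)[OF f f xf F(10,9)[OF f]])
  have "\<tau> f * bf ?J (n f) (cross3 y (n f)) x = (\<tau> f * \<tau> f) * (- (s e <.> y) * bf ?J (n f) (m f) x + (m f <.> y) * bf ?J (n f) (s e) x)"
   unfolding 1 by (simp add: bf_lin algebra_simps)
  moreover have "\<tau> f * bf ?J (cross3 (s e) y) (s e) x = (\<tau> f * \<tau> f) * ((m f <.> y) * bf ?J (n f) (s e) x)"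
   unfolding 2 by (simp add: bf_lin z algebra_simps)
  ultimately show ?thesis unfolding \<tau>_def[symmetric] unfolding cr(4)[OF f] by simp
 qed
 then have "(\<Sum>f\<in>fan e. orient n s f e * bf (jump S f) (n f) (cross3 y (n f)) x)
   = - (s e <.> y) * (\<Sum>f\<in>fan e. bf (jump S f) (n f) (m f) x) + (\<Sum>f\<in>fan e. \<tau> f * bf (jump S f) (cross3 (s e) y) (s e) x)"
  by (simp add: sum.distrib sum_subtractf sum_distrib_left sum_negf)
 also have "\<dots> = 0"
  using C fan_sum[OF mf(1), of "%K. bf (S K) (cross3 (s e) y) (s e) x"] by (simp add: bf_jump \<tau>_def)
 finally show ?thesis .
qed

lemma fint_jump:
 assumes S: "S : Th_space"
 shows "fint (jump S f) \<phi> (n f) p q r t x = (\<Sum>K\<in>around f. osign (n f) K f * fint (S K) \<phi> (n f) p q r t x)"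
proof -
 define o' where "o' K = osign (n f) K f" for K
 show ?thesis
  unfolding fint_def bf_jump[THEN fun_cong] dd_bf_jump[OF S] o'_def[symmetric]
  by (simp add: right_diff_distrib left_diff_distrib sum_distrib_left sum_distrib_right sum_subtractf mult_ac)
qed

text \<open>After Stokes' theorem the terms do not cancel face by face but only around each edge,
  hence the exchange of summations and \<open>edge_vanish\<close>. The hypothesis \<open>i\<close>
  matches the derivative in \<open>fint_trace\<close> with the one in
  \<open>stokes_triangle\<close>.\<close>

lemma Th_parts:
 assumes S: "S : Th_space" and \<phi>: "test_fun \<Omega> \<phi>" and i: "axis i (1 :: real) = cross3 p q"
 shows "(\<Sum>K\<in>\<T>. integral K (%x. bf (ccs (S K)) (cross3 p q) (cross3 r t) x * \<phi> x - hpair (S K) \<phi> p q r t x)) = 0"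
proof -
 note s\<phi> = test_fun_smooth[OF \<phi>]
 define g where "g f x = \<phi> x * bf (jump S f) (n f) (cross3 (cross3 r t) (n f)) x" for f x
 have sJ: "smooth (jump S f)" for f by (rule polyi_smooth[OF jump_poly[OF S]])
 have sg: "smooth (g f)" for f unfolding g_def[abs_def] using s\<phi> sJ by (intro smooth_mult smooth_bf)
 have "(\<Sum>K\<in>\<T>. integral K (%x. bf (ccs (S K)) (cross3 p q) (cross3 r t) x * \<phi> x - hpair (S K) \<phi> p q r t x))
  = (\<Sum>K\<in>\<T>. \<Sum>f\<in>faces K. osign (n f) K f * face_int f (fint (S K) \<phi> (n f) p q r t))"
 proof (rule sum.cong[OF refl])
  fix K assume K: "K : \<T>"
  obtain a b c d where T: "tetv K a b c d" by (rule mesh_tetv[OF K])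
  show "integral K (%x. bf (ccs (S K)) (cross3 p q) (cross3 r t) x * \<phi> x - hpair (S K) \<phi> p q r t x)
   = (\<Sum>f\<in>faces K. osign (n f) K f * face_int f (fint (S K) \<phi> (n f) p q r t))"
   by (rule ccs_parts[OF T Th_smooth[OF S K] s\<phi> mesh_normal[OF K]])
 qed
 also have "\<dots> = (\<Sum>f\<in>mesh_faces. \<Sum>K\<in>around f. osign (n f) K f * face_int f (fint (S K) \<phi> (n f) p q r t))"
  by (rule face_sum_swap)
 also have "\<dots> = (\<Sum>f\<in>mesh_faces. \<Sum>e\<in>edges f. cross3 (conormal f e) (n f) $ i * edge_int e (g f))"
 proof (rule sum.cong[OF refl])
  fix f assume f: "f : mesh_faces"
  then obtain K0 where K0: "K0 : \<T>" "f : faces K0" by (auto simp: mesh_faces_def)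
  obtain a b c where T: "triv f a b c" by (rule mesh_triv[OF K0])
  have nf: "unit_normal f (n f)" by (rule mesh_normal[OF K0])
  have sf: "smooth (fint (S K) \<phi> (n f) p q r t)" if "K : around f" for K
   using Th_smooth[OF S around_mesh(1)[OF that]] s\<phi> by (rule smooth_fint)
  have fi: "(\<Sum>K\<in>around f. osign (n f) K f * face_int f (fint (S K) \<phi> (n f) p q r t)) = face_int f (fint (jump S f) \<phi> (n f) p q r t)"
  proof -
   have "fint (jump S f) \<phi> (n f) p q r t = (%x. \<Sum>K\<in>around f. osign (n f) K f * fint (S K) \<phi> (n f) p q r t x)"
    by (rule ext) (rule fint_jump[OF S])
   then have "face_int f (fint (jump S f) \<phi> (n f) p q r t) = (\<Sum>K\<in>around f. face_int f (%x. osign (n f) K f * fint (S K) \<phi> (n f) p q r t x))"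
    using sf by (simp only:) (intro face_int_sum[OF T finite_around] smooth_mult smooth_const; assumption)
   then show ?thesis using sf by (simp add: face_int_cmult[OF T])
  qed
  show "(\<Sum>K\<in>around f. osign (n f) K f * face_int f (fint (S K) \<phi> (n f) p q r t))
   = (\<Sum>e\<in>edges f. cross3 (conormal f e) (n f) $ i * edge_int e (g f))"
  proof (cases "f \<inter> \<Omega> = {}")
   case True
   have z: "\<phi> x = 0" "dd v \<phi> x = 0" if "x : f" for x v using outside_test[OF \<phi> True that] by auto
   have "face_int f (fint (jump S f) \<phi> (n f) p q r t) = 0"
    using smooth_fint[OF sJ s\<phi>] by (intro face_int_zero[OF T]) (auto simp: fint_def z)
   moreover have "edge_int e (g f) = 0" if e: "e : edges f" for e
   proof -
    obtain a' b' c' where T': "triv f a' b' c'" "e = seg a' b'" by (rule face_edge_cases[OF T e])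
    then show ?thesis using triv_seg_sub(1)[OF T'(1)] z(1) by (auto simp: edge_int_eq g_def intro!: M1_zero)
   qed
   ultimately show ?thesis unfolding fi by simp
  next
   case False
   note jt = jump_traces[OF S f False]
   have eq: "fint (jump S f) \<phi> (n f) p q r t x = dd (cross3 (axis i 1) (n f)) (g f) x" if x: "x : f" for x
    unfolding i g_def[abs_def]
    using sJ polyi_val[OF jump_poly[OF S] subspace_Sym] s\<phi> unit_normal_triv(1)[OF T nf] jt(1-3)[OF x]
    by (intro fint_trace) auto
   have "face_int f (fint (jump S f) \<phi> (n f) p q r t) = face_int f (dd (cross3 (axis i 1) (n f)) (g f))"
    using smooth_fint[OF sJ s\<phi>] sg eq by (intro face_int_cong[OF T]) (auto intro!: smooth_cont smooth_dd)
   then show ?thesis unfolding fi using stokes_triangle[OF T nf sg, of i f] by simp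
  qed
 qed
 also have "\<dots> = (\<Sum>f\<in>mesh_faces. \<Sum>e | e : mesh_edges & e : edges f. cross3 (conormal f e) (n f) $ i * edge_int e (g f))"
  by (intro sum.cong refl) (auto simp: mesh_edges_def)
 also have "\<dots> = (\<Sum>e\<in>mesh_edges. \<Sum>f | f : mesh_faces & e : edges f. cross3 (conormal f e) (n f) $ i * edge_int e (g f))"
  by (rule sum.swap_restrict[OF finite_mesh_faces finite_mesh_edges])
 also have "\<dots> = (\<Sum>e\<in>mesh_edges. 0)"
 proof (rule sum.cong[OF refl])
  fix e assume e: "e : mesh_edges"
  then obtain K0 f0 where K0: "K0 : \<T>" and f0: "f0 : faces K0" "e : edges f0" by (auto simp: mesh_edges_def mesh_faces_def)
  have eK: "e : edges K0" using f0 faces_edges by blast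
  obtain a b where ab: "e = seg a b" by (rule mesh_edge[OF K0 eK])
  \<comment> \<open>Makes \<open>s e $ i\<close> a common factor, so that the faces of the fan
    differ only by the sign \<open>orient\<close>.\<close>
  have cross: "cross3 (conormal f e) (n f) = orient n s f e *R s e" if f: "f : fan e" for f
  proof -
   obtain K where K: "K : \<T>" "f : faces K" and ef: "e : edges f" using f by (auto simp: fan_def mesh_faces_def)
   obtain a0 b0 c0 where T0: "triv f a0 b0 c0" by (rule mesh_triv[OF K])
   obtain a' b' c' where T: "triv f a' b' c'" "e = seg a' b'" by (rule face_edge_cases[OF T0 ef])
   show ?thesis
    unfolding orient_def T(2)
    by (rule frame_crosses(1)[OF face_frame[OF T(1) mesh_normal[OF K] mesh_frame(1)[OF K0 eK, unfolded T(2)]]])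
  qed
  have "(\<Sum>f\<in>fan e. orient n s f e * g f x) = 0" if x: "x : e" for x
  proof (cases "e \<inter> \<Omega> = {}")
   case True
   then show ?thesis using outside_test[OF \<phi> True x] by (simp add: g_def)
  next
   case False
   have "(\<Sum>f\<in>fan e. orient n s f e * g f x) = \<phi> x * (\<Sum>f\<in>fan e. orient n s f e * bf (jump S f) (n f) (cross3 (cross3 r t) (n f)) x)"
    by (simp add: g_def sum_distrib_left mult_ac)
   then show ?thesis using edge_vanish[OF S e x False] by simp
  qed
  then have "M1 a b (%x. \<Sum>f\<in>fan e. orient n s f e * g f x) = 0" unfolding ab by (intro M1_zero)
  then have "(\<Sum>f\<in>fan e. orient n s f e * M1 a b (g f)) = 0"
   using sg finite_fan by (simp add: M1_sum M1_cmult smooth_cont)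
  then have "(\<Sum>f\<in>fan e. orient n s f e * edge_int e (g f)) = 0"
   by (simp add: edge_int_eq ab mult.left_commute[of _ "norm _"] sum_distrib_left[symmetric])
  then have "s e $ i * (\<Sum>f\<in>fan e. orient n s f e * edge_int e (g f)) = 0" by simp
  then have "(\<Sum>f\<in>fan e. cross3 (conormal f e) (n f) $ i * edge_int e (g f)) = 0"
   by (simp add: cross sum_distrib_left mult_ac)
  then show "(\<Sum>f | f : mesh_faces & e : edges f. cross3 (conormal f e) (n f) $ i * edge_int e (g f)) = 0"
   unfolding fan_def .
 qed
 finally show ?thesis by simp
qed

lemma Th_weak_ccs:
 assumes S: "S : Th_space" shows "weak_ccs \<Omega> (glue \<T> S) (glue \<T> (piecewise ccs S))"
 unfolding weak_ccs_def
proof (intro allI impI)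
 fix \<phi> i j assume \<phi>: "test_fun \<Omega> \<phi>"
 note s\<phi> = test_fun_smooth[OF \<phi>]
 obtain p q where i: "axis i (1 :: real) = cross3 p q" by (rule axis_cross)
 obtain r t where j: "axis j (1 :: real) = cross3 r t" by (rule axis_cross)
 let ?A = "%K x. bf (ccs (S K)) (cross3 p q) (cross3 r t) x * \<phi> x" and ?B = "%K. hpair (S K) \<phi> p q r t"
 have sA: "smooth (?A K)" and sB: "smooth (?B K)" if "K : \<T>" for K
  using Th_smooth[OF S that] s\<phi> by (auto intro!: smooth_mult smooth_bf smooth_ccs smooth_hpair)
 have 1: "(LINT x|lebesgue_on \<Omega>. glue \<T> (piecewise ccs S) x $ i $ j * \<phi> x) = (\<Sum>K\<in>\<T>. integral K (?A K))"
 proof (rule LINT_pieces(2))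
  fix K x assume "K : \<T>" "x : interior K"
  then show "glue \<T> (piecewise ccs S) x $ i $ j * \<phi> x = ?A K x"
   by (simp add: glue_eq piecewise_def i[symmetric] j[symmetric] bf_axis)
 qed (intro smooth_cont sA)
 have 2: "(LINT x|lebesgue_on \<Omega>. (\<Sum>k\<in>UNIV. \<Sum>l\<in>UNIV. \<Sum>m\<in>UNIV. \<Sum>p\<in>UNIV.
    levi_civita i k l * levi_civita j m p * glue \<T> S x $ l $ p * pd k (pd m \<phi>) x)) = (\<Sum>K\<in>\<T>. integral K (?B K))"
 proof (rule LINT_pieces(2))
  fix K x assume "K : \<T>" "x : interior K"
  then show "(\<Sum>k\<in>UNIV. \<Sum>l\<in>UNIV. \<Sum>m\<in>UNIV. \<Sum>p\<in>UNIV.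
    levi_civita i k l * levi_civita j m p * glue \<T> S x $ l $ p * pd k (pd m \<phi>) x) = ?B K x"
   unfolding glue_eq[OF \<open>K : \<T>\<close> \<open>x : interior K\<close>] by (intro levi_civita_sum_hpair[OF i j s\<phi>])
 qed (intro smooth_cont sB)
 have "(\<Sum>K\<in>\<T>. integral K (?A K)) - (\<Sum>K\<in>\<T>. integral K (?B K)) = (\<Sum>K\<in>\<T>. integral K (%x. ?A K x - ?B K x))"
  unfolding sum_subtractf[symmetric]
  by (intro sum.cong refl integral_K_linear(2)[symmetric] mesh_compact smooth_cont sA sB)
 also have "\<dots> = 0" by (rule Th_parts[OF S \<phi> i])
 finally show "(LINT x|lebesgue_on \<Omega>. glue \<T> (piecewise ccs S) x $ i $ j * \<phi> x) =
   (LINT x|lebesgue_on \<Omega>. (\<Sum>k\<in>UNIV. \<Sum>l\<in>UNIV. \<Sum>m\<in>UNIV. \<Sum>p\<in>UNIV.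
    levi_civita i k l * levi_civita j m p * glue \<T> S x $ l $ p * pd k (pd m \<phi>) x))"
  unfolding 1 2 by simp
qed

lemma Th_H_ccs: assumes S: "S : Th_space" shows "glue \<T> S : H_ccs \<Omega>"
proof -
 have "L2 \<Omega> (glue \<T> S)" by (rule L2_glue) (intro smooth_cont Th_smooth[OF S])
 moreover have "L2 \<Omega> (glue \<T> (piecewise ccs S))"
  unfolding piecewise_def by (rule L2_glue) (intro smooth_cont smooth_ccs Th_smooth[OF S])
 moreover have "glue \<T> S x : Sym" for x
  using polyi_val[OF Th_piece[OF S] subspace_Sym] by (rule glue_Sym)
 ultimately show ?thesis unfolding H_ccs_def using Th_weak_ccs[OF S] by blast
qed

end

section \<open>Interpolation\<close>

lemma unisolvent_eqI:
 assumes u: "unisolvent K X P D" and p: "p : P" "q : P" and d: "!!d. d : D ==> d p = d q" shows "p = q"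
proof -
 obtain B where B: "B \<subseteq> D" "!!\<alpha>. \<exists>!p. p : P & (\<forall>b\<in>B. b p = \<alpha> b)"
  using u unfolding unisolvent_def by blast
 have "\<exists>!r. r : P & (\<forall>b\<in>B. b r = b q)" by (rule B(2))
 moreover have "p : P & (\<forall>b\<in>B. b p = b q)" "q : P & (\<forall>b\<in>B. b q = b q)" using p d B(1) by auto
 ultimately show ?thesis by blast
qed

text \<open>Agreement on the list \<open>B\<close> extends to \<open>D\<close>: \<open>p\<close> and
  \<open>w\<close> are both smooth and \<open>X\<close>-valued on \<open>K\<close>, so the same
  combinations express the remaining functionals for both.\<close>

lemma unisolvent_local:
 assumes u: "unisolvent K X P D" and P: "!!p. p : P ==> smooth p & (\<forall>x. p x : X)"
  and w: "smooth w" "!!x. x : K ==> w x : X"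
 shows "\<exists>p. p : P & (\<forall>d\<in>D. d p = d w)"
proof -
 obtain B where B: "B \<subseteq> D"
  "\<forall>d\<in>D. \<exists>c. \<forall>w. smooth w & (\<forall>x\<in>K. w x : X) \<longrightarrow> d w = (\<Sum>b\<in>B. c b * b w)"
  "\<forall>\<alpha>. \<exists>!p. p : P & (\<forall>b\<in>B. b p = \<alpha> b)"
  using u unfolding unisolvent_def by (elim exE conjE) (rule that; assumption)
 have "\<exists>!p. p : P & (\<forall>b\<in>B. b p = b w)" by (rule B(3)[THEN spec, of "%b. b w"])
 then obtain p where p: "p : P" "\<forall>b\<in>B. b p = b w" by (elim ex1E conjE) (rule that)
 have "d p = d w" if d: "d : D" for d
 proof -
  obtain c where c: "\<forall>w. smooth w & (\<forall>x\<in>K. w x : X) \<longrightarrow> d w = (\<Sum>b\<in>B. c b * b w)"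
   using bspec[OF B(2) d] by (rule exE)
  have "d p = (\<Sum>b\<in>B. c b * b p)" using c[rule_format, of p] P[OF p(1)] by blast
  also have "\<dots> = (\<Sum>b\<in>B. c b * b w)" using p(2) by (intro sum.cong refl) simp
  also have "\<dots> = d w" using c[rule_format, of w] w by simp
  finally show ?thesis .
 qed
 with p(1) show ?thesis by blast
qed

text \<open>Local interpolants fit together because a shared degree of freedom has the value it
  takes on \<open>w\<close> from either side.\<close>

lemma interpolant_exists:
 assumes u: "!!K. K : \<T> ==> unisolvent K X P (all_dofs vd ed fd kd K)"
  and P: "!!p. p : P ==> smooth p" "!!p x. p : P ==> p x : X"
  and w: "smooth w" "!!K x. K : \<T> ==> x : K ==> w x : X"
 shows "\<exists>!u. u : fe_space \<T> P vd ed fd & (\<forall>K\<in>\<T>. \<forall>d\<in>all_dofs vd ed fd kd K. d (u K) = d w)"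
proof -
 let ?D = "all_dofs vd ed fd kd"
 have "\<exists>p. p : P & (\<forall>d\<in>?D K. d p = d w)" if K: "K : \<T>" for K
  by (rule unisolvent_local[OF u[OF K]]) (use P w K in auto)
 then obtain p where p: "!!K. K : \<T> ==> p K : P" "!!K d. K : \<T> ==> d : ?D K ==> d (p K) = d w" by metis
 define q where "q K = (if K : \<T> then p K else (%x. 0))" for K
 have q: "q K = p K" if "K : \<T>" for K using that by (simp add: q_def)
 have "q : fe_space \<T> P vd ed fd"
  unfolding fe_space_def broken_def
 proof (intro CollectI conjI ballI allI impI)
  fix K K' assume K: "K : \<T>" "K' : \<T>"
  show "d (q K) = d (q K')" if "x : verts K \<inter> verts K'" "d : vd x" for x d
  proof -
   have "d : ?D K" "d : ?D K'" using that unfolding all_dofs_def by blast+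
   then show ?thesis using p(2) K q by metis
  qed
  show "d (q K) = d (q K')" if "e : edges K \<inter> edges K'" "d : ed e" for e d
  proof -
   have "d : ?D K" "d : ?D K'" using that unfolding all_dofs_def by blast+
   then show ?thesis using p(2) K q by metis
  qed
  show "d (q K) = d (q K')" if "f : faces K \<inter> faces K'" "d : fd f" for f d
  proof -
   have "d : ?D K" "d : ?D K'" using that unfolding all_dofs_def by blast+
   then show ?thesis using p(2) K q by metis
  qed
 qed (use p(1) in \<open>simp_all add: q_def\<close>)
 moreover have "\<forall>K\<in>\<T>. \<forall>d\<in>?D K. d (q K) = d w" using p(2) q by simp
 moreover have "u = u'" if u1: "u : fe_space \<T> P vd ed fd" "\<forall>K\<in>\<T>. \<forall>d\<in>?D K. d (u K) = d w"
  and u2: "u' : fe_space \<T> P vd ed fd" "\<forall>K\<in>\<T>. \<forall>d\<in>?D K. d (u' K) = d w" for u u'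
 proof
  fix K show "u K = u' K"
  proof (cases "K : \<T>")
   case True
   show ?thesis
   proof (rule unisolvent_eqI[OF u[OF True] fe_spaceD(1)[OF u1(1) True True] fe_spaceD(1)[OF u2(1) True True]])
    fix d assume d: "d : ?D K"
    have "d (u K) = d w" using u1(2) True d by blast
    moreover have "d (u' K) = d w" using u2(2) True d by blast
    ultimately show "d (u K) = d (u' K)" by (rule trans[OF _ sym])
   qed
  next
   case False
   show ?thesis unfolding fe_space_zero[OF u1(1) False] fe_space_zero[OF u2(1) False] ..
  qed
 qed
 ultimately show ?thesis by blast
qed

lemma interpolantI:
 assumes "\<exists>!u. u : U & (\<forall>K\<in>\<T>. \<forall>d\<in>D K. d (u K) = d w)" "u : U" "!!K d. K : \<T> ==> d : D K ==> d (u K) = d w"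
 shows "interpolant \<T> U D w = u"
 unfolding interpolant_def using assms by (intro the1_equality) auto

lemma interpolantD:
 assumes "\<exists>!u. u : U & (\<forall>K\<in>\<T>. \<forall>d\<in>D K. d (u K) = d w)"
 shows "interpolant \<T> U D w : U" "K : \<T> ==> d : D K ==> d (interpolant \<T> U D w K) = d w"
 using theI'[OF assms] unfolding interpolant_def by blast+

section \<open>Fields vanishing on a tetrahedron\<close>

lemma dd_vanish:
 assumes "smooth f" "!!y. y : K ==> f y = 0" "K \<subseteq> closure (interior K)" "x : K" shows "dd v f x = 0"
proof -
 have "dd v f x = dd v (%x. 0) x" using assms by (intro dd_cong_closure[of f "%x. 0" K]) auto
 then show ?thesis by simp
qed

text \<open>A field on the closed domain is represented by a smooth extension. Two extensions that
  agree on \<open>K\<close> have to have the same degrees of freedom there, and the derivatives must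
  not see the difference.\<close>

lemma vanish_ops:
 assumes N: "smooth N" "!!y. y : K ==> N y = 0" and K: "K \<subseteq> closure (interior K)" and x: "x : K"
 shows "ccs N x = 0" "Gam s N x = 0" "rot_perp s \<mu> \<nu> N x = 0" "Lam n N x = 0"
proof -
 have b: "bf N u v y = 0" if "y : K" for u v y using N(2)[OF that] by (simp add: bf_def)
 have d: "dd w (bf N u v) y = 0" if "y : K" for u v w y
  by (rule dd_vanish[OF smooth_bf[OF N(1)] b K that])
 have d2: "dd r (dd w (bf N u v)) y = 0" if "y : K" for u v w r y
  by (rule dd_vanish[OF smooth_dd[OF smooth_bf[OF N(1)]] d K that])
 show "ccs N x = 0"
 proof -
  have "ccs N x $ i $ j = 0" for i j
  proof -
   obtain p q where i: "axis i (1 :: real) = cross3 p q" by (rule axis_cross)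
   obtain r t where j: "axis j (1 :: real) = cross3 r t" by (rule axis_cross)
   have "ccs N x $ i $ j = bf (ccs N) (cross3 p q) (cross3 r t) x" by (simp add: i[symmetric] j[symmetric] bf_axis)
   also have "\<dots> = 0" unfolding ccs_form[OF N(1)] by (simp add: d2[OF x])
   finally show ?thesis .
  qed
  then show ?thesis by (simp add: vec_eq_iff)
 qed
 show "Gam s N x = 0"
 proof -
  have "w <.> Gam s N x = w <.> 0" for w by (simp add: Gam_form[OF N(1)] d[OF x])
  then show ?thesis using vector_eq_ldot by blast
 qed
 show "rot_perp s \<mu> \<nu> N x = 0" by (simp add: rot_perp_bf d[OF x])
 show "Lam n N x = 0" by (rule mat_eqI) (simp add: Lam_form[OF N(1)] d[OF x])
qed

lemma edge_int_zero: "(!!x. x : seg a b ==> g x = 0) ==> edge_int (seg a b) g = 0"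
 by (simp add: edge_int_eq M1_zero)

lemma integral_K_zero: "(!!x. x : K ==> g x = (0 :: real)) ==> integral K g = 0"
 using integral_cong[of K g "%x. 0"] by simp

lemma rigid_poly: assumes "r : rigid" shows "polyi UNIV 7 r" "eps r x = 0"
proof -
 obtain a b where r: "r = (%x. a + cross3 b x)" using assms by (auto simp: rigid_def)
 have l: "bounded_linear (cross3 b)" by (rule linear_conv_bounded_linear[THEN iffD1]) (rule linearI; simp add: cross_add_right cross_mult_right)
 have id: "polyi UNIV 1 (%x :: vec3. x)"
 proof (rule polyi_vec)
  show "polyi UNIV 1 (%z. z $ i)" for i using polyi_affine[of "axis i 1" 0] by (simp add: inner_axis')
 qed
 then have "polyi UNIV 7 (%x. cross3 b x)"
  by (intro polyi_mono[of 1 7] polyi_linear[OF _ bounded_linear.linear[OF l]]) auto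
 then show p: "polyi UNIV 7 r" unfolding r by (intro polyi.add polyi_const) auto
 have d: "dd v r x = cross3 b v" for v
 proof -
  have "dd v (%x. a + cross3 b x) = (%x. dd v (%x. a) x + dd v (%x. cross3 b x) x)"
   by (rule dd_add[OF smooth_const smooth_linear[OF l polyi_smooth[OF id]]])
  also have "\<dots> = (%x. cross3 b v)" unfolding dd_linear[OF l polyi_smooth[OF id]] dd_id by simp
  finally show ?thesis unfolding r by (rule fun_cong)
 qed
 have sk: "y <.> cross3 b z = - (z <.> cross3 b y)" for y z
 proof -
  have "cross3 b z <.> y = cross3 z y <.> b" "cross3 b y <.> z = cross3 y z <.> b" by (metis cross_triple)+
  moreover have "cross3 y z = - cross3 z y" by (rule cross_skew)
  ultimately show ?thesis by (simp add: inner_commute)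
 qed
 have "y <.> cross3 b z + z <.> cross3 b y = 0" for y z unfolding sk[of y z] by simp
 then show "eps r x = 0"
  by (intro mat_eqI) (simp add: eps_form[OF polyi_smooth[OF p]] d)
qed

context mesh
begin

lemma closure_interior_mesh: "K : \<T> ==> K \<subseteq> closure (interior K)"
 using convex_closure_interior[OF mesh_convex mesh_interior] closure_subset by blast

lemma mesh_sub: "K : \<T> ==> f : faces K ==> f \<subseteq> K" "K : \<T> ==> e : edges K ==> e \<subseteq> K" "K : \<T> ==> x : verts K ==> x : K"
 by (auto simp: faces_def edges_def verts_def extreme_point_of_def dest: face_of_imp_subset)

lemma Th_vanish:
 assumes K: "K : \<T>" and N: "smooth N" "!!y. y : K ==> N y = 0" and d: "d : Th_dofs n s \<mu> \<nu> K"
 shows "d N = 0"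
proof -
 note op = vanish_ops[OF N closure_interior_mesh[OF K]]
 have "d : (\<Union>x\<in>verts K. Th_vdofs x) \<or> d : (\<Union>e\<in>edges K. Th_edofs s \<mu> \<nu> e) \<or> d : (\<Union>f\<in>faces K. Th_fdofs n s f) \<or> d : Th_kdofs n K"
  using d unfolding Th_dofs_def all_dofs_def by blast
 then consider (v) x where "x : verts K" "d : Th_vdofs x" | (e) e where "e : edges K" "d : Th_edofs s \<mu> \<nu> e"
  | (f) f where "f : faces K" "d : Th_fdofs n s f" | (k) "d : Th_kdofs n K" by blast
 then show ?thesis
 proof cases
  case v
  then show ?thesis using N(2) op(1) mesh_sub(3)[OF K v(1)] by (auto simp: Th_vdofs_def)
 next
  case e
  obtain a b where ab: "e = seg a b" by (rule mesh_edge[OF K e(1)])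
  have z: "edge_int e g = 0" if "!!x. x : K ==> g x = 0" for g
   unfolding ab by (rule edge_int_zero) (use that mesh_sub(2)[OF K e(1)] ab in blast)
  show ?thesis
   using e(2) unfolding Th_edofs_def by (auto intro!: z simp: N(2) op)
 next
  case f
  obtain a b c where T: "triv f a b c" by (rule mesh_triv[OF K f(1)])
  have z: "face_int f g = 0" if "smooth g" "!!x. x : K ==> g x = 0" for g
   by (rule face_int_zero[OF T that(1)]) (use that mesh_sub(1)[OF K f(1)] in blast)
  have ze: "edge_int e g = 0" if e: "e : edges f" and g: "!!x. x : K ==> g x = 0" for e g
  proof -
   have eK: "e : edges K" using faces_edges[OF f(1)] e by blast
   obtain a b where ab: "e = seg a b" by (rule mesh_edge[OF K eK])
   show ?thesis unfolding ab by (rule edge_int_zero) (use g mesh_sub(2)[OF K eK] ab in blast)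
  qed
  have s1: "smooth (%x. Qp (n f) ** N x ** Qp (n f))"
   using sub_op_smooth[OF sub_op_lin[OF bl_Qp(2)] N(1)] .
  note sL = smooth_Lam[OF N(1), of "n f"]
  have "face_int f (%x. (Qp (n f) ** N x ** Qp (n f)) <.> eps_f (n f) v x) = 0" if "v : bubble_polys f 4 (range ((*v) (Qp (n f))))" for v
   by (rule z[OF smooth_inner[OF s1 smooth_eps_f[OF bubble_smooth[OF that]]]]) (simp add: N(2))
  moreover have "edge_int e (%x. (s e <.> (Lam (n f) N x *v conormal f e)) * v x) = 0" if "e : edges f" for e v
   by (rule ze[OF that]) (simp add: op(4))
  moreover have "face_int f (%x. Lam (n f) N x $ i $ j) = 0" for i j
   by (rule z) (use sL in \<open>auto simp: op(4) intro!: smooth_nth\<close>)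
  moreover have "face_int f (%x. Lam (n f) N x <.> hess_f (n f) v x) = 0" if "v : Ef f" for v
   by (rule z[OF smooth_inner[OF sL smooth_hess_f[OF Ef_smooth[OF that]]]]) (simp add: op(4))
  ultimately show ?thesis using f(2) unfolding Th_fdofs_def by blast
 next
  case k
  then show ?thesis unfolding Th_kdofs_def by (auto intro!: integral_K_zero simp: N(2) op(1))
 qed
qed

lemma Sg_vanish:
 assumes K: "K : \<T>" and N: "smooth N" "!!y. y : K ==> N y = 0" and d: "d : Sg_dofs n s nm np K"
 shows "d N = 0"
proof -
 have "d : (\<Union>x\<in>verts K. Sg_vdofs x) \<or> d : (\<Union>e\<in>edges K. Sg_edofs s nm np e) \<or> d : (\<Union>f\<in>faces K. Sg_fdofs n f) \<or> d : Sg_kdofs n K"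
  using d unfolding Sg_dofs_def all_dofs_def by blast
 then consider (v) x where "x : verts K" "d : Sg_vdofs x" | (e) e where "e : edges K" "d : Sg_edofs s nm np e"
  | (f) f where "f : faces K" "d : Sg_fdofs n f" | (k) "d : Sg_kdofs n K" by blast
 then show ?thesis
 proof cases
  case v
  then show ?thesis using N(2) mesh_sub(3)[OF K v(1)] by (auto simp: Sg_vdofs_def)
 next
  case e
  obtain a b where ab: "e = seg a b" by (rule mesh_edge[OF K e(1)])
  have z: "edge_int e g = 0" if "!!x. x : K ==> g x = 0" for g
   unfolding ab by (rule edge_int_zero) (use that mesh_sub(2)[OF K e(1)] ab in blast)
  have "edge_int e (%x. (a <.> (N x *v b)) * v x) = 0" for a b v by (rule z) (simp add: N(2))
  then show ?thesis using e(2) unfolding Sg_edofs_def by blast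
 next
  case f
  obtain a b c where T: "triv f a b c" by (rule mesh_triv[OF K f(1)])
  have "face_int f (%x. (N x *v n f) <.> v x) = 0" if "v : polys 1 UNIV" for v
   using N mesh_sub(1)[OF K f(1)] polys_smooth[OF that] by (intro face_int_zero[OF T]) (auto intro!: smooth_inner smooth_mv)
  then show ?thesis using f(2) unfolding Sg_fdofs_def by blast
 next
  case k
  have "integral K (%x. N x $ i $ j) = 0" "integral K (%x. N x <.> U x) = 0" for i j U
   by (rule integral_K_zero, simp add: N(2))+
  with k show ?thesis unfolding Sg_kdofs_def by fastforce
 qed
qed

lemma sub_all:
 assumes K: "K : \<T>" and d: "d : all_dofs vd ed fd kd K"
  and sub: "!!x d. d : vd x ==> subtractive d" "!!a b d. d : ed (seg a b) ==> subtractive d"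
   "!!f a b c d. triv f a b c ==> d : fd f ==> subtractive d" "!!a b c d0 d. tetv K a b c d0 ==> d : kd K ==> subtractive d"
 shows "subtractive d"
proof -
 have e: "subtractive d" if "e : edges K" "d : ed e" for e
  using mesh_edge[OF K that(1)] sub(2) that(2) by metis
 have f: "subtractive d" if "f : faces K" "d : fd f" for f
  using mesh_triv[OF K that(1)] sub(3) that(2) by metis
 have k: "subtractive d" if "d : kd K"
  using mesh_tetv[OF K] sub(4) that by metis
 show ?thesis using d e f k sub(1) unfolding all_dofs_def by blast
qed

lemma sub_W: "K : \<T> ==> d : W_dofs n K ==> subtractive d"
 unfolding W_dofs_def by (erule (1) sub_all; (erule sub_W_v sub_W_e | erule (1) sub_W_f sub_W_k))

lemma sub_Th: "K : \<T> ==> d : Th_dofs n s \<mu> \<nu> K ==> subtractive d"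
 unfolding Th_dofs_def by (erule (1) sub_all; (erule sub_Th_v sub_Th_e | erule (1) sub_Th_f sub_Th_k))

lemma sub_Sg: "K : \<T> ==> d : Sg_dofs n s nm np K ==> subtractive d"
 unfolding Sg_dofs_def by (erule (1) sub_all; (erule sub_Sg_v sub_Sg_e | erule (1) sub_Sg_f sub_Sg_k))

lemma all_dofs_parts:
 assumes "\<forall>d\<in>all_dofs vd ed fd kd K. d u = (0 :: real)"
 shows "x : verts K ==> \<forall>d\<in>vd x. d u = 0" "e : edges K ==> \<forall>d\<in>ed e. d u = 0" "f : faces K ==> \<forall>d\<in>fd f. d u = 0" "\<forall>d\<in>kd K. d u = 0"
 using assms unfolding all_dofs_def by blast+

lemma all_dofsI:
 assumes "!!x. x : verts K ==> \<forall>d\<in>vd x. d u = (0 :: real)" "!!e. e : edges K ==> \<forall>d\<in>ed e. d u = 0" "!!f. f : faces K ==> \<forall>d\<in>fd f. d u = 0" "\<forall>d\<in>kd K. d u = 0"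
 shows "\<forall>d\<in>all_dofs vd ed fd kd K. d u = 0"
 using assms unfolding all_dofs_def by blast

lemma W_zero_eps:
 assumes K: "K : \<T>" and u: "smooth u" and z: "\<forall>d\<in>W_dofs n K. d u = 0"
 shows "\<forall>d\<in>Th_dofs n s \<mu> \<nu> K. d (eps u) = 0"
proof -
 note W = all_dofs_parts[OF z[unfolded W_dofs_def]]
 show ?thesis unfolding Th_dofs_def
 proof (rule all_dofsI)
  show "\<forall>d\<in>Th_vdofs x. d (eps u) = 0" if "x : verts K" for x by (rule eps_vdofs[OF u W(1)[OF that]])
  show "\<forall>d\<in>Th_edofs s \<mu> \<nu> e. d (eps u) = 0" if e: "e : edges K" for e
   using edge_verts[OF e] by (intro eps_zero_edge[OF K e u W(1) W(2)[OF e]]) auto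
  show "\<forall>d\<in>Th_fdofs n s f. d (eps u) = 0" if f: "f : faces K" for f
   using faces_verts[OF f] by (intro eps_zero_face[OF K f u W(1) W(3)[OF f]]) auto
  show "\<forall>d\<in>Th_kdofs n K. d (eps u) = 0" by (rule eps_kdofs[OF u W(4)])
 qed
qed

text \<open>The averages of \<open>ccs S\<close> vanish by the divergence theorem for \<open>x\<^sub>j ccs S\<close>, as \<open>ccs S\<close> is divergence free.\<close>
lemma Th_zero_ccs:
 assumes K: "K : \<T>" and S: "smooth S" "!!x. S x : Sym" and z: "\<forall>d\<in>Th_dofs n s \<mu> \<nu> K. d S = 0"
 shows "\<forall>d\<in>Sg_dofs n s nm np K. d (ccs S) = 0"
proof -
 note W = all_dofs_parts[OF z[unfolded Th_dofs_def]]
 obtain a b c d where TK: "tetv K a b c d" by (rule mesh_tetv[OF K])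
 have F: "face_dofs S f (n f) s \<mu> \<nu>" if f: "f : faces K" for f
  using W(1,2) faces_verts[OF f] faces_edges[OF f] by (intro Th_face_dofs[OF K f S _ _ W(3)[OF f]]) blast+
 show ?thesis unfolding Sg_dofs_def
 proof (rule all_dofsI)
  show "\<forall>d\<in>Sg_vdofs x. d (ccs S) = 0" if "x : verts K" for x by (rule ccs_vdofs[OF W(1)[OF that]])
  show "\<forall>d\<in>Sg_edofs s nm np e. d (ccs S) = 0" if e: "e : edges K" for e
   using edge_verts[OF e] by (intro ccs_zero_edge[OF K e S W(1) W(2)[OF e]]) auto
  show "\<forall>d\<in>Sg_fdofs n f. d (ccs S) = 0" if f: "f : faces K" for f
   by (rule ccs_zero_face[OF K f F[OF f]])
  have av: "integral K (%x. ccs S x $ i $ j) = 0" for i j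
  proof -
   define \<phi> where "\<phi> x = axis j 1 <.> x + 0" for x :: vec3
   have \<phi>: "polyi UNIV 1 \<phi>" unfolding \<phi>_def[abs_def] using polyi_affine[of "axis j 1" 0] by simp
   have pd: "pd k \<phi> x = (axis j 1 :: vec3) <.> axis k 1" for k x
    unfolding \<phi>_def[abs_def] pd_def by (simp add: dd_cinner dd_id)
   have "face_int f (%x. \<phi> x * bf (ccs S) (axis i 1) (n f) x) = 0" if f: "f : faces K" for f
   proof -
    obtain a b c where T: "triv f a b c" by (rule mesh_triv[OF K f])
    interpret F: face_dofs S f "n f" s \<mu> \<nu> by (rule F[OF f])
    show ?thesis
     using F.ccs_moment[OF T \<phi>, of "axis i 1"] polyi_smooth[OF \<phi>] S(1)
     by (subst face_int_eq[OF T]) (auto intro!: smooth_cont smooth_mult smooth_bf smooth_ccs)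
   qed
   then have "integral K (%x. \<phi> x * (axis i 1 <.> mdiv (ccs S) x) + (\<Sum>k\<in>UNIV. pd k \<phi> x * bf (ccs S) (axis i 1) (axis k 1) x)) = 0"
    using gauss_matrix[OF TK smooth_ccs[OF S(1)] polyi_smooth[OF \<phi>] mesh_normal[OF K], of "axis i 1"] by simp
   moreover have "(%x. \<phi> x * (axis i 1 <.> mdiv (ccs S) x) + (\<Sum>k\<in>UNIV. pd k \<phi> x * bf (ccs S) (axis i 1) (axis k 1) x)) = (%x. ccs S x $ i $ j)"
    by (simp add: mdiv_ccs[OF S(1)] pd bf_axis inner_axis_axis if_distrib[of "%y. y * _"] cong: if_cong)
   ultimately show ?thesis by simp
  qed
  have "integral K (%x. ccs S x <.> U x) = 0" if "U : M4 n K" for U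
  proof -
   have "(%S. integral K (%x. ccs S x <.> U x)) : Th_kdofs n K" unfolding Th_kdofs_def using that by blast
   with W(4) show ?thesis by (rule bspec)
  qed
  then show "\<forall>d\<in>Sg_kdofs n K. d (ccs S) = 0" unfolding Sg_kdofs_def using av by auto
 qed
qed

lemma ccs_vanish: "K : \<T> ==> smooth N ==> (!!y. y : K ==> N y = 0) ==> x : K ==> ccs N x = 0"
 by (rule vanish_ops(1)[OF _ _ closure_interior_mesh])

text \<open>A smooth strain is symmetric only on the domain, whereas the lemmas on degrees of
  freedom assume symmetry everywhere. Its symmetric part agrees with it on \<open>K\<close>.\<close>

lemma symmetrize:
 fixes S :: "vec3 => mat3"
 assumes "smooth S" "!!x. x : K ==> S x : Sym"
 obtains S' where "smooth S'" "!!x. S' x : Sym" "!!x. x : K ==> S' x = S x"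
proof
 define S' where "S' x = (1/2) *R (S x + transpose (S x))" for x
 show "smooth (%x. (1/2) *R (S x + transpose (S x)))" using assms(1) by auto
 show "(1/2) *R (S x + transpose (S x)) : Sym" for x by (auto simp: Sym_def transpose_def vec_eq_iff)
 show "(1/2) *R (S x + transpose (S x)) = S x" if "x : K" for x
  using assms(2)[OF that] by (simp add: Sym_def scaleR_2[symmetric])
qed

lemma Th_zero_ccs_local:
 assumes K: "K : \<T>" and S: "smooth S" "!!x. x : K ==> S x : Sym" and z: "\<forall>d\<in>Th_dofs n s \<mu> \<nu> K. d S = 0"
  and d: "d : Sg_dofs n s nm np K"
 shows "d (ccs S) = 0"
proof -
 obtain S' where S': "smooth S'" "!!x. S' x : Sym" "!!x. x : K ==> S' x = S x" using symmetrize[OF S] by blast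
 define N where "N x = S x - S' x" for x
 have N: "smooth N" "!!x. x : K ==> N x = 0" unfolding N_def[abs_def] using S(1) S' by auto
 have "\<forall>d\<in>Th_dofs n s \<mu> \<nu> K. d S' = 0"
 proof
  fix d assume d: "d : Th_dofs n s \<mu> \<nu> K"
  have "d N = d S - d S'" unfolding N_def[abs_def] by (rule subtractiveD[OF sub_Th[OF K d] S(1) S'(1)])
  moreover have "d S = 0" using z d by blast
  ultimately show "d S' = 0" using Th_vanish[OF K N d] by simp
 qed
 from Th_zero_ccs[OF K S'(1,2) this] have 1: "d (ccs S') = 0" using d by blast
 have "ccs N = (%x. ccs S x - ccs S' x)" unfolding N_def[abs_def] by (rule sub_op_diff[OF sub_op_ccs S(1) S'(1)])
 then have "d (ccs N) = d (ccs S) - d (ccs S')"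
  using subtractiveD[OF sub_Sg[OF K d] smooth_ccs[OF S(1)] smooth_ccs[OF S'(1)]] by simp
 moreover have "d (ccs N) = 0" by (rule Sg_vanish[OF K smooth_ccs[OF N(1)] ccs_vanish[OF K N] d])
 ultimately show ?thesis using 1 by simp
qed

lemma ccs_Sym_local:
 assumes K: "K : \<T>" and S: "smooth S" "!!x. x : K ==> S x : Sym" and x: "x : K"
 shows "ccs S x : Sym"
proof -
 obtain S' where S': "smooth S'" "!!x. S' x : Sym" "!!x. x : K ==> S' x = S x" using symmetrize[OF S] by blast
 have "ccs (%x. S x - S' x) x = 0" using S' S(1) by (intro ccs_vanish[OF K _ _ x]) auto
 then have "ccs S x = ccs S' x" using sub_op_diff[OF sub_op_ccs S(1) S'(1)] by simp
 then show ?thesis using ccs_Sym[OF S'(1,2)] by simp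
qed

text \<open>Integration by parts leaves face moments of degree 1 of the normal trace and, as the
  gradient of \<open>v\<close> is constant, averages of \<open>D\<close>. Both are stress degrees of
  freedom.\<close>

lemma mdiv_moment:
 assumes K: "K : \<T>" and D: "smooth D" and z: "\<forall>d\<in>Sg_dofs n s nm np K. d D = 0" and v: "polyi UNIV 1 v"
 shows "integral K (%x. mdiv D x <.> v x) = 0"
proof -
 note W = all_dofs_parts[OF z[unfolded Sg_dofs_def]]
 obtain a b c d where TK: "tetv K a b c d" by (rule mesh_tetv[OF K])
 have mK: "measure lebesgue K ~= 0"
  using negligible_iff_measure0[OF lmeasurable_compact[OF mesh_compact[OF K]]] negligible_convex_interior[OF mesh_convex[OF K]] mesh_interior[OF K] by blast
 have av: "integral K (%x. D x $ i $ j) = 0" for i j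
 proof -
  have "(%T. integral K (%x. T x $ i $ j) / measure lebesgue K) : Sg_kdofs n K" unfolding Sg_kdofs_def by blast
  with W(4) have "integral K (%x. D x $ i $ j) / measure lebesgue K = 0" by (rule bspec)
  with mK show ?thesis by simp
 qed
 have comp: "integral K (%x. v x $ i * (axis i 1 <.> mdiv D x)) = 0" for i
 proof -
  have vi: "polyi UNIV 1 (%x. v x $ i)" by (rule polyi_nth[OF v])
  note svi = polyi_smooth[OF vi]
  have fz: "face_int f (%x. v x $ i * bf D (axis i 1) (n f) x) = 0" if f: "f : faces K" for f
  proof -
   have "(%x. v x $ i *R axis i 1) : polys 1 (UNIV :: vec3 set)"
    unfolding polys_iff[OF subspace_UNIV] by (rule polyi_scaleR_const[OF vi UNIV_I subspace_UNIV])
   then have "(%T. face_int f (%x. (T x *v n f) <.> (v x $ i *R axis i 1))) : Sg_fdofs n f"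
    unfolding Sg_fdofs_def by (intro CollectI exI[of _ "%x. v x $ i *R axis i 1"]) simp
   with W(3)[OF f] have "face_int f (%x. (D x *v n f) <.> (v x $ i *R axis i 1)) = 0" by (rule bspec)
   then show ?thesis by (simp add: bf_def inner_commute)
  qed
  have "\<exists>c. \<forall>k x. pd k (%x. v x $ i) x = c k"
  proof (intro exI allI)
   fix k x
   have "polyi UNIV 0 (pd k (%x. v x $ i))" using polyi_pd[OF vi subspace_UNIV, of k] by simp
   then show "pd k (%x. v x $ i) x = pd k (%x. v x $ i) 0" by (rule polyi_0_const)
  qed
  then obtain c where c: "!!k x. pd k (%x. v x $ i) x = c k" by blast
  have sD: "smooth (%x. D x $ i $ k)" for k using D by (intro smooth_nth)
  have "integral K (%x. v x $ i * (axis i 1 <.> mdiv D x) + (\<Sum>k\<in>UNIV. pd k (%x. v x $ i) x * bf D (axis i 1) (axis k 1) x)) = 0"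
   using gauss_matrix[OF TK D svi mesh_normal[OF K], of "axis i 1"] by (simp add: fz)
  then have "integral K (%x. v x $ i * (axis i 1 <.> mdiv D x) + (\<Sum>k\<in>UNIV. c k * D x $ i $ k)) = 0"
   by (simp add: c bf_axis)
  moreover have "integral K (%x. v x $ i * (axis i 1 <.> mdiv D x) + (\<Sum>k\<in>UNIV. c k * D x $ i $ k))
   = integral K (%x. v x $ i * (axis i 1 <.> mdiv D x)) + integral K (%x. \<Sum>k\<in>UNIV. c k * D x $ i $ k)"
   using svi D sD by (intro integral_K_linear mesh_compact[OF K] smooth_cont) auto
  moreover have "integral K (%x. \<Sum>k\<in>UNIV. c k * D x $ i $ k) = (\<Sum>k\<in>UNIV. integral K (%x. c k * D x $ i $ k))"
  proof (rule integral_sum)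
   fix k
   show "(%x. c k * D x $ i $ k) integrable_on K"
    using sD compact_absolutely_integrable[OF mesh_compact[OF K]]
    by (intro set_lebesgue_integral_eq_integral(1) compact_absolutely_integrable[OF mesh_compact[OF K]] continuous_on_subset[OF smooth_cont]) auto
  qed simp
  ultimately show ?thesis by (simp add: av)
 qed
 have "(%x. mdiv D x <.> v x) = (%x. \<Sum>i\<in>UNIV. v x $ i * (axis i 1 <.> mdiv D x))"
  by (simp only: inner_expand[of "mdiv D _"])
 moreover have "integral K (%x. \<Sum>i\<in>UNIV. v x $ i * (axis i 1 <.> mdiv D x)) = (\<Sum>i\<in>UNIV. integral K (%x. v x $ i * (axis i 1 <.> mdiv D x)))"
 proof (rule integral_sum)
  fix i
  have "smooth (%x. v x $ i * (axis i 1 <.> mdiv D x))"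
   using polyi_smooth[OF polyi_nth[OF v]] smooth_mdiv[OF D] by (intro smooth_mult smooth_inner smooth_const)
  then show "(%x. v x $ i * (axis i 1 <.> mdiv D x)) integrable_on K"
   by (intro set_lebesgue_integral_eq_integral(1) compact_absolutely_integrable[OF mesh_compact[OF K]] continuous_on_subset[OF smooth_cont]) auto
 qed simp
 ultimately show ?thesis by (simp add: comp)
qed

text \<open>The integrand is nonnegative, so \<open>v\<close> vanishes in the interior of
  \<open>K\<close>, and then as a polynomial on every line through an interior point.\<close>

lemma zero_by_square:
 assumes K: "K : \<T>" and v: "polyi UNIV 1 v" and z: "integral K (%x. v x <.> v x) = 0"
 shows "v = (%x. (0 :: vec3))"
proof
 fix x
 have iK: "(%x. v x <.> v x) integrable_on S" if "compact S" for S
  using polyi_smooth[OF v] that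
  by (intro set_lebesgue_integral_eq_integral(1) compact_absolutely_integrable continuous_on_subset[OF smooth_cont]) auto
 have K0: "v y = 0" if y: "y : interior K" for y
 proof -
  obtain a b where ab: "y : box a b" "cbox a b \<subseteq> interior K"
   using open_contains_cbox[OF open_interior y] by metis
  have "integral (cbox a b) (%x. v x <.> v x) <= integral K (%x. v x <.> v x)"
   using ab(2) interior_subset[of K] by (intro integral_subset_le iK compact_cbox mesh_compact[OF K]) auto
  moreover have "0 <= integral (cbox a b) (%x. v x <.> v x)" by (intro integral_nonneg iK compact_cbox) auto
  ultimately have "integral (cbox a b) (%x. v x <.> v x) = 0" using z by simp
  then have "((%x. v x <.> v x) has_integral 0) (cbox a b)"
   using integrable_integral[OF iK[OF compact_cbox, of a b]] by simp
  moreover have "continuous_on (cbox a b) (%x. v x <.> v x)"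
   using polyi_smooth[OF v] by (intro continuous_on_subset[OF smooth_cont]) auto
  ultimately have "v y <.> v y = 0"
   using ab(1) box_subset_cbox[of a b] by (intro has_integral_0_cbox_imp_0[of a b "%x. v x <.> v x"]) auto
  then show ?thesis by simp
 qed
 obtain y where y: "y : interior K" using mesh_interior[OF K] by blast
 obtain e where e: "e > 0" "ball y e \<subseteq> interior K" using openE[OF open_interior y] by blast
 \<comment> \<open>Up to the parameter \<open>h\<close> the line from \<open>y\<close> towards
   \<open>x\<close> stays in a ball on which \<open>v\<close> is known to vanish.\<close>
 define h where "h = e / (1 + norm (x - y))"
 have h: "h > 0" using e by (simp add: h_def add_pos_nonneg)
 have "v (pt1 y x 1) = 0"
 proof (rule line_zero_interval[OF v subspace_UNIV, of 0 h])
  fix t :: real assume t: "0 < t" "t < h"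
  have "norm (t *R (x - y)) <= t * (1 + norm (x - y))" using t by (simp add: mult_left_mono)
  also have "\<dots> < h * (1 + norm (x - y))" using t by (intro mult_strict_right_mono) (auto simp: add_pos_nonneg)
  also have "\<dots> = e" using add_pos_nonneg[of 1 "norm (x - y)"] by (simp add: h_def)
  finally have "pt1 y x t : ball y e" by (simp add: dist_norm)
  then show "v (pt1 y x t) = 0" using e K0 by blast
 qed (rule h)
 then show "v x = 0" by simp
qed

text \<open>Orthogonality on each tetrahedron yields the global condition by summation. A second
  candidate differs from \<open>u\<close> by a member of \<open>V_h\<close> orthogonal to itself,
  which \<open>zero_by_square\<close> annihilates piece by piece.\<close>

lemma Pi_V_eqI:
 assumes g: "smooth g" and u: "u : V_h \<T>"
  and o: "!!K v. K : \<T> ==> polyi UNIV 1 v ==> integral K (%x. (u K x - g x) <.> v x) = 0"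
 shows "Pi_V \<T> g = u"
 unfolding Pi_V_def
proof (rule the_equality)
 have V: "w K : polys 1 UNIV" if "w : V_h \<T>" "K : \<T>" for w K using that by (simp add: V_h_def broken_def)
 have Vp: "polyi UNIV 1 (w K)" if "w : V_h \<T>" "K : \<T>" for w K
  using V[OF that] unfolding polys_iff[OF subspace_UNIV] .
 show "u : V_h \<T> & (\<forall>v\<in>V_h \<T>. (\<Sum>K\<in>\<T>. integral K (%x. (u K x - g x) <.> v K x)) = 0)"
  using u o Vp by (auto intro!: sum.neutral)
 fix w assume w: "w : V_h \<T> & (\<forall>v\<in>V_h \<T>. (\<Sum>K\<in>\<T>. integral K (%x. (w K x - g x) <.> v K x)) = 0)"
 define v where "v K x = w K x - u K x" for K x
 have vp: "polyi UNIV 1 (v K)" if "K : \<T>" for K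
  unfolding v_def[abs_def] using w u that by (intro polyi_diff Vp subspace_UNIV) auto
 have vz: "v K = (%x. 0)" if "K \<notin> \<T>" for K
  using w u that by (simp add: v_def[abs_def] V_h_def broken_def)
 have "v : V_h \<T>" unfolding V_h_def broken_def using vp vz by (auto simp only: mem_Collect_eq polys_iff[OF subspace_UNIV])
 then have 1: "(\<Sum>K\<in>\<T>. integral K (%x. (w K x - g x) <.> v K x)) = 0" using w by blast
 have c: "continuous_on K h" if "smooth h" for K and h :: "vec3 => real"
  using that by (intro continuous_on_subset[OF smooth_cont]) auto
 have int: "integral K (%x. (w K x - g x) <.> v K x) = integral K (%x. v K x <.> v K x)" if K: "K : \<T>" for K
 proof -
  have sm: "smooth (v K)" "smooth (u K)" "smooth (w K)" using polyi_smooth vp[OF K] Vp[of _ K] u w K by blast+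
  have "(%x. (w K x - g x) <.> v K x) = (%x. v K x <.> v K x + (u K x - g x) <.> v K x)"
   by (simp add: v_def inner_diff_left)
  moreover have "integral K (%x. v K x <.> v K x + (u K x - g x) <.> v K x) = integral K (%x. v K x <.> v K x) + integral K (%x. (u K x - g x) <.> v K x)"
   using sm g by (intro integral_K_linear mesh_compact[OF K] smooth_cont smooth_inner smooth_diff)
  ultimately show ?thesis using o[OF K vp[OF K]] by simp
 qed
 have "(\<Sum>K\<in>\<T>. integral K (%x. v K x <.> v K x)) = 0" using 1 int by simp
 moreover have nn: "0 <= integral K (%x. v K x <.> v K x)" if K: "K : \<T>" for K
  using polyi_smooth[OF vp[OF K]]
  by (intro integral_nonneg set_lebesgue_integral_eq_integral(1) compact_absolutely_integrable[OF mesh_compact[OF K]] c smooth_inner) auto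
 ultimately have "integral K (%x. v K x <.> v K x) = 0" if "K : \<T>" for K
  using that by (simp add: sum_nonneg_eq_0_iff[OF finite_mesh])
 then have "v K = (%x. 0)" if "K : \<T>" for K using zero_by_square[OF that vp[OF that]] that by blast
 with vz have "v K = (%x. 0)" for K by blast
 then show "w = u" by (simp add: v_def fun_eq_iff)
qed

end

section \<open>Interpolation operators and the commuting diagram\<close>

locale unisolvent_mesh = mesh +
 assumes uW: "\<forall>K\<in>\<T>. unisolvent K UNIV W_loc (W_dofs n K)"
  and uTh: "\<forall>K\<in>\<T>. unisolvent K Sym Th_loc (Th_dofs n s \<mu> \<nu> K)"
  and uSg: "\<forall>K\<in>\<T>. unisolvent K Sym Sg_loc (Sg_dofs n s nm np K)"
begin

lemma Pi_W_exists: "smooth w ==> \<exists>!u. u : W_space & (\<forall>K\<in>\<T>. \<forall>d\<in>W_dofs n K. d (u K) = d w)"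
 unfolding W_space_def W_h_def W_dofs_def using uW[unfolded W_dofs_def] polys_smooth
 by (intro interpolant_exists[where X = UNIV]) (auto simp: W_loc_def)

lemma Pi_Th_exists:
 assumes "smooth S" "!!x. x : \<Union>\<T> ==> S x : Sym"
 shows "\<exists>!u. u : Th_space & (\<forall>K\<in>\<T>. \<forall>d\<in>Th_dofs n s \<mu> \<nu> K. d (u K) = d S)"
 unfolding Th_space_def Th_h_def Th_dofs_def
proof (rule interpolant_exists[where X = Sym])
 show "unisolvent K Sym Th_loc (all_dofs Th_vdofs (Th_edofs s \<mu> \<nu>) (Th_fdofs n s) (Th_kdofs n) K)" if "K : \<T>" for K
  using uTh that unfolding Th_dofs_def by blast
 show "smooth p" "p x : Sym" if "p : Th_loc" for p x
  using that polyi_val[OF _ subspace_Sym] polys_smooth unfolding Th_loc_def polys_iff[OF subspace_Sym, symmetric] by blast+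
qed (use assms in auto)

lemma Pi_Sg_exists:
 assumes "smooth S" "!!x. x : \<Union>\<T> ==> S x : Sym"
 shows "\<exists>!u. u : Sg_space & (\<forall>K\<in>\<T>. \<forall>d\<in>Sg_dofs n s nm np K. d (u K) = d S)"
 unfolding Sg_space_def Sg_h_def Sg_dofs_def
proof (rule interpolant_exists[where X = Sym])
 show "unisolvent K Sym Sg_loc (all_dofs Sg_vdofs (Sg_edofs s nm np) (Sg_fdofs n) (Sg_kdofs n) K)" if "K : \<T>" for K
  using uSg that unfolding Sg_dofs_def by blast
 show "smooth p" "p x : Sym" if "p : Sg_loc" for p x
  using that polyi_val[OF _ subspace_Sym] polys_smooth unfolding Sg_loc_def polys_iff[OF subspace_Sym, symmetric] by blast+
qed (use assms in auto)

lemma Pi_W_D: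
 assumes "smooth w" shows "Pi_W \<T> n w : W_space" "K : \<T> ==> d : W_dofs n K ==> d (Pi_W \<T> n w K) = d w"
 using interpolantD[OF Pi_W_exists[OF assms]] unfolding Pi_W_def W_space_def by blast+

lemma Pi_Th_D:
 assumes "smooth S" "!!x. x : \<Union>\<T> ==> S x : Sym"
 shows "Pi_Th \<T> n s \<mu> \<nu> S : Th_space" "K : \<T> ==> d : Th_dofs n s \<mu> \<nu> K ==> d (Pi_Th \<T> n s \<mu> \<nu> S K) = d S"
 using interpolantD[OF Pi_Th_exists[OF assms]] unfolding Pi_Th_def Th_space_def by blast+

lemma Pi_Sg_D:
 assumes "smooth S" "!!x. x : \<Union>\<T> ==> S x : Sym"
 shows "Pi_Sg \<T> n s nm np S : Sg_space" "K : \<T> ==> d : Sg_dofs n s nm np K ==> d (Pi_Sg \<T> n s nm np S K) = d S"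
 using interpolantD[OF Pi_Sg_exists[OF assms]] unfolding Pi_Sg_def Sg_space_def by blast+

lemma commute_eps:
 assumes w: "smooth w" shows "Pi_Th \<T> n s \<mu> \<nu> (eps w) = piecewise eps (Pi_W \<T> n w)"
proof -
 let ?I = "Pi_W \<T> n w"
 note I = Pi_W_D[OF w]
 have "interpolant \<T> Th_space (Th_dofs n s \<mu> \<nu>) (eps w) = piecewise eps ?I"
 proof (rule interpolantI[OF Pi_Th_exists eps_maps[OF I(1)]])
  show "smooth (eps w)" using w by (rule smooth_eps)
  show "eps w x : Sym" for x by (rule eps_Sym[OF w])
  fix K d assume K: "K : \<T>" and d: "d : Th_dofs n s \<mu> \<nu> K"
  note sI = W_smooth[OF I(1) K]
  \<comment> \<open>Commutation is reduced to the interpolation error: its degrees of freedom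
    vanish, hence so do those of its strain.\<close>
  have "d (%x. w x - ?I K x) = 0" if "d : W_dofs n K" for d
   using subtractiveD[OF sub_W[OF K that] w sI] I(2)[OF K that] by simp
  then have "d (eps (%x. w x - ?I K x)) = 0"
   using W_zero_eps[OF K smooth_diff[OF w sI]] d by blast
  then show "d (piecewise eps ?I K) = d (eps w)"
   unfolding sub_op_diff[OF sub_op_eps w sI] piecewise_def
   using subtractiveD[OF sub_Th[OF K d] smooth_eps[OF w] smooth_eps[OF sI]] by simp
 qed
 then show ?thesis unfolding Pi_Th_def Th_space_def .
qed

lemma commute_ccs:
 assumes S: "smooth S" "!!x. x : closure \<Omega> ==> S x : Sym"
 shows "Pi_Sg \<T> n s nm np (ccs S) = piecewise ccs (Pi_Th \<T> n s \<mu> \<nu> S)"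
proof -
 let ?I = "Pi_Th \<T> n s \<mu> \<nu> S"
 have SU: "S x : Sym" if "x : \<Union>\<T>" for x using S(2) that unfolding Union_mesh .
 have SK: "S x : Sym" if "K : \<T>" "x : K" for K x using SU that by blast
 have I1: "?I : Th_space" by (rule Pi_Th_D(1)[OF S(1) SU])
 have I2: "d (?I K) = d S" if "K : \<T>" "d : Th_dofs n s \<mu> \<nu> K" for K d by (rule Pi_Th_D(2)[OF S(1) SU that])
 note I = I1 I2
 have "interpolant \<T> Sg_space (Sg_dofs n s nm np) (ccs S) = piecewise ccs ?I"
 proof (rule interpolantI[OF Pi_Sg_exists ccs_maps[OF I(1)]])
  show "smooth (ccs S)" using S(1) by (rule smooth_ccs)
  show "ccs S x : Sym" if x: "x : \<Union>\<T>" for x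
  proof -
   obtain K where K: "K : \<T>" "x : K" using x by blast
   show ?thesis by (rule ccs_Sym_local[OF K(1) S(1) SK[OF K(1)] K(2)])
  qed
  fix K d assume K: "K : \<T>" and d: "d : Sg_dofs n s nm np K"
  note sI = Th_smooth[OF I(1) K]
  have z: "\<forall>d\<in>Th_dofs n s \<mu> \<nu> K. d (%x. S x - ?I K x) = 0"
   by (rule ballI) (simp only: subtractiveD[OF sub_Th[OF K] S(1) sI] I(2)[OF K] diff_self)
  have "S x - ?I K x : Sym" if "x : K" for x
   using SK[OF K that] polyi_val[OF Th_piece[OF I(1) K] subspace_Sym] subspace_diff[OF subspace_Sym] by blast
  then have "d (ccs (%x. S x - ?I K x)) = 0"
   by (intro Th_zero_ccs_local[OF K smooth_diff[OF S(1) sI] _ z d])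
  then show "d (piecewise ccs ?I K) = d (ccs S)"
   unfolding sub_op_diff[OF sub_op_ccs S(1) sI] piecewise_def
   using subtractiveD[OF sub_Sg[OF K d] smooth_ccs[OF S(1)] smooth_ccs[OF sI]] by simp
 qed
 then show ?thesis unfolding Pi_Sg_def Sg_space_def .
qed

lemma mdiv_maps: assumes "T : Sg_space" shows "piecewise mdiv T : V_h \<T>"
proof -
 have "mdiv (%x. 0) = (%x. 0)" using mdiv_diff[of "%x. 0" "%x. 0"] by simp
 then show ?thesis
  using Sg_piece_div[OF assms] fe_space_zero[OF assms[unfolded Sg_space_def Sg_h_def]] unfolding V_h_def broken_def piecewise_def by auto
qed

lemma commute_mdiv:
 assumes T: "smooth T" "!!x. x : closure \<Omega> ==> T x : Sym"
 shows "Pi_V \<T> (mdiv T) = piecewise mdiv (Pi_Sg \<T> n s nm np T)"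
proof -
 let ?I = "Pi_Sg \<T> n s nm np T"
 have TU: "T x : Sym" if "x : \<Union>\<T>" for x using T(2) that unfolding Union_mesh .
 have I1: "?I : Sg_space" by (rule Pi_Sg_D(1)[OF T(1) TU])
 have I2: "d (?I K) = d T" if "K : \<T>" "d : Sg_dofs n s nm np K" for K d by (rule Pi_Sg_D(2)[OF T(1) TU that])
 note I = I1 I2
 show ?thesis
 proof (rule Pi_V_eqI[OF smooth_mdiv[OF T(1)] mdiv_maps[OF I(1)]])
  fix K and v :: "vec3 => vec3" assume K: "K : \<T>" and v: "polyi UNIV 1 v"
  note sI = Sg_smooth[OF I(1) K]
  have z: "\<forall>d\<in>Sg_dofs n s nm np K. d (%x. ?I K x - T x) = 0"
   by (rule ballI) (simp only: subtractiveD[OF sub_Sg[OF K] sI T(1)] I(2)[OF K] diff_self)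
  show "integral K (%x. (piecewise mdiv ?I K x - mdiv T x) <.> v x) = 0"
   using mdiv_moment[OF K smooth_diff[OF sI T(1)] z v] by (simp add: piecewise_def mdiv_diff[OF sI T(1)])
 qed
qed

lemma rigid_maps: assumes "r : rigid" shows "restrict_mesh \<T> r : W_space" "piecewise eps (restrict_mesh \<T> r) = (%K x. 0)"
proof -
 show "restrict_mesh \<T> r : W_space"
  using rigid_poly(1)[OF assms] unfolding W_space_def W_h_def fe_space_def broken_def restrict_mesh_def W_loc_def polys_iff[OF subspace_UNIV]
  by simp
 have "eps (%x. 0) = (%x. 0)" using sub_op_diff[OF sub_op_eps, of "%x. 0" "%x. 0"] by simp
 then show "piecewise eps (restrict_mesh \<T> r) = (%K x. 0)"
  using rigid_poly(2)[OF assms] by (auto simp: piecewise_def restrict_mesh_def fun_eq_iff)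
qed

lemma eps_ccs_zero: assumes "w : W_space" shows "piecewise ccs (piecewise eps w) = (%K x. 0)"
proof (intro ext)
 fix K x
 have "smooth (w K)"
  using W_smooth[OF assms] fe_space_zero[OF assms[unfolded W_space_def W_h_def]] by (cases "K : \<T>") auto
 then show "piecewise ccs (piecewise eps w) K x = 0" by (simp add: piecewise_def ccs_eps)
qed

lemma ccs_mdiv_zero: assumes "S : Th_space" shows "piecewise mdiv (piecewise ccs S) = (%K x. 0)"
proof (intro ext)
 fix K x
 have "smooth (S K)"
  using Th_smooth[OF assms] fe_space_zero[OF assms[unfolded Th_space_def Th_h_def]] by (cases "K : \<T>") auto
 then show "piecewise mdiv (piecewise ccs S) K x = 0" by (simp add: piecewise_def mdiv_ccs)
qed

end

theorem mainTheorem8: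
  fixes \<Omega> :: "vec3 set" and \<T> :: "vec3 set set"
    and n s nm np \<mu> \<nu> :: "vec3 set \<Rightarrow> vec3"
  assumes domain: "polyhedral_domain \<Omega>" "contractible \<Omega>"
    and mesh: "simplicial_mesh \<Omega> \<T>"
    and frame: "frame_choice \<T> n s nm np \<mu> \<nu>"
    and unisolvent_W: "\<forall>K\<in>\<T>. unisolvent K UNIV W_loc (W_dofs n K)"
    and unisolvent_Th: "\<forall>K\<in>\<T>. unisolvent K Sym Th_loc (Th_dofs n s \<mu> \<nu> K)"
    and unisolvent_Sg: "\<forall>K\<in>\<T>. unisolvent K Sym Sg_loc (Sg_dofs n s nm np K)"
  shows
    \<comment> \<open>conformity\<close>
    "(\<forall>w\<in>W_h \<T> n. glue \<T> w \<in> H1 \<Omega>) \<and>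
     (\<forall>S\<in>Th_h \<T> n s \<mu> \<nu>. glue \<T> S \<in> H_ccs \<Omega>) \<and>
     (\<forall>T\<in>Sg_h \<T> n s nm np. glue \<T> T \<in> H_div \<Omega>) \<and>
     \<comment> \<open>each operator, taken in the distributional sense on \<open>\<Omega>\<close>, maps its space into the next one\<close>
     (\<forall>r\<in>rigid. restrict_mesh \<T> r \<in> W_h \<T> n) \<and>
     (\<forall>w\<in>W_h \<T> n. piecewise eps w \<in> Th_h \<T> n s \<mu> \<nu> \<and>
        weak_eps \<Omega> (glue \<T> w) (glue \<T> (piecewise eps w))) \<and>
     (\<forall>S\<in>Th_h \<T> n s \<mu> \<nu>. piecewise ccs S \<in> Sg_h \<T> n s nm np \<and>
        weak_ccs \<Omega> (glue \<T> S) (glue \<T> (piecewise ccs S))) \<and>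
     (\<forall>T\<in>Sg_h \<T> n s nm np. piecewise mdiv T \<in> V_h \<T> \<and>
        weak_div \<Omega> (glue \<T> T) (glue \<T> (piecewise mdiv T))) \<and>
     \<comment> \<open>successive operators compose to zero\<close>
     (\<forall>r\<in>rigid. piecewise eps (restrict_mesh \<T> r) = (\<lambda>K x. 0)) \<and>
     (\<forall>w\<in>W_h \<T> n. piecewise ccs (piecewise eps w) = (\<lambda>K x. 0)) \<and>
     (\<forall>S\<in>Th_h \<T> n s \<mu> \<nu>. piecewise mdiv (piecewise ccs S) = (\<lambda>K x. 0)) \<and>
     \<comment> \<open>commuting interpolation\<close>
     (\<forall>w. smooth w \<longrightarrow> Pi_Th \<T> n s \<mu> \<nu> (eps w) = piecewise eps (Pi_W \<T> n w)) \<and>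
     (\<forall>S. smooth S \<and> (\<forall>x\<in>closure \<Omega>. S x \<in> Sym) \<longrightarrow>
        Pi_Sg \<T> n s nm np (ccs S) = piecewise ccs (Pi_Th \<T> n s \<mu> \<nu> S)) \<and>
     (\<forall>T. smooth T \<and> (\<forall>x\<in>closure \<Omega>. T x \<in> Sym) \<longrightarrow>
        Pi_V \<T> (mdiv T) = piecewise mdiv (Pi_Sg \<T> n s nm np T))"
proof -
 interpret unisolvent_mesh \<Omega> \<T> n s nm np \<mu> \<nu>
  using assms by unfold_locales
 note spaces = W_space_def[symmetric] Th_space_def[symmetric] Sg_space_def[symmetric]
 show ?thesis
  unfolding spaces
  by (intro conjI ballI allI impI; (elim conjE)?)
   (rule W_H1 Th_H_ccs Sg_H_div rigid_maps eps_maps W_weak_eps ccs_maps Th_weak_ccs mdiv_maps Sg_weak_div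
    eps_ccs_zero ccs_mdiv_zero commute_eps commute_ccs commute_mdiv; (assumption | erule (1) bspec)+)+
qed

end
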